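(* Let $M$ be a complex manifold with an open cover $\mathcal U=\{U_i\}_{i\in I}$. Then $\mathbf{Ch}(\check{N}\mathcal U):\mathbf{HVB}(\check{N}\mathcal U)\to\mathbf{\Omega}(\check{N}\mathcal U)$ is a map of cosimplicial simplicial sets, and thus induces a map of simplicial sets on totalizations $$\mathbf{Tot}(\mathbf{Ch}(\check{N}\mathcal U)):\mathbf{Tot}(\mathbf{HVB}(\check{N}\mathcal U))\to\mathbf{Tot}(\mathbf{\Omega}(\check{N}\mathcal U)).$$
   Context: $\mathbf{HVB}$: for a complex manifold $U$, $\mathcal{HVB}^\nabla(U)$ is the groupoid whose objects are finite rank holomorphic vector bundles $E\to U$ with a holomorphic connection $\nabla_E$, and whose morphisms are all holomorphic bundle isomorphisms (over $\mathrm{id}_U$), not required to respect the connections. Pullback along holomorphic maps makes this a contravariant functor (pullbacks are treated as strictly functorial). $\mathbf{HVB}(U)$ is the nerve of $\mathcal{HVB}^\nabla(U)$. $\mathbf{\Omega}$: $\Omega^\bullet_{hol}(U)$ denotes holomorphic differential forms with zero differential. With $u$ a formal variable of degree $-2$, $\Omega^\bullet_{hol}(U)[u]^{\bullet\le0}$ is the quotient of $\Omega^\bullet_{hol}(U)\otimes\mathbb Z[u]$ by all elements of positive degree. $N(\mathbb Z\Delta^k)$ is the normalized chain complex of the standard simplex in non-positive degrees: in degree $-\ell$ free abelian on $e_{i_0,\dots,i_\ell}$, $0\le i_0<\dots<i_\ell\le k$, with $d(e_{i_0,\dots,i_\ell})=\sum_j(-1)^je_{i_0,\dots,\widehat{i_j},\dots,i_\ell}$.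 $\underline{DK}(C)$ is the simplicial set with $k$-simplices the chain maps $N(\mathbb Z\Delta^k)\to C$. Put $\mathbf{\Omega}(U)=\underline{DK}(\Omega^\bullet_{hol}(U)[u]^{\bullet\le0})$. $\mathbf{Ch}(U):\mathbf{HVB}(U)\to\mathbf{\Omega}(U)$ sends a $k$-simplex $E_0\xrightarrow{f_1}E_1\to\dots\xrightarrow{f_k}E_k$ to the chain map with $e_i\mapsto\dim(E_i)$ and, for $\ell>0$, $e_{i_0,\dots,i_\ell}\mapsto \mathrm{tr}\big(\tilde f_{i_\ell,i_0}^{-1}\circ\nabla_{i_\ell,i_{\ell-1}}(\tilde f_{i_\ell,i_{\ell-1}})\circ\dots\circ\nabla_{i_1,i_0}(\tilde f_{i_1,i_0})\big)u^\ell$, where $\tilde f_{q,p}=f_q\circ\dots\circ f_{p+1}$ and $\nabla_{q,p}$ is the induced connection on $Hom(E_p,E_q)$. Čech nerve: $\check{N}\mathcal U$ is the simplicial complex manifold with $\check{N}\mathcal U_k=\coprod_{i_0,\dots,i_k\in I}U_{i_0,\dots,i_k}$, $U_{i_0,\dots,i_k}=U_{i_0}\cap\dots\cap U_{i_k}$, faces induced by the inclusions $U_{i_0,\dots,i_k}\hookrightarrow U_{i_0,\dots,\widehat{i_j},\dots,i_k}$, degeneracies by the identities $U_{i_0,\dots,i_k}\to U_{i_0,\dots,i_j,i_j,\dots,i_k}$. For a simplicial presheaf $\mathbf F$, $\mathbf F(\check{N}\mathcal U)$ is the cosimplicial simplicial set $[\ell]\mapsto\mathbf F(\check{N}\mathcal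 U_\ell)$, and $\mathbf{Ch}(\check N\mathcal U)$ is given levelwise by $\mathbf{Ch}(\check N\mathcal U_\ell)$. Totalization: for a cosimplicial simplicial set $X$, $\mathbf{Tot}(X)$ is the simplicial set whose $n$-simplices are families of simplicial maps $(F_\ell:\Delta^\ell\times\Delta^n\to X^\ell)_{\ell\ge0}$ such that for all $\rho:[k]\to[m]$ in $\mathbf\Delta$, $F_m\circ(\rho_*\times \mathrm{id})=X(\rho)\circ F_k$ as maps $\Delta^k\times\Delta^n\to X^m$. *)

theory Defs
  imports "HOL-Analysis.Analysis" "HOL-Algebra.Module" "HOL-Algebra.Free_Abelian_Groups"
begin

section \<open>Finite-dimensional complex vector spaces as model spaces\<close>

text \<open>
  The type class fixes the dimension of a manifold. It is used instead of \<open>complex ^ 'n\<close>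
  so that dimension zero is not excluded; the instances below cover \<open>complex ^ 'n\<close> and
  the zero space.
\<close>

class complex_model_space = real_normed_vector +
  fixes scaleC :: "complex \<Rightarrow> 'a \<Rightarrow> 'a" (infixr \<open>*\<^sub>C\<close> 75)
  assumes scaleC_add_right: "c *\<^sub>C (x + y) = c *\<^sub>C x + c *\<^sub>C y"
    and scaleC_add_left: "(c + d) *\<^sub>C x = c *\<^sub>C x + d *\<^sub>C x"
    and scaleC_scaleC: "c *\<^sub>C d *\<^sub>C x = (c * d) *\<^sub>C x"
    and scaleC_of_real: "complex_of_real r *\<^sub>C x = r *\<^sub>R x"
    and norm_scaleC: "norm (c *\<^sub>C x) = cmod c * norm x"
    and finite_dimensional: "\<exists>B. finite B \<and> (\<forall>x. \<exists>a. x = (\<Sum>b\<in>B. a b *\<^sub>C b))"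

instantiation complex :: complex_model_space
begin

definition scaleC_complex :: "complex \<Rightarrow> complex \<Rightarrow> complex"
  where "scaleC_complex c x = c * x"

instance
proof
  show "\<exists>B. finite B \<and> (\<forall>x::complex. \<exists>a. x = (\<Sum>b\<in>B. a b *\<^sub>C b))"
    by (rule exI[of _ "{1}"]) (auto simp: scaleC_complex_def)
qed (auto simp: scaleC_complex_def algebra_simps norm_mult scaleR_conv_of_real)

end

instantiation vec :: (complex_model_space, finite) complex_model_space
begin

definition scaleC_vec :: "complex \<Rightarrow> 'a ^ 'b \<Rightarrow> 'a ^ 'b"
  where "scaleC_vec c x = (\<chi> i. c *\<^sub>C (x $ i))"

instance
proof
  fix c :: complex and x :: "'a ^ 'b"
  show "norm (c *\<^sub>C x) = cmod c * norm x"
    by (simp add: norm_vec_def scaleC_vec_def norm_scaleC L2_set_right_distrib)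
next
  obtain B :: "'a set" where B: "finite B" "\<And>x. \<exists>a. x = (\<Sum>b\<in>B. a b *\<^sub>C b)"
    using finite_dimensional by blast
  have zero: "c *\<^sub>C (0::'a) = 0" for c
    using scaleC_add_right[of c 0 0] by simp
  let ?h = "\<lambda>(i::'b, b). axis i b :: 'a ^ 'b"
  let ?S = "?h ` (UNIV \<times> (B - {0}))"
  have inj: "inj_on ?h (UNIV \<times> (B - {0}))"
    by (auto simp: inj_on_def axis_eq_axis)
  have "\<exists>a. x = (\<Sum>b\<in>?S. a b *\<^sub>C b)" for x :: "'a ^ 'b"
  proof -
    have "\<forall>i. \<exists>a. x $ i = (\<Sum>b\<in>B. a b *\<^sub>C b)"
      by (intro allI B(2))
    from choice[OF this] obtain a where a: "\<And>i. x $ i = (\<Sum>b\<in>B. a i b *\<^sub>C b)"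
      by blast
    define a' where "a' = (\<lambda>v. case inv_into (UNIV \<times> (B - {0})) ?h v of (i, b) \<Rightarrow> a i b)"
    have "(\<Sum>v\<in>?S. a' v *\<^sub>C v) = (\<Sum>p\<in>UNIV \<times> (B - {0}). a' (?h p) *\<^sub>C ?h p)"
      using sum.reindex[OF inj] by simp
    also have "\<dots> = (\<Sum>p\<in>UNIV \<times> (B - {0}). a (fst p) (snd p) *\<^sub>C axis (fst p) (snd p))"
    proof (rule sum.cong)
      fix p :: "'b \<times> 'a" assume p: "p \<in> UNIV \<times> (B - {0})"
      have "a' (?h p) = a (fst p) (snd p)"
        unfolding a'_def inv_into_f_f[OF inj p] by (simp add: case_prod_beta)
      then show "a' (?h p) *\<^sub>C ?h p = a (fst p) (snd p) *\<^sub>C axis (fst p) (snd p)"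
        by (simp add: case_prod_beta)
    qed simp
    also have "\<dots> = (\<Sum>i\<in>UNIV. \<Sum>b\<in>B - {0}. a i b *\<^sub>C axis i b)"
      by (simp add: sum.cartesian_product case_prod_beta)
    also have "\<dots> = x"
    proof (rule vec_eq_iff[THEN iffD2], rule allI)
      fix j
      have "(\<Sum>i\<in>UNIV. \<Sum>b\<in>B - {0}. a i b *\<^sub>C axis i b) $ j
          = (\<Sum>i\<in>UNIV. if i = j then (\<Sum>b\<in>B - {0}. a j b *\<^sub>C b) else 0)"
        unfolding sum_component
      proof (rule sum.cong)
        fix i
        show "(\<Sum>b\<in>B - {0}. (a i b *\<^sub>C axis i b) $ j)
            = (if i = j then (\<Sum>b\<in>B - {0}. a j b *\<^sub>C b) else 0)"
          by (cases "i = j") (simp_all add: scaleC_vec_def axis_def zero)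
      qed simp
      also have "\<dots> = (\<Sum>b\<in>B - {0}. a j b *\<^sub>C b)" by simp
      also have "\<dots> = x $ j"
        unfolding a using B(1) by (intro sum.mono_neutral_left) (auto simp: zero)
      finally show "(\<Sum>i\<in>UNIV. \<Sum>b\<in>B - {0}. a i b *\<^sub>C axis i b) $ j = x $ j" .
    qed
    finally show ?thesis by (intro exI[of _ a']) (rule sym)
  qed
  moreover have "finite ?S" using B(1) by simp
  ultimately show "\<exists>S. finite S \<and> (\<forall>x::'a ^ 'b. \<exists>a. x = (\<Sum>b\<in>S. a b *\<^sub>C b))"
    by blast
qed (auto simp: scaleC_vec_def vec_eq_iff scaleC_add_right scaleC_add_left scaleC_scaleC scaleC_of_real)

end

instantiation unit :: complex_model_space
begin

definition zero_unit :: unit where "zero_unit = ()"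
definition plus_unit :: "unit \<Rightarrow> unit \<Rightarrow> unit" where "plus_unit x y = ()"
definition scaleR_unit :: "real \<Rightarrow> unit \<Rightarrow> unit" where "scaleR_unit r x = ()"
definition scaleC_unit :: "complex \<Rightarrow> unit \<Rightarrow> unit" where "scaleC_unit c x = ()"
definition norm_unit :: "unit \<Rightarrow> real" where "norm_unit x = 0"
definition dist_unit :: "unit \<Rightarrow> unit \<Rightarrow> real" where "dist_unit x y = 0"
definition sgn_unit :: "unit \<Rightarrow> unit" where "sgn_unit x = ()"
definition uniformity_unit :: "(unit \<times> unit) filter"
  where "uniformity_unit = (INF e\<in>{0<..}. principal {(x, y). dist x y < e})"
definition open_unit :: "unit set \<Rightarrow> bool"
  where "open_unit U \<longleftrightarrow> (\<forall>x\<in>U. \<forall>\<^sub>F (x', y) in uniformity. x' = x \<longrightarrow> y \<in> U)"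

instance
  by standard
    (auto simp: norm_unit_def dist_unit_def uniformity_unit_def open_unit_def
      intro!: exI[of _ "{}::unit set"])

end


section \<open>Holomorphic functions and complex manifolds\<close>

definition cholomorphic_on ::
  "'v::complex_model_space set \<Rightarrow> ('v \<Rightarrow> 'w::complex_model_space) \<Rightarrow> bool" where
  "cholomorphic_on S g \<longleftrightarrow>
     (\<forall>y\<in>S. \<exists>g'. (g has_derivative g') (at y) \<and> (\<forall>c v. g' (c *\<^sub>C v) = c *\<^sub>C g' v))"

text \<open>A chart is a pair of its domain and its coordinate map (only relevant on the domain).\<close>

type_synonym ('p, 'v) chart = "'p set \<times> ('p \<Rightarrow> 'v)"

definition chart_inv :: "('p, 'v) chart \<Rightarrow> 'v \<Rightarrow> 'p" where
  "chart_inv c = inv_into (fst c) (snd c)"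

record ('p, 'v) cmanifold =
  mtop :: "'p topology"
  charts :: "('p, 'v) chart set"

abbreviation points :: "('p, 'v) cmanifold \<Rightarrow> 'p set" where
  "points X \<equiv> topspace (mtop X)"

text \<open>The atlas need not be maximal. No countability axiom is imposed, since the Cech nerve
  of an uncountable cover is not second countable.\<close>

definition complex_manifold :: "('p, 'v::complex_model_space) cmanifold \<Rightarrow> bool" where
  "complex_manifold X \<longleftrightarrow>
     Hausdorff_space (mtop X) \<and>
     (\<forall>(D, \<kappa>)\<in>charts X. openin (mtop X) D \<and> open (\<kappa> ` D) \<and>
        homeomorphic_map (subtopology (mtop X) D) (top_of_set (\<kappa> ` D)) \<kappa>) \<and>
     (\<Union>(D, \<kappa>)\<in>charts X. D) = points X \<and>
     (\<forall>c\<in>charts X. \<forall>c'\<in>charts X.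
        cholomorphic_on (snd c ` (fst c \<inter> fst c')) (snd c' \<circ> chart_inv c))"

definition open_submanifold :: "('p, 'v) cmanifold \<Rightarrow> 'p set \<Rightarrow> ('p, 'v) cmanifold" where
  "open_submanifold X W =
     \<lparr>mtop = subtopology (mtop X) W, charts = (\<lambda>(D, \<kappa>). (D \<inter> W, \<kappa>)) ` charts X\<rparr>"

definition coproduct_manifold ::
  "'j set \<Rightarrow> ('j \<Rightarrow> ('p, 'v) cmanifold) \<Rightarrow> ('j \<times> 'p, 'v) cmanifold" where
  "coproduct_manifold J N =
     \<lparr>mtop = sum_topology (\<lambda>j. mtop (N j)) J,
      charts = (\<Union>j\<in>J. (\<lambda>(D, \<kappa>). ({j} \<times> D, \<kappa> \<circ> snd)) ` charts (N j))\<rparr>"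

definition holomorphic_fun ::
  "('p, 'v::complex_model_space) cmanifold \<Rightarrow> 'p set \<Rightarrow> ('p \<Rightarrow> complex) \<Rightarrow> bool" where
  "holomorphic_fun X W g \<longleftrightarrow>
     (\<forall>c\<in>charts X. cholomorphic_on (snd c ` (fst c \<inter> W)) (g \<circ> chart_inv c))"


subsection \<open>Tangent spaces\<close>

text \<open>A tangent vector at a point is the family of its coordinate representations in all
  charts around that point, related by the derivatives of the coordinate changes. The space is
  the holomorphic tangent space, through its identification with the real one.\<close>

type_synonym ('p, 'v) tangent = "('p, 'v) chart \<Rightarrow> 'v"

definition charts_at :: "('p, 'v) cmanifold \<Rightarrow> 'p \<Rightarrow> ('p, 'v) chart set" where
  "charts_at X x = {c \<in> charts X. x \<in> fst c}"

definition tangent_space ::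
  "('p, 'v::complex_model_space) cmanifold \<Rightarrow> 'p \<Rightarrow> ('p, 'v) tangent set" where
  "tangent_space X x =
     {\<xi> \<in> extensional (charts_at X x). \<forall>c\<in>charts_at X x. \<forall>c'\<in>charts_at X x.
        \<xi> c' = frechet_derivative (snd c' \<circ> chart_inv c) (at (snd c x)) (\<xi> c)}"

definition tangent_add ::
  "('p, 'v::complex_model_space) cmanifold \<Rightarrow> 'p \<Rightarrow>
     ('p, 'v) tangent \<Rightarrow> ('p, 'v) tangent \<Rightarrow> ('p, 'v) tangent" where
  "tangent_add X x \<xi> \<eta> = (\<lambda>c\<in>charts_at X x. \<xi> c + \<eta> c)"

definition tangent_scale ::
  "('p, 'v::complex_model_space) cmanifold \<Rightarrow> 'p \<Rightarrow>
     complex \<Rightarrow> ('p, 'v) tangent \<Rightarrow> ('p, 'v) tangent" where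
  "tangent_scale X x a \<xi> = (\<lambda>c\<in>charts_at X x. a *\<^sub>C \<xi> c)"

text \<open>The tangent vector at \<open>x\<close> with coordinates \<open>v\<close> in the chart \<open>c\<close>.\<close>

definition coord_tangent ::
  "('p, 'v::complex_model_space) cmanifold \<Rightarrow> 'p \<Rightarrow> ('p, 'v) chart \<Rightarrow> 'v \<Rightarrow> ('p, 'v) tangent" where
  "coord_tangent X x c v =
     (\<lambda>c'\<in>charts_at X x. frechet_derivative (snd c' \<circ> chart_inv c) (at (snd c x)) v)"

text \<open>Differentials of functions and of maps, computed in an arbitrary chart at \<open>x\<close>.\<close>

definition differential ::
  "('p, 'v::complex_model_space) cmanifold \<Rightarrow> ('p \<Rightarrow> complex) \<Rightarrow> 'p \<Rightarrow> ('p, 'v) tangent \<Rightarrow> complex" where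
  "differential X g x \<xi> =
     (let c = (SOME c. c \<in> charts_at X x)
      in frechet_derivative (g \<circ> chart_inv c) (at (snd c x)) (\<xi> c))"

definition tangent_map ::
  "('p, 'v::complex_model_space) cmanifold \<Rightarrow> ('q, 'w::complex_model_space) cmanifold \<Rightarrow>
     ('p \<Rightarrow> 'q) \<Rightarrow> 'p \<Rightarrow> ('p, 'v) tangent \<Rightarrow> ('q, 'w) tangent" where
  "tangent_map X Y f x \<xi> =
     (let c = (SOME c. c \<in> charts_at X x)
      in (\<lambda>c'\<in>charts_at Y (f x).
            frechet_derivative (snd c' \<circ> f \<circ> chart_inv c) (at (snd c x)) (\<xi> c)))"


subsection \<open>Holomorphic differential forms\<close>

type_synonym ('p, 'v) form = "'p \<Rightarrow> (nat \<Rightarrow> ('p, 'v) tangent) \<Rightarrow> complex"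

definition tangent_tuples ::
  "('p, 'v::complex_model_space) cmanifold \<Rightarrow> nat \<Rightarrow> 'p \<Rightarrow> (nat \<Rightarrow> ('p, 'v) tangent) set" where
  "tangent_tuples X k x = ({..<k} \<rightarrow>\<^sub>E tangent_space X x)"

definition holomorphic_forms ::
  "('p, 'v::complex_model_space) cmanifold \<Rightarrow> 'p set \<Rightarrow> nat \<Rightarrow> ('p, 'v) form set" where
  "holomorphic_forms X W k =
     {\<omega> \<in> (\<Pi>\<^sub>E x\<in>W. tangent_tuples X k x \<rightarrow>\<^sub>E UNIV).
        (\<forall>x\<in>W. \<forall>\<Xi>\<in>tangent_tuples X k x. \<forall>i<k.
           (\<forall>\<xi>\<in>tangent_space X x.
              \<omega> x (\<Xi>(i := tangent_add X x (\<Xi> i) \<xi>)) = \<omega> x \<Xi> + \<omega> x (\<Xi>(i := \<xi>))) \<and>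
           (\<forall>a. \<omega> x (\<Xi>(i := tangent_scale X x a (\<Xi> i))) = a * \<omega> x \<Xi>) \<and>
           (\<forall>j<k. i \<noteq> j \<and> \<Xi> i = \<Xi> j \<longrightarrow> \<omega> x \<Xi> = 0)) \<and>
        (\<forall>c\<in>charts X. \<forall>v. cholomorphic_on (snd c ` (fst c \<inter> W))
           (\<lambda>y. \<omega> (chart_inv c y) (\<lambda>i\<in>{..<k}. coord_tangent X (chart_inv c y) c (v i))))}"

definition form_zero :: "('p, 'v::complex_model_space) cmanifold \<Rightarrow> nat \<Rightarrow> ('p, 'v) form" where
  "form_zero X k = (\<lambda>x\<in>points X. \<lambda>\<Xi>\<in>tangent_tuples X k x. 0)"

definition form_add ::
  "('p, 'v::complex_model_space) cmanifold \<Rightarrow> nat \<Rightarrow>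
     ('p, 'v) form \<Rightarrow> ('p, 'v) form \<Rightarrow> ('p, 'v) form" where
  "form_add X k \<omega> \<eta> = (\<lambda>x\<in>points X. \<lambda>\<Xi>\<in>tangent_tuples X k x. \<omega> x \<Xi> + \<eta> x \<Xi>)"

definition form_pullback ::
  "('p, 'v::complex_model_space) cmanifold \<Rightarrow> ('q, 'w::complex_model_space) cmanifold \<Rightarrow>
     ('p \<Rightarrow> 'q) \<Rightarrow> nat \<Rightarrow> ('q, 'w) form \<Rightarrow> ('p, 'v) form" where
  "form_pullback X Y f k \<omega> =
     (\<lambda>x\<in>points X. \<lambda>\<Xi>\<in>tangent_tuples X k x. \<omega> (f x) (\<lambda>i\<in>{..<k}. tangent_map X Y f x (\<Xi> i)))"


section \<open>Holomorphic vector bundles with holomorphic connection\<close>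

subsection \<open>Finite-dimensional vector spaces\<close>

definition complex_ring :: "complex ring" where
  "complex_ring = \<lparr>carrier = UNIV, monoid.mult = (*), one = 1, ring.zero = 0, ring.add = (+)\<rparr>"

text \<open>Linear isomorphisms onto \<open>\<complex>\<^sup>r\<close>, i.e. choices of a basis.\<close>

definition coord_iso :: "(complex, 'f) module \<Rightarrow> nat \<Rightarrow> ('f \<Rightarrow> nat \<Rightarrow> complex) \<Rightarrow> bool" where
  "coord_iso V r \<phi> \<longleftrightarrow>
     bij_betw \<phi> (carrier V) ({..<r} \<rightarrow>\<^sub>E UNIV) \<and>
     (\<forall>v\<in>carrier V. \<forall>w\<in>carrier V. \<forall>j<r. \<phi> (v \<oplus>\<^bsub>V\<^esub> w) j = \<phi> v j + \<phi> w j) \<and>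
     (\<forall>a. \<forall>v\<in>carrier V. \<forall>j<r. \<phi> (a \<odot>\<^bsub>V\<^esub> v) j = a * \<phi> v j)"

definition basis_vector ::
  "(complex, 'f) module \<Rightarrow> nat \<Rightarrow> ('f \<Rightarrow> nat \<Rightarrow> complex) \<Rightarrow> nat \<Rightarrow> 'f" where
  "basis_vector V r \<phi> k = inv_into (carrier V) \<phi> (\<lambda>j\<in>{..<r}. if j = k then 1 else 0)"

definition vdim :: "(complex, 'f) module \<Rightarrow> nat" where
  "vdim V = (THE r. \<exists>\<phi>. coord_iso V r \<phi>)"

definition vtrace :: "(complex, 'f) module \<Rightarrow> ('f \<Rightarrow> 'f) \<Rightarrow> complex" where
  "vtrace V T =
     (let \<phi> = (SOME \<phi>. coord_iso V (vdim V) \<phi>)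
      in \<Sum>k<vdim V. \<phi> (T (basis_vector V (vdim V) \<phi> k)) k)"


subsection \<open>Bundles\<close>

text \<open>
  A bundle is given by its family of fibres, whose vectors live in an arbitrary type \<open>'f\<close>; a
  bundle with projection \<open>p : E \<rightarrow> X\<close> is represented by the fibres of \<open>p\<close>. This makes pullback
  strictly functorial. The holomorphic structure is the maximal atlas of local trivializations
  \<open>(W, r, \<phi>)\<close>, where \<open>\<phi> x : E\<^sub>x \<rightarrow> \<complex>\<^sup>r\<close> for \<open>x \<in> W\<close>. The connection is the operator on sections over
  open sets: \<open>conn E W s x \<xi>\<close> is the value at \<open>x\<close> of the covariant derivative of \<open>s\<close> in
  the direction \<open>\<xi>\<close>.
\<close>

type_synonym ('p, 'f) triv = "'p set \<times> nat \<times> ('p \<Rightarrow> 'f \<Rightarrow> nat \<Rightarrow> complex)"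

type_synonym ('p, 'v, 'f) connection =
  "'p set \<Rightarrow> ('p \<Rightarrow> 'f) \<Rightarrow> 'p \<Rightarrow> ('p, 'v) tangent \<Rightarrow> 'f"

record ('p, 'v, 'f) vbundle =
  fibre :: "'p \<Rightarrow> (complex, 'f) module"
  trivs :: "('p, 'f) triv set"
  conn :: "('p, 'v, 'f) connection"

definition is_triv ::
  "('p, 'v) cmanifold \<Rightarrow> ('p \<Rightarrow> (complex, 'f) module) \<Rightarrow> ('p, 'f) triv \<Rightarrow> bool" where
  "is_triv X F = (\<lambda>(W, r, \<phi>). openin (mtop X) W \<and> (\<forall>x\<in>W. coord_iso (F x) r (\<phi> x)))"

text \<open>Holomorphic matrix entries of a family of linear maps \<open>m x : F x \<rightarrow> G x\<close> with respect to a
  trivialization of \<open>F\<close> and one of \<open>G\<close>.\<close>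

definition holomorphic_matrix ::
  "('p, 'v::complex_model_space) cmanifold \<Rightarrow> ('p \<Rightarrow> (complex, 'f) module) \<Rightarrow>
     ('p, 'f) triv \<Rightarrow> ('p, 'f) triv \<Rightarrow> ('p \<Rightarrow> 'f \<Rightarrow> 'f) \<Rightarrow> bool" where
  "holomorphic_matrix X F = (\<lambda>(W, r, \<phi>) (W', r', \<phi>') m.
     \<forall>k<r. \<forall>j<r'. holomorphic_fun X (W \<inter> W')
       (\<lambda>x. \<phi>' x (m x (basis_vector (F x) r (\<phi> x) k)) j))"

definition compatible_trivs ::
  "('p, 'v::complex_model_space) cmanifold \<Rightarrow> ('p \<Rightarrow> (complex, 'f) module) \<Rightarrow>
     ('p, 'f) triv \<Rightarrow> ('p, 'f) triv \<Rightarrow> bool" where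
  "compatible_trivs X F t t' \<longleftrightarrow>
     holomorphic_matrix X F t t' (\<lambda>x v. v) \<and> holomorphic_matrix X F t' t (\<lambda>x v. v)"

definition triv_closure ::
  "('p, 'v::complex_model_space) cmanifold \<Rightarrow> ('p \<Rightarrow> (complex, 'f) module) \<Rightarrow>
     ('p, 'f) triv set \<Rightarrow> ('p, 'f) triv set" where
  "triv_closure X F A = {t. is_triv X F t \<and> (\<forall>t'\<in>A. compatible_trivs X F t t')}"

text \<open>The fixed point equation says that the trivializations are pairwise compatible and form a
  maximal such family.\<close>

definition holomorphic_bundle ::
  "('p, 'v::complex_model_space) cmanifold \<Rightarrow> ('p, 'v, 'f) vbundle \<Rightarrow> bool" where
  "holomorphic_bundle X E \<longleftrightarrow>
     fibre E \<in> extensional (points X) \<and>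
     (\<forall>x\<in>points X. module complex_ring (fibre E x)) \<and>
     (\<Union>(W, r, \<phi>)\<in>trivs E. W) = points X \<and>
     trivs E = triv_closure X (fibre E) (trivs E)"

definition holomorphic_sections ::
  "('p, 'v::complex_model_space) cmanifold \<Rightarrow> ('p, 'v, 'f) vbundle \<Rightarrow> 'p set \<Rightarrow> ('p \<Rightarrow> 'f) set" where
  "holomorphic_sections X E W =
     {s \<in> (\<Pi>\<^sub>E x\<in>W. carrier (fibre E x)).
        \<forall>(W', r, \<phi>)\<in>trivs E. \<forall>j<r. holomorphic_fun X (W \<inter> W') (\<lambda>x. \<phi> x (s x) j)}"

text \<open>Holomorphic sections of \<open>\<Omega>\<^sup>1 \<otimes> E\<close> over \<open>W\<close>.\<close>

definition bundle_one_forms ::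
  "('p, 'v::complex_model_space) cmanifold \<Rightarrow> ('p, 'v, 'f) vbundle \<Rightarrow> 'p set \<Rightarrow>
     ('p \<Rightarrow> ('p, 'v) tangent \<Rightarrow> 'f) set" where
  "bundle_one_forms X E W =
     {\<eta> \<in> (\<Pi>\<^sub>E x\<in>W. tangent_space X x \<rightarrow>\<^sub>E carrier (fibre E x)).
        \<forall>(W', r, \<phi>)\<in>trivs E. \<forall>j<r.
          (\<lambda>x\<in>W \<inter> W'. \<lambda>\<Xi>\<in>tangent_tuples X 1 x. \<phi> x (\<eta> x (\<Xi> 0)) j)
            \<in> holomorphic_forms X (W \<inter> W') 1}"

definition holomorphic_connection ::
  "('p, 'v::complex_model_space) cmanifold \<Rightarrow> ('p, 'v, 'f) vbundle \<Rightarrow>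
     ('p, 'v, 'f) connection \<Rightarrow> bool" where
  "holomorphic_connection X E N \<longleftrightarrow>
     N \<in> (\<Pi>\<^sub>E W\<in>{W. openin (mtop X) W}. holomorphic_sections X E W \<rightarrow>\<^sub>E bundle_one_forms X E W) \<and>
     (\<forall>W s t. openin (mtop X) W \<and> s \<in> holomorphic_sections X E W \<and> t \<in> holomorphic_sections X E W \<longrightarrow>
        (\<forall>x\<in>W. \<forall>\<xi>\<in>tangent_space X x.
           N W (\<lambda>y\<in>W. s y \<oplus>\<^bsub>fibre E y\<^esub> t y) x \<xi> = N W s x \<xi> \<oplus>\<^bsub>fibre E x\<^esub> N W t x \<xi>)) \<and>
     (\<forall>W s g. openin (mtop X) W \<and> s \<in> holomorphic_sections X E W \<and> holomorphic_fun X W g \<longrightarrow>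
        (\<forall>x\<in>W. \<forall>\<xi>\<in>tangent_space X x.
           N W (\<lambda>y\<in>W. g y \<odot>\<^bsub>fibre E y\<^esub> s y) x \<xi> =
             (differential X g x \<xi> \<odot>\<^bsub>fibre E x\<^esub> s x) \<oplus>\<^bsub>fibre E x\<^esub> (g x \<odot>\<^bsub>fibre E x\<^esub> N W s x \<xi>))) \<and>
     (\<forall>W W' s. openin (mtop X) W \<and> openin (mtop X) W' \<and> W' \<subseteq> W \<and> s \<in> holomorphic_sections X E W \<longrightarrow>
        N W' (restrict s W') = restrict (N W s) W')"

definition bundle_pullback ::
  "('p, 'v::complex_model_space) cmanifold \<Rightarrow> ('q, 'w::complex_model_space) cmanifold \<Rightarrow>
     ('p \<Rightarrow> 'q) \<Rightarrow> ('q, 'w, 'f) vbundle \<Rightarrow> ('p, 'v, 'f) vbundle" where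
  "bundle_pullback X Y f E =
     (let F = (\<lambda>x\<in>points X. fibre E (f x));
          A = triv_closure X F ((\<lambda>(W, r, \<phi>). (f -` W \<inter> points X, r, \<lambda>x. \<phi> (f x))) ` trivs E);
          E0 = \<lparr>fibre = F, trivs = A, conn = undefined\<rparr>
      in E0\<lparr>conn := (THE N. holomorphic_connection X E0 N \<and>
           (\<forall>W. openin (mtop Y) W \<longrightarrow> (\<forall>s\<in>holomorphic_sections Y E W.
              \<forall>x\<in>f -` W \<inter> points X. \<forall>\<xi>\<in>tangent_space X x.
                N (f -` W \<inter> points X) (\<lambda>y\<in>f -` W \<inter> points X. s (f y)) x \<xi> =
                  conn E W s (f x) (tangent_map X Y f x \<xi>))))\<rparr>)"

type_synonym ('p, 'f) bundle_map = "'p \<Rightarrow> 'f \<Rightarrow> 'f"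

definition bundle_isos ::
  "('p, 'v::complex_model_space) cmanifold \<Rightarrow> ('p, 'v, 'f) vbundle \<Rightarrow> ('p, 'v, 'f) vbundle \<Rightarrow>
     ('p, 'f) bundle_map set" where
  "bundle_isos X E F =
     {m \<in> (\<Pi>\<^sub>E x\<in>points X. carrier (fibre E x) \<rightarrow>\<^sub>E carrier (fibre F x)).
        (\<forall>x\<in>points X.
           bij_betw (m x) (carrier (fibre E x)) (carrier (fibre F x)) \<and>
           (\<forall>u\<in>carrier (fibre E x). \<forall>v\<in>carrier (fibre E x).
              m x (u \<oplus>\<^bsub>fibre E x\<^esub> v) = m x u \<oplus>\<^bsub>fibre F x\<^esub> m x v) \<and>
           (\<forall>a. \<forall>u\<in>carrier (fibre E x). m x (a \<odot>\<^bsub>fibre E x\<^esub> u) = a \<odot>\<^bsub>fibre F x\<^esub> m x u)) \<and>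
        (\<forall>t\<in>trivs E. \<forall>t'\<in>trivs F. holomorphic_matrix X (fibre E) t t' m)}"

definition bundle_map_pullback ::
  "('p, 'v) cmanifold \<Rightarrow> ('p \<Rightarrow> 'q) \<Rightarrow> ('q, 'f) bundle_map \<Rightarrow> ('p, 'f) bundle_map" where
  "bundle_map_pullback X f m = (\<lambda>x\<in>points X. m (f x))"

text \<open>The induced connection on \<open>Hom(E, F)\<close>, applied to a global section \<open>m\<close>: at \<open>x\<close> it sends
  \<open>\<xi>\<close> to the linear map \<open>s(x) \<mapsto> (\<nabla>\<^sub>F (m s) - m (\<nabla>\<^sub>E s))(x)(\<xi>)\<close>.\<close>

definition hom_connection ::
  "('p, 'v::complex_model_space) cmanifold \<Rightarrow> ('p, 'v, 'f) vbundle \<Rightarrow> ('p, 'v, 'f) vbundle \<Rightarrow>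
     ('p, 'f) bundle_map \<Rightarrow> 'p \<Rightarrow> ('p, 'v) tangent \<Rightarrow> 'f \<Rightarrow> 'f" where
  "hom_connection X E F m x \<xi> e =
     (THE w. \<exists>W s. openin (mtop X) W \<and> x \<in> W \<and> s \<in> holomorphic_sections X E W \<and> s x = e \<and>
        w = conn F W (\<lambda>y\<in>W. m y (s y)) x \<xi> \<ominus>\<^bsub>fibre F x\<^esub> m x (conn E W s x \<xi>))"


section \<open>Simplicial sets\<close>

text \<open>The morphisms \<open>[m] \<rightarrow> [n]\<close> of the simplex category.\<close>

definition Delta_hom :: "nat \<Rightarrow> nat \<Rightarrow> (nat \<Rightarrow> nat) set" where
  "Delta_hom m n = {\<rho> \<in> {..m} \<rightarrow>\<^sub>E {..n}. mono_on {..m} \<rho>}"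

text \<open>\<open>act X m n \<rho>\<close> is the operator from \<open>n\<close>-simplices to \<open>m\<close>-simplices belonging to \<open>\<rho> : [m] \<rightarrow> [n]\<close>.\<close>

record 'a sset =
  simp :: "nat \<Rightarrow> 'a set"
  act :: "nat \<Rightarrow> nat \<Rightarrow> (nat \<Rightarrow> nat) \<Rightarrow> 'a \<Rightarrow> 'a"

definition simplicial_set :: "'a sset \<Rightarrow> bool" where
  "simplicial_set X \<longleftrightarrow>
     (\<forall>m n. \<forall>\<rho>\<in>Delta_hom m n. \<forall>x\<in>simp X n. act X m n \<rho> x \<in> simp X m) \<and>
     (\<forall>n. \<forall>x\<in>simp X n. act X n n (\<lambda>i\<in>{..n}. i) x = x) \<and>
     (\<forall>l m n. \<forall>\<sigma>\<in>Delta_hom l m. \<forall>\<rho>\<in>Delta_hom m n. \<forall>x\<in>simp X n.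
        act X l n (compose {..l} \<rho> \<sigma>) x = act X l m \<sigma> (act X m n \<rho> x))"

definition simplicial_map :: "'a sset \<Rightarrow> 'b sset \<Rightarrow> (nat \<Rightarrow> 'a \<Rightarrow> 'b) \<Rightarrow> bool" where
  "simplicial_map X Y g \<longleftrightarrow>
     simplicial_set X \<and> simplicial_set Y \<and>
     (\<forall>n. g n \<in> simp X n \<rightarrow>\<^sub>E simp Y n) \<and>
     (\<forall>m n. \<forall>\<rho>\<in>Delta_hom m n. \<forall>x\<in>simp X n. g m (act X m n \<rho> x) = act Y m n \<rho> (g n x))"

definition standard_simplex :: "nat \<Rightarrow> (nat \<Rightarrow> nat) sset" where
  "standard_simplex l =
     \<lparr>simp = (\<lambda>k. Delta_hom k l), act = (\<lambda>m n \<rho> \<alpha>. compose {..m} \<alpha> \<rho>)\<rparr>"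

definition sset_prod :: "'a sset \<Rightarrow> 'b sset \<Rightarrow> ('a \<times> 'b) sset" where
  "sset_prod X Y =
     \<lparr>simp = (\<lambda>k. simp X k \<times> simp Y k),
      act = (\<lambda>m n \<rho> (x, y). (act X m n \<rho> x, act Y m n \<rho> y))\<rparr>"

text \<open>\<open>coact X k m \<rho>\<close> is the simplicial map \<open>X\<^sup>k \<rightarrow> X\<^sup>m\<close> belonging to \<open>\<rho> : [k] \<rightarrow> [m]\<close>.\<close>

record 'a cosset =
  level :: "nat \<Rightarrow> 'a sset"
  coact :: "nat \<Rightarrow> nat \<Rightarrow> (nat \<Rightarrow> nat) \<Rightarrow> nat \<Rightarrow> 'a \<Rightarrow> 'a"

definition cosimplicial_sset :: "'a cosset \<Rightarrow> bool" where
  "cosimplicial_sset X \<longleftrightarrow>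
     (\<forall>l. simplicial_set (level X l)) \<and>
     (\<forall>k m. \<forall>\<rho>\<in>Delta_hom k m. simplicial_map (level X k) (level X m) (coact X k m \<rho>)) \<and>
     (\<forall>l n. \<forall>x\<in>simp (level X l) n. coact X l l (\<lambda>i\<in>{..l}. i) n x = x) \<and>
     (\<forall>j k m. \<forall>\<sigma>\<in>Delta_hom j k. \<forall>\<rho>\<in>Delta_hom k m. \<forall>n. \<forall>x\<in>simp (level X j) n.
        coact X j m (compose {..j} \<rho> \<sigma>) n x = coact X k m \<rho> n (coact X j k \<sigma> n x))"

definition cosimplicial_map :: "'a cosset \<Rightarrow> 'b cosset \<Rightarrow> (nat \<Rightarrow> nat \<Rightarrow> 'a \<Rightarrow> 'b) \<Rightarrow> bool" where
  "cosimplicial_map X Y g \<longleftrightarrow>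
     cosimplicial_sset X \<and> cosimplicial_sset Y \<and>
     (\<forall>l. simplicial_map (level X l) (level Y l) (g l)) \<and>
     (\<forall>k m. \<forall>\<rho>\<in>Delta_hom k m. \<forall>n. \<forall>x\<in>simp (level X k) n.
        g m n (coact X k m \<rho> n x) = coact Y k m \<rho> n (g k n x))"


subsection \<open>Totalization\<close>

type_synonym 'a tot_simplex = "nat \<Rightarrow> nat \<Rightarrow> (nat \<Rightarrow> nat) \<times> (nat \<Rightarrow> nat) \<Rightarrow> 'a"

definition Tot :: "'a cosset \<Rightarrow> 'a tot_simplex sset" where
  "Tot X =
     \<lparr>simp = (\<lambda>n. {F.
        (\<forall>l. simplicial_map (sset_prod (standard_simplex l) (standard_simplex n)) (level X l) (F l)) \<and>
        (\<forall>k m. \<forall>\<rho>\<in>Delta_hom k m. \<forall>j. \<forall>\<alpha>\<in>Delta_hom j k. \<forall>\<beta>\<in>Delta_hom j n.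
           F m j (compose {..j} \<rho> \<alpha>, \<beta>) = coact X k m \<rho> j (F k j (\<alpha>, \<beta>)))}),
      act = (\<lambda>m n \<rho> F l j. \<lambda>p\<in>Delta_hom j l \<times> Delta_hom j m.
        F l j (fst p, compose {..j} \<rho> (snd p)))\<rparr>"

definition Tot_map :: "(nat \<Rightarrow> nat \<Rightarrow> 'a \<Rightarrow> 'b) \<Rightarrow> 'a cosset \<Rightarrow>
     nat \<Rightarrow> 'a tot_simplex \<Rightarrow> 'b tot_simplex" where
  "Tot_map g X n = (\<lambda>F\<in>simp (Tot X) n. \<lambda>l j. \<lambda>p\<in>Delta_hom j l \<times> Delta_hom j n. g l j (F l j p))"


subsection \<open>Nerves\<close>

record ('o, 'm) cat =
  Ob :: "'o set"
  Hom :: "'o \<Rightarrow> 'o \<Rightarrow> 'm set"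
  Id :: "'o \<Rightarrow> 'm"
  Comp :: "'o \<Rightarrow> 'o \<Rightarrow> 'o \<Rightarrow> 'm \<Rightarrow> 'm \<Rightarrow> 'm"

text \<open>A \<open>k\<close>-simplex of the nerve is a pair \<open>(E, f)\<close> of objects \<open>E 0, \<dots>, E k\<close> and morphisms
  \<open>f i : E (i - 1) \<rightarrow> E i\<close> for \<open>1 \<le> i \<le> k\<close>. \<open>nerve_comp C E f p q\<close> is the composite
  \<open>f q \<circ> \<dots> \<circ> f (p + 1)\<close> for \<open>p \<le> q\<close>.\<close>

type_synonym ('o, 'm) nerve_simplex = "(nat \<Rightarrow> 'o) \<times> (nat \<Rightarrow> 'm)"

primrec nerve_comp_aux ::
  "('o, 'm) cat \<Rightarrow> (nat \<Rightarrow> 'o) \<Rightarrow> (nat \<Rightarrow> 'm) \<Rightarrow> nat \<Rightarrow> nat \<Rightarrow> 'm" where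
  "nerve_comp_aux C E f p 0 = Id C (E p)"
| "nerve_comp_aux C E f p (Suc d) =
     Comp C (E p) (E (p + d)) (E (p + Suc d)) (f (p + Suc d)) (nerve_comp_aux C E f p d)"

definition nerve_comp ::
  "('o, 'm) cat \<Rightarrow> (nat \<Rightarrow> 'o) \<Rightarrow> (nat \<Rightarrow> 'm) \<Rightarrow> nat \<Rightarrow> nat \<Rightarrow> 'm" where
  "nerve_comp C E f p q = nerve_comp_aux C E f p (q - p)"

definition nerve :: "('o, 'm) cat \<Rightarrow> ('o, 'm) nerve_simplex sset" where
  "nerve C =
     \<lparr>simp = (\<lambda>k. {(E, f). E \<in> {..k} \<rightarrow>\<^sub>E Ob C \<and> f \<in> (\<Pi>\<^sub>E i\<in>{1..k}. Hom C (E (i - 1)) (E i))}),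
      act = (\<lambda>m n \<rho> (E, f).
        (\<lambda>j\<in>{..m}. E (\<rho> j), \<lambda>j\<in>{1..m}. nerve_comp C E f (\<rho> (j - 1)) (\<rho> j)))\<rparr>"


subsection \<open>The Dold-Kan construction\<close>

text \<open>Chain complexes in non-positive degrees: \<open>Grp C n\<close> is the group in degree \<open>-n\<close> and \<open>Diff C n\<close>
  the differential from degree \<open>-(n + 1)\<close> to degree \<open>-n\<close>.\<close>

record 'a chain_complex =
  Grp :: "nat \<Rightarrow> 'a monoid"
  Diff :: "nat \<Rightarrow> 'a \<Rightarrow> 'a"

definition chain_maps :: "'a chain_complex \<Rightarrow> 'b chain_complex \<Rightarrow> (nat \<Rightarrow> 'a \<Rightarrow> 'b) set" where
  "chain_maps C D =
     {h. (\<forall>n. h n \<in> hom (Grp C n) (Grp D n) \<inter> extensional (carrier (Grp C n))) \<and>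
         (\<forall>n. \<forall>c\<in>carrier (Grp C (Suc n)). h n (Diff C n c) = Diff D n (h (Suc n) c))}"

text \<open>The generator \<open>e\<close> with indices \<open>i\<^sub>0 < \<dots> < i\<^sub>l\<close> is the strictly increasing list of its indices.\<close>

definition simplex_generators :: "nat \<Rightarrow> nat \<Rightarrow> nat list set" where
  "simplex_generators k l = {is. length is = Suc l \<and> sorted_wrt (<) is \<and> set is \<subseteq> {..k}}"

definition normalized_chains :: "nat \<Rightarrow> (nat list \<Rightarrow>\<^sub>0 int) chain_complex" where
  "normalized_chains k =
     \<lparr>Grp = (\<lambda>l. free_Abelian_group (simplex_generators k l)),
      Diff = (\<lambda>l. frag_extend (\<lambda>is. \<Sum>j\<le>Suc l.
        frag_cmul ((-1) ^ j) (frag_of (take j is @ drop (Suc j) is))))\<rparr>"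

definition normalized_chains_map ::
  "(nat \<Rightarrow> nat) \<Rightarrow> (nat list \<Rightarrow>\<^sub>0 int) \<Rightarrow> (nat list \<Rightarrow>\<^sub>0 int)" where
  "normalized_chains_map \<rho> =
     frag_extend (\<lambda>is. if sorted_wrt (<) (map \<rho> is) then frag_of (map \<rho> is) else 0)"

type_synonym 'a DK_simplex = "nat \<Rightarrow> (nat list \<Rightarrow>\<^sub>0 int) \<Rightarrow> 'a"

definition DK :: "'a chain_complex \<Rightarrow> 'a DK_simplex sset" where
  "DK C =
     \<lparr>simp = (\<lambda>k. chain_maps (normalized_chains k) C),
      act = (\<lambda>m n \<rho> h l. \<lambda>c\<in>carrier (Grp (normalized_chains m) l). h l (normalized_chains_map \<rho> c))\<rparr>"

text \<open>The homomorphism from a free abelian group that extends a given map on the generators.\<close>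

definition free_extension :: "'b set \<Rightarrow> 'a monoid \<Rightarrow> ('b \<Rightarrow> 'a) \<Rightarrow> ('b \<Rightarrow>\<^sub>0 int) \<Rightarrow> 'a" where
  "free_extension S G g =
     (\<lambda>c\<in>carrier (free_Abelian_group S).
        finprod G (\<lambda>b. g b [^]\<^bsub>G\<^esub> Poly_Mapping.lookup c b) (Poly_Mapping.keys c))"


section \<open>Simplicial presheaves on complex manifolds\<close>

text \<open>\<open>psh_map F X Y f\<close> is the restriction \<open>F(Y) \<rightarrow> F(X)\<close> along a holomorphic map \<open>f : X \<rightarrow> Y\<close>.\<close>

record ('p, 'v, 'a) presheaf =
  psh_obj :: "('p, 'v) cmanifold \<Rightarrow> 'a sset"
  psh_map :: "('p, 'v) cmanifold \<Rightarrow> ('p, 'v) cmanifold \<Rightarrow> ('p \<Rightarrow> 'p) \<Rightarrow> nat \<Rightarrow> 'a \<Rightarrow> 'a"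


subsection \<open>Holomorphic vector bundles\<close>

definition HVB_cat ::
  "('p, 'v::complex_model_space) cmanifold \<Rightarrow> (('p, 'v, 'f) vbundle, ('p, 'f) bundle_map) cat" where
  "HVB_cat X =
     \<lparr>Ob = {E. holomorphic_bundle X E \<and> holomorphic_connection X E (conn E)},
      Hom = bundle_isos X,
      Id = (\<lambda>E. \<lambda>x\<in>points X. \<lambda>e\<in>carrier (fibre E x). e),
      Comp = (\<lambda>E F G n m. \<lambda>x\<in>points X. \<lambda>e\<in>carrier (fibre E x). n x (m x e))\<rparr>"

type_synonym ('p, 'v, 'f) HVB_simplex =
  "(('p, 'v, 'f) vbundle, ('p, 'f) bundle_map) nerve_simplex"

definition HVB :: "('p, 'v::complex_model_space, ('p, 'v, 'f) HVB_simplex) presheaf" where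
  "HVB =
     \<lparr>psh_obj = (\<lambda>X. nerve (HVB_cat X)),
      psh_map = (\<lambda>X Y f k. \<lambda>(E, g)\<in>simp (nerve (HVB_cat Y)) k.
        (\<lambda>j\<in>{..k}. bundle_pullback X Y f (E j), \<lambda>j\<in>{1..k}. bundle_map_pullback X f (g j)))\<rparr>"


subsection \<open>Holomorphic forms\<close>

text \<open>
  The complex \<open>\<Omega>[u]\<close> truncated to degrees \<open>\<le> 0\<close>. A form of degree \<open>q\<close> times \<open>u\<^sup>p\<close> has degree
  \<open>q - 2p\<close>, so an element of degree \<open>-n\<close> is a polynomial \<open>\<Sum>\<^sub>p a\<^sub>p u\<^sup>p\<close> whose coefficient \<open>a\<^sub>p\<close> is a form of
  degree \<open>2p - n\<close>, with \<open>2p \<ge> n\<close>.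
\<close>

type_synonym ('p, 'v) form_poly = "nat \<Rightarrow> ('p, 'v) form"

definition Omega_group ::
  "('p, 'v::complex_model_space) cmanifold \<Rightarrow> nat \<Rightarrow> ('p, 'v) form_poly monoid" where
  "Omega_group X n =
     \<lparr>carrier = {a \<in> (\<Pi>\<^sub>E p\<in>{p. n \<le> 2 * p}. holomorphic_forms X (points X) (2 * p - n)).
        finite {p. n \<le> 2 * p \<and> a p \<noteq> form_zero X (2 * p - n)}},
      monoid.mult = (\<lambda>a b. \<lambda>p\<in>{p. n \<le> 2 * p}. form_add X (2 * p - n) (a p) (b p)),
      one = (\<lambda>p\<in>{p. n \<le> 2 * p}. form_zero X (2 * p - n))\<rparr>"

definition Omega_complex ::
  "('p, 'v::complex_model_space) cmanifold \<Rightarrow> ('p, 'v) form_poly chain_complex" where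
  "Omega_complex X =
     \<lparr>Grp = Omega_group X, Diff = (\<lambda>n a. \<one>\<^bsub>Omega_group X n\<^esub>)\<rparr>"

definition Omega_pullback ::
  "('p, 'v::complex_model_space) cmanifold \<Rightarrow> ('p, 'v) cmanifold \<Rightarrow> ('p \<Rightarrow> 'p) \<Rightarrow> nat \<Rightarrow>
     ('p, 'v) form_poly \<Rightarrow> ('p, 'v) form_poly" where
  "Omega_pullback X Y f n a = (\<lambda>p\<in>{p. n \<le> 2 * p}. form_pullback X Y f (2 * p - n) (a p))"

type_synonym ('p, 'v) Omega_simplex = "('p, 'v) form_poly DK_simplex"

definition Omega :: "('p, 'v::complex_model_space, ('p, 'v) Omega_simplex) presheaf" where
  "Omega =
     \<lparr>psh_obj = (\<lambda>X. DK (Omega_complex X)),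
      psh_map = (\<lambda>X Y f k. \<lambda>h\<in>simp (DK (Omega_complex Y)) k.
        \<lambda>l. \<lambda>c\<in>carrier (Grp (normalized_chains k) l). Omega_pullback X Y f l (h l c))\<rparr>"


subsection \<open>The Chern character\<close>

text \<open>
  For 1-forms \<open>A\<^sub>1, \<dots>, A\<^sub>l\<close> with values in composable Hom bundles, the composite
  \<open>A\<^sub>l \<circ> \<dots> \<circ> A\<^sub>1\<close> is the \<open>l\<close>-form
  \<open>(\<xi>\<^sub>1, \<dots>, \<xi>\<^sub>l) \<mapsto> \<Sum>\<^sub>\<sigma> sgn(\<sigma>) A\<^sub>l(\<xi>\<^sub>\<sigma>\<^sub>(\<^sub>1\<^sub>)) \<circ> \<dots> \<circ> A\<^sub>1(\<xi>\<^sub>\<sigma>\<^sub>(\<^sub>l\<^sub>))\<close>, without a factorial. \<open>word_comp A \<Xi> l j\<close> is the part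
  \<open>A\<^sub>j(\<Xi> (l - j)) \<circ> \<dots> \<circ> A\<^sub>1(\<Xi> (l - 1))\<close> of one summand, where \<open>\<Xi>\<close> is indexed from 0 and is
  already permuted, and where \<open>A j\<close> stands for \<open>A\<^sub>j\<^sub>+\<^sub>1\<close>.
\<close>

primrec word_comp :: "(nat \<Rightarrow> 't \<Rightarrow> 'f \<Rightarrow> 'f) \<Rightarrow> (nat \<Rightarrow> 't) \<Rightarrow> nat \<Rightarrow> nat \<Rightarrow> 'f \<Rightarrow> 'f" where
  "word_comp A \<Xi> l 0 = (\<lambda>e. e)"
| "word_comp A \<Xi> l (Suc j) = (\<lambda>e. A j (\<Xi> (l - Suc j)) (word_comp A \<Xi> l j e))"

text \<open>The form assigned to the generator with index list \<open>is\<close> of length \<open>l + 1\<close>.\<close>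

definition Ch_form ::
  "('p, 'v::complex_model_space) cmanifold \<Rightarrow> ('p, 'v, 'f) HVB_simplex \<Rightarrow> nat \<Rightarrow> nat list \<Rightarrow>
     ('p, 'v) form" where
  "Ch_form X = (\<lambda>(E, f) l is.
     let V = (\<lambda>x. fibre (E (is ! 0)) x);
         F = (\<lambda>q p. nerve_comp (HVB_cat X) E f (is ! p) (is ! q))
     in if l = 0 then (\<lambda>x\<in>points X. \<lambda>\<Xi>\<in>tangent_tuples X 0 x. of_nat (vdim (V x)))
        else (\<lambda>x\<in>points X. \<lambda>\<Xi>\<in>tangent_tuples X l x.
          \<Sum>\<sigma> | \<sigma> permutes {..<l}. of_int (sign \<sigma>) *
            vtrace (V x) (\<lambda>e. inv_into (carrier (V x)) (F l 0 x)
              (word_comp (\<lambda>j. hom_connection X (E (is ! j)) (E (is ! Suc j)) (F (Suc j) j) x)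
                (\<Xi> \<circ> \<sigma>) l l e))))"

definition Ch ::
  "('p, 'v::complex_model_space) cmanifold \<Rightarrow> nat \<Rightarrow> ('p, 'v, 'f) HVB_simplex \<Rightarrow>
     ('p, 'v) Omega_simplex" where
  "Ch X k = (\<lambda>Ef\<in>simp (psh_obj HVB X) k. \<lambda>l.
     free_extension (simplex_generators k l) (Omega_group X l)
       (\<lambda>is. \<lambda>p\<in>{p. l \<le> 2 * p}. if p = l then Ch_form X Ef l is else form_zero X (2 * p - l)))"


section \<open>Cech nerves\<close>

definition open_cover :: "('p, 'v) cmanifold \<Rightarrow> 'i set \<Rightarrow> ('i \<Rightarrow> 'p set) \<Rightarrow> bool" where
  "open_cover M I U \<longleftrightarrow> (\<forall>i\<in>I. openin (mtop M) (U i)) \<and> (\<Union>i\<in>I. U i) = points M"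

text \<open>The component of a tuple \<open>i = (i\<^sub>0, \<dots>, i\<^sub>k)\<close> consists of the points \<open>(i, x)\<close> with \<open>x\<close> in the
  intersection of the corresponding open sets.\<close>

definition cech_nerve ::
  "('p, 'v) cmanifold \<Rightarrow> 'i set \<Rightarrow> ('i \<Rightarrow> 'p set) \<Rightarrow> nat \<Rightarrow> ((nat \<Rightarrow> 'i) \<times> 'p, 'v) cmanifold" where
  "cech_nerve M I U k =
     coproduct_manifold ({..k} \<rightarrow>\<^sub>E I) (\<lambda>i. open_submanifold M (\<Inter>j\<in>{..k}. U (i j)))"

text \<open>The structure map of the Cech nerve, from level \<open>m\<close> to level \<open>k\<close>, of \<open>\<rho> : [k] \<rightarrow> [m]\<close>; the
  injections and surjections give the faces and degeneracies.\<close>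

definition cech_map :: "nat \<Rightarrow> (nat \<Rightarrow> nat) \<Rightarrow> (nat \<Rightarrow> 'i) \<times> 'p \<Rightarrow> (nat \<Rightarrow> 'i) \<times> 'p" where
  "cech_map k \<rho> = (\<lambda>(i, x). (compose {..k} i \<rho>, x))"

definition cech_eval ::
  "((nat \<Rightarrow> 'i) \<times> 'p, 'v, 'a) presheaf \<Rightarrow> ('p, 'v) cmanifold \<Rightarrow> 'i set \<Rightarrow> ('i \<Rightarrow> 'p set) \<Rightarrow> 'a cosset" where
  "cech_eval F M I U =
     \<lparr>level = (\<lambda>l. psh_obj F (cech_nerve M I U l)),
      coact = (\<lambda>k m \<rho>. psh_map F (cech_nerve M I U m) (cech_nerve M I U k) (cech_map k \<rho>))\<rparr>"

end

theory Submission
  imports Defs "Jordan_Normal_Form.Determinant"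
begin

text \<open>
  The heart of the matter is that \<open>Ch\<close> takes values in chain maps. The differential of the target
  vanishes, so for the generator with indices \<open>0, \<dots>, l\<close> one needs \<open>\<Sum>\<^sub>j (-1)\<^sup>j \<omega>\<^sub>j = 0\<close>, where \<open>\<omega>\<^sub>j\<close> belongs
  to the \<open>j\<close>-th face. Let \<open>f\<^sub>j : E\<^sub>j\<^sub>-\<^sub>1 \<rightarrow> E\<^sub>j\<close>, let \<open>A\<^sub>j = \<nabla>(f\<^sub>j)\<close>, and let \<open>T\<^sub>j\<close> be the trace of
  \<open>(f\<^sub>l \<circ> \<dots> \<circ> f\<^sub>1)\<^sup>-\<^sup>1 \<circ> A\<^sub>l \<circ> \<dots> \<circ> A\<^sub>1\<close> with \<open>A\<^sub>j\<close> replaced by \<open>f\<^sub>j\<close>. By the Leibniz rule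
  \<open>\<nabla>(f\<^sub>j\<^sub>+\<^sub>1 \<circ> f\<^sub>j) = f\<^sub>j\<^sub>+\<^sub>1 \<circ> A\<^sub>j + A\<^sub>j\<^sub>+\<^sub>1 \<circ> f\<^sub>j\<close>, the inner faces are \<open>\<omega>\<^sub>j = T\<^sub>j\<^sub>+\<^sub>1 + T\<^sub>j\<close>; moreover
  \<open>\<omega>\<^sub>l = T\<^sub>l\<close>, and \<open>\<omega>\<^sub>0 = T\<^sub>1\<close> since the trace is invariant under conjugation by \<open>f\<^sub>1\<close>. Hence the
  alternating sum telescopes. Compatibility with degeneracies holds because \<open>\<nabla>(id) = 0\<close>.

  For naturality, the structure maps of the Cech nerve are the identity in suitable charts, and
  connections are local operators, so that they can be pulled back along such maps sheet by sheet.
  Functoriality in the level of the Cech nerve and compatibility with \<open>Ch\<close> are then pointwise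
  statements, and the map on totalizations is composition with a cosimplicial map.
\<close>

section \<open>Simplicial sets, totalizations and nerves\<close>

text \<open>Both \<open>hom_connection\<close> and the connection of \<open>bundle_pullback\<close>
  are definite descriptions, so existence and uniqueness must be settled before anything can be
  computed. For \<open>hom_connection\<close> this is tensoriality: what the formula gives on a
  section at x depends only on the value of the section at x. There are no holomorphic bump
  functions to extend local sections; instead a connection acts on sections over all open sets,
  compatibly with restriction, and comparisons are made on a small trivialized open set. For
  pullbacks the obstacle is that a section upstairs need not come from below, since a structure map
  of the Cech nerve can send several components into the same one. Where the map is injective the
  section does descend, and this both defines the connection and forces it. Equations between
  vectors are checked in coordinates of the fibre, and the vanishing of a vector often takes the
  form v + v = v, which linear maps preserve.\<close>

lemma Delta_hom_le: "\<rho> \<in> Delta_hom m n \<Longrightarrow> i \<le> m \<Longrightarrow> \<rho> i \<le> n"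
  by (auto simp: Delta_hom_def PiE_iff)

lemma Delta_hom_mono: "\<rho> \<in> Delta_hom m n \<Longrightarrow> i \<le> j \<Longrightarrow> j \<le> m \<Longrightarrow> \<rho> i \<le> \<rho> j"
  by (auto simp: Delta_hom_def mono_on_def)

lemma Delta_hom_ext: "\<rho> \<in> Delta_hom m n \<Longrightarrow> \<rho> \<in> extensional {..m}"
  by (auto simp: Delta_hom_def PiE_iff)

lemma Delta_homI:
  assumes "\<And>i. i \<le> m \<Longrightarrow> \<rho> i \<le> n" "\<And>i j. i \<le> j \<Longrightarrow> j \<le> m \<Longrightarrow> \<rho> i \<le> \<rho> j" "\<rho> \<in> extensional {..m}"
  shows "\<rho> \<in> Delta_hom m n"
  using assms by (auto simp: Delta_hom_def mono_on_def PiE_iff)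

lemma Delta_hom_compose:
  assumes "\<sigma> \<in> Delta_hom l m" "\<rho> \<in> Delta_hom m n"
  shows "compose {..l} \<rho> \<sigma> \<in> Delta_hom l n"
  by (rule Delta_homI)
    (use assms in \<open>auto simp: compose_def intro!: Delta_hom_le[OF assms(2)] Delta_hom_le[OF assms(1)]
      Delta_hom_mono[OF assms(2)] Delta_hom_mono[OF assms(1)]\<close>)

lemma Delta_hom_id: "(\<lambda>i\<in>{..n}. i) \<in> Delta_hom n n"
  by (rule Delta_homI) auto

text \<open>\<open>compose\<close> is \<open>undefined\<close> outside its set, so the inner
  restriction to \<open>{..m}\<close> is harmless only because \<sigma> takes its values
  there.\<close>

lemma compose_Delta_assoc:
  assumes "\<sigma> \<in> Delta_hom l m"
  shows "compose {..l} \<alpha> (compose {..l} \<rho> \<sigma>) = compose {..l} (compose {..m} \<alpha> \<rho>) \<sigma>"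
  using Delta_hom_le[OF assms] by (auto simp: compose_def fun_eq_iff)

lemma compose_Delta_Id:
  assumes "\<rho> \<in> Delta_hom m n"
  shows "compose {..m} (\<lambda>i\<in>{..n}. i) \<rho> = \<rho>" and "compose {..m} \<rho> (\<lambda>i\<in>{..m}. i) = \<rho>"
  using Delta_hom_le[OF assms] Delta_hom_ext[OF assms]
  by (auto simp: compose_def fun_eq_iff extensional_def)

lemma simplicial_setI:
  assumes "\<And>m n \<rho> x. \<rho> \<in> Delta_hom m n \<Longrightarrow> x \<in> simp X n \<Longrightarrow> act X m n \<rho> x \<in> simp X m"
    and "\<And>n x. x \<in> simp X n \<Longrightarrow> act X n n (\<lambda>i\<in>{..n}. i) x = x"
    and "\<And>l m n \<sigma> \<rho> x. \<sigma> \<in> Delta_hom l m \<Longrightarrow> \<rho> \<in> Delta_hom m n \<Longrightarrow> x \<in> simp X n \<Longrightarrow>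
      act X l n (compose {..l} \<rho> \<sigma>) x = act X l m \<sigma> (act X m n \<rho> x)"
  shows "simplicial_set X"
  using assms unfolding simplicial_set_def by blast

lemma simplicial_setD:
  assumes "simplicial_set X"
  shows "\<And>m n \<rho> x. \<rho> \<in> Delta_hom m n \<Longrightarrow> x \<in> simp X n \<Longrightarrow> act X m n \<rho> x \<in> simp X m"
    and "\<And>n x. x \<in> simp X n \<Longrightarrow> act X n n (\<lambda>i\<in>{..n}. i) x = x"
    and "\<And>l m n \<sigma> \<rho> x. \<sigma> \<in> Delta_hom l m \<Longrightarrow> \<rho> \<in> Delta_hom m n \<Longrightarrow> x \<in> simp X n \<Longrightarrow>
      act X l n (compose {..l} \<rho> \<sigma>) x = act X l m \<sigma> (act X m n \<rho> x)"
  using assms unfolding simplicial_set_def by blast+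

lemma simplicial_mapI:
  assumes "simplicial_set X" "simplicial_set Y"
    and "\<And>n. g n \<in> simp X n \<rightarrow>\<^sub>E simp Y n"
    and "\<And>m n \<rho> x. \<rho> \<in> Delta_hom m n \<Longrightarrow> x \<in> simp X n \<Longrightarrow> g m (act X m n \<rho> x) = act Y m n \<rho> (g n x)"
  shows "simplicial_map X Y g"
  using assms unfolding simplicial_map_def by blast

lemma simplicial_mapD:
  assumes "simplicial_map X Y g"
  shows "simplicial_set X" "simplicial_set Y"
    and "\<And>n. g n \<in> simp X n \<rightarrow>\<^sub>E simp Y n"
    and "\<And>n x. x \<in> simp X n \<Longrightarrow> g n x \<in> simp Y n"
    and "\<And>m n \<rho> x. \<rho> \<in> Delta_hom m n \<Longrightarrow> x \<in> simp X n \<Longrightarrow> g m (act X m n \<rho> x) = act Y m n \<rho> (g n x)"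
  using assms unfolding simplicial_map_def by blast+

lemma simplicial_set_standard_simplex: "simplicial_set (standard_simplex l)"
  by (rule simplicial_setI)
    (auto simp: standard_simplex_def Delta_hom_compose compose_Delta_Id compose_Delta_assoc)

lemma simplicial_set_prod:
  assumes "simplicial_set X" "simplicial_set Y"
  shows "simplicial_set (sset_prod X Y)"
  by (rule simplicial_setI)
    (auto simp: sset_prod_def simplicial_setD[OF assms(1)] simplicial_setD[OF assms(2)])

lemma simp_prod_standard:
  "simp (sset_prod (standard_simplex l) (standard_simplex n)) j = Delta_hom j l \<times> Delta_hom j n"
  by (simp add: sset_prod_def standard_simplex_def)

lemma act_prod_standard:
  "act (sset_prod (standard_simplex l) (standard_simplex n)) i j \<sigma> (\<alpha>, \<beta>) =
     (compose {..i} \<alpha> \<sigma>, compose {..i} \<beta> \<sigma>)"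
  by (simp add: sset_prod_def standard_simplex_def)

lemmas simplicial_set_prod_standard =
  simplicial_set_prod[OF simplicial_set_standard_simplex simplicial_set_standard_simplex]

section \<open>Totalization\<close>

lemma simp_Tot_iff:
  "F \<in> simp (Tot X) n \<longleftrightarrow>
     (\<forall>l. simplicial_map (sset_prod (standard_simplex l) (standard_simplex n)) (level X l) (F l)) \<and>
     (\<forall>k m. \<forall>\<rho>\<in>Delta_hom k m. \<forall>j. \<forall>\<alpha>\<in>Delta_hom j k. \<forall>\<beta>\<in>Delta_hom j n.
        F m j (compose {..j} \<rho> \<alpha>, \<beta>) = coact X k m \<rho> j (F k j (\<alpha>, \<beta>)))"
  by (simp add: Tot_def)

lemma simp_TotD:
  assumes "F \<in> simp (Tot X) n"
  shows "F l j \<in> extensional (Delta_hom j l \<times> Delta_hom j n)"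
    and "\<alpha> \<in> Delta_hom j l \<Longrightarrow> \<beta> \<in> Delta_hom j n \<Longrightarrow> F l j (\<alpha>, \<beta>) \<in> simp (level X l) j"
    and "\<sigma> \<in> Delta_hom i j \<Longrightarrow> \<alpha> \<in> Delta_hom j l \<Longrightarrow> \<beta> \<in> Delta_hom j n \<Longrightarrow>
      F l i (compose {..i} \<alpha> \<sigma>, compose {..i} \<beta> \<sigma>) = act (level X l) i j \<sigma> (F l j (\<alpha>, \<beta>))"
    and "\<rho> \<in> Delta_hom k m \<Longrightarrow> \<alpha> \<in> Delta_hom j k \<Longrightarrow> \<beta> \<in> Delta_hom j n \<Longrightarrow>
      F m j (compose {..j} \<rho> \<alpha>, \<beta>) = coact X k m \<rho> j (F k j (\<alpha>, \<beta>))"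
proof -
  have F: "simplicial_map (sset_prod (standard_simplex l) (standard_simplex n)) (level X l) (F l)"
    using assms by (simp add: simp_Tot_iff)
  show "F l j \<in> extensional (Delta_hom j l \<times> Delta_hom j n)"
    using simplicial_mapD(3)[OF F, of j] by (auto simp: simp_prod_standard PiE_iff)
  show "\<alpha> \<in> Delta_hom j l \<Longrightarrow> \<beta> \<in> Delta_hom j n \<Longrightarrow> F l j (\<alpha>, \<beta>) \<in> simp (level X l) j"
    using simplicial_mapD(4)[OF F, of "(\<alpha>, \<beta>)" j] by (simp add: simp_prod_standard)
  show "\<sigma> \<in> Delta_hom i j \<Longrightarrow> \<alpha> \<in> Delta_hom j l \<Longrightarrow> \<beta> \<in> Delta_hom j n \<Longrightarrow>
      F l i (compose {..i} \<alpha> \<sigma>, compose {..i} \<beta> \<sigma>) = act (level X l) i j \<sigma> (F l j (\<alpha>, \<beta>))"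
    using simplicial_mapD(5)[OF F, of \<sigma> i j "(\<alpha>, \<beta>)"] by (simp add: simp_prod_standard act_prod_standard)
  show "\<rho> \<in> Delta_hom k m \<Longrightarrow> \<alpha> \<in> Delta_hom j k \<Longrightarrow> \<beta> \<in> Delta_hom j n \<Longrightarrow>
      F m j (compose {..j} \<rho> \<alpha>, \<beta>) = coact X k m \<rho> j (F k j (\<alpha>, \<beta>))"
    using assms by (simp add: simp_Tot_iff)
qed

lemma simp_TotI:
  assumes "\<And>l. simplicial_set (level X l)"
    and "\<And>l j. F l j \<in> extensional (Delta_hom j l \<times> Delta_hom j n)"
    and "\<And>l j \<alpha> \<beta>. \<alpha> \<in> Delta_hom j l \<Longrightarrow> \<beta> \<in> Delta_hom j n \<Longrightarrow> F l j (\<alpha>, \<beta>) \<in> simp (level X l) j"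
    and "\<And>l i j \<sigma> \<alpha> \<beta>. \<sigma> \<in> Delta_hom i j \<Longrightarrow> \<alpha> \<in> Delta_hom j l \<Longrightarrow> \<beta> \<in> Delta_hom j n \<Longrightarrow>
      F l i (compose {..i} \<alpha> \<sigma>, compose {..i} \<beta> \<sigma>) = act (level X l) i j \<sigma> (F l j (\<alpha>, \<beta>))"
    and "\<And>k m j \<rho> \<alpha> \<beta>. \<rho> \<in> Delta_hom k m \<Longrightarrow> \<alpha> \<in> Delta_hom j k \<Longrightarrow> \<beta> \<in> Delta_hom j n \<Longrightarrow>
      F m j (compose {..j} \<rho> \<alpha>, \<beta>) = coact X k m \<rho> j (F k j (\<alpha>, \<beta>))"
  shows "F \<in> simp (Tot X) n"
proof -
  have "simplicial_map (sset_prod (standard_simplex l) (standard_simplex n)) (level X l) (F l)" for l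
    by (rule simplicial_mapI)
      (use assms in \<open>auto simp: simp_prod_standard act_prod_standard simplicial_set_prod_standard PiE_iff\<close>)
  then show ?thesis using assms(5) by (simp add: simp_Tot_iff)
qed

lemma act_Tot:
  "act (Tot X) m n \<rho> F l j = (\<lambda>p\<in>Delta_hom j l \<times> Delta_hom j m. F l j (fst p, compose {..j} \<rho> (snd p)))"
  by (simp add: Tot_def)

text \<open>The operator precomposes in the second factor only. It therefore commutes with
  simplicial operators by associativity, and with the cosimplicial structure because that one
  touches only the first factor.\<close>

lemma act_Tot_in:
  assumes "\<And>l. simplicial_set (level X l)" "\<rho> \<in> Delta_hom m n" "F \<in> simp (Tot X) n"
  shows "act (Tot X) m n \<rho> F \<in> simp (Tot X) m"
proof (rule simp_TotI)
  fix l i j \<sigma> \<alpha> \<beta>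
  assume *: "\<sigma> \<in> Delta_hom i j" "\<alpha> \<in> Delta_hom j l" "\<beta> \<in> Delta_hom j m"
  show "act (Tot X) m n \<rho> F l i (compose {..i} \<alpha> \<sigma>, compose {..i} \<beta> \<sigma>) =
      act (level X l) i j \<sigma> (act (Tot X) m n \<rho> F l j (\<alpha>, \<beta>))"
    using * by (simp add: act_Tot Delta_hom_compose[OF _ *(2)] Delta_hom_compose[OF _ *(3)]
      Delta_hom_compose[OF _ assms(2)] compose_Delta_assoc simp_TotD(3)[OF assms(3)])
next
  fix k m' j \<rho>' \<alpha> \<beta>
  assume *: "\<rho>' \<in> Delta_hom k m'" "\<alpha> \<in> Delta_hom j k" "\<beta> \<in> Delta_hom j m"
  show "act (Tot X) m n \<rho> F m' j (compose {..j} \<rho>' \<alpha>, \<beta>) =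
     coact X k m' \<rho>' j (act (Tot X) m n \<rho> F k j (\<alpha>, \<beta>))"
    using * by (simp add: act_Tot Delta_hom_compose[OF _ *(1)] Delta_hom_compose[OF _ assms(2)]
       simp_TotD(4)[OF assms(3)])
qed (use assms in \<open>auto simp: act_Tot Delta_hom_compose simp_TotD(2)[OF assms(3)]\<close>)

lemma simplicial_set_Tot:
  assumes "\<And>l. simplicial_set (level X l)"
  shows "simplicial_set (Tot X)"
proof (rule simplicial_setI)
  fix n F assume F: "F \<in> simp (Tot X) n"
  show "act (Tot X) n n (\<lambda>i\<in>{..n}. i) F = F"
  proof (intro ext)
    fix l j p
    show "act (Tot X) n n (\<lambda>i\<in>{..n}. i) F l j p = F l j p"
      using simp_TotD(1)[OF F, of l j]
      by (cases p) (auto simp: act_Tot compose_Delta_Id extensional_def)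
  qed
next
  fix l m n \<sigma> \<rho> F
  assume "\<sigma> \<in> Delta_hom l m" "\<rho> \<in> Delta_hom m n" "F \<in> simp (Tot X) n"
  then show "act (Tot X) l n (compose {..l} \<rho> \<sigma>) F = act (Tot X) l m \<sigma> (act (Tot X) m n \<rho> F)"
    by (intro ext) (auto simp: act_Tot Delta_hom_compose compose_Delta_assoc restrict_def)
qed (use assms in \<open>auto intro: act_Tot_in\<close>)

text \<open>\<open>g\<close> is applied to the values of the maps \<open>F l\<close>, while the
  operators of \<open>Tot\<close> change their arguments, so the two commute. The conditions on a
  simplex of the target are the two naturality conditions of a cosimplicial map.\<close>

lemma simplicial_map_Tot:
  assumes "cosimplicial_map X Y g"
  shows "simplicial_map (Tot X) (Tot Y) (Tot_map g X)"
proof -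
  have X: "\<And>l. simplicial_set (level X l)" and Y: "\<And>l. simplicial_set (level Y l)"
    and g: "\<And>l. simplicial_map (level X l) (level Y l) (g l)"
    and nat: "\<And>k m \<rho> n x. \<rho> \<in> Delta_hom k m \<Longrightarrow> x \<in> simp (level X k) n \<Longrightarrow>
        g m n (coact X k m \<rho> n x) = coact Y k m \<rho> n (g k n x)"
    using assms by (auto simp: cosimplicial_map_def cosimplicial_sset_def)
  have in_Tot: "Tot_map g X n F \<in> simp (Tot Y) n" if F: "F \<in> simp (Tot X) n" for n F
  proof (rule simp_TotI)
    fix l i j \<sigma> \<alpha> \<beta>
    assume "\<sigma> \<in> Delta_hom i j" "\<alpha> \<in> Delta_hom j l" "\<beta> \<in> Delta_hom j n"
    then show "Tot_map g X n F l i (compose {..i} \<alpha> \<sigma>, compose {..i} \<beta> \<sigma>) =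
        act (level Y l) i j \<sigma> (Tot_map g X n F l j (\<alpha>, \<beta>))"
      using F by (simp add: Tot_map_def Delta_hom_compose simp_TotD(2,3)[OF F] simplicial_mapD(5)[OF g])
  next
    fix k m j \<rho> \<alpha> \<beta>
    assume "\<rho> \<in> Delta_hom k m" "\<alpha> \<in> Delta_hom j k" "\<beta> \<in> Delta_hom j n"
    then show "Tot_map g X n F m j (compose {..j} \<rho> \<alpha>, \<beta>) =
        coact Y k m \<rho> j (Tot_map g X n F k j (\<alpha>, \<beta>))"
      using F by (simp add: Tot_map_def Delta_hom_compose simp_TotD(2,4)[OF F] nat)
  qed (use F Y in \<open>auto simp: Tot_map_def simp_TotD(2)[OF F] simplicial_mapD(4)[OF g]\<close>)
  show ?thesis
  proof (rule simplicial_mapI)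
    fix m n \<rho> F assume \<rho>: "\<rho> \<in> Delta_hom m n" and F: "F \<in> simp (Tot X) n"
    show "Tot_map g X m (act (Tot X) m n \<rho> F) = act (Tot Y) m n \<rho> (Tot_map g X n F)"
      using F \<rho> act_Tot_in[OF X \<rho> F]
      by (intro ext) (auto simp: Tot_map_def act_Tot Delta_hom_compose restrict_def)
  qed (use in_Tot X Y in \<open>auto simp: simplicial_set_Tot Tot_map_def\<close>)
qed

section \<open>Categories and their nerves\<close>

definition category :: "('o, 'm) cat \<Rightarrow> bool" where
  "category C \<longleftrightarrow>
     (\<forall>A\<in>Ob C. Id C A \<in> Hom C A A) \<and>
     (\<forall>A\<in>Ob C. \<forall>B\<in>Ob C. \<forall>D\<in>Ob C. \<forall>m\<in>Hom C A B. \<forall>n\<in>Hom C B D. Comp C A B D n m \<in> Hom C A D) \<and>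
     (\<forall>A\<in>Ob C. \<forall>B\<in>Ob C. \<forall>m\<in>Hom C A B. Comp C A A B m (Id C A) = m \<and> Comp C A B B (Id C B) m = m) \<and>
     (\<forall>A\<in>Ob C. \<forall>B\<in>Ob C. \<forall>D\<in>Ob C. \<forall>G\<in>Ob C. \<forall>m\<in>Hom C A B. \<forall>n\<in>Hom C B D. \<forall>k\<in>Hom C D G.
        Comp C A B G (Comp C B D G k n) m = Comp C A D G k (Comp C A B D n m))"

lemma categoryD:
  assumes "category C"
  shows "A \<in> Ob C \<Longrightarrow> Id C A \<in> Hom C A A"
    and "A \<in> Ob C \<Longrightarrow> B \<in> Ob C \<Longrightarrow> D \<in> Ob C \<Longrightarrow> m \<in> Hom C A B \<Longrightarrow> n \<in> Hom C B D \<Longrightarrow>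
      Comp C A B D n m \<in> Hom C A D"
    and "A \<in> Ob C \<Longrightarrow> B \<in> Ob C \<Longrightarrow> m \<in> Hom C A B \<Longrightarrow> Comp C A A B m (Id C A) = m"
    and "A \<in> Ob C \<Longrightarrow> B \<in> Ob C \<Longrightarrow> m \<in> Hom C A B \<Longrightarrow> Comp C A B B (Id C B) m = m"
    and "A \<in> Ob C \<Longrightarrow> B \<in> Ob C \<Longrightarrow> D \<in> Ob C \<Longrightarrow> G \<in> Ob C \<Longrightarrow>
      m \<in> Hom C A B \<Longrightarrow> n \<in> Hom C B D \<Longrightarrow> k \<in> Hom C D G \<Longrightarrow>
      Comp C A B G (Comp C B D G k n) m = Comp C A D G k (Comp C A B D n m)"
  using assms unfolding category_def by blast+

text \<open>Indexing the morphisms by \<open>Suc i\<close> removes the truncated subtraction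
  \<open>i - 1\<close>, which suits inductions on the target vertex.\<close>

lemma simp_nerve_iff:
  "(E, f) \<in> simp (nerve C) n \<longleftrightarrow>
     (\<forall>i\<le>n. E i \<in> Ob C) \<and> E \<in> extensional {..n} \<and>
     (\<forall>i<n. f (Suc i) \<in> Hom C (E i) (E (Suc i))) \<and> f \<in> extensional {1..n}"
proof -
  have "(\<forall>i\<in>{1..n}. f i \<in> Hom C (E (i - 1)) (E i)) \<longleftrightarrow> (\<forall>i<n. f (Suc i) \<in> Hom C (E i) (E (Suc i)))"
  proof
    assume h: "\<forall>i\<in>{1..n}. f i \<in> Hom C (E (i - 1)) (E i)"
    show "\<forall>i<n. f (Suc i) \<in> Hom C (E i) (E (Suc i))"
    proof (intro allI impI)
      fix i assume "i < n"
      then show "f (Suc i) \<in> Hom C (E i) (E (Suc i))" using h[rule_format, of "Suc i"] by simp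
    qed
  next
    assume h: "\<forall>i<n. f (Suc i) \<in> Hom C (E i) (E (Suc i))"
    show "\<forall>i\<in>{1..n}. f i \<in> Hom C (E (i - 1)) (E i)"
    proof
      fix i assume "i \<in> {1..n}"
      then show "f i \<in> Hom C (E (i - 1)) (E i)" using h[rule_format, of "i - 1"] by (cases i) simp_all
    qed
  qed
  then show ?thesis by (auto simp: nerve_def PiE_iff)
qed

lemma nerve_comp_same: "nerve_comp C E f p p = Id C (E p)"
  by (simp add: nerve_comp_def)

lemma nerve_comp_Suc:
  "p \<le> q \<Longrightarrow> nerve_comp C E f p (Suc q) = Comp C (E p) (E q) (E (Suc q)) (f (Suc q)) (nerve_comp C E f p q)"
  by (simp add: nerve_comp_def Suc_diff_le)

lemma nerve_comp_in_Hom: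
  assumes "category C" "(E, f) \<in> simp (nerve C) n" "p \<le> q" "q \<le> n"
  shows "nerve_comp C E f p q \<in> Hom C (E p) (E q)"
  using assms(3,4)
proof (induction q rule: dec_induct)
  case base
  then show ?case using assms(2) by (simp add: nerve_comp_same simp_nerve_iff categoryD[OF assms(1)])
next
  case (step q)
  then have "nerve_comp C E f p q \<in> Hom C (E p) (E q)" by simp
  moreover have "f (Suc q) \<in> Hom C (E q) (E (Suc q))" "E p \<in> Ob C" "E q \<in> Ob C" "E (Suc q) \<in> Ob C"
    using assms(2) step by (auto simp: simp_nerve_iff)
  ultimately show ?case using step by (simp add: nerve_comp_Suc categoryD(2)[OF assms(1)])
qed

lemma nerve_comp_step:
  assumes "category C" "(E, f) \<in> simp (nerve C) n" "i < n"
  shows "nerve_comp C E f i (Suc i) = f (Suc i)"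
  using assms(2,3) by (simp add: nerve_comp_Suc nerve_comp_same simp_nerve_iff categoryD(3)[OF assms(1)])

text \<open>Composites grow at their target end, so the induction is on \<open>r\<close> and uses
  associativity once in each step.\<close>

lemma nerve_comp_trans:
  assumes "category C" "(E, f) \<in> simp (nerve C) n" "p \<le> q" "q \<le> r" "r \<le> n"
  shows "Comp C (E p) (E q) (E r) (nerve_comp C E f q r) (nerve_comp C E f p q) = nerve_comp C E f p r"
  using assms(4,5)
proof (induction r rule: dec_induct)
  case base
  then show ?case
    using nerve_comp_in_Hom[OF assms(1,2,3) base] assms(2) assms(3)
    by (simp add: nerve_comp_same simp_nerve_iff categoryD(4)[OF assms(1)])
next
  case (step r)
  have ob: "f (Suc r) \<in> Hom C (E r) (E (Suc r))" "E p \<in> Ob C" "E q \<in> Ob C" "E r \<in> Ob C" "E (Suc r) \<in> Ob C"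
    using assms(2,3) step by (auto simp: simp_nerve_iff)
  have h: "nerve_comp C E f p q \<in> Hom C (E p) (E q)" "nerve_comp C E f q r \<in> Hom C (E q) (E r)"
    using step assms(3) by (auto intro!: nerve_comp_in_Hom[OF assms(1,2)])
  from step have IH: "Comp C (E p) (E q) (E r) (nerve_comp C E f q r) (nerve_comp C E f p q) = nerve_comp C E f p r"
    by simp
  show ?case
    using step assms(3) categoryD(5)[OF assms(1) ob(2,3,4,5) h ob(1)]
    by (simp add: nerve_comp_Suc IH)
qed

lemma act_nerve:
  "act (nerve C) m n \<rho> (E, f) = (\<lambda>j\<in>{..m}. E (\<rho> j), \<lambda>j\<in>{1..m}. nerve_comp C E f (\<rho> (j - 1)) (\<rho> j))"
  by (simp add: nerve_def)

lemma act_nerve_in: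
  assumes "category C" "\<rho> \<in> Delta_hom m n" "(E, f) \<in> simp (nerve C) n"
  shows "act (nerve C) m n \<rho> (E, f) \<in> simp (nerve C) m"
  unfolding act_nerve simp_nerve_iff
  using assms Delta_hom_le[OF assms(2)] Delta_hom_mono[OF assms(2)]
  by (auto intro!: nerve_comp_in_Hom simp: simp_nerve_iff[THEN iffD1])

text \<open>The morphisms of the new simplex are themselves composites, and transitivity merges
  them. Functoriality of the nerve and the compatibility of \<open>Ch_form\<close> with operators
  both rest on this.\<close>

lemma nerve_comp_act:
  assumes "category C" "\<rho> \<in> Delta_hom m n" "(E, f) \<in> simp (nerve C) n" "p \<le> q" "q \<le> m"
  shows "nerve_comp C (\<lambda>j\<in>{..m}. E (\<rho> j)) (\<lambda>j\<in>{1..m}. nerve_comp C E f (\<rho> (j - 1)) (\<rho> j)) p q =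
    nerve_comp C E f (\<rho> p) (\<rho> q)"
  using assms(4,5)
proof (induction q rule: dec_induct)
  case base
  then show ?case by (simp add: nerve_comp_same)
next
  case (step q)
  then show ?case
    using nerve_comp_trans[OF assms(1,3) Delta_hom_mono[OF assms(2)] Delta_hom_mono[OF assms(2)] Delta_hom_le[OF assms(2)], of p q "Suc q"]
    by (simp add: nerve_comp_Suc)
qed

lemma simplicial_set_nerve:
  assumes "category C"
  shows "simplicial_set (nerve C)"
proof (rule simplicial_setI)
  fix n and x :: "('a, 'b) nerve_simplex" assume x: "x \<in> simp (nerve C) n"
  obtain E f where [simp]: "x = (E, f)" by (cases x)
  have "E \<in> extensional {..n}" "f \<in> extensional {1..n}" using x by (auto simp: simp_nerve_iff)
  moreover have "nerve_comp C E f (j - 1) j = f j" if "j \<in> {1..n}" for j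
    using nerve_comp_step[OF assms x[simplified], of "j - 1"] that by (cases j) simp_all
  ultimately show "act (nerve C) n n (\<lambda>i\<in>{..n}. i) x = x"
    by (auto simp: act_nerve fun_eq_iff extensional_def restrict_def)
next
  fix l m n \<sigma> \<rho> and x :: "('a, 'b) nerve_simplex"
  assume *: "\<sigma> \<in> Delta_hom l m" "\<rho> \<in> Delta_hom m n" "x \<in> simp (nerve C) n"
  obtain E f where [simp]: "x = (E, f)" by (cases x)
  have "nerve_comp C (\<lambda>j\<in>{..m}. E (\<rho> j)) (\<lambda>j\<in>{1..m}. nerve_comp C E f (\<rho> (j - 1)) (\<rho> j)) (\<sigma> (j - 1)) (\<sigma> j)
     = nerve_comp C E f (\<rho> (\<sigma> (j - 1))) (\<rho> (\<sigma> j))" if "j \<in> {1..l}" for j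
    using that *
    by (intro nerve_comp_act[OF assms *(2)]) (auto intro: Delta_hom_mono[OF *(1)] Delta_hom_le[OF *(1)])
  then show "act (nerve C) l n (compose {..l} \<rho> \<sigma>) x = act (nerve C) l m \<sigma> (act (nerve C) m n \<rho> x)"
    using Delta_hom_le[OF *(1)] by (auto simp: act_nerve compose_def fun_eq_iff)
qed (use act_nerve_in[OF assms] in auto)

lemma nerve_comp_functor:
  assumes C: "category C" and x: "(E, f) \<in> simp (nerve C) n" and "p \<le> q" "q \<le> n"
    and Id: "\<And>A. A \<in> Ob C \<Longrightarrow> Fm (Id C A) = Id D (Fo A)"
    and Comp: "\<And>A B G m n. A \<in> Ob C \<Longrightarrow> B \<in> Ob C \<Longrightarrow> G \<in> Ob C \<Longrightarrow> m \<in> Hom C A B \<Longrightarrow> n \<in> Hom C B G \<Longrightarrow>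
      Fm (Comp C A B G n m) = Comp D (Fo A) (Fo B) (Fo G) (Fm n) (Fm m)"
  shows "nerve_comp D (\<lambda>j\<in>{..n}. Fo (E j)) (\<lambda>j\<in>{1..n}. Fm (f j)) p q = Fm (nerve_comp C E f p q)"
  using assms(3,4)
proof (induction q rule: dec_induct)
  case base
  then show ?case using x by (simp add: nerve_comp_same Id simp_nerve_iff)
next
  case (step q)
  then show ?case using x nerve_comp_in_Hom[OF C x, of p q]
    by (simp add: nerve_comp_Suc Comp simp_nerve_iff)
qed

text \<open>Functoriality of the nerve. It is applied to the pullback of bundles, where the effect
  on a morphism does not refer to its source and target; hence \<open>Fm\<close> takes the morphism
  alone.\<close>

lemma simplicial_map_nerve:
  assumes C: "category C" and D: "category D"
    and Ob: "\<And>A. A \<in> Ob C \<Longrightarrow> Fo A \<in> Ob D"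
    and Hom: "\<And>A B m. A \<in> Ob C \<Longrightarrow> B \<in> Ob C \<Longrightarrow> m \<in> Hom C A B \<Longrightarrow> Fm m \<in> Hom D (Fo A) (Fo B)"
    and Id: "\<And>A. A \<in> Ob C \<Longrightarrow> Fm (Id C A) = Id D (Fo A)"
    and Comp: "\<And>A B G m n. A \<in> Ob C \<Longrightarrow> B \<in> Ob C \<Longrightarrow> G \<in> Ob C \<Longrightarrow> m \<in> Hom C A B \<Longrightarrow> n \<in> Hom C B G \<Longrightarrow>
      Fm (Comp C A B G n m) = Comp D (Fo A) (Fo B) (Fo G) (Fm n) (Fm m)"
  shows "simplicial_map (nerve C) (nerve D)
    (\<lambda>k. \<lambda>(E, g)\<in>simp (nerve C) k. (\<lambda>j\<in>{..k}. Fo (E j), \<lambda>j\<in>{1..k}. Fm (g j)))"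
proof (rule simplicial_mapI)
  fix n
  show "(\<lambda>(E, g)\<in>simp (nerve C) n. (\<lambda>j\<in>{..n}. Fo (E j), \<lambda>j\<in>{1..n}. Fm (g j)))
      \<in> simp (nerve C) n \<rightarrow>\<^sub>E simp (nerve D) n"
    by (auto simp: simp_nerve_iff intro!: Ob Hom)
next
  fix m n \<rho> and x :: "('a, 'b) nerve_simplex"
  assume \<rho>: "\<rho> \<in> Delta_hom m n" and x: "x \<in> simp (nerve C) n"
  obtain E f where [simp]: "x = (E, f)" by (cases x)
  have "nerve_comp D (\<lambda>j\<in>{..n}. Fo (E j)) (\<lambda>j\<in>{1..n}. Fm (f j)) (\<rho> (j - 1)) (\<rho> j) =
      Fm (nerve_comp C E f (\<rho> (j - 1)) (\<rho> j))" if "j \<in> {1..m}" for j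
    using that x
    by (intro nerve_comp_functor[OF C] Id Comp)
      (auto intro: Delta_hom_mono[OF \<rho>] Delta_hom_le[OF \<rho>])
  then show "(\<lambda>(E, g)\<in>simp (nerve C) m. (\<lambda>j\<in>{..m}. Fo (E j), \<lambda>j\<in>{1..m}. Fm (g j))) (act (nerve C) m n \<rho> x) =
      act (nerve D) m n \<rho> ((\<lambda>(E, g)\<in>simp (nerve C) n. (\<lambda>j\<in>{..n}. Fo (E j), \<lambda>j\<in>{1..n}. Fm (g j))) x)"
    using x act_nerve_in[OF C \<rho> x[simplified]] Delta_hom_le[OF \<rho>]
    by (simp add: act_nerve restrict_def) (auto simp: fun_eq_iff)
qed (use C D in \<open>auto intro: simplicial_set_nerve\<close>)

section \<open>The Dold-Kan construction\<close>

lemma carrier_normalized_chains [simp]: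
  "c \<in> carrier (Grp (normalized_chains k) l) \<longleftrightarrow> Poly_Mapping.keys c \<subseteq> simplex_generators k l"
  by (simp add: normalized_chains_def)

lemma Grp_normalized_chains: "Grp (normalized_chains k) l = free_Abelian_group (simplex_generators k l)"
  by (simp add: normalized_chains_def)

lemma Diff_normalized_chains:
  "Diff (normalized_chains k) l = frag_extend (\<lambda>is. \<Sum>j\<le>Suc l.
        frag_cmul ((-1) ^ j) (frag_of (take j is @ drop (Suc j) is)))"
  by (simp add: normalized_chains_def)

lemma in_simplex_generators_iff:
  "is \<in> simplex_generators k l \<longleftrightarrow>
     length is = Suc l \<and> (\<forall>i j. i < j \<longrightarrow> j \<le> l \<longrightarrow> is ! i < is ! j) \<and> (\<forall>i\<le>l. is ! i \<le> k)"
  by (fastforce simp: simplex_generators_def sorted_wrt_iff_nth_less less_Suc_eq_le set_conv_nth)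

lemma simplex_generators_face:
  assumes "is \<in> simplex_generators k (Suc l)" "j \<le> Suc l"
  shows "take j is @ drop (Suc j) is \<in> simplex_generators k l"
proof -
  have *: "length is = Suc (Suc l)" "sorted_wrt (<) is" "set is \<subseteq> {..k}"
    using assms by (auto simp: simplex_generators_def)
  have "sorted_wrt (<) (take j is @ drop j is)" using * by simp
  then have "sorted_wrt (<) (take j is)" "sorted_wrt (<) (drop j is)"
     "\<And>x y. x \<in> set (take j is) \<Longrightarrow> y \<in> set (drop j is) \<Longrightarrow> x < y"
    unfolding sorted_wrt_append by blast+
  moreover have "set (drop (Suc j) is) \<subseteq> set (drop j is)" by (simp add: set_drop_subset_set_drop)
  moreover have "sorted_wrt (<) (drop (Suc j) is)" using * by (rule_tac sorted_wrt_drop)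
  ultimately have "sorted_wrt (<) (take j is @ drop (Suc j) is)"
    unfolding sorted_wrt_append by blast
  moreover have "set (take j is @ drop (Suc j) is) \<subseteq> {..k}"
    using *(3) set_take_subset[of j "is"] set_drop_subset[of "Suc j" "is"] by auto
  ultimately show ?thesis using * assms by (simp add: simplex_generators_def)
qed

lemma keys_Diff_normalized_chains:
  assumes "Poly_Mapping.keys c \<subseteq> simplex_generators k (Suc l)"
  shows "Poly_Mapping.keys (Diff (normalized_chains k) l c) \<subseteq> simplex_generators k l"
proof -
  have "Poly_Mapping.keys (\<Sum>j\<le>Suc l. frag_cmul ((-1) ^ j) (frag_of (take j is @ drop (Suc j) is)))
      \<subseteq> simplex_generators k l" if "is \<in> simplex_generators k (Suc l)" for "is"
    using simplex_generators_face[OF that] keys_cmul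
    by (intro order_trans[OF keys_sum]) (auto split: if_splits)
  then show ?thesis
    unfolding Diff_normalized_chains using assms by (intro order_trans[OF keys_frag_extend]) blast
qed

lemma simplex_generators_map:
  assumes "\<rho> \<in> Delta_hom m n" "is \<in> simplex_generators m l" "sorted_wrt (<) (map \<rho> is)"
  shows "map \<rho> is \<in> simplex_generators n l"
  using assms Delta_hom_le[OF assms(1)] by (auto simp: simplex_generators_def)

lemma keys_normalized_chains_map:
  assumes "\<rho> \<in> Delta_hom m n" "Poly_Mapping.keys c \<subseteq> simplex_generators m l"
  shows "Poly_Mapping.keys (normalized_chains_map \<rho> c) \<subseteq> simplex_generators n l"
  unfolding normalized_chains_map_def
  using simplex_generators_map[OF assms(1)] assms(2)
  by (intro order_trans[OF keys_frag_extend]) (auto split: if_splits)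

lemma sorted_wrt_less_map_iff:
  assumes "\<rho> \<in> Delta_hom m n" "is \<in> simplex_generators m l"
  shows "sorted_wrt (<) (map \<rho> is) \<longleftrightarrow> (\<forall>a<l. \<rho> (is ! a) < \<rho> (is ! Suc a))"
  using assms(2) 
  by (auto simp: sorted_wrt_iff_nth_Suc_transp[OF transp_on_less] in_simplex_generators_iff)

text \<open>For a monotone map, equality is the only way in which the images of neighbours can fail
  to increase. The position \<open>a\<close> is the starting point for all arguments about
  degenerate generators, in the chain complex as well as for \<open>Ch_form\<close>.\<close>

lemma not_sorted_wrt_less_map:
  assumes \<rho>: "\<rho> \<in> Delta_hom m n" and is': "is \<in> simplex_generators m l"
    and "\<not> sorted_wrt (<) (map \<rho> is)"
  obtains a where "a < l" "\<rho> (is ! a) = \<rho> (is ! Suc a)"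
proof -
  obtain a where a: "a < l" "\<not> \<rho> (is ! a) < \<rho> (is ! Suc a)"
    using assms by (auto simp: sorted_wrt_less_map_iff)
  moreover have "\<rho> (is ! a) \<le> \<rho> (is ! Suc a)"
    using is' a(1) by (intro Delta_hom_mono[OF \<rho>]) (auto simp: in_simplex_generators_iff less_imp_le)
  ultimately show ?thesis using that by simp
qed

lemma normalized_chains_map_frag_of:
  "normalized_chains_map \<rho> (frag_of is) = (if sorted_wrt (<) (map \<rho> is) then frag_of (map \<rho> is) else 0)"
  by (simp add: normalized_chains_map_def)

lemma normalized_chains_map_id:
  assumes "Poly_Mapping.keys c \<subseteq> simplex_generators n l"
  shows "normalized_chains_map (\<lambda>i\<in>{..n}. i) c = c"
proof -
  have "map (\<lambda>i\<in>{..n}. i) is = is" "sorted_wrt (<) is" if "is \<in> simplex_generators n l" for "is"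
    using that by (auto simp: simplex_generators_def intro!: map_idI)
  then have "normalized_chains_map (\<lambda>i\<in>{..n}. i) c = frag_extend frag_of c"
    unfolding normalized_chains_map_def using assms by (intro frag_extend_eq) auto
  then show ?thesis using frag_expansion by metis
qed

lemma normalized_chains_map_compose:
  assumes "\<sigma> \<in> Delta_hom i m" "\<rho> \<in> Delta_hom m n" "Poly_Mapping.keys c \<subseteq> simplex_generators i l"
  shows "normalized_chains_map (compose {..i} \<rho> \<sigma>) c = normalized_chains_map \<rho> (normalized_chains_map \<sigma> c)"
  using assms(3)
proof (induction c rule: free_Abelian_group_induct[consumes 1, case_names zero diff gen])
  case (gen "is")
  have eq: "map (compose {..i} \<rho> \<sigma>) is = map \<rho> (map \<sigma> is)"
    using gen by (auto simp: simplex_generators_def compose_def)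
  show ?case
  proof (cases "sorted_wrt (<) (map \<sigma> is)")
    \<comment> \<open>If \<sigma> already identifies two neighbours, so does the composite, and both
      sides are 0.\<close>
    case False
    then obtain a where "a < l" "\<sigma> (is ! a) = \<sigma> (is ! Suc a)"
      using not_sorted_wrt_less_map[OF assms(1) gen] by blast
    moreover have "length is = Suc l" using gen by (simp add: simplex_generators_def)
    ultimately have "\<not> sorted_wrt (<) (map \<rho> (map \<sigma> is))"
      using sorted_wrt_nth_less[of "(<)" "map \<rho> (map \<sigma> is)" a "Suc a"] by auto
    then show ?thesis using False unfolding normalized_chains_map_frag_of eq by (simp add: normalized_chains_map_def)
  qed (unfold normalized_chains_map_frag_of eq, simp add: normalized_chains_map_def)
qed (simp_all add: normalized_chains_map_def frag_extend_diff)

text \<open>If \<open>\<rho>\<close> identifies the vertices \<open>a\<close> and \<open>a + 1\<close>, then all faces except these two are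
  degenerate, and these two cancel.\<close>

lemma normalized_chains_map_Diff:
  assumes \<rho>: "\<rho> \<in> Delta_hom m n" and c: "Poly_Mapping.keys c \<subseteq> simplex_generators m (Suc l)"
  shows "normalized_chains_map \<rho> (Diff (normalized_chains m) l c) =
    Diff (normalized_chains n) l (normalized_chains_map \<rho> c)"
  using c
proof (induction c rule: free_Abelian_group_induct[consumes 1, case_names zero diff gen])
  case (gen "is")
  let ?d = "\<lambda>j. take j is @ drop (Suc j) is"
  let ?N = "normalized_chains_map \<rho>"
  have len: "length is = Suc (Suc l)" using gen by (simp add: simplex_generators_def)
  have dmap: "map \<rho> (?d j) = take j (map \<rho> is) @ drop (Suc j) (map \<rho> is)" for j
    by (simp add: take_map drop_map)
  have lhs: "?N (Diff (normalized_chains m) l (frag_of is)) =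
      (\<Sum>j\<le>Suc l. frag_cmul ((-1) ^ j) (?N (frag_of (?d j))))"
    by (simp add: Diff_normalized_chains normalized_chains_map_def frag_extend_sum frag_extend_cmul frag_extend_add)
  show ?case
  proof (cases "sorted_wrt (<) (map \<rho> is)")
    case True
    then have "map \<rho> is \<in> simplex_generators n (Suc l)" using simplex_generators_map[OF \<rho> gen] by simp
    from simplex_generators_face[OF this] have "sorted_wrt (<) (map \<rho> (?d j))" if "j \<le> Suc l" for j
      using that unfolding dmap by (simp add: simplex_generators_def)
    then show ?thesis unfolding lhs
      by (simp add: normalized_chains_map_frag_of True Diff_normalized_chains take_map drop_map cong: sum.cong_simp)
  next
    case False
    then obtain a where a: "a < Suc l" "\<rho> (is ! a) = \<rho> (is ! Suc a)"
      using not_sorted_wrt_less_map[OF \<rho> gen] by blast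
    have zero: "?N (frag_of (?d j)) = 0" if "j \<le> Suc l" "j \<noteq> a" "j \<noteq> Suc a" for j
    proof -
      \<comment> \<open>The two identified entries remain neighbours in this face; they move down by
        one place when the omitted entry precedes them.\<close>
      define b where "b = (if a < j then a else a - 1)"
      have "?d j ! b = is ! a" "?d j ! Suc b = is ! Suc a" "Suc b < length (?d j)"
        using that a(1) len by (auto simp: b_def nth_append min_def)
      then have "\<not> sorted_wrt (<) (map \<rho> (?d j))"
        using a(2) unfolding sorted_wrt_iff_nth_less
        by (intro notI) (metis (no_types, lifting) Suc_lessD length_map lessI less_irrefl nth_map)
      then show ?thesis by (simp add: normalized_chains_map_frag_of)
    qed
    have eq: "map \<rho> (?d a) = map \<rho> (?d (Suc a))"
    proof -
      have "take (Suc a) is = take a is @ [is ! a]" "drop (Suc a) is = is ! Suc a # drop (Suc (Suc a)) is"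
        using a(1) len by (auto simp: take_Suc_conv_app_nth Cons_nth_drop_Suc)
      then show ?thesis using a(2) by simp
    qed
    have "(\<Sum>j\<le>Suc l. frag_cmul ((-1) ^ j) (?N (frag_of (?d j)))) =
       (\<Sum>j\<in>{a, Suc a}. frag_cmul ((-1) ^ j) (?N (frag_of (?d j))))"
      using a(1) zero by (intro sum.mono_neutral_right) auto
    also have "\<dots> = 0"
      using eq by (simp add: normalized_chains_map_frag_of flip: minus_frag_cmul)
    finally show ?thesis unfolding lhs using False by (simp add: normalized_chains_map_frag_of Diff_normalized_chains)
  qed
qed (simp_all add: normalized_chains_map_def Diff_normalized_chains frag_extend_diff)

section \<open>Simplices of the Dold-Kan construction\<close>

lemma chain_maps_iff:
  "h \<in> chain_maps (normalized_chains k) D \<longleftrightarrow>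
     (\<forall>l. h l \<in> hom (free_Abelian_group (simplex_generators k l)) (Grp D l)) \<and>
     (\<forall>l. h l \<in> extensional (carrier (free_Abelian_group (simplex_generators k l)))) \<and>
     (\<forall>l c. Poly_Mapping.keys c \<subseteq> simplex_generators k (Suc l) \<longrightarrow>
        h l (Diff (normalized_chains k) l c) = Diff D l (h (Suc l) c))"
  by (auto simp: chain_maps_def Grp_normalized_chains Ball_def)

lemma simp_DK: "simp (DK C) k = chain_maps (normalized_chains k) C"
  and act_DK: "act (DK C) m n \<rho> h l =
    (\<lambda>c\<in>carrier (free_Abelian_group (simplex_generators m l)). h l (normalized_chains_map \<rho> c))"
  by (simp_all add: DK_def Grp_normalized_chains)

lemma act_DK_in:
  assumes \<rho>: "\<rho> \<in> Delta_hom m n" and h: "h \<in> simp (DK C) n"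
  shows "act (DK C) m n \<rho> h \<in> simp (DK C) m"
proof -
  have h: "\<And>l. h l \<in> hom (free_Abelian_group (simplex_generators n l)) (Grp C l)"
    "\<And>l c. Poly_Mapping.keys c \<subseteq> simplex_generators n (Suc l) \<Longrightarrow>
        h l (Diff (normalized_chains n) l c) = Diff C l (h (Suc l) c)"
    using h by (auto simp: simp_DK chain_maps_iff)
  have "act (DK C) m n \<rho> h l \<in> hom (free_Abelian_group (simplex_generators m l)) (Grp C l)" for l
  proof (rule homI)
    fix x y assume "x \<in> carrier (free_Abelian_group (simplex_generators m l))"
      "y \<in> carrier (free_Abelian_group (simplex_generators m l))"
    then show "act (DK C) m n \<rho> h l (x \<otimes>\<^bsub>free_Abelian_group (simplex_generators m l)\<^esub> y) =
        act (DK C) m n \<rho> h l x \<otimes>\<^bsub>Grp C l\<^esub> act (DK C) m n \<rho> h l y"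
      using keys_normalized_chains_map[OF \<rho>] keys_add[of x y] hom_mult[OF h(1)[of l]]
      by (auto simp: act_DK normalized_chains_map_def frag_extend_add)
  qed (use keys_normalized_chains_map[OF \<rho>] in \<open>auto simp: act_DK intro!: hom_in_carrier[OF h(1)]\<close>)
  then show ?thesis
    using keys_normalized_chains_map[OF \<rho>] keys_Diff_normalized_chains
    by (simp add: simp_DK chain_maps_iff act_DK normalized_chains_map_Diff[OF \<rho>] h(2))
qed

lemma simplicial_set_DK: "simplicial_set (DK C)"
proof (rule simplicial_setI)
  fix n h assume "h \<in> simp (DK C) n"
  then have "h l \<in> extensional (carrier (free_Abelian_group (simplex_generators n l)))" for l
    by (auto simp: simp_DK chain_maps_iff)
  then show "act (DK C) n n (\<lambda>i\<in>{..n}. i) h = h"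
    by (intro ext) (auto simp: act_DK extensional_def normalized_chains_map_id)
next
  fix l m n \<sigma> \<rho> h
  assume "\<sigma> \<in> Delta_hom l m" "\<rho> \<in> Delta_hom m n" "h \<in> simp (DK C) n"
  then show "act (DK C) l n (compose {..l} \<rho> \<sigma>) h = act (DK C) l m \<sigma> (act (DK C) m n \<rho> h)"
    by (intro ext) (auto simp: act_DK keys_normalized_chains_map normalized_chains_map_compose)
qed (rule act_DK_in)

lemma DK_map_in:
  assumes f: "\<And>l. f l \<in> hom (Grp C l) (Grp D l)"
    and Diff: "\<And>l a. a \<in> carrier (Grp C (Suc l)) \<Longrightarrow> f l (Diff C l a) = Diff D l (f (Suc l) a)"
    and h: "h \<in> simp (DK C) k"
  shows "(\<lambda>l. \<lambda>c\<in>carrier (free_Abelian_group (simplex_generators k l)). f l (h l c)) \<in> simp (DK D) k"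
proof -
  have h: "\<And>l. h l \<in> hom (free_Abelian_group (simplex_generators k l)) (Grp C l)"
    "\<And>l c. Poly_Mapping.keys c \<subseteq> simplex_generators k (Suc l) \<Longrightarrow>
        h l (Diff (normalized_chains k) l c) = Diff C l (h (Suc l) c)"
    using h by (auto simp: simp_DK chain_maps_iff)
  have "(\<lambda>c\<in>carrier (free_Abelian_group (simplex_generators k l)). f l (h l c))
      \<in> hom (free_Abelian_group (simplex_generators k l)) (Grp D l)" for l
  proof (rule homI)
    fix x y assume xy: "x \<in> carrier (free_Abelian_group (simplex_generators k l))"
      "y \<in> carrier (free_Abelian_group (simplex_generators k l))"
    then have "Poly_Mapping.keys (x + y) \<subseteq> simplex_generators k l" using keys_add[of x y] by auto
    then show "(\<lambda>c\<in>carrier (free_Abelian_group (simplex_generators k l)). f l (h l c))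
        (x \<otimes>\<^bsub>free_Abelian_group (simplex_generators k l)\<^esub> y) =
      (\<lambda>c\<in>carrier (free_Abelian_group (simplex_generators k l)). f l (h l c)) x \<otimes>\<^bsub>Grp D l\<^esub>
      (\<lambda>c\<in>carrier (free_Abelian_group (simplex_generators k l)). f l (h l c)) y"
      using xy hom_mult[OF h(1) xy] hom_mult[OF f hom_in_carrier[OF h(1)] hom_in_carrier[OF h(1)]]
      by simp
  qed (auto intro!: hom_in_carrier[OF f] hom_in_carrier[OF h(1)])
  moreover have "h (Suc l) c \<in> carrier (Grp C (Suc l))" if "Poly_Mapping.keys c \<subseteq> simplex_generators k (Suc l)" for l c
    using hom_in_carrier[OF h(1)] that by simp
  ultimately show ?thesis
    using keys_Diff_normalized_chains by (simp add: simp_DK chain_maps_iff h(2) Diff)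
qed

lemma simplicial_map_DK:
  assumes f: "\<And>l. f l \<in> hom (Grp C l) (Grp D l)"
    and Diff: "\<And>l a. a \<in> carrier (Grp C (Suc l)) \<Longrightarrow> f l (Diff C l a) = Diff D l (f (Suc l) a)"
  shows "simplicial_map (DK C) (DK D) (\<lambda>k. \<lambda>h\<in>simp (DK C) k.
     \<lambda>l. \<lambda>c\<in>carrier (Grp (normalized_chains k) l). f l (h l c))"
  unfolding Grp_normalized_chains
proof (rule simplicial_mapI)
  fix m n \<rho> h assume \<rho>: "\<rho> \<in> Delta_hom m n" and h: "h \<in> simp (DK C) n"
  show "(\<lambda>h\<in>simp (DK C) m. \<lambda>l. \<lambda>c\<in>carrier (free_Abelian_group (simplex_generators m l)). f l (h l c))
      (act (DK C) m n \<rho> h) = act (DK D) m n \<rho>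
      ((\<lambda>h\<in>simp (DK C) n. \<lambda>l. \<lambda>c\<in>carrier (free_Abelian_group (simplex_generators n l)). f l (h l c)) h)"
    unfolding restrict_apply'[OF h] restrict_apply'[OF act_DK_in[OF \<rho> h]]
    using keys_normalized_chains_map[OF \<rho>] by (intro ext) (simp add: act_DK)
next
  fix n
  show "(\<lambda>h\<in>simp (DK C) n. \<lambda>l. \<lambda>c\<in>carrier (free_Abelian_group (simplex_generators n l)). f l (h l c))
      \<in> simp (DK C) n \<rightarrow>\<^sub>E simp (DK D) n"
    using DK_map_in[OF f Diff] by (intro restrict_PiE_iff[THEN iffD2] ballI) blast
qed (rule simplicial_set_DK)+

section \<open>Homomorphisms out of free abelian groups\<close>

lemma hom_free_Abelian_group_eqI:
  assumes G: "group G" and h: "h \<in> hom (free_Abelian_group S) G" and h': "h' \<in> hom (free_Abelian_group S) G"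
    and eq: "\<And>b. b \<in> S \<Longrightarrow> h (frag_of b) = h' (frag_of b)" and c: "Poly_Mapping.keys c \<subseteq> S"
  shows "h c = h' c"
  using c
proof (induction c rule: free_Abelian_group_induct[consumes 1, case_names zero diff gen])
  case zero
  interpret h: group_hom "free_Abelian_group S" G h using G h by (simp add: group_hom_def group_hom_axioms_def)
  interpret h': group_hom "free_Abelian_group S" G h' using G h' by (simp add: group_hom_def group_hom_axioms_def)
  show ?case using h.hom_one h'.hom_one by simp
next
  case (diff x y)
  interpret h: group_hom "free_Abelian_group S" G h using G h by (simp add: group_hom_def group_hom_axioms_def)
  interpret h': group_hom "free_Abelian_group S" G h' using G h' by (simp add: group_hom_def group_hom_axioms_def)
  have "h (x - y) = h x \<otimes>\<^bsub>G\<^esub> inv\<^bsub>G\<^esub> h y" "h' (x - y) = h' x \<otimes>\<^bsub>G\<^esub> inv\<^bsub>G\<^esub> h' y"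
    using h.hom_mult[of x "-y"] h'.hom_mult[of x "-y"] h.hom_inv[of y] h'.hom_inv[of y] diff by auto
  then show ?case using diff by simp
qed (rule eq)

text \<open>Homomorphisms from a free abelian group agree once they agree on generators, and
  extensionality covers the other arguments. Simpliciality and naturality of \<open>Ch\<close> are
  both verified through this lemma, generator by generator.\<close>

lemma DK_simplex_eqI:
  assumes "\<And>l. group (Grp C l)" "h \<in> simp (DK C) k" "h' \<in> simp (DK C) k"
    and "\<And>l is. is \<in> simplex_generators k l \<Longrightarrow> h l (frag_of is) = h' l (frag_of is)"
  shows "h = h'"
proof (intro ext)
  fix l c
  have *: "h l \<in> hom (free_Abelian_group (simplex_generators k l)) (Grp C l)"
    "h' l \<in> hom (free_Abelian_group (simplex_generators k l)) (Grp C l)"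
    "h l \<in> extensional (carrier (free_Abelian_group (simplex_generators k l)))"
    "h' l \<in> extensional (carrier (free_Abelian_group (simplex_generators k l)))"
    using assms(2,3) by (auto simp: simp_DK chain_maps_iff)
  show "h l c = h' l c"
  proof (cases "Poly_Mapping.keys c \<subseteq> simplex_generators k l")
    case True
    then show ?thesis using hom_free_Abelian_group_eqI[OF assms(1) *(1,2) assms(4)] by blast
  qed (use * in \<open>auto simp: extensional_def\<close>)
qed

lemma additive_frag_cmul:
  fixes f :: "('b \<Rightarrow>\<^sub>0 int) \<Rightarrow> 'a::ring_1"
  assumes add: "\<And>x y. Poly_Mapping.keys x \<subseteq> S \<Longrightarrow> Poly_Mapping.keys y \<subseteq> S \<Longrightarrow> f (x + y) = f x + f y"
    and x: "Poly_Mapping.keys x \<subseteq> S"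
  shows "f (frag_cmul c x) = of_int c * f x"
proof -
  have keys: "Poly_Mapping.keys (frag_cmul c x) \<subseteq> S" for c using x keys_cmul by blast
  have f0: "f 0 = 0" using add[of 0 0] by simp
  show ?thesis
  proof (induction c)
    case (nonneg n)
    show ?case
    proof (induction n)
      case (Suc n)
      then show ?case using add[OF x keys, of "int n"]
        by (simp add: frag_cmul_distrib algebra_simps)
    qed (simp add: f0)
  next
    case (neg n)
    \<comment> \<open>This case comes without an induction hypothesis. Positive multiples are
      treated again, and a negative multiple then has the opposite value by additivity.\<close>
    have pos: "f (frag_cmul (int m) x) = of_nat m * f x" for m
    proof (induction m)
      case (Suc m)
      then show ?case using add[OF x keys, of "int m"]
        by (simp add: frag_cmul_distrib algebra_simps)
    qed (simp add: f0)
    have "f (frag_cmul (- int (Suc n)) x) + f (frag_cmul (int (Suc n)) x) = 0"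
      using add[OF keys keys, of "- int (Suc n)" "int (Suc n)"] f0
      by (simp flip: frag_cmul_distrib)
    then show ?case using pos[of "Suc n"] by (simp add: eq_neg_iff_add_eq_0 algebra_simps)
  qed
qed

text \<open>In \<open>Ch_Diff\<close> the map \<open>f\<close> evaluates the form attached to a
  chain at a fixed point and tuple of tangent vectors. It is additive only on chains supported in
  the generators of the given degree, whence the relativization to \<open>S\<close>.\<close>

lemma additive_frag_sum:
  fixes f :: "('b \<Rightarrow>\<^sub>0 int) \<Rightarrow> 'a::ring_1"
  assumes add: "\<And>x y. Poly_Mapping.keys x \<subseteq> S \<Longrightarrow> Poly_Mapping.keys y \<subseteq> S \<Longrightarrow> f (x + y) = f x + f y"
    and "finite J" "\<And>j. j \<in> J \<Longrightarrow> b j \<in> S"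
  shows "f (\<Sum>j\<in>J. frag_cmul (c j) (frag_of (b j))) = (\<Sum>j\<in>J. of_int (c j) * f (frag_of (b j)))"
  using assms(2,3)
proof (induction J rule: finite_induct)
  case empty
  then show ?case using add[of 0 0] by simp
next
  case (insert j J)
  have "Poly_Mapping.keys (\<Sum>j\<in>J. frag_cmul (c j) (frag_of (b j))) \<subseteq> S"
    using insert.prems by (intro order_trans[OF keys_sum]) (auto dest!: keys_cmul[THEN subsetD] split: if_splits)
  moreover have "Poly_Mapping.keys (frag_cmul (c j) (frag_of (b j))) \<subseteq> S"
    using insert.prems by (auto dest!: keys_cmul[THEN subsetD] split: if_splits)
  ultimately show ?case using insert by (simp add: add additive_frag_cmul[of S f, OF add])
qed

lemma free_extension_hom:
  assumes G: "comm_group G" and g: "\<And>b. b \<in> S \<Longrightarrow> g b \<in> carrier G"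
  shows "free_extension S G g \<in> hom (free_Abelian_group S) G"
proof -
  interpret comm_group G by fact
  \<comment> \<open>The product over the keys of \<open>c\<close> has a varying index set. Padding
    with the trivial factors of exponent 0 makes the products for \<open>c\<close>, \<open>d\<close>
    and \<open>c + d\<close> comparable.\<close>
  have ext: "free_extension S G g c = finprod G (\<lambda>b. g b [^]\<^bsub>G\<^esub> Poly_Mapping.lookup c b) K"
    if "finite K" "Poly_Mapping.keys c \<subseteq> K" "K \<subseteq> S" for c K
  proof -
    have "finprod G (\<lambda>b. g b [^]\<^bsub>G\<^esub> Poly_Mapping.lookup c b) (Poly_Mapping.keys c) =
       finprod G (\<lambda>b. g b [^]\<^bsub>G\<^esub> Poly_Mapping.lookup c b) K"
      using that g by (intro finprod_mono_neutral_cong_left) (auto simp: in_keys_iff)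
    then show ?thesis using that by (auto simp: free_extension_def)
  qed
  show ?thesis
  proof (rule homI)
    fix c assume c: "c \<in> carrier (free_Abelian_group S)"
    then show "free_extension S G g c \<in> carrier G"
      by (subst ext[of "Poly_Mapping.keys c"]) (auto intro!: finprod_closed g)
  next
    fix c d assume c: "c \<in> carrier (free_Abelian_group S)" and d: "d \<in> carrier (free_Abelian_group S)"
    let ?K = "Poly_Mapping.keys c \<union> Poly_Mapping.keys d"
    have K: "finite ?K" "?K \<subseteq> S" "Poly_Mapping.keys (c + d) \<subseteq> ?K" using c d by (auto dest: keys_add[THEN subsetD])
    have "free_extension S G g (c + d) = finprod G (\<lambda>b. g b [^]\<^bsub>G\<^esub> Poly_Mapping.lookup c b \<otimes>\<^bsub>G\<^esub> g b [^]\<^bsub>G\<^esub> Poly_Mapping.lookup d b) ?K"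
      unfolding ext[OF K(1,3,2)] using K(2) g
      by (intro finprod_cong) (auto simp: lookup_add int_pow_mult simp_implies_def)
    also have "\<dots> = free_extension S G g c \<otimes>\<^bsub>G\<^esub> free_extension S G g d"
      using K g by (subst finprod_multf) (auto simp: ext[of ?K c] ext[of ?K d])
    finally show "free_extension S G g (c \<otimes>\<^bsub>free_Abelian_group S\<^esub> d) = free_extension S G g c \<otimes>\<^bsub>G\<^esub> free_extension S G g d"
      by simp
  qed
qed

lemma free_extension_frag_of:
  assumes G: "comm_group G" and "b \<in> S" "g b \<in> carrier G"
  shows "free_extension S G g (frag_of b) = g b"
proof -
  interpret comm_group G by fact
  show ?thesis using assms by (simp add: free_extension_def finprod_singleton[of b "{b}" "\<lambda>b. g b [^]\<^bsub>G\<^esub> (1::int)", simplified])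
qed

section \<open>Complex differentiability\<close>

text \<open>Complex differentiability at a single point. As \<open>cholomorphic_on\<close> asks for
  it at each point of the set, holomorphy can be argued pointwise throughout.\<close>

definition chol_at :: "('v::complex_model_space \<Rightarrow> 'w::complex_model_space) \<Rightarrow> 'v \<Rightarrow> bool" where
  "chol_at g y \<longleftrightarrow> (\<exists>g'. (g has_derivative g') (at y) \<and> (\<forall>c v. g' (c *\<^sub>C v) = c *\<^sub>C g' v))"

lemma cholomorphic_on_iff: "cholomorphic_on S g \<longleftrightarrow> (\<forall>y\<in>S. chol_at g y)"
  by (simp add: cholomorphic_on_def chol_at_def)

lemma scaleC_zero_right [simp]: "c *\<^sub>C (0::'a::complex_model_space) = 0"
  using scaleC_add_right[of c 0 "0::'a"] by simp

lemma chol_at_derivative: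
  assumes "chol_at g y"
  shows "(g has_derivative frechet_derivative g (at y)) (at y)"
    and "frechet_derivative g (at y) (c *\<^sub>C v) = c *\<^sub>C frechet_derivative g (at y) v"
    and "frechet_derivative g (at y) (v + w) = frechet_derivative g (at y) v + frechet_derivative g (at y) w"
proof -
  obtain g' where g': "(g has_derivative g') (at y)" "\<forall>c v. g' (c *\<^sub>C v) = c *\<^sub>C g' v"
    using assms by (auto simp: chol_at_def)
  have eq: "frechet_derivative g (at y) = g'" using frechet_derivative_at[OF g'(1)] by simp
  show "(g has_derivative frechet_derivative g (at y)) (at y)" using g' eq by simp
  show "frechet_derivative g (at y) (c *\<^sub>C v) = c *\<^sub>C frechet_derivative g (at y) v" using g' eq by simp
  show "frechet_derivative g (at y) (v + w) = frechet_derivative g (at y) v + frechet_derivative g (at y) w"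
    using linear_add[OF has_derivative_linear[OF g'(1)]] eq by simp
qed

text \<open>Differentiability is not assumed: the two functions have the same derivatives, if any,
  so the choice behind \<open>frechet_derivative\<close> is the same even when there is
  none.\<close>

lemma frechet_derivative_cong_open:
  assumes "open S" "y \<in> S" "\<And>z. z \<in> S \<Longrightarrow> f z = g z"
  shows "frechet_derivative f (at y) = frechet_derivative g (at y)"
proof -
  have "(f has_derivative f') (at y) \<longleftrightarrow> (g has_derivative f') (at y)" for f'
    using assms has_derivative_transform_within_open[of _ _ y UNIV S] by metis
  then show ?thesis by (simp add: frechet_derivative_def)
qed

lemma chol_at_cong_open:
  assumes "open S" "y \<in> S" "\<And>z. z \<in> S \<Longrightarrow> f z = g z"
  shows "chol_at f y \<longleftrightarrow> chol_at g y"
proof -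
  have "(f has_derivative f') (at y) \<longleftrightarrow> (g has_derivative f') (at y)" for f'
    using assms has_derivative_transform_within_open[of _ _ y UNIV S] by metis
  then show ?thesis by (simp add: chol_at_def)
qed

lemma chol_at_const: "chol_at (\<lambda>_. a) y"
  unfolding chol_at_def by (intro exI[of _ "\<lambda>_. 0"]) auto

lemma chol_at_add:
  assumes "chol_at f y" "chol_at g y"
  shows "chol_at (\<lambda>z. f z + g z) y"
proof -
  obtain f' g' where "(f has_derivative f') (at y)" "(g has_derivative g') (at y)"
    and "\<forall>c v. f' (c *\<^sub>C v) = c *\<^sub>C f' v" "\<forall>c v. g' (c *\<^sub>C v) = c *\<^sub>C g' v"
    using assms by (auto simp: chol_at_def)
  then show ?thesis unfolding chol_at_def
    by (intro exI[of _ "\<lambda>v. f' v + g' v"]) (auto intro: has_derivative_add simp: scaleC_add_right)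
qed

lemma chol_at_mult:
  fixes f g :: "'v::complex_model_space \<Rightarrow> complex"
  assumes "chol_at f y" "chol_at g y"
  shows "chol_at (\<lambda>z. f z * g z) y"
proof -
  obtain f' g' where "(f has_derivative f') (at y)" "(g has_derivative g') (at y)"
    and "\<forall>c v. f' (c *\<^sub>C v) = c *\<^sub>C f' v" "\<forall>c v. g' (c *\<^sub>C v) = c *\<^sub>C g' v"
    using assms by (auto simp: chol_at_def)
  then show ?thesis unfolding chol_at_def
    by (intro exI[of _ "\<lambda>v. f y * g' v + f' v * g y"])
      (auto intro: has_derivative_mult simp: scaleC_complex_def algebra_simps)
qed

lemma chol_at_sum: "(\<And>i. i \<in> A \<Longrightarrow> chol_at (f i) y) \<Longrightarrow> chol_at (\<lambda>z. \<Sum>i\<in>A. f i z) y"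
  by (induction A rule: infinite_finite_induct) (auto intro: chol_at_const chol_at_add)

lemma chol_at_prod:
  fixes f :: "'i \<Rightarrow> 'v::complex_model_space \<Rightarrow> complex"
  shows "(\<And>i. i \<in> A \<Longrightarrow> chol_at (f i) y) \<Longrightarrow> chol_at (\<lambda>z. \<Prod>i\<in>A. f i z) y"
  by (induction A rule: infinite_finite_induct) (auto intro: chol_at_const chol_at_mult)

lemma chol_at_divide:
  fixes f g :: "'v::complex_model_space \<Rightarrow> complex"
  assumes "chol_at f y" "chol_at g y" "g y \<noteq> 0"
  shows "chol_at (\<lambda>z. f z / g z) y"
proof -
  obtain f' g' where "(f has_derivative f') (at y)" "(g has_derivative g') (at y)"
    and "\<forall>c v. f' (c *\<^sub>C v) = c *\<^sub>C f' v" "\<forall>c v. g' (c *\<^sub>C v) = c *\<^sub>C g' v"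
    using assms by (auto simp: chol_at_def)
  then show ?thesis unfolding chol_at_def using assms(3)
    by (intro exI[of _ "\<lambda>v. - f y * (inverse (g y) * g' v * inverse (g y)) + f' v / g y"] conjI
        has_derivative_divide) (auto simp: scaleC_complex_def algebra_simps)
qed

lemma chol_at_compose:
  assumes "chol_at f y" "chol_at g (f y)"
  shows "chol_at (g \<circ> f) y"
    and "frechet_derivative (g \<circ> f) (at y) v = frechet_derivative g (at (f y)) (frechet_derivative f (at y) v)"
proof -
  have d: "((g \<circ> f) has_derivative frechet_derivative g (at (f y)) \<circ> frechet_derivative f (at y)) (at y)"
    by (intro diff_chain_at chol_at_derivative(1) assms)
  then show "chol_at (g \<circ> f) y"
    unfolding chol_at_def by (intro exI[of _ "frechet_derivative g (at (f y)) \<circ> frechet_derivative f (at y)"])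
      (simp add: chol_at_derivative(2) assms)
  show "frechet_derivative (g \<circ> f) (at y) v = frechet_derivative g (at (f y)) (frechet_derivative f (at y) v)"
    using frechet_derivative_at[OF d] by (metis comp_apply)
qed


section \<open>Manifolds and tangent spaces\<close>

text \<open>Unlike \<open>complex_manifold\<close>, this omits the Hausdorff axiom and the openness of the images of
  charts is built into the homeomorphism condition.\<close>

definition complex_atlas :: "('p, 'v::complex_model_space) cmanifold \<Rightarrow> bool" where
  "complex_atlas X \<longleftrightarrow>
     (\<forall>c\<in>charts X. openin (mtop X) (fst c) \<and> inj_on (snd c) (fst c) \<and>
        (\<forall>W. openin (mtop X) W \<longrightarrow> open (snd c ` (fst c \<inter> W))) \<and>
        (\<forall>S. open S \<longrightarrow> openin (mtop X) {x \<in> fst c. snd c x \<in> S})) \<and>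
     points X \<subseteq> (\<Union>c\<in>charts X. fst c) \<and>
     (\<forall>c\<in>charts X. \<forall>c'\<in>charts X.
        cholomorphic_on (snd c ` (fst c \<inter> fst c')) (snd c' \<circ> chart_inv c))"

lemma complex_manifold_atlas:
  assumes X: "complex_manifold X"
  shows "complex_atlas X"
  unfolding complex_atlas_def
proof (intro conjI ballI allI impI)
  fix c assume c: "c \<in> charts X"
  have D: "openin (mtop X) (fst c)" "open (snd c ` fst c)"
    and h: "homeomorphic_map (subtopology (mtop X) (fst c)) (top_of_set (snd c ` fst c)) (snd c)"
    using X c by (auto simp: complex_manifold_def case_prod_beta)
  have sub: "topspace (subtopology (mtop X) (fst c)) = fst c"
    using openin_subset[OF D(1)] by auto
  show "openin (mtop X) (fst c)" by fact
  show "inj_on (snd c) (fst c)" using homeomorphic_imp_injective_map[OF h] by (simp only: sub)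
  show "open (snd c ` (fst c \<inter> W))" if "openin (mtop X) W" for W
  proof -
    have "openin (subtopology (mtop X) (fst c)) (fst c \<inter> W)"
      using that by (metis inf_commute openin_subtopology)
    then have "openin (top_of_set (snd c ` fst c)) (snd c ` (fst c \<inter> W))"
      using homeomorphic_imp_open_map[OF h] by (simp add: open_map_def)
    then show ?thesis using D(2) openin_open_trans by blast
  qed
  show "openin (mtop X) {x \<in> fst c. snd c x \<in> S}" if "open S" for S
  proof -
    have "openin (top_of_set (snd c ` fst c)) (snd c ` fst c \<inter> S)" using that by blast
    then have "openin (subtopology (mtop X) (fst c)) {x \<in> fst c. snd c x \<in> snd c ` fst c \<inter> S}"
      using openin_continuous_map_preimage[OF homeomorphic_imp_continuous_map[OF h]] by (simp only: sub)
    moreover have "{x \<in> fst c. snd c x \<in> snd c ` fst c \<inter> S} = {x \<in> fst c. snd c x \<in> S}" by blast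
    ultimately show ?thesis using D(1) openin_trans_full by metis
  qed
next
  show "points X \<subseteq> (\<Union>c\<in>charts X. fst c)"
    using X by (auto simp: complex_manifold_def case_prod_beta)
next
  fix c c' assume "c \<in> charts X" "c' \<in> charts X"
  then show "cholomorphic_on (snd c ` (fst c \<inter> fst c')) (snd c' \<circ> chart_inv c)"
    using X by (simp add: complex_manifold_def)
qed

text \<open>Holomorphy of functions is carried one chart at a time: a claim is proved for an
  arbitrary chart around the point, which avoids changing charts.\<close>

definition hol_in :: "('p, 'v::complex_model_space) chart \<Rightarrow> ('p \<Rightarrow> complex) \<Rightarrow> 'p \<Rightarrow> bool" where
  "hol_in c g x \<longleftrightarrow> chol_at (g \<circ> chart_inv c) (snd c x)"

lemma charts_at_iff: "c \<in> charts_at X x \<longleftrightarrow> c \<in> charts X \<and> x \<in> fst c"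
  by (simp add: charts_at_def)

lemma holomorphic_fun_iff: "holomorphic_fun X W g \<longleftrightarrow> (\<forall>x\<in>W. \<forall>c\<in>charts_at X x. hol_in c g x)"
  unfolding holomorphic_fun_def cholomorphic_on_iff hol_in_def charts_at_def by blast

lemma hol_in_const: "hol_in c (\<lambda>_. a) x"
  using chol_at_const by (simp add: hol_in_def comp_def)

lemma hol_in_add: "hol_in c f x \<Longrightarrow> hol_in c g x \<Longrightarrow> hol_in c (\<lambda>y. f y + g y) x"
  by (simp add: hol_in_def comp_def chol_at_add)

lemma hol_in_mult: "hol_in c f x \<Longrightarrow> hol_in c g x \<Longrightarrow> hol_in c (\<lambda>y. f y * g y) x"
  by (simp add: hol_in_def comp_def chol_at_mult)

lemma hol_in_diff: "hol_in c f x \<Longrightarrow> hol_in c g x \<Longrightarrow> hol_in c (\<lambda>y. f y - g y) x"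
  using hol_in_add[OF _ hol_in_mult[OF hol_in_const[of c "-1"]]] by simp

lemma hol_in_sum: "(\<And>i. i \<in> A \<Longrightarrow> hol_in c (f i) x) \<Longrightarrow> hol_in c (\<lambda>y. \<Sum>i\<in>A. f i y) x"
  by (simp add: hol_in_def comp_def chol_at_sum)

lemma hol_in_prod: "(\<And>i. i \<in> A \<Longrightarrow> hol_in c (f i) x) \<Longrightarrow> hol_in c (\<lambda>y. \<Prod>i\<in>A. f i y) x"
  by (simp add: hol_in_def comp_def chol_at_prod)

text \<open>The Jacobian of the coordinate change, that is, the cocycle by which the coordinates of
  a tangent vector transform.\<close>

definition transition ::
  "('p, 'v::complex_model_space) chart \<Rightarrow> ('p, 'v) chart \<Rightarrow> 'p \<Rightarrow> 'v \<Rightarrow> 'v" where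
  "transition c c' x = frechet_derivative (snd c' \<circ> chart_inv c) (at (snd c x))"

section \<open>Charts, transition maps and tangent vectors\<close>

locale atlas =
  fixes X :: "('p, 'v::complex_model_space) cmanifold"
  assumes atlas: "complex_atlas X"
begin

lemma
  assumes "c \<in> charts X"
  shows chart_openin: "openin (mtop X) (fst c)"
    and chart_inj: "inj_on (snd c) (fst c)"
    and chart_subset: "fst c \<subseteq> points X"
    and open_chart_image: "openin (mtop X) W \<Longrightarrow> open (snd c ` (fst c \<inter> W))"
    and openin_chart_preimage: "open S \<Longrightarrow> openin (mtop X) {x \<in> fst c. snd c x \<in> S}"
  using assms atlas openin_subset unfolding complex_atlas_def by blast+

lemma chart_inv_left [simp]: "c \<in> charts X \<Longrightarrow> x \<in> fst c \<Longrightarrow> chart_inv c (snd c x) = x"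
  by (simp add: chart_inv_def chart_inj)

lemma charts_at_nonempty: "x \<in> points X \<Longrightarrow> \<exists>c. c \<in> charts_at X x"
  using atlas unfolding complex_atlas_def charts_at_iff by blast

lemma charts_at_points: "c \<in> charts_at X x \<Longrightarrow> x \<in> points X"
  using chart_subset unfolding charts_at_iff by blast

text \<open>One congruence for two purposes. With \<open>f\<close> the identity and
  \<open>c'\<close> equal to \<open>c\<close> it replaces \<open>g\<close> by a function that agrees
  with it near \<open>x\<close>; with \<open>f\<close> an etale map it passes from a chart of the
  source to the chart below it.\<close>

lemma
  assumes c: "c \<in> charts_at X x" and W: "openin (mtop X) W" "x \<in> W"
    and eq: "\<And>y. y \<in> W \<Longrightarrow> y \<in> fst c \<Longrightarrow> g y = h (f y)"
    and c': "\<And>y. y \<in> W \<Longrightarrow> y \<in> fst c \<Longrightarrow> chart_inv c' (snd c y) = f y"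
  shows chol_at_chart_cong: "chol_at (g \<circ> chart_inv c) (snd c x) \<longleftrightarrow> chol_at (h \<circ> chart_inv c') (snd c x)"
    and frechet_derivative_chart_cong:
      "frechet_derivative (g \<circ> chart_inv c) (at (snd c x)) = frechet_derivative (h \<circ> chart_inv c') (at (snd c x))"
proof -
  have c: "c \<in> charts X" "x \<in> fst c" using c by (auto simp: charts_at_iff)
  have *: "open (snd c ` (fst c \<inter> W))" "snd c x \<in> snd c ` (fst c \<inter> W)"
    using open_chart_image[OF c(1) W(1)] c W by auto
  have "(g \<circ> chart_inv c) z = (h \<circ> chart_inv c') z" if "z \<in> snd c ` (fst c \<inter> W)" for z
    using that eq c' c by auto
  then show "chol_at (g \<circ> chart_inv c) (snd c x) \<longleftrightarrow> chol_at (h \<circ> chart_inv c') (snd c x)"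
    "frechet_derivative (g \<circ> chart_inv c) (at (snd c x)) = frechet_derivative (h \<circ> chart_inv c') (at (snd c x))"
    using chol_at_cong_open[OF *] frechet_derivative_cong_open[OF *] by blast+
qed

lemma hol_in_cong:
  assumes "c \<in> charts_at X x" "openin (mtop X) W" "x \<in> W" "\<And>y. y \<in> W \<Longrightarrow> g y = h y"
  shows "hol_in c g x \<longleftrightarrow> hol_in c h x"
  unfolding hol_in_def
  by (rule chol_at_chart_cong[where f = "\<lambda>y. y", OF assms(1-3)]) (use assms in \<open>auto simp: charts_at_iff\<close>)

lemma hol_in_divide:
  assumes "c \<in> charts_at X x" "hol_in c f x" "hol_in c g x" "g x \<noteq> 0"
  shows "hol_in c (\<lambda>y. f y / g y) x"
  using assms chol_at_divide[of "f \<circ> chart_inv c" "snd c x" "g \<circ> chart_inv c"]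
  by (simp add: hol_in_def comp_def charts_at_iff)

lemma chol_at_transition:
  assumes "c \<in> charts_at X x" "c' \<in> charts_at X x"
  shows "chol_at (snd c' \<circ> chart_inv c) (snd c x)"
  using assms atlas unfolding complex_atlas_def charts_at_iff cholomorphic_on_iff by blast

lemma transition_self:
  assumes "c \<in> charts_at X x"
  shows "transition c c x = (\<lambda>v. v)"
proof -
  have c: "c \<in> charts X" "x \<in> fst c" using assms by (auto simp: charts_at_iff)
  have "transition c c x = frechet_derivative (\<lambda>z. z) (at (snd c x))"
    unfolding transition_def
    by (rule frechet_derivative_cong_open[OF open_chart_image[OF c(1) chart_openin[OF c(1)]]]) (use c in auto)
  then show ?thesis using frechet_derivative_at[OF has_derivative_ident, of "snd c x"] by metis
qed

text \<open>The chain rule, after \<open>g\<close> in the chart \<open>c\<close> has been factored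
  near \<open>x\<close> through the coordinate change to \<open>c'\<close>.\<close>

lemma derivative_transition:
  fixes g :: "'p \<Rightarrow> 'w::complex_model_space"
  assumes "c \<in> charts_at X x" "c' \<in> charts_at X x" and g: "chol_at (g \<circ> chart_inv c') (snd c' x)"
  shows "frechet_derivative (g \<circ> chart_inv c) (at (snd c x)) v =
    frechet_derivative (g \<circ> chart_inv c') (at (snd c' x)) (transition c c' x v)"
proof -
  have c: "c \<in> charts X" "x \<in> fst c" "c' \<in> charts X" "x \<in> fst c'" using assms by (auto simp: charts_at_iff)
  have "frechet_derivative (g \<circ> chart_inv c) (at (snd c x)) =
      frechet_derivative ((g \<circ> chart_inv c') \<circ> (snd c' \<circ> chart_inv c)) (at (snd c x))"
    by (rule frechet_derivative_cong_open[OF open_chart_image[OF c(1) chart_openin[OF c(3)]]]) (use c in auto)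
  then show ?thesis
    using chol_at_compose(2)[OF chol_at_transition[OF assms(1,2)], of "g \<circ> chart_inv c'" v] g c
    by (simp add: transition_def)
qed

text \<open>The cocycle rule is the preceding chain rule with the coordinate map of
  \<open>c''\<close> in the role of \<open>g\<close>.\<close>

lemma transition_trans:
  assumes "c \<in> charts_at X x" "c' \<in> charts_at X x" "c'' \<in> charts_at X x"
  shows "transition c' c'' x (transition c c' x v) = transition c c'' x v"
  using derivative_transition[OF assms(1,2) chol_at_transition[OF assms(2,3)]] by (simp add: transition_def)

lemma transition_linear:
  assumes "c \<in> charts_at X x" "c' \<in> charts_at X x"
  shows "transition c c' x (v + w) = transition c c' x v + transition c c' x w"
    and "transition c c' x (a *\<^sub>C v) = a *\<^sub>C transition c c' x v"
  using chol_at_derivative[OF chol_at_transition[OF assms]] by (simp_all add: transition_def)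

lemma tangent_space_iff:
  "\<xi> \<in> tangent_space X x \<longleftrightarrow> \<xi> \<in> extensional (charts_at X x) \<and>
     (\<forall>c\<in>charts_at X x. \<forall>c'\<in>charts_at X x. \<xi> c' = transition c c' x (\<xi> c))"
  by (simp add: tangent_space_def transition_def)

lemma tangent_extensional: "\<xi> \<in> tangent_space X x \<Longrightarrow> \<xi> \<in> extensional (charts_at X x)"
  unfolding tangent_space_iff by blast

lemma tangent_transition:
  "\<xi> \<in> tangent_space X x \<Longrightarrow> c \<in> charts_at X x \<Longrightarrow> c' \<in> charts_at X x \<Longrightarrow> transition c c' x (\<xi> c) = \<xi> c'"
  unfolding tangent_space_iff by metis

lemma coord_tangent_apply:
  "c' \<in> charts_at X x \<Longrightarrow> coord_tangent X x c v c' = transition c c' x v"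
  by (simp add: coord_tangent_def transition_def)

lemma coord_tangent_self [simp]: "c \<in> charts_at X x \<Longrightarrow> coord_tangent X x c v c = v"
  by (simp add: coord_tangent_apply transition_self)

lemma coord_tangent_in: "c \<in> charts_at X x \<Longrightarrow> coord_tangent X x c v \<in> tangent_space X x"
  by (simp add: tangent_space_iff coord_tangent_apply transition_trans) (simp add: coord_tangent_def)

text \<open>The transition maps recover all other coordinates from those in \<open>c\<close>, and
  outside \<open>charts_at X x\<close> both vectors are \<open>undefined\<close>.\<close>

lemma tangent_eqI:
  assumes "\<xi> \<in> tangent_space X x" "\<eta> \<in> tangent_space X x" "c \<in> charts_at X x" "\<xi> c = \<eta> c"
  shows "\<xi> = \<eta>"
proof
  fix c'
  show "\<xi> c' = \<eta> c'"
  proof (cases "c' \<in> charts_at X x")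
    case True
    then show ?thesis using assms by (metis tangent_transition)
  next
    case False
    then show ?thesis
      using tangent_extensional[OF assms(1)] tangent_extensional[OF assms(2)] by (metis extensional_arb)
  qed
qed

lemma tangent_add_in:
  assumes "\<xi> \<in> tangent_space X x" "\<eta> \<in> tangent_space X x"
  shows "tangent_add X x \<xi> \<eta> \<in> tangent_space X x"
  unfolding tangent_space_iff using tangent_transition[OF assms(1)] tangent_transition[OF assms(2)]
  by (simp add: tangent_add_def transition_linear)

lemma tangent_scale_in:
  assumes "\<xi> \<in> tangent_space X x"
  shows "tangent_scale X x a \<xi> \<in> tangent_space X x"
  unfolding tangent_space_iff using tangent_transition[OF assms]
  by (simp add: tangent_scale_def transition_linear)

text \<open>\<open>differential\<close> computes in a chosen chart. For a function that is
  holomorphic in all charts at \<open>x\<close>, the chain rule makes the choice irrelevant.\<close>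

lemma differential_eq:
  assumes "c \<in> charts_at X x" "\<xi> \<in> tangent_space X x" "\<And>c'. c' \<in> charts_at X x \<Longrightarrow> hol_in c' g x"
  shows "differential X g x \<xi> = frechet_derivative (g \<circ> chart_inv c) (at (snd c x)) (\<xi> c)"
proof -
  define c0 where "c0 = (SOME c. c \<in> charts_at X x)"
  have c0: "c0 \<in> charts_at X x" unfolding c0_def using assms(1) by (rule someI)
  have "frechet_derivative (g \<circ> chart_inv c0) (at (snd c0 x)) (\<xi> c0) =
      frechet_derivative (g \<circ> chart_inv c) (at (snd c x)) (transition c0 c x (\<xi> c0))"
    using derivative_transition[OF c0 assms(1)] assms(3)[OF assms(1)] by (simp add: hol_in_def)
  also have "transition c0 c x (\<xi> c0) = \<xi> c" using tangent_transition[OF assms(2) c0 assms(1)] .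
  finally show ?thesis by (simp only: differential_def Let_def flip: c0_def)
qed

end


section \<open>Maps that are the identity in suitable charts\<close>

text \<open>The structure maps of a Cech nerve are of this kind: every chart of the source is the
  composition of the map with a chart of the target, restricted to a sheet.\<close>

definition chart_over :: "('p \<Rightarrow> 'q) \<Rightarrow> ('p, 'v) chart \<Rightarrow> ('q, 'v) chart \<Rightarrow> bool" where
  "chart_over f c c' \<longleftrightarrow> (\<forall>y\<in>fst c. f y \<in> fst c' \<and> snd c y = snd c' (f y))"

lemma chart_over_compose:
  "chart_over f c c' \<Longrightarrow> chart_over g c' c'' \<Longrightarrow> (\<And>x. x \<in> fst c \<Longrightarrow> h x = g (f x)) \<Longrightarrow> chart_over h c c''"
  by (simp add: chart_over_def)

text \<open>The first clause moves from the source to the target. The second lifts a chart of the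
  target, possibly after shrinking, to a chart around a prescribed preimage; it is what makes
  statements about all charts of the target accessible. Injectivity is not demanded.\<close>

definition etale :: "('p, 'v) cmanifold \<Rightarrow> ('q, 'v) cmanifold \<Rightarrow> ('p \<Rightarrow> 'q) \<Rightarrow> bool" where
  "etale X Y f \<longleftrightarrow> (\<forall>c\<in>charts X. \<exists>c'\<in>charts Y. chart_over f c c') \<and>
     (\<forall>c'\<in>charts Y. \<forall>x\<in>points X. f x \<in> fst c' \<longrightarrow> (\<exists>c\<in>charts_at X x. chart_over f c c'))"

locale etale_map = X: atlas X + Y: atlas Y
  for X :: "('p, 'v::complex_model_space) cmanifold" and Y :: "('q, 'v) cmanifold" +
  fixes f :: "'p \<Rightarrow> 'q"
  assumes etale: "etale X Y f"
begin

lemma chart_below: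
  assumes "c \<in> charts_at X x"
  obtains c' where "c' \<in> charts_at Y (f x)" "chart_over f c c'"
  using etale assms unfolding etale_def charts_at_iff chart_over_def by blast

lemma chart_above:
  assumes "c' \<in> charts_at Y (f x)" "x \<in> points X"
  obtains c where "c \<in> charts_at X x" "chart_over f c c'"
proof -
  have "c' \<in> charts Y" "f x \<in> fst c'" using assms(1) by (auto simp: charts_at_iff)
  then show ?thesis using etale assms(2) that unfolding etale_def by blast
qed

lemma image_points: "x \<in> points X \<Longrightarrow> f x \<in> points Y"
  by (meson X.charts_at_nonempty Y.charts_at_points chart_below)

lemma chart_over_inv:
  "chart_over f c c' \<Longrightarrow> c' \<in> charts Y \<Longrightarrow> y \<in> fst c \<Longrightarrow> chart_inv c' (snd c y) = f y"
  by (simp add: chart_over_def)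

lemma chart_over_at: "chart_over f c c' \<Longrightarrow> c' \<in> charts Y \<Longrightarrow> x \<in> fst c \<Longrightarrow> c' \<in> charts_at Y (f x)"
  by (simp add: chart_over_def charts_at_iff)

lemma chart_over_inj:
  assumes "chart_over f c c'" "c \<in> charts X"
  shows "inj_on f (fst c)"
  using X.chart_inj[OF assms(2)] assms(1) unfolding inj_on_def chart_over_def by metis

text \<open>Openness and continuity are not part of \<open>etale\<close>. They follow because
  \<open>c\<close> and \<open>c'\<close> have the same coordinates at corresponding points, so the
  coordinate image of an open set in one chart can be read in the other.\<close>

lemma openin_image:
  assumes "openin (mtop X) W"
  shows "openin (mtop Y) (f ` W)"
proof (subst openin_subopen, intro ballI)
  fix q assume "q \<in> f ` W"
  then obtain x where x: "x \<in> W" "q = f x" by blast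
  then have "x \<in> points X" using assms openin_subset by blast
  then obtain c where c: "c \<in> charts_at X x" using X.charts_at_nonempty by blast
  obtain c' where c': "c' \<in> charts_at Y (f x)" "chart_over f c c'" using chart_below[OF c] .
  have cc: "c \<in> charts X" "x \<in> fst c" "c' \<in> charts Y" "f x \<in> fst c'" using c c' by (auto simp: charts_at_iff)
  let ?V = "{q \<in> fst c'. snd c' q \<in> snd c ` (fst c \<inter> W)}"
  have "openin (mtop Y) ?V"
    by (intro Y.openin_chart_preimage X.open_chart_image cc assms)
  moreover have "q \<in> ?V" using x cc c' by (auto simp: chart_over_def)
  moreover have "?V \<subseteq> f ` W"
  proof
    fix p assume p: "p \<in> ?V"
    then obtain y where y: "y \<in> fst c" "y \<in> W" "snd c' p = snd c y" by blast
    then have "p = f y" using p c'(2) Y.chart_inj[OF cc(3)] by (auto simp: chart_over_def inj_on_def)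
    then show "p \<in> f ` W" using y by blast
  qed
  ultimately show "\<exists>T. openin (mtop Y) T \<and> q \<in> T \<and> T \<subseteq> f ` W" by blast
qed

lemma openin_preimage:
  assumes "openin (mtop Y) W"
  shows "openin (mtop X) (f -` W \<inter> points X)"
proof (subst openin_subopen, intro ballI)
  fix x assume x: "x \<in> f -` W \<inter> points X"
  then obtain c where c: "c \<in> charts_at X x" using X.charts_at_nonempty by blast
  obtain c' where c': "c' \<in> charts_at Y (f x)" "chart_over f c c'" using chart_below[OF c] .
  have cc: "c \<in> charts X" "x \<in> fst c" "c' \<in> charts Y" "f x \<in> fst c'" using c c' by (auto simp: charts_at_iff)
  let ?V = "{y \<in> fst c. snd c y \<in> snd c' ` (fst c' \<inter> W)}"
  have "openin (mtop X) ?V"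
    by (intro X.openin_chart_preimage Y.open_chart_image cc assms)
  moreover have "x \<in> ?V" using x cc c' by (auto simp: chart_over_def)
  moreover have "?V \<subseteq> f -` W \<inter> points X"
  proof
    fix y assume y: "y \<in> ?V"
    then obtain q where q: "q \<in> fst c'" "q \<in> W" "snd c y = snd c' q" by blast
    then have "q = f y" using y c'(2) Y.chart_inj[OF cc(3)] by (auto simp: chart_over_def inj_on_def)
    then show "y \<in> f -` W \<inter> points X" using q y X.chart_subset[OF cc(1)] by blast
  qed
  ultimately show "\<exists>T. openin (mtop X) T \<and> x \<in> T \<and> T \<subseteq> f -` W \<inter> points X" by blast
qed

text \<open>\<open>g\<close> read in \<open>c\<close> and \<open>h\<close> read in \<open>c'\<close>
  are the same function of the coordinates near the point, since the two charts have the same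
  coordinates there.\<close>

lemma
  assumes c: "c \<in> charts_at X x" "c' \<in> charts Y" "chart_over f c c'"
    and W: "openin (mtop X) W" "x \<in> W" and eq: "\<And>y. y \<in> W \<Longrightarrow> y \<in> fst c \<Longrightarrow> g y = h (f y)"
  shows hol_in_over: "hol_in c g x \<longleftrightarrow> hol_in c' h (f x)"
    and frechet_derivative_over: "frechet_derivative (g \<circ> chart_inv c) (at (snd c x)) =
      frechet_derivative (h \<circ> chart_inv c') (at (snd c' (f x)))"
proof -
  have [simp]: "snd c' (f x) = snd c x" using c by (simp add: chart_over_def charts_at_iff)
  show "hol_in c g x \<longleftrightarrow> hol_in c' h (f x)"
    using X.chol_at_chart_cong[OF c(1) W, where c' = c' and f = f and g = g and h = h] eq
      chart_over_inv[OF c(3,2)] by (simp add: hol_in_def)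
  show "frechet_derivative (g \<circ> chart_inv c) (at (snd c x)) =
      frechet_derivative (h \<circ> chart_inv c') (at (snd c' (f x)))"
    using X.frechet_derivative_chart_cong[OF c(1) W, where c' = c' and f = f and g = g and h = h] eq
      chart_over_inv[OF c(3,2)] by simp
qed

text \<open>In the charts \<open>c\<close> and \<open>c'\<close> the map is the identity. The chart
  chosen inside \<open>tangent_map\<close> contributes only its transition map to \<open>c\<close>,
  which the tangent vector absorbs.\<close>

lemma tangent_map_over:
  assumes c: "c \<in> charts_at X x" "c' \<in> charts Y" "chart_over f c c'" and \<xi>: "\<xi> \<in> tangent_space X x"
  shows "tangent_map X Y f x \<xi> c' = \<xi> c"
proof -
  define c0 where "c0 = (SOME c. c \<in> charts_at X x)"
  have c0: "c0 \<in> charts_at X x" unfolding c0_def using c(1) by (rule someI)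
  have cc: "c \<in> charts X" "c0 \<in> charts X" "x \<in> fst c" "x \<in> fst c0" using c c0 by (auto simp: charts_at_iff)
  have "frechet_derivative (snd c' \<circ> f \<circ> chart_inv c0) (at (snd c0 x)) = transition c0 c x"
    unfolding transition_def
    by (rule frechet_derivative_cong_open[OF X.open_chart_image[OF cc(2) X.chart_openin[OF cc(1)]]])
      (use cc c in \<open>auto simp: chart_over_def\<close>)
  then have "tangent_map X Y f x \<xi> c' = transition c0 c x (\<xi> c0)"
    using chart_over_at[OF c(3,2) cc(3)] by (simp add: tangent_map_def flip: c0_def)
  then show ?thesis using X.tangent_transition[OF \<xi> c0 c(1)] by simp
qed

lemma transition_over:
  assumes "c1 \<in> charts_at X x" "c1' \<in> charts Y" "chart_over f c1 c1'"
    and "c2 \<in> charts_at X x" "c2' \<in> charts Y" "chart_over f c2 c2'"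
  shows "transition c1' c2' (f x) = transition c1 c2 x"
proof -
  have cc: "c1 \<in> charts X" "x \<in> fst c1" "c2 \<in> charts X" "x \<in> fst c2" using assms by (auto simp: charts_at_iff)
  have eq: "snd c1' (f x) = snd c1 x" using assms cc by (simp add: chart_over_def)
  have "(snd c2' \<circ> chart_inv c1') z = (snd c2 \<circ> chart_inv c1) z" if z: "z \<in> snd c1 ` (fst c1 \<inter> fst c2)" for z
  proof -
    obtain y where y: "y \<in> fst c1" "y \<in> fst c2" "z = snd c1 y" using z by blast
    have "snd c2 y = snd c2' (f y)" using y(2) assms(6) unfolding chart_over_def by blast
    then show ?thesis using y cc chart_over_inv[OF assms(3,2) y(1)] by simp
  qed
  moreover have "snd c1 x \<in> snd c1 ` (fst c1 \<inter> fst c2)" using cc by blast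
  ultimately show ?thesis unfolding transition_def eq
    using frechet_derivative_cong_open[OF X.open_chart_image[OF cc(1) X.chart_openin[OF cc(3)]]] by blast
qed

lemma tangent_map_in:
  assumes x: "x \<in> points X" and \<xi>: "\<xi> \<in> tangent_space X x"
  shows "tangent_map X Y f x \<xi> \<in> tangent_space Y (f x)"
  unfolding Y.tangent_space_iff
proof (intro conjI ballI)
  fix c1' c2' assume c': "c1' \<in> charts_at Y (f x)" "c2' \<in> charts_at Y (f x)"
  obtain c1 where c1: "c1 \<in> charts_at X x" "chart_over f c1 c1'" using chart_above[OF c'(1) x] .
  obtain c2 where c2: "c2 \<in> charts_at X x" "chart_over f c2 c2'" using chart_above[OF c'(2) x] .
  have "c1' \<in> charts Y" "c2' \<in> charts Y" using c' by (auto simp: charts_at_iff)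
  then show "tangent_map X Y f x \<xi> c2' = transition c1' c2' (f x) (tangent_map X Y f x \<xi> c1')"
    using tangent_map_over[OF c1(1) _ c1(2) \<xi>] tangent_map_over[OF c2(1) _ c2(2) \<xi>]
      transition_over[OF c1(1) _ c1(2) c2(1) _ c2(2)] X.tangent_transition[OF \<xi> c1(1) c2(1)] by simp
qed (simp add: tangent_map_def Let_def)

lemma tangent_map_eqI:
  assumes "x \<in> points X" "\<xi> \<in> tangent_space X x" "\<eta> \<in> tangent_space Y (f x)"
    and "c \<in> charts_at X x" "c' \<in> charts Y" "chart_over f c c'" "\<xi> c = \<eta> c'"
  shows "tangent_map X Y f x \<xi> = \<eta>"
  using assms tangent_map_over[OF assms(4-6,2)] chart_over_at[OF assms(6,5)]
  by (intro Y.tangent_eqI[OF tangent_map_in[OF assms(1,2)] assms(3)]) (auto simp: charts_at_iff)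

lemma tangent_map_add:
  assumes "x \<in> points X" "\<xi> \<in> tangent_space X x" "\<eta> \<in> tangent_space X x"
  shows "tangent_map X Y f x (tangent_add X x \<xi> \<eta>) =
    tangent_add Y (f x) (tangent_map X Y f x \<xi>) (tangent_map X Y f x \<eta>)"
proof -
  obtain c where c: "c \<in> charts_at X x" using X.charts_at_nonempty[OF assms(1)] by blast
  obtain c' where c': "c' \<in> charts_at Y (f x)" "chart_over f c c'" using chart_below[OF c] .
  then have c'Y: "c' \<in> charts Y" by (simp add: charts_at_iff)
  have "tangent_add X x \<xi> \<eta> \<in> tangent_space X x"
    "tangent_add Y (f x) (tangent_map X Y f x \<xi>) (tangent_map X Y f x \<eta>) \<in> tangent_space Y (f x)"
    using assms by (auto intro: X.tangent_add_in Y.tangent_add_in tangent_map_in)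
  then show ?thesis using c c'
    by (intro tangent_map_eqI[OF assms(1) _ _ c c'Y c'(2)])
      (simp_all add: tangent_add_def tangent_map_over[OF c c'Y c'(2)] assms)
qed

lemma tangent_map_scale:
  assumes "x \<in> points X" "\<xi> \<in> tangent_space X x"
  shows "tangent_map X Y f x (tangent_scale X x a \<xi>) = tangent_scale Y (f x) a (tangent_map X Y f x \<xi>)"
proof -
  obtain c where c: "c \<in> charts_at X x" using X.charts_at_nonempty[OF assms(1)] by blast
  obtain c' where c': "c' \<in> charts_at Y (f x)" "chart_over f c c'" using chart_below[OF c] .
  then have c'Y: "c' \<in> charts Y" by (simp add: charts_at_iff)
  have "tangent_scale X x a \<xi> \<in> tangent_space X x"
    "tangent_scale Y (f x) a (tangent_map X Y f x \<xi>) \<in> tangent_space Y (f x)"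
    using assms by (auto intro: X.tangent_scale_in Y.tangent_scale_in tangent_map_in)
  then show ?thesis using c c'
    by (intro tangent_map_eqI[OF assms(1) _ _ c c'Y c'(2)])
      (simp_all add: tangent_scale_def tangent_map_over[OF c c'Y c'(2)] assms)
qed

lemma tangent_map_coord:
  assumes "c \<in> charts_at X x" "c' \<in> charts Y" "chart_over f c c'"
  shows "tangent_map X Y f x (coord_tangent X x c v) = coord_tangent Y (f x) c' v"
  using assms chart_over_at[OF assms(3,2)] X.charts_at_points[OF assms(1)]
  by (intro tangent_map_eqI[OF _ _ _ assms])
    (auto simp: charts_at_iff intro: X.coord_tangent_in Y.coord_tangent_in)

text \<open>This is what the Leibniz rule of a pulled back connection needs, where \<open>h\<close>
  is a function \<open>g\<close> pushed down from a sheet.\<close>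

lemma differential_over:
  assumes x: "x \<in> points X" and \<xi>: "\<xi> \<in> tangent_space X x"
    and W: "openin (mtop X) W" "x \<in> W" and eq: "\<And>y. y \<in> W \<Longrightarrow> g y = h (f y)"
    and h: "\<And>c'. c' \<in> charts_at Y (f x) \<Longrightarrow> hol_in c' h (f x)"
  shows "differential Y h (f x) (tangent_map X Y f x \<xi>) = differential X g x \<xi>"
proof -
  obtain c where c: "c \<in> charts_at X x" using X.charts_at_nonempty[OF x] by blast
  obtain c' where c': "c' \<in> charts_at Y (f x)" "chart_over f c c'" using chart_below[OF c] .
  then have c'Y: "c' \<in> charts Y" by (simp add: charts_at_iff)
  have g: "hol_in d g x" if d: "d \<in> charts_at X x" for d
  proof -
    obtain d' where d': "d' \<in> charts_at Y (f x)" "chart_over f d d'" using chart_below[OF d] .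
    then show ?thesis using hol_in_over[OF d _ d'(2) W, where g = g and h = h] eq h by (simp add: charts_at_iff)
  qed
  show ?thesis
    using X.differential_eq[OF c \<xi> g] Y.differential_eq[OF c'(1) tangent_map_in[OF x \<xi>] h]
      frechet_derivative_over[OF c c'Y c'(2) W, where g = g and h = h] eq tangent_map_over[OF c c'Y c'(2) \<xi>] by simp
qed

end

lemma etale_compose:
  assumes f: "etale_map X Y f" and g: "etale_map Y Z g" and h: "\<And>x. x \<in> points X \<Longrightarrow> h x = g (f x)"
  shows "etale_map X Z h"
proof -
  interpret f: etale_map X Y f by fact
  interpret g: etale_map Y Z g by fact
  have comp: "chart_over h c c''" if "chart_over f c c'" "chart_over g c' c''" "c \<in> charts X" for c c' c''
    using f.X.chart_subset[OF that(3)] h by (intro chart_over_compose[OF that(1,2)]) blast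
  have "etale X Z h" unfolding etale_def
  proof (intro conjI ballI impI)
    fix c assume c: "c \<in> charts X"
    obtain c' c'' where "c' \<in> charts Y" "chart_over f c c'" "c'' \<in> charts Z" "chart_over g c' c''"
      using f.etale g.etale c unfolding etale_def by metis
    then show "\<exists>c''\<in>charts Z. chart_over h c c''" using comp c by blast
  next
    fix c'' x assume c'': "c'' \<in> charts Z" and x: "x \<in> points X" "h x \<in> fst c''"
    have "c'' \<in> charts_at Z (g (f x))" using c'' x by (simp add: charts_at_iff h)
    then obtain c' where c': "c' \<in> charts_at Y (f x)" "chart_over g c' c''"
      using g.chart_above f.image_points[OF x(1)] by blast
    then obtain c where c: "c \<in> charts_at X x" "chart_over f c c'" using f.chart_above x(1) by blast
    then have "c \<in> charts X" by (simp add: charts_at_iff)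
    then show "\<exists>c\<in>charts_at X x. chart_over h c c''" using comp c' c by blast
  qed
  then show ?thesis by unfold_locales
qed

lemma tangent_map_compose:
  assumes f: "etale_map X Y f" and g: "etale_map Y Z g" and h: "\<And>x. x \<in> points X \<Longrightarrow> h x = g (f x)"
    and x: "x \<in> points X" and \<xi>: "\<xi> \<in> tangent_space X x"
  shows "tangent_map X Z h x \<xi> = tangent_map Y Z g (f x) (tangent_map X Y f x \<xi>)"
proof -
  interpret f: etale_map X Y f by fact
  interpret g: etale_map Y Z g by fact
  interpret h: etale_map X Z h by (rule etale_compose[OF f g h])
  obtain c where c: "c \<in> charts_at X x" using f.X.charts_at_nonempty[OF x] by blast
  obtain c' where c': "c' \<in> charts_at Y (f x)" "chart_over f c c'" using f.chart_below[OF c] .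
  obtain c'' where c'': "c'' \<in> charts_at Z (g (f x))" "chart_over g c' c''" using g.chart_below[OF c'(1)] .
  have cc: "c' \<in> charts Y" "c'' \<in> charts Z" using c' c'' by (auto simp: charts_at_iff)
  have "fst c \<subseteq> points X" using c f.X.chart_subset by (simp add: charts_at_iff)
  then have "chart_over h c c''" using h by (intro chart_over_compose[OF c'(2) c''(2)]) blast
  then show ?thesis
    using g.tangent_map_in[OF f.image_points[OF x] f.tangent_map_in[OF x \<xi>]] c cc(2)
      g.tangent_map_over[OF c'(1) cc(2) c''(2) f.tangent_map_in[OF x \<xi>]] f.tangent_map_over[OF c cc(1) c'(2) \<xi>]
    by (intro h.tangent_map_eqI[OF x \<xi>]) (auto simp: h[OF x])
qed

text \<open>The map is required to be the identity on points only: \<open>cech_map\<close> for the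
  identity of [k] truncates index functions that are not extensional, so it is not the identity of
  the whole type.\<close>

lemma etale_ident:
  assumes "complex_atlas X" "\<And>x. x \<in> points X \<Longrightarrow> f x = x"
  shows "etale_map X X f" and "x \<in> points X \<Longrightarrow> \<xi> \<in> tangent_space X x \<Longrightarrow> tangent_map X X f x \<xi> = \<xi>"
proof -
  interpret atlas X by unfold_locales fact
  have over: "chart_over f c c" if "c \<in> charts X" for c
    using assms(2) chart_subset[OF that] by (auto simp: chart_over_def)
  have "\<exists>c'\<in>charts_at X x. chart_over f c' c" if "c \<in> charts X" "x \<in> points X" "f x \<in> fst c" for c x
    using that over[OF that(1)] assms(2)[OF that(2)] by (intro bexI[of _ c]) (simp_all add: charts_at_iff)
  then have "etale X X f" unfolding etale_def using over by blast
  then show e: "etale_map X X f" by unfold_locales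
  interpret etale_map X X f by fact
  show "tangent_map X X f x \<xi> = \<xi>" if "x \<in> points X" "\<xi> \<in> tangent_space X x"
  proof -
    obtain c where c: "c \<in> charts_at X x" using charts_at_nonempty \<open>x \<in> points X\<close> by blast
    then have "c \<in> charts X" by (simp add: charts_at_iff)
    then show ?thesis
      using that assms(2)[OF that(1)] by (intro tangent_map_eqI[OF that _ c _ over]) simp_all
  qed
qed

section \<open>Holomorphic forms\<close>

context atlas
begin

lemma tangent_tuples_upd:
  "\<Xi> \<in> tangent_tuples X k x \<Longrightarrow> i < k \<Longrightarrow> \<xi> \<in> tangent_space X x \<Longrightarrow> \<Xi>(i := \<xi>) \<in> tangent_tuples X k x"
  by (auto simp: tangent_tuples_def PiE_iff extensional_def)

lemma tangent_tuplesD: "\<Xi> \<in> tangent_tuples X k x \<Longrightarrow> i < k \<Longrightarrow> \<Xi> i \<in> tangent_space X x"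
  by (auto simp: tangent_tuples_def PiE_iff)

lemma coord_tuple_in:
  "c \<in> charts_at X x \<Longrightarrow> (\<lambda>i\<in>{..<k}. coord_tangent X x c (v i)) \<in> tangent_tuples X k x"
  by (simp add: tangent_tuples_def coord_tangent_in)

lemma holomorphic_forms_iff:
  "\<omega> \<in> holomorphic_forms X W k \<longleftrightarrow>
     \<omega> \<in> (\<Pi>\<^sub>E x\<in>W. tangent_tuples X k x \<rightarrow>\<^sub>E UNIV) \<and>
     (\<forall>x\<in>W. \<forall>\<Xi>\<in>tangent_tuples X k x. \<forall>i<k.
       (\<forall>\<xi>\<in>tangent_space X x. \<omega> x (\<Xi>(i := tangent_add X x (\<Xi> i) \<xi>)) = \<omega> x \<Xi> + \<omega> x (\<Xi>(i := \<xi>))) \<and>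
       (\<forall>a. \<omega> x (\<Xi>(i := tangent_scale X x a (\<Xi> i))) = a * \<omega> x \<Xi>) \<and>
       (\<forall>j<k. i \<noteq> j \<and> \<Xi> i = \<Xi> j \<longrightarrow> \<omega> x \<Xi> = 0)) \<and>
     (\<forall>x\<in>W. \<forall>c\<in>charts_at X x. \<forall>v. hol_in c (\<lambda>y. \<omega> y (\<lambda>i\<in>{..<k}. coord_tangent X y c (v i))) x)"
proof -
  have "(\<forall>c\<in>charts X. \<forall>v. cholomorphic_on (snd c ` (fst c \<inter> W))
           (\<lambda>y. \<omega> (chart_inv c y) (\<lambda>i\<in>{..<k}. coord_tangent X (chart_inv c y) c (v i)))) \<longleftrightarrow>
     (\<forall>x\<in>W. \<forall>c\<in>charts_at X x. \<forall>v. hol_in c (\<lambda>y. \<omega> y (\<lambda>i\<in>{..<k}. coord_tangent X y c (v i))) x)"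
    unfolding cholomorphic_on_iff hol_in_def charts_at_def comp_def by blast
  then show ?thesis unfolding holomorphic_forms_def by blast
qed

lemma
  assumes "\<omega> \<in> holomorphic_forms X W k"
  shows form_ext: "\<omega> \<in> (\<Pi>\<^sub>E x\<in>W. tangent_tuples X k x \<rightarrow>\<^sub>E UNIV)"
    and form_additive: "x \<in> W \<Longrightarrow> \<Xi> \<in> tangent_tuples X k x \<Longrightarrow> i < k \<Longrightarrow> \<xi> \<in> tangent_space X x \<Longrightarrow>
      \<omega> x (\<Xi>(i := tangent_add X x (\<Xi> i) \<xi>)) = \<omega> x \<Xi> + \<omega> x (\<Xi>(i := \<xi>))"
    and form_homogeneous: "x \<in> W \<Longrightarrow> \<Xi> \<in> tangent_tuples X k x \<Longrightarrow> i < k \<Longrightarrow>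
      \<omega> x (\<Xi>(i := tangent_scale X x a (\<Xi> i))) = a * \<omega> x \<Xi>"
    and form_alternating: "x \<in> W \<Longrightarrow> \<Xi> \<in> tangent_tuples X k x \<Longrightarrow> i < k \<Longrightarrow> j < k \<Longrightarrow> i \<noteq> j \<Longrightarrow>
      \<Xi> i = \<Xi> j \<Longrightarrow> \<omega> x \<Xi> = 0"
    and form_hol_in: "x \<in> W \<Longrightarrow> c \<in> charts_at X x \<Longrightarrow>
      hol_in c (\<lambda>y. \<omega> y (\<lambda>i\<in>{..<k}. coord_tangent X y c (v i))) x"
  using assms unfolding holomorphic_forms_iff by blast+

lemma holomorphic_formsI:
  assumes "\<omega> \<in> (\<Pi>\<^sub>E x\<in>W. tangent_tuples X k x \<rightarrow>\<^sub>E UNIV)"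
    and "\<And>x \<Xi> i \<xi>. x \<in> W \<Longrightarrow> \<Xi> \<in> tangent_tuples X k x \<Longrightarrow> i < k \<Longrightarrow> \<xi> \<in> tangent_space X x \<Longrightarrow>
      \<omega> x (\<Xi>(i := tangent_add X x (\<Xi> i) \<xi>)) = \<omega> x \<Xi> + \<omega> x (\<Xi>(i := \<xi>))"
    and "\<And>x \<Xi> i a. x \<in> W \<Longrightarrow> \<Xi> \<in> tangent_tuples X k x \<Longrightarrow> i < k \<Longrightarrow>
      \<omega> x (\<Xi>(i := tangent_scale X x a (\<Xi> i))) = a * \<omega> x \<Xi>"
    and "\<And>x \<Xi> i j. x \<in> W \<Longrightarrow> \<Xi> \<in> tangent_tuples X k x \<Longrightarrow> i < k \<Longrightarrow> j < k \<Longrightarrow> i \<noteq> j \<Longrightarrow>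
      \<Xi> i = \<Xi> j \<Longrightarrow> \<omega> x \<Xi> = 0"
    and "\<And>x c v. x \<in> W \<Longrightarrow> c \<in> charts_at X x \<Longrightarrow>
      hol_in c (\<lambda>y. \<omega> y (\<lambda>i\<in>{..<k}. coord_tangent X y c (v i))) x"
  shows "\<omega> \<in> holomorphic_forms X W k"
  using assms unfolding holomorphic_forms_iff by blast

lemma form_eqI:
  assumes "\<omega> \<in> holomorphic_forms X W k" "\<eta> \<in> holomorphic_forms X W k"
    and "\<And>x \<Xi>. x \<in> W \<Longrightarrow> \<Xi> \<in> tangent_tuples X k x \<Longrightarrow> \<omega> x \<Xi> = \<eta> x \<Xi>"
  shows "\<omega> = \<eta>"
proof (rule PiE_ext[OF form_ext[OF assms(1)] form_ext[OF assms(2)]])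
  fix x assume x: "x \<in> W"
  show "\<omega> x = \<eta> x"
    by (rule PiE_ext[OF PiE_mem[OF form_ext[OF assms(1)] x] PiE_mem[OF form_ext[OF assms(2)] x] assms(3)[OF x]])
qed

lemma form_add_apply:
  "x \<in> points X \<Longrightarrow> \<Xi> \<in> tangent_tuples X k x \<Longrightarrow> form_add X k \<omega> \<eta> x \<Xi> = \<omega> x \<Xi> + \<eta> x \<Xi>"
  by (simp add: form_add_def)

lemma form_zero_apply: "x \<in> points X \<Longrightarrow> \<Xi> \<in> tangent_tuples X k x \<Longrightarrow> form_zero X k x \<Xi> = 0"
  by (simp add: form_zero_def)

text \<open>All operations on forms have the shape \<open>restricted_form\<close>, which moves the bookkeeping of
  domains out of the way.\<close>

definition restricted_form :: "nat \<Rightarrow> ('p, 'v) form \<Rightarrow> ('p, 'v) form" where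
  "restricted_form k \<omega> = (\<lambda>x\<in>points X. \<lambda>\<Xi>\<in>tangent_tuples X k x. \<omega> x \<Xi>)"

lemma restricted_form_in:
  assumes "\<And>x \<Xi> i \<xi>. x \<in> points X \<Longrightarrow> \<Xi> \<in> tangent_tuples X k x \<Longrightarrow> i < k \<Longrightarrow> \<xi> \<in> tangent_space X x \<Longrightarrow>
      \<omega> x (\<Xi>(i := tangent_add X x (\<Xi> i) \<xi>)) = \<omega> x \<Xi> + \<omega> x (\<Xi>(i := \<xi>))"
    and "\<And>x \<Xi> i a. x \<in> points X \<Longrightarrow> \<Xi> \<in> tangent_tuples X k x \<Longrightarrow> i < k \<Longrightarrow>
      \<omega> x (\<Xi>(i := tangent_scale X x a (\<Xi> i))) = a * \<omega> x \<Xi>"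
    and "\<And>x \<Xi> i j. x \<in> points X \<Longrightarrow> \<Xi> \<in> tangent_tuples X k x \<Longrightarrow> i < k \<Longrightarrow> j < k \<Longrightarrow> i \<noteq> j \<Longrightarrow>
      \<Xi> i = \<Xi> j \<Longrightarrow> \<omega> x \<Xi> = 0"
    and hol: "\<And>x c v. x \<in> points X \<Longrightarrow> c \<in> charts_at X x \<Longrightarrow>
      hol_in c (\<lambda>y. \<omega> y (\<lambda>i\<in>{..<k}. coord_tangent X y c (v i))) x"
  shows "restricted_form k \<omega> \<in> holomorphic_forms X (points X) k"
proof (rule holomorphic_formsI)
  fix x \<Xi> i \<xi>
  assume *: "x \<in> points X" "\<Xi> \<in> tangent_tuples X k x" "i < k" "\<xi> \<in> tangent_space X x"
  then have "\<Xi>(i := tangent_add X x (\<Xi> i) \<xi>) \<in> tangent_tuples X k x" "\<Xi>(i := \<xi>) \<in> tangent_tuples X k x"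
    using tangent_tuples_upd[OF *(2,3)] tangent_add_in[OF tangent_tuplesD[OF *(2,3)] *(4)] by blast+
  then show "restricted_form k \<omega> x (\<Xi>(i := tangent_add X x (\<Xi> i) \<xi>)) =
      restricted_form k \<omega> x \<Xi> + restricted_form k \<omega> x (\<Xi>(i := \<xi>))"
    using * assms(1)[OF *] by (simp add: restricted_form_def)
next
  fix x \<Xi> i a
  assume *: "x \<in> points X" "\<Xi> \<in> tangent_tuples X k x" "i < k"
  then have "\<Xi>(i := tangent_scale X x a (\<Xi> i)) \<in> tangent_tuples X k x"
    using tangent_tuples_upd[OF *(2,3)] tangent_scale_in[OF tangent_tuplesD[OF *(2,3)]] by blast
  then show "restricted_form k \<omega> x (\<Xi>(i := tangent_scale X x a (\<Xi> i))) = a * restricted_form k \<omega> x \<Xi>"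
    using * assms(2)[OF *] by (simp add: restricted_form_def)
next
  fix x c v assume x: "x \<in> points X" and c: "c \<in> charts_at X x"
  \<comment> \<open>Throughout the domain of \<open>c\<close> the coordinate tuples are genuine
    tuples of tangent vectors, so the restriction is invisible near \<open>x\<close>.\<close>
  have "restricted_form k \<omega> y (\<lambda>i\<in>{..<k}. coord_tangent X y c (v i)) =
      \<omega> y (\<lambda>i\<in>{..<k}. coord_tangent X y c (v i))" if "y \<in> fst c" for y
  proof -
    have "c \<in> charts_at X y" using that c by (simp add: charts_at_iff)
    then show ?thesis using charts_at_points[of c y] coord_tuple_in[of c y v k] by (simp add: restricted_form_def)
  qed
  moreover have "openin (mtop X) (fst c)" "x \<in> fst c" using c chart_openin by (auto simp: charts_at_iff)
  ultimately show "hol_in c (\<lambda>y. restricted_form k \<omega> y (\<lambda>i\<in>{..<k}. coord_tangent X y c (v i))) x"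
    using hol[OF x c, of v]
    by (subst hol_in_cong[OF c, where W = "fst c" and h = "\<lambda>y. \<omega> y (\<lambda>i\<in>{..<k}. coord_tangent X y c (v i))"]) simp_all
qed (use assms(3) in \<open>auto simp: restricted_form_def\<close>)

lemma form_zero_in: "form_zero X k \<in> holomorphic_forms X (points X) k"
proof -
  have "restricted_form k (\<lambda>_ _. 0) \<in> holomorphic_forms X (points X) k"
    by (rule restricted_form_in) (auto intro: hol_in_const)
  then show ?thesis by (simp add: restricted_form_def form_zero_def)
qed

lemma form_add_in:
  assumes "\<omega> \<in> holomorphic_forms X (points X) k" "\<eta> \<in> holomorphic_forms X (points X) k"
  shows "form_add X k \<omega> \<eta> \<in> holomorphic_forms X (points X) k"
proof -
  have "restricted_form k (\<lambda>x \<Xi>. \<omega> x \<Xi> + \<eta> x \<Xi>) \<in> holomorphic_forms X (points X) k"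
    by (rule restricted_form_in)
      (auto intro!: hol_in_add form_hol_in[OF assms(1)] form_hol_in[OF assms(2)] simp: algebra_simps
        form_additive[OF assms(1)] form_additive[OF assms(2)] form_homogeneous[OF assms(1)]
        form_homogeneous[OF assms(2)] form_alternating[OF assms(1)] form_alternating[OF assms(2)])
  then show ?thesis by (simp add: restricted_form_def form_add_def)
qed

lemma hol_in_minus: "hol_in c g x \<Longrightarrow> hol_in c (\<lambda>y. - g y) x"
  using hol_in_mult[OF hol_in_const[of c "-1"]] by fastforce

lemma form_inverse:
  assumes "\<omega> \<in> holomorphic_forms X (points X) k"
  shows "\<exists>\<eta>\<in>holomorphic_forms X (points X) k. form_add X k \<eta> \<omega> = form_zero X k"
proof
  show "restricted_form k (\<lambda>x \<Xi>. - \<omega> x \<Xi>) \<in> holomorphic_forms X (points X) k"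
    by (rule restricted_form_in)
      (auto intro!: hol_in_minus form_hol_in[OF assms] simp: algebra_simps
        form_additive[OF assms] form_homogeneous[OF assms] form_alternating[OF assms])
  show "form_add X k (restricted_form k (\<lambda>x \<Xi>. - \<omega> x \<Xi>)) \<omega> = form_zero X k"
    by (auto simp: form_add_def form_zero_def restricted_form_def fun_eq_iff)
qed

lemma form_add_zero:
  assumes "\<omega> \<in> holomorphic_forms X (points X) k"
  shows "form_add X k (form_zero X k) \<omega> = \<omega>"
  by (rule form_eqI[OF form_add_in[OF form_zero_in assms] assms]) (simp add: form_add_apply form_zero_apply)

section \<open>The groups of polynomials with form coefficients\<close>

lemma carrier_Omega_group:
  "a \<in> carrier (Omega_group X n) \<longleftrightarrow>
    a \<in> (\<Pi>\<^sub>E p\<in>{p. n \<le> 2 * p}. holomorphic_forms X (points X) (2 * p - n)) \<and>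
    finite {p. n \<le> 2 * p \<and> a p \<noteq> form_zero X (2 * p - n)}"
  by (simp add: Omega_group_def)

lemma carrier_Omega_groupI:
  assumes "\<And>p. n \<le> 2 * p \<Longrightarrow> a p \<in> holomorphic_forms X (points X) (2 * p - n)"
    and "a \<in> extensional {p. n \<le> 2 * p}" "finite S"
    and "\<And>p. n \<le> 2 * p \<Longrightarrow> p \<notin> S \<Longrightarrow> a p = form_zero X (2 * p - n)"
  shows "a \<in> carrier (Omega_group X n)"
  unfolding carrier_Omega_group
  using assms by (auto simp: PiE_iff intro: finite_subset[OF _ assms(3)])

lemma Omega_group_form: "a \<in> carrier (Omega_group X n) \<Longrightarrow> n \<le> 2 * p \<Longrightarrow>
    a p \<in> holomorphic_forms X (points X) (2 * p - n)"
  by (auto simp: carrier_Omega_group PiE_iff)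

lemma mult_Omega_group:
  "(a \<otimes>\<^bsub>Omega_group X n\<^esub> b) = (\<lambda>p\<in>{p. n \<le> 2 * p}. form_add X (2 * p - n) (a p) (b p))"
  by (simp add: Omega_group_def)

lemma one_Omega_group: "\<one>\<^bsub>Omega_group X n\<^esub> = (\<lambda>p\<in>{p. n \<le> 2 * p}. form_zero X (2 * p - n))"
  by (simp add: Omega_group_def)

lemma Omega_group_eqI:
  assumes "a \<in> carrier (Omega_group X n)" "b \<in> carrier (Omega_group X n)"
    and "\<And>p x \<Xi>. n \<le> 2 * p \<Longrightarrow> x \<in> points X \<Longrightarrow> \<Xi> \<in> tangent_tuples X (2 * p - n) x \<Longrightarrow> a p x \<Xi> = b p x \<Xi>"
  shows "a = b"
proof (rule PiE_ext)
  show "a \<in> (\<Pi>\<^sub>E p\<in>{p. n \<le> 2 * p}. holomorphic_forms X (points X) (2 * p - n))"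
    and "b \<in> (\<Pi>\<^sub>E p\<in>{p. n \<le> 2 * p}. holomorphic_forms X (points X) (2 * p - n))"
    using assms by (simp_all add: carrier_Omega_group)
  fix p assume "p \<in> {p. n \<le> 2 * p}"
  then show "a p = b p"
    using assms by (intro form_eqI[of _ "points X" "2 * p - n"] Omega_group_form) auto
qed

lemma mult_Omega_group_apply:
  "n \<le> 2 * p \<Longrightarrow> x \<in> points X \<Longrightarrow> \<Xi> \<in> tangent_tuples X (2 * p - n) x \<Longrightarrow>
    (a \<otimes>\<^bsub>Omega_group X n\<^esub> b) p x \<Xi> = a p x \<Xi> + b p x \<Xi>"
  by (simp add: mult_Omega_group form_add_apply)

lemma one_Omega_group_apply:
  "n \<le> 2 * p \<Longrightarrow> x \<in> points X \<Longrightarrow> \<Xi> \<in> tangent_tuples X (2 * p - n) x \<Longrightarrow>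
    \<one>\<^bsub>Omega_group X n\<^esub> p x \<Xi> = 0"
  by (simp add: one_Omega_group form_zero_apply)

lemma mult_Omega_group_in:
  assumes "a \<in> carrier (Omega_group X n)" "b \<in> carrier (Omega_group X n)"
  shows "a \<otimes>\<^bsub>Omega_group X n\<^esub> b \<in> carrier (Omega_group X n)"
proof -
  have "form_add X (2 * p - n) (a p) (b p) = form_zero X (2 * p - n)"
    if "n \<le> 2 * p" "a p = form_zero X (2 * p - n)" "b p = form_zero X (2 * p - n)" for p
    using that form_add_zero[OF form_zero_in] by simp
  then show ?thesis
    using assms form_add_in
    by (intro carrier_Omega_groupI[where S = "{p. n \<le> 2 * p \<and> a p \<noteq> form_zero X (2 * p - n)} \<union>
        {p. n \<le> 2 * p \<and> b p \<noteq> form_zero X (2 * p - n)}"])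
      (auto simp: carrier_Omega_group mult_Omega_group PiE_iff)
qed

lemma one_Omega_group_in: "\<one>\<^bsub>Omega_group X n\<^esub> \<in> carrier (Omega_group X n)"
proof -
  have "{p. n \<le> 2 * p \<and> \<one>\<^bsub>Omega_group X n\<^esub> p \<noteq> form_zero X (2 * p - n)} = {}"
    by (auto simp: one_Omega_group)
  then show ?thesis unfolding carrier_Omega_group by (simp add: one_Omega_group form_zero_in)
qed

lemma comm_group_Omega_group: "comm_group (Omega_group X n)"
proof (rule comm_groupI)
  fix a assume a: "a \<in> carrier (Omega_group X n)"
  have "\<exists>b. \<forall>p. n \<le> 2 * p \<longrightarrow> b p \<in> holomorphic_forms X (points X) (2 * p - n) \<and>
      form_add X (2 * p - n) (b p) (a p) = form_zero X (2 * p - n)"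
    by (rule choice) (use form_inverse Omega_group_form[OF a] in blast)
  then obtain b where b: "\<And>p. n \<le> 2 * p \<Longrightarrow> b p \<in> holomorphic_forms X (points X) (2 * p - n)"
    "\<And>p. n \<le> 2 * p \<Longrightarrow> form_add X (2 * p - n) (b p) (a p) = form_zero X (2 * p - n)" by blast
  let ?b = "restrict b {p. n \<le> 2 * p}"
  \<comment> \<open>The inverses are chosen coefficient by coefficient. Finite support survives
    because the inverse of the zero form is forced to be zero.\<close>
  have "b p = form_zero X (2 * p - n)" if "n \<le> 2 * p" "a p = form_zero X (2 * p - n)" for p
  proof (rule form_eqI[OF b(1)[OF that(1)] form_zero_in])
    fix x \<Xi> assume *: "x \<in> points X" "\<Xi> \<in> tangent_tuples X (2 * p - n) x"
    then show "b p x \<Xi> = form_zero X (2 * p - n) x \<Xi>"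
      using form_add_apply[OF *, of "b p" "a p"] b(2)[OF that(1)] that by (simp add: form_zero_apply)
  qed
  then have "?b \<in> carrier (Omega_group X n)"
    using a b by (intro carrier_Omega_groupI[where S = "{p. n \<le> 2 * p \<and> a p \<noteq> form_zero X (2 * p - n)}"])
      (auto simp: carrier_Omega_group)
  moreover have "?b \<otimes>\<^bsub>Omega_group X n\<^esub> a = \<one>\<^bsub>Omega_group X n\<^esub>"
    using b by (auto simp: mult_Omega_group one_Omega_group fun_eq_iff)
  ultimately show "\<exists>y\<in>carrier (Omega_group X n). y \<otimes>\<^bsub>Omega_group X n\<^esub> a = \<one>\<^bsub>Omega_group X n\<^esub>" by blast
qed (auto intro!: Omega_group_eqI mult_Omega_group_in one_Omega_group_in
    simp: mult_Omega_group_apply one_Omega_group_apply algebra_simps)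

end

section \<open>Pullback of forms\<close>

context etale_map
begin

lemma tangent_map_tuple:
  assumes "x \<in> points X" "\<Xi> \<in> tangent_tuples X k x"
  shows "(\<lambda>i\<in>{..<k}. tangent_map X Y f x (\<Xi> i)) \<in> tangent_tuples Y k (f x)"
  using tangent_map_in[OF assms(1) X.tangent_tuplesD[OF assms(2)]] by (simp add: tangent_tuples_def)

lemma tangent_map_tuple_upd:
  "i < k \<Longrightarrow> (\<lambda>j\<in>{..<k}. tangent_map X Y f x ((\<Xi>(i := \<xi>)) j)) =
     (\<lambda>j\<in>{..<k}. tangent_map X Y f x (\<Xi> j))(i := tangent_map X Y f x \<xi>)"
  by (auto simp: fun_eq_iff)

lemma form_pullback_in:
  assumes \<omega>: "\<omega> \<in> holomorphic_forms Y (points Y) k"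
  shows "form_pullback X Y f k \<omega> \<in> holomorphic_forms X (points X) k"
proof -
  let ?T = "\<lambda>x \<Xi>. \<lambda>i\<in>{..<k}. tangent_map X Y f x (\<Xi> i)"
  have "X.restricted_form k (\<lambda>x \<Xi>. \<omega> (f x) (?T x \<Xi>)) \<in> holomorphic_forms X (points X) k"
  proof (rule X.restricted_form_in)
    fix x \<Xi> i \<xi>
    assume *: "x \<in> points X" "\<Xi> \<in> tangent_tuples X k x" "i < k" "\<xi> \<in> tangent_space X x"
    show "\<omega> (f x) (?T x (\<Xi>(i := tangent_add X x (\<Xi> i) \<xi>))) = \<omega> (f x) (?T x \<Xi>) + \<omega> (f x) (?T x (\<Xi>(i := \<xi>)))"
      unfolding tangent_map_tuple_upd[OF *(3)]
      using Y.form_additive[OF \<omega> image_points[OF *(1)] tangent_map_tuple[OF *(1,2)] *(3) tangent_map_in[OF *(1,4)]]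
      by (simp add: tangent_map_add * X.tangent_tuplesD[OF *(2,3)])
  next
    fix x \<Xi> i a
    assume *: "x \<in> points X" "\<Xi> \<in> tangent_tuples X k x" "i < k"
    show "\<omega> (f x) (?T x (\<Xi>(i := tangent_scale X x a (\<Xi> i)))) = a * \<omega> (f x) (?T x \<Xi>)"
      unfolding tangent_map_tuple_upd[OF *(3)]
      using Y.form_homogeneous[OF \<omega> image_points[OF *(1)] tangent_map_tuple[OF *(1,2)] *(3)]
      by (simp add: tangent_map_scale * X.tangent_tuplesD[OF *(2,3)])
  next
    fix x \<Xi> i j
    assume *: "x \<in> points X" "\<Xi> \<in> tangent_tuples X k x" "i < k" "j < k" "i \<noteq> j" "\<Xi> i = \<Xi> j"
    then show "\<omega> (f x) (?T x \<Xi>) = 0"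
      by (intro Y.form_alternating[OF \<omega> image_points[OF *(1)] tangent_map_tuple[OF *(1,2)] *(3,4,5)]) simp
  next
    fix x c v assume x: "x \<in> points X" and c: "c \<in> charts_at X x"
    obtain c' where c': "c' \<in> charts_at Y (f x)" "chart_over f c c'" using chart_below[OF c] .
    have c'Y: "c' \<in> charts Y" and cX: "c \<in> charts X" "x \<in> fst c" using c c' by (auto simp: charts_at_iff)
    \<comment> \<open>The coordinate fields of \<open>c\<close> are mapped to those of
      \<open>c'\<close>, so the function to be tested upstairs is the one tested downstairs composed
      with \<open>f\<close>.\<close>
    have "?T y (\<lambda>i\<in>{..<k}. coord_tangent X y c (v i)) = (\<lambda>i\<in>{..<k}. coord_tangent Y (f y) c' (v i))"
      if "y \<in> fst c" for y
      using that cX tangent_map_coord[of c y, OF _ c'Y c'(2)] by (auto simp: charts_at_iff)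
    then show "hol_in c (\<lambda>y. \<omega> (f y) (?T y (\<lambda>i\<in>{..<k}. coord_tangent X y c (v i)))) x"
      using hol_in_over[OF c c'Y c'(2) X.chart_openin[OF cX(1)] cX(2),
          where h = "\<lambda>z. \<omega> z (\<lambda>i\<in>{..<k}. coord_tangent Y z c' (v i))"]
        Y.form_hol_in[OF \<omega> image_points[OF x] c'(1), of v] by simp
  qed
  then show ?thesis by (simp add: form_pullback_def X.restricted_form_def)
qed

lemma form_pullback_zero: "form_pullback X Y f k (form_zero Y k) = form_zero X k"
  using tangent_map_tuple image_points by (auto simp: form_pullback_def form_zero_def fun_eq_iff)

end

lemma Omega_pullback_hom:
  assumes "etale_map X Y f"
  shows "Omega_pullback X Y f n \<in> hom (Omega_group Y n) (Omega_group X n)"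
proof (rule homI)
  interpret etale_map X Y f by fact
  fix a assume a: "a \<in> carrier (Omega_group Y n)"
  show "Omega_pullback X Y f n a \<in> carrier (Omega_group X n)"
    using a form_pullback_in[OF Y.Omega_group_form[OF a]] form_pullback_zero
    by (intro X.carrier_Omega_groupI[where S = "{p. n \<le> 2 * p \<and> a p \<noteq> form_zero Y (2 * p - n)}"])
      (auto simp: Y.carrier_Omega_group Omega_pullback_def)
next
  interpret etale_map X Y f by fact
  fix a b assume "a \<in> carrier (Omega_group Y n)" "b \<in> carrier (Omega_group Y n)"
  show "Omega_pullback X Y f n (a \<otimes>\<^bsub>Omega_group Y n\<^esub> b) =
      Omega_pullback X Y f n a \<otimes>\<^bsub>Omega_group X n\<^esub> Omega_pullback X Y f n b"
    using tangent_map_tuple image_points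
    by (auto simp: Omega_pullback_def X.mult_Omega_group Y.mult_Omega_group form_pullback_def form_add_def
      fun_eq_iff)
qed

lemma Omega_pullback_one:
  assumes "etale_map X Y f"
  shows "Omega_pullback X Y f n \<one>\<^bsub>Omega_group Y n\<^esub> = \<one>\<^bsub>Omega_group X n\<^esub>"
proof -
  interpret etale_map X Y f by fact
  show ?thesis by (auto simp: Omega_pullback_def X.one_Omega_group Y.one_Omega_group form_pullback_zero fun_eq_iff)
qed

lemma simplicial_map_Omega:
  assumes "etale_map X Y f"
  shows "simplicial_map (psh_obj Omega Y) (psh_obj Omega X) (psh_map Omega X Y f)"
proof -
  have "simplicial_map (DK (Omega_complex Y)) (DK (Omega_complex X)) (\<lambda>k. \<lambda>h\<in>simp (DK (Omega_complex Y)) k.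
     \<lambda>l. \<lambda>c\<in>carrier (Grp (normalized_chains k) l). Omega_pullback X Y f l (h l c))"
    by (rule simplicial_map_DK)
      (use Omega_pullback_hom[OF assms] Omega_pullback_one[OF assms] in \<open>simp_all add: Omega_complex_def\<close>)
  then show ?thesis by (simp add: Omega_def)
qed
lemma simp_Omega:
  assumes "h \<in> simp (psh_obj Omega X) k" "Poly_Mapping.keys c \<subseteq> simplex_generators k l"
  shows "h l c \<in> carrier (Omega_group X l)"
  using assms hom_in_carrier[of "h l" "free_Abelian_group (simplex_generators k l)" "Omega_group X l" c]
  by (simp add: Omega_def simp_DK chain_maps_iff Omega_complex_def)

lemma simp_Omega_ext:
  assumes "h \<in> simp (psh_obj Omega X) k" "\<not> Poly_Mapping.keys c \<subseteq> simplex_generators k l"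
  shows "h l c = undefined"
  using assms by (simp add: Omega_def simp_DK chain_maps_iff extensional_def)

lemma psh_map_Omega_apply:
  assumes "h \<in> simp (psh_obj Omega Y) k"
  shows "psh_map Omega X Y f k h l c =
    (if Poly_Mapping.keys c \<subseteq> simplex_generators k l then Omega_pullback X Y f l (h l c) else undefined)"
  using assms by (simp add: Omega_def)

lemma psh_map_Omega_id:
  assumes X: "complex_atlas X" and f: "\<And>x. x \<in> points X \<Longrightarrow> f x = x" and h: "h \<in> simp (psh_obj Omega X) k"
  shows "psh_map Omega X X f k h = h"
proof (rule ext, rule ext)
  fix l c
  interpret etale_map X X f by (rule etale_ident[OF X f])
  have T: "(\<lambda>i\<in>{..<j}. tangent_map X X f x (\<Xi> i)) = \<Xi>" if "x \<in> points X" "\<Xi> \<in> tangent_tuples X j x" for x \<Xi> j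
    using that etale_ident(2)[OF X f that(1)] X.tangent_tuplesD[OF that(2)]
    by (auto simp: fun_eq_iff tangent_tuples_def PiE_iff extensional_def)
  show "psh_map Omega X X f k h l c = h l c"
  proof (cases "Poly_Mapping.keys c \<subseteq> simplex_generators k l")
    case True
    have "Omega_pullback X X f l (h l c) = h l c"
      using simp_Omega[OF h True] hom_in_carrier[OF Omega_pullback_hom[OF etale_map_axioms]] T f
      by (intro X.Omega_group_eqI) (auto simp: Omega_pullback_def form_pullback_def)
    then show ?thesis using True by (simp add: psh_map_Omega_apply[OF h])
  qed (simp add: psh_map_Omega_apply[OF h] simp_Omega_ext[OF h])
qed

lemma psh_map_Omega_compose:
  assumes f: "etale_map X Y f" and g: "etale_map Y Z g" and e: "\<And>x. x \<in> points X \<Longrightarrow> e x = g (f x)"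
    and h: "h \<in> simp (psh_obj Omega Z) k"
  shows "psh_map Omega X Z e k h = psh_map Omega X Y f k (psh_map Omega Y Z g k h)"
proof (rule ext, rule ext)
  fix l c
  interpret f: etale_map X Y f by fact
  interpret g: etale_map Y Z g by fact
  have gh: "psh_map Omega Y Z g k h \<in> simp (psh_obj Omega Y) k"
    by (rule simplicial_mapD(4)[OF simplicial_map_Omega[OF g] h])
  have "form_pullback X Z e j \<omega> x \<Xi> = form_pullback X Y f j (form_pullback Y Z g j \<omega>) x \<Xi>"
    if "x \<in> points X" "\<Xi> \<in> tangent_tuples X j x" for j \<omega> x \<Xi>
    using that f.tangent_map_tuple[OF that] f.image_points[OF that(1)] e[OF that(1)]
      tangent_map_compose[OF f g e that(1)] f.X.tangent_tuplesD[OF that(2)]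
    by (auto simp: form_pullback_def intro!: arg_cong[where f = "\<omega> (g (f x))"] restrict_ext)
  then have "form_pullback X Z e j \<omega> = form_pullback X Y f j (form_pullback Y Z g j \<omega>)" for j \<omega>
    by (intro ext) (simp add: form_pullback_def)
  then have "Omega_pullback X Z e l a = Omega_pullback X Y f l (Omega_pullback Y Z g l a)" for a
    by (auto simp: Omega_pullback_def fun_eq_iff)
  then show "psh_map Omega X Z e k h l c = psh_map Omega X Y f k (psh_map Omega Y Z g k h) l c"
    by (simp add: psh_map_Omega_apply[OF h] psh_map_Omega_apply[OF gh])
qed

section \<open>Finite-dimensional vector spaces and traces\<close>

lemma complex_module_closed:
  assumes "module complex_ring V" "v \<in> carrier V" "w \<in> carrier V"
  shows "v \<oplus>\<^bsub>V\<^esub> w \<in> carrier V" "a \<odot>\<^bsub>V\<^esub> v \<in> carrier V" "v \<ominus>\<^bsub>V\<^esub> w \<in> carrier V"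
proof -
  interpret module complex_ring V by fact
  show "v \<oplus>\<^bsub>V\<^esub> w \<in> carrier V" "a \<odot>\<^bsub>V\<^esub> v \<in> carrier V" "v \<ominus>\<^bsub>V\<^esub> w \<in> carrier V"
    using assms(2,3) by (auto simp: complex_ring_def)
qed

lemma
  assumes "coord_iso V r \<phi>"
  shows coord_iso_bij: "bij_betw \<phi> (carrier V) ({..<r} \<rightarrow>\<^sub>E UNIV)"
    and coord_add: "v \<in> carrier V \<Longrightarrow> w \<in> carrier V \<Longrightarrow> j < r \<Longrightarrow> \<phi> (v \<oplus>\<^bsub>V\<^esub> w) j = \<phi> v j + \<phi> w j"
    and coord_smult: "v \<in> carrier V \<Longrightarrow> j < r \<Longrightarrow> \<phi> (a \<odot>\<^bsub>V\<^esub> v) j = a * \<phi> v j"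
  using assms by (auto simp: coord_iso_def)

lemma coord_minus:
  assumes V: "module complex_ring V" and \<phi>: "coord_iso V r \<phi>"
    and vw: "v \<in> carrier V" "w \<in> carrier V" and j: "j < r"
  shows "\<phi> (v \<ominus>\<^bsub>V\<^esub> w) j = \<phi> v j - \<phi> w j"
proof -
  interpret module complex_ring V by fact
  have "(v \<ominus>\<^bsub>V\<^esub> w) \<oplus>\<^bsub>V\<^esub> w = v"
    using vw by (simp add: a_minus_def M.a_assoc M.l_neg)
  then have "\<phi> v j = \<phi> (v \<ominus>\<^bsub>V\<^esub> w) j + \<phi> w j"
    using coord_add[OF \<phi> complex_module_closed(3)[OF V vw] vw(2) j] by simp
  then show ?thesis by simp
qed

lemma coord_eqI:
  assumes "coord_iso V r \<phi>" "v \<in> carrier V" "w \<in> carrier V" "\<And>j. j < r \<Longrightarrow> \<phi> v j = \<phi> w j"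
  shows "v = w"
proof -
  have "\<phi> v \<in> {..<r} \<rightarrow>\<^sub>E UNIV" "\<phi> w \<in> {..<r} \<rightarrow>\<^sub>E UNIV"
    using bij_betwE[OF coord_iso_bij[OF assms(1)]] assms(2,3) by auto
  then have "\<phi> v = \<phi> w" by (rule PiE_ext) (use assms(4) in auto)
  then show ?thesis
    using bij_betw_imp_inj_on[OF coord_iso_bij[OF assms(1)]] assms(2,3) by (auto dest: inj_onD)
qed

definition coord_vector :: "(complex, 'f) module \<Rightarrow> nat \<Rightarrow> ('f \<Rightarrow> nat \<Rightarrow> complex) \<Rightarrow> (nat \<Rightarrow> complex) \<Rightarrow> 'f" where
  "coord_vector V r \<phi> a = inv_into (carrier V) \<phi> (\<lambda>j\<in>{..<r}. a j)"

lemma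
  assumes "coord_iso V r \<phi>"
  shows coord_vector_in: "coord_vector V r \<phi> a \<in> carrier V"
    and coord_coord_vector: "j < r \<Longrightarrow> \<phi> (coord_vector V r \<phi> a) j = a j"
proof -
  have img: "\<phi> ` carrier V = {..<r} \<rightarrow>\<^sub>E UNIV" using coord_iso_bij[OF assms] by (rule bij_betw_imp_surj_on)
  have mem: "(\<lambda>j\<in>{..<r}. a j) \<in> \<phi> ` carrier V" unfolding img by simp
  show "coord_vector V r \<phi> a \<in> carrier V" unfolding coord_vector_def by (rule inv_into_into[OF mem])
  show "j < r \<Longrightarrow> \<phi> (coord_vector V r \<phi> a) j = a j"
    unfolding coord_vector_def using f_inv_into_f[OF mem] by simp
qed

lemma basis_vector_eq: "basis_vector V r \<phi> k = coord_vector V r \<phi> (\<lambda>j. if j = k then 1 else 0)"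
  by (simp add: basis_vector_def coord_vector_def)

lemma basis_vector_in: "coord_iso V r \<phi> \<Longrightarrow> basis_vector V r \<phi> k \<in> carrier V"
  by (simp add: basis_vector_eq coord_vector_in)

lemma coord_basis_vector:
  "coord_iso V r \<phi> \<Longrightarrow> j < r \<Longrightarrow> \<phi> (basis_vector V r \<phi> k) j = (if j = k then 1 else 0)"
  by (simp add: basis_vector_eq coord_coord_vector)

text \<open>The induction is on a bound \<open>n\<close> for the nonzero coordinates and splits off
  one basis vector at a time, so that no finite sums inside the module are formed.\<close>

lemma coord_expansion:
  fixes L :: "'f \<Rightarrow> complex"
  assumes V: "module complex_ring V" and \<phi>: "coord_iso V r \<phi>" and v: "v \<in> carrier V"
    and add: "\<And>v w. v \<in> carrier V \<Longrightarrow> w \<in> carrier V \<Longrightarrow> L (v \<oplus>\<^bsub>V\<^esub> w) = L v + L w"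
    and smult: "\<And>a v. v \<in> carrier V \<Longrightarrow> L (a \<odot>\<^bsub>V\<^esub> v) = a * L v"
  shows "L v = (\<Sum>k<r. \<phi> v k * L (basis_vector V r \<phi> k))"
proof -
  have "L v = (\<Sum>k<n. \<phi> v k * L (basis_vector V r \<phi> k))"
    if "v \<in> carrier V" "n \<le> r" "\<And>k. n \<le> k \<Longrightarrow> k < r \<Longrightarrow> \<phi> v k = 0" for v n
    using that
  proof (induction n arbitrary: v)
    case 0
    \<comment> \<open>All coordinates of \<open>v\<close> vanish here. The equation v = v + v then
      yields L v = 0 from additivity alone.\<close>
    have "v = v \<oplus>\<^bsub>V\<^esub> v"
      using 0 by (intro coord_eqI[OF \<phi>] complex_module_closed[OF V]) (auto simp: coord_add[OF \<phi>])
    then show ?case using add[OF 0(1) 0(1)] by simp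
  next
    case (Suc n)
    define w where "w = coord_vector V r \<phi> (\<lambda>k. if k = n then 0 else \<phi> v k)"
    let ?b = "basis_vector V r \<phi> n"
    have w: "w \<in> carrier V" "\<And>k. k < r \<Longrightarrow> \<phi> w k = (if k = n then 0 else \<phi> v k)"
      by (simp_all add: w_def coord_vector_in[OF \<phi>] coord_coord_vector[OF \<phi>])
    have b: "?b \<in> carrier V" "\<phi> v n \<odot>\<^bsub>V\<^esub> ?b \<in> carrier V"
      using basis_vector_in[OF \<phi>] complex_module_closed(2)[OF V] by auto
    have "v = w \<oplus>\<^bsub>V\<^esub> (\<phi> v n \<odot>\<^bsub>V\<^esub> ?b)"
      using Suc.prems w b
      by (intro coord_eqI[OF \<phi>] complex_module_closed[OF V])
        (auto simp: coord_add[OF \<phi>] coord_smult[OF \<phi>] coord_basis_vector[OF \<phi>])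
    then have "L v = L w + \<phi> v n * L ?b" using add[OF w(1) b(2)] smult[OF b(1)] by metis
    also have "L w = (\<Sum>k<n. \<phi> w k * L (basis_vector V r \<phi> k))"
      using Suc.prems w by (intro Suc.IH) (auto simp: le_Suc_eq)
    also have "\<dots> = (\<Sum>k<n. \<phi> v k * L (basis_vector V r \<phi> k))"
      using w Suc.prems(2) by (intro sum.cong) auto
    finally show ?case by simp
  qed
  from this[of v r] v show ?thesis by simp
qed

section \<open>Linear maps and traces\<close>

definition clinear :: "(complex, 'f) module \<Rightarrow> (complex, 'f) module \<Rightarrow> ('f \<Rightarrow> 'f) \<Rightarrow> bool" where
  "clinear V W T \<longleftrightarrow> (\<forall>v\<in>carrier V. T v \<in> carrier W) \<and>
     (\<forall>v\<in>carrier V. \<forall>w\<in>carrier V. T (v \<oplus>\<^bsub>V\<^esub> w) = T v \<oplus>\<^bsub>W\<^esub> T w) \<and>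
     (\<forall>a. \<forall>v\<in>carrier V. T (a \<odot>\<^bsub>V\<^esub> v) = a \<odot>\<^bsub>W\<^esub> T v)"

lemma
  assumes "clinear V W T"
  shows clinear_in: "v \<in> carrier V \<Longrightarrow> T v \<in> carrier W"
    and clinear_add: "v \<in> carrier V \<Longrightarrow> w \<in> carrier V \<Longrightarrow> T (v \<oplus>\<^bsub>V\<^esub> w) = T v \<oplus>\<^bsub>W\<^esub> T w"
    and clinear_smult: "v \<in> carrier V \<Longrightarrow> T (a \<odot>\<^bsub>V\<^esub> v) = a \<odot>\<^bsub>W\<^esub> T v"
  using assms by (auto simp: clinear_def)

lemma clinear_id: "clinear V V (\<lambda>v. v)"
  by (simp add: clinear_def)

lemma clinear_compose: "clinear V W T \<Longrightarrow> clinear W Z S \<Longrightarrow> clinear V Z (\<lambda>v. S (T v))"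
  by (simp add: clinear_def)

lemma clinear_inv:
  assumes V: "module complex_ring V" and T: "clinear V W T" and bij: "bij_betw T (carrier V) (carrier W)"
  shows "clinear W V (inv_into (carrier V) T)"
proof -
  let ?S = "inv_into (carrier V) T"
  have S: "?S w \<in> carrier V" "T (?S w) = w" if "w \<in> carrier W" for w
    using that bij by (auto simp: bij_betw_def inv_into_into f_inv_into_f)
  have inj: "?S (T v) = v" if "v \<in> carrier V" for v using that bij by (simp add: bij_betw_def)
  have "?S (u \<oplus>\<^bsub>W\<^esub> w) = ?S u \<oplus>\<^bsub>V\<^esub> ?S w" if "u \<in> carrier W" "w \<in> carrier W" for u w
    using inj[of "?S u \<oplus>\<^bsub>V\<^esub> ?S w"] that S complex_module_closed(1)[OF V S(1) S(1)] by (simp add: clinear_add[OF T])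
  moreover have "?S (a \<odot>\<^bsub>W\<^esub> w) = a \<odot>\<^bsub>V\<^esub> ?S w" if "w \<in> carrier W" for a w
    using inj[of "a \<odot>\<^bsub>V\<^esub> ?S w"] that S complex_module_closed(2)[OF V S(1) S(1)] by (simp add: clinear_smult[OF T])
  ultimately show ?thesis using S by (simp add: clinear_def)
qed

lemma coord_clinear:
  assumes V: "module complex_ring V" and \<phi>: "coord_iso V r \<phi>" and \<psi>: "coord_iso W s \<psi>"
    and T: "clinear V W T" and v: "v \<in> carrier V" and j: "j < s"
  shows "\<psi> (T v) j = (\<Sum>k<r. \<phi> v k * \<psi> (T (basis_vector V r \<phi> k)) j)"
  by (rule coord_expansion[OF V \<phi> v])
    (use j in \<open>simp_all add: clinear_add[OF T] clinear_smult[OF T] clinear_in[OF T] coord_add[OF \<psi>] coord_smult[OF \<psi>]\<close>)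

text \<open>The vectors of one basis are expanded in the other and the double sum is reordered. The
  sizes \<open>r\<close> and \<open>s\<close> are kept independent, so that the identity map yields
  the invariance of dimension.\<close>

lemma trace_basis_independent:
  assumes V: "module complex_ring V" and \<phi>: "coord_iso V r \<phi>" and \<psi>: "coord_iso V s \<psi>" and T: "clinear V V T"
  shows "(\<Sum>k<r. \<phi> (T (basis_vector V r \<phi> k)) k) = (\<Sum>j<s. \<psi> (T (basis_vector V s \<psi> j)) j)"
proof -
  have "(\<Sum>k<r. \<phi> (T (basis_vector V r \<phi> k)) k) =
     (\<Sum>k<r. \<Sum>j<s. \<psi> (basis_vector V r \<phi> k) j * \<phi> (T (basis_vector V s \<psi> j)) k)"
    by (intro sum.cong coord_clinear[OF V \<psi> \<phi> T]) (auto intro: basis_vector_in[OF \<phi>])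
  also have "\<dots> = (\<Sum>j<s. \<Sum>k<r. \<phi> (T (basis_vector V s \<psi> j)) k * \<psi> (basis_vector V r \<phi> k) j)"
    by (subst sum.swap) (simp add: mult.commute)
  also have "\<dots> = (\<Sum>j<s. \<psi> (T (basis_vector V s \<psi> j)) j)"
    by (intro sum.cong refl coord_clinear[OF V \<phi> \<psi> clinear_id, symmetric] clinear_in[OF T])
      (auto intro: basis_vector_in[OF \<psi>])
  finally show ?thesis .
qed

text \<open>The trace of the identity is \<open>r\<close> in one basis and \<open>s\<close> in the
  other, and the complex numbers have characteristic zero.\<close>

lemma coord_iso_dim_unique:
  assumes V: "module complex_ring V" and \<phi>: "coord_iso V r \<phi>" and \<psi>: "coord_iso V s \<psi>"
  shows "r = s"
  using trace_basis_independent[OF assms clinear_id] by (simp add: coord_basis_vector[OF \<phi>] coord_basis_vector[OF \<psi>])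

lemma vdim_eq: "module complex_ring V \<Longrightarrow> coord_iso V r \<phi> \<Longrightarrow> vdim V = r"
  unfolding vdim_def using coord_iso_dim_unique by (intro the_equality) blast+

lemma vtrace_eq:
  assumes V: "module complex_ring V" and \<phi>: "coord_iso V r \<phi>" and T: "clinear V V T"
  shows "vtrace V T = (\<Sum>k<r. \<phi> (T (basis_vector V r \<phi> k)) k)"
proof -
  have "coord_iso V (vdim V) (SOME \<phi>. coord_iso V (vdim V) \<phi>)"
    using \<phi> vdim_eq[OF V \<phi>] by (intro someI[of "coord_iso V (vdim V)"]) simp
  from trace_basis_independent[OF V this \<phi> T] show ?thesis by (simp add: vtrace_def Let_def)
qed

lemma coord_iso_pullback:
  assumes \<psi>: "coord_iso W s \<psi>" and F: "clinear V W F" "bij_betw F (carrier V) (carrier W)"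
  shows "coord_iso V s (\<psi> \<circ> F)"
  using bij_betw_trans[OF F(2) coord_iso_bij[OF \<psi>]]
  by (simp add: coord_iso_def clinear_add[OF F(1)] clinear_smult[OF F(1)] clinear_in[OF F(1)]
    coord_add[OF \<psi>] coord_smult[OF \<psi>])

lemma vdim_iso:
  assumes "module complex_ring V" "module complex_ring W" "coord_iso W s \<psi>"
    and "clinear V W F" "bij_betw F (carrier V) (carrier W)"
  shows "vdim V = vdim W"
  using vdim_eq[OF assms(1) coord_iso_pullback[OF assms(3-5)]] vdim_eq[OF assms(2,3)] by simp

text \<open>In the coordinates on \<open>V\<close> transported along \<open>F\<close>, basis vectors
  correspond to basis vectors, so both traces are the same sum.\<close>

lemma vtrace_conjugate:
  assumes V: "module complex_ring V" and W: "module complex_ring W" and \<psi>: "coord_iso W s \<psi>"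
    and F: "clinear V W F" "bij_betw F (carrier V) (carrier W)" and S: "clinear W W S"
  shows "vtrace V (\<lambda>v. inv_into (carrier V) F (S (F v))) = vtrace W S"
proof -
  let ?\<phi> = "\<psi> \<circ> F"
  note \<phi> = coord_iso_pullback[OF \<psi> F]
  have T: "clinear V V (\<lambda>v. inv_into (carrier V) F (S (F v)))"
    by (intro clinear_compose[OF clinear_compose[OF F(1) S] clinear_inv[OF V F]])
  have basis: "F (basis_vector V s ?\<phi> k) = basis_vector W s \<psi> k" for k
    using coord_basis_vector[OF \<phi>]
    by (intro coord_eqI[OF \<psi>] clinear_in[OF F(1)] basis_vector_in \<phi> \<psi>) (simp add: coord_basis_vector[OF \<psi>])
  have "F (inv_into (carrier V) F (S (basis_vector W s \<psi> k))) = S (basis_vector W s \<psi> k)" for k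
    using F(2) clinear_in[OF S basis_vector_in[OF \<psi>]] by (auto simp: bij_betw_def f_inv_into_f)
  then show ?thesis
    unfolding vtrace_eq[OF V \<phi> T] vtrace_eq[OF W \<psi> S] by (simp add: basis)
qed

lemma vtrace_cong:
  assumes V: "module complex_ring V" and \<phi>: "coord_iso V r \<phi>"
    and eq: "\<And>v. v \<in> carrier V \<Longrightarrow> T v = T' v"
  shows "vtrace V T = vtrace V T'"
proof -
  have "coord_iso V (vdim V) (SOME \<phi>. coord_iso V (vdim V) \<phi>)"
    using \<phi> vdim_eq[OF V \<phi>] by (intro someI[of "coord_iso V (vdim V)"]) simp
  from basis_vector_in[OF this] show ?thesis by (simp add: vtrace_def Let_def eq)
qed


section \<open>Holomorphic bundles\<close>

text \<open>By Cramer's rule, the entries of \<open>B\<close> are quotients of determinants in the entries of \<open>A\<close>.\<close>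

lemma (in atlas) hol_in_inverse_matrix:
  fixes A B :: "'p \<Rightarrow> nat \<Rightarrow> nat \<Rightarrow> complex"
  assumes c: "c \<in> charts_at X x" and V: "openin (mtop X) V" "x \<in> V"
    and AB: "\<And>y i j. y \<in> V \<Longrightarrow> i < r \<Longrightarrow> j < r \<Longrightarrow> (\<Sum>k<r. A y i k * B y k j) = (if i = j then 1 else 0)"
    and A: "\<And>i j. i < r \<Longrightarrow> j < r \<Longrightarrow> hol_in c (\<lambda>y. A y i j) x"
    and ij: "i < r" "j < r"
  shows "hol_in c (\<lambda>y. B y i j) x"
proof -
  define M where "M y = mat r r (\<lambda>(i, j). A y i j)" for y
  define N where "N y = mat r r (\<lambda>(i, j). B y i j)" for y
  have [simp]: "M y \<in> carrier_mat r r" "N y \<in> carrier_mat r r" "dim_row (M y) = r" "dim_col (M y) = r" for y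
    by (auto simp: M_def N_def)
  have MN: "M y * N y = 1\<^sub>m r" if "y \<in> V" for y
  proof (rule eq_matI)
    fix i j assume "i < dim_row (1\<^sub>m r)" "j < dim_col (1\<^sub>m r)"
    then show "(M y * N y) $$ (i, j) = 1\<^sub>m r $$ (i, j)"
      using AB[OF that, of i j] by (simp add: M_def N_def times_mat_def scalar_prod_def lessThan_atLeast0)
  qed (auto simp: M_def N_def)
  have det: "det (M y) \<noteq> 0" if "y \<in> V" for y
    using det_mult[of "M y" r "N y"] MN[OF that] by auto
  have cof: "B y i j = cofactor (M y) j i / det (M y)" if "y \<in> V" for y
  proof -
    have "adj_mat (M y) = adj_mat (M y) * (M y * N y)"
      using adj_mat(1)[of "M y" r] MN[OF that] by simp
    also have "\<dots> = (adj_mat (M y) * M y) * N y"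
      by (rule assoc_mult_mat[symmetric, of _ r r _ r _ r]) (auto intro: adj_mat(1))
    also have "\<dots> = det (M y) \<cdot>\<^sub>m N y"
      by (subst adj_mat(3)[of _ r]) (auto simp: mult_smult_assoc_mat[of _ r r _ r] left_mult_one_mat[of _ r r])
    finally have "adj_mat (M y) $$ (i, j) = det (M y) * B y i j" using ij by (simp add: N_def)
    moreover have "adj_mat (M y) $$ (i, j) = cofactor (M y) j i" using ij by (simp add: adj_mat_def)
    ultimately show ?thesis using det[OF that] by simp
  qed
  have hol_det: "hol_in c (\<lambda>y. det (mat n n (\<lambda>(i, j). G y i j))) x"
    if "\<And>i j. i < n \<Longrightarrow> j < n \<Longrightarrow> hol_in c (\<lambda>y. G y i j) x" for n and G :: "'p \<Rightarrow> nat \<Rightarrow> nat \<Rightarrow> complex"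
  proof -
    have lt: "p i < n" if "p permutes {0..<n}" "i < n" for p i
      using permutes_in_image[OF that(1), of i] that(2) by auto
    have "det (mat n n (\<lambda>(i, j). G y i j)) =
        (\<Sum>p | p permutes {0..<n}. of_int (sign p) * (\<Prod>i = 0..<n. G y i (p i)))" for y
      by (auto simp: det_def lt intro!: sum.cong prod.cong)
    then show ?thesis using that lt by (auto intro!: hol_in_sum hol_in_mult hol_in_prod hol_in_const)
  qed
  have "hol_in c (\<lambda>y. det (M y)) x" unfolding M_def by (rule hol_det) (rule A)
  moreover have "hol_in c (\<lambda>y. cofactor (M y) j i) x"
  proof -
    have "mat_delete (M y) j i = mat (r - 1) (r - 1) (\<lambda>(i', j'). A y (if i' < j then i' else Suc i') (if j' < i then j' else Suc j'))" for y
      using ij by (auto simp: mat_delete_def M_def)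
    then show ?thesis
      unfolding cofactor_def using ij by (auto intro!: hol_in_mult hol_in_const hol_det A)
  qed
  ultimately have "hol_in c (\<lambda>y. cofactor (M y) j i / det (M y)) x"
    using det[OF V(2)] by (intro hol_in_divide[OF c])
  then show ?thesis using hol_in_cong[OF c V, of "\<lambda>y. B y i j"] cof by simp
qed

text \<open>Holomorphy of a section at one point and in one chart, detached from any domain:
  \<open>s\<close> has to take values in the fibres near \<open>x\<close> and is arbitrary
  elsewhere. Maps, inverses and connections are followed through this notion rather than through
  sections over fixed open sets.\<close>

definition hol_sec ::
  "('p, 'v::complex_model_space) cmanifold \<Rightarrow> ('p, 'v, 'f) vbundle \<Rightarrow> ('p, 'v) chart \<Rightarrow> ('p \<Rightarrow> 'f) \<Rightarrow> 'p \<Rightarrow> bool" where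
  "hol_sec X E c s x \<longleftrightarrow>
     (\<exists>V. openin (mtop X) V \<and> x \<in> V \<and> (\<forall>y\<in>V. s y \<in> carrier (fibre E y))) \<and>
     (\<forall>W r \<phi>. (W, r, \<phi>) \<in> trivs E \<longrightarrow> x \<in> W \<longrightarrow> (\<forall>j<r. hol_in c (\<lambda>y. \<phi> y (s y) j) x))"

lemma hol_sec_carrier: "hol_sec X E c s x \<Longrightarrow> s x \<in> carrier (fibre E x)"
  by (auto simp: hol_sec_def)

lemma hol_sec_coord:
  "hol_sec X E c s x \<Longrightarrow> (W, r, \<phi>) \<in> trivs E \<Longrightarrow> x \<in> W \<Longrightarrow> j < r \<Longrightarrow> hol_in c (\<lambda>y. \<phi> y (s y) j) x"
  by (auto simp: hol_sec_def)

section \<open>Sections of a bundle and one-forms with values in it\<close>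

locale holo_bundle = atlas X for X :: "('p, 'v::complex_model_space) cmanifold" +
  fixes E :: "('p, 'v, 'f) vbundle"
  assumes is_bundle: "holomorphic_bundle X E"
begin

lemma
  assumes "(W, r, \<phi>) \<in> trivs E"
  shows triv_open: "openin (mtop X) W"
    and triv_coord: "y \<in> W \<Longrightarrow> coord_iso (fibre E y) r (\<phi> y)"
    and triv_compatible: "t \<in> trivs E \<Longrightarrow> compatible_trivs X (fibre E) (W, r, \<phi>) t"
proof -
  have "(W, r, \<phi>) \<in> triv_closure X (fibre E) (trivs E)" using assms is_bundle by (simp add: holomorphic_bundle_def)
  then show "openin (mtop X) W" "y \<in> W \<Longrightarrow> coord_iso (fibre E y) r (\<phi> y)"
    "t \<in> trivs E \<Longrightarrow> compatible_trivs X (fibre E) (W, r, \<phi>) t"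
    by (auto simp: triv_closure_def is_triv_def)
qed

lemma triv_points: "(W, r, \<phi>) \<in> trivs E \<Longrightarrow> y \<in> W \<Longrightarrow> y \<in> points X"
  using openin_subset[OF triv_open] by blast

lemma triv_at:
  assumes "x \<in> points X"
  obtains W r \<phi> where "(W, r, \<phi>) \<in> trivs E" "x \<in> W"
  using assms is_bundle unfolding holomorphic_bundle_def by blast

lemma fibre_module: "x \<in> points X \<Longrightarrow> module complex_ring (fibre E x)"
  using is_bundle by (simp add: holomorphic_bundle_def)

lemma fibre_coord: assumes "x \<in> points X" obtains r \<phi> where "coord_iso (fibre E x) r \<phi>"
  using triv_at[OF assms] triv_coord by metis

lemma hol_sec_cong:
  assumes c: "c \<in> charts_at X x" and W: "openin (mtop X) W" "x \<in> W" and eq: "\<And>y. y \<in> W \<Longrightarrow> s y = t y"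
    and s: "hol_sec X E c s x"
  shows "hol_sec X E c t x"
proof -
  obtain V where "openin (mtop X) V" "x \<in> V" "\<forall>y\<in>V. s y \<in> carrier (fibre E y)"
    using s by (auto simp: hol_sec_def)
  then have "openin (mtop X) (V \<inter> W)" "x \<in> V \<inter> W" "\<forall>y\<in>V \<inter> W. t y \<in> carrier (fibre E y)"
    using W eq by auto
  moreover have "hol_in c (\<lambda>y. \<phi> y (t y) j) x"
    if "(W', r, \<phi>) \<in> trivs E" "x \<in> W'" "j < r" for W' r \<phi> j
    using hol_in_cong[OF c W, of "\<lambda>y. \<phi> y (s y) j" "\<lambda>y. \<phi> y (t y) j"] eq hol_sec_coord[OF s that] by simp
  ultimately show ?thesis unfolding hol_sec_def by blast
qed

text \<open>One trivialization around \<open>x\<close> suffices: the coordinates in another are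
  linear combinations whose coefficients, the entries of the transition matrix, are holomorphic by
  compatibility.\<close>

lemma hol_secI:
  assumes c: "c \<in> charts_at X x" and t: "(W, r, \<phi>) \<in> trivs E" "x \<in> W"
    and V: "openin (mtop X) V" "x \<in> V" "\<And>y. y \<in> V \<Longrightarrow> s y \<in> carrier (fibre E y)"
    and hol: "\<And>j. j < r \<Longrightarrow> hol_in c (\<lambda>y. \<phi> y (s y) j) x"
  shows "hol_sec X E c s x"
  unfolding hol_sec_def
proof (intro conjI allI impI)
  fix W' r' \<phi>' j assume t': "(W', r', \<phi>') \<in> trivs E" "x \<in> W'" and j: "j < r'"
  let ?b = "\<lambda>y. basis_vector (fibre E y) r (\<phi> y)"
  have "\<phi>' y (s y) j = (\<Sum>k<r. \<phi> y (s y) k * \<phi>' y (?b y k) j)" if "y \<in> V \<inter> W \<inter> W'" for y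
    using that j fibre_module[OF triv_points[OF t(1)]] V(3)
    by (intro coord_clinear[OF _ triv_coord[OF t(1)] triv_coord[OF t'(1)] clinear_id]) auto
  moreover have "hol_in c (\<lambda>y. \<Sum>k<r. \<phi> y (s y) k * \<phi>' y (?b y k) j) x"
  proof (intro hol_in_sum hol_in_mult)
    fix k assume "k \<in> {..<r}"
    then show "hol_in c (\<lambda>y. \<phi> y (s y) k) x" using hol by simp
    have "holomorphic_matrix X (fibre E) (W, r, \<phi>) (W', r', \<phi>') (\<lambda>x v. v)"
      using triv_compatible[OF t(1) t'(1)] by (simp add: compatible_trivs_def)
    then show "hol_in c (\<lambda>y. \<phi>' y (?b y k) j) x"
      using t t' j c \<open>k \<in> {..<r}\<close> by (simp add: holomorphic_matrix_def holomorphic_fun_iff)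
  qed
  moreover have "openin (mtop X) (V \<inter> W \<inter> W')" "x \<in> V \<inter> W \<inter> W'"
    using V t t' triv_open[OF t(1)] triv_open[OF t'(1)] by (auto intro!: openin_Int)
  ultimately show "hol_in c (\<lambda>y. \<phi>' y (s y) j) x"
    using hol_in_cong[OF c, of "V \<inter> W \<inter> W'" "\<lambda>y. \<phi>' y (s y) j"] by simp
qed (use V in blast)

lemma hol_sec_coord_vector:
  assumes c: "c \<in> charts_at X x" and t: "(W, r, \<phi>) \<in> trivs E" "x \<in> W"
    and "\<And>j. j < r \<Longrightarrow> hol_in c (\<lambda>y. a y j) x"
  shows "hol_sec X E c (\<lambda>y. coord_vector (fibre E y) r (\<phi> y) (a y)) x"
proof (rule hol_secI[OF c t triv_open[OF t(1)] t(2)])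
  fix j assume j: "j < r"
  then show "hol_in c (\<lambda>y. \<phi> y (coord_vector (fibre E y) r (\<phi> y) (a y)) j) x"
    using hol_in_cong[OF c triv_open[OF t(1)] t(2), of "\<lambda>y. \<phi> y (coord_vector (fibre E y) r (\<phi> y) (a y)) j" "\<lambda>y. a y j"]
      assms(4)[OF j] coord_coord_vector[OF triv_coord[OF t(1)] j] by simp
qed (rule coord_vector_in[OF triv_coord[OF t(1)]])

lemma hol_sec_basis_vector:
  assumes c: "c \<in> charts_at X x" and t: "(W, r, \<phi>) \<in> trivs E" "x \<in> W"
  shows "hol_sec X E c (\<lambda>y. basis_vector (fibre E y) r (\<phi> y) k) x"
  unfolding basis_vector_eq by (rule hol_sec_coord_vector[OF c t hol_in_const])

lemma
  assumes c: "c \<in> charts_at X x" and s: "hol_sec X E c s x" and s': "hol_sec X E c s' x"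
  shows hol_sec_add: "hol_sec X E c (\<lambda>y. s y \<oplus>\<^bsub>fibre E y\<^esub> s' y) x"
    and hol_sec_minus: "hol_sec X E c (\<lambda>y. s y \<ominus>\<^bsub>fibre E y\<^esub> s' y) x"
proof -
  obtain W r \<phi> where t: "(W, r, \<phi>) \<in> trivs E" "x \<in> W" using triv_at[OF charts_at_points[OF c]] .
  obtain V V' where V: "openin (mtop X) V" "x \<in> V" "\<forall>y\<in>V. s y \<in> carrier (fibre E y)"
    "openin (mtop X) V'" "x \<in> V'" "\<forall>y\<in>V'. s' y \<in> carrier (fibre E y)"
    using s s' by (auto simp: hol_sec_def)
  let ?U = "V \<inter> V' \<inter> W"
  have U: "openin (mtop X) ?U" "x \<in> ?U" using V t triv_open by auto
  note m = fibre_module[OF triv_points[OF t(1)]]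
  have sub: "hol_in c (\<lambda>y. \<phi> y (s y \<oplus>\<^bsub>fibre E y\<^esub> s' y) j) x"
    "hol_in c (\<lambda>y. \<phi> y (s y \<ominus>\<^bsub>fibre E y\<^esub> s' y) j) x" if j: "j < r" for j
    using hol_in_cong[OF c U, of "\<lambda>y. \<phi> y (s y \<oplus>\<^bsub>fibre E y\<^esub> s' y) j" "\<lambda>y. \<phi> y (s y) j + \<phi> y (s' y) j"]
      hol_in_cong[OF c U, of "\<lambda>y. \<phi> y (s y \<ominus>\<^bsub>fibre E y\<^esub> s' y) j" "\<lambda>y. \<phi> y (s y) j - \<phi> y (s' y) j"]
      hol_in_add[OF hol_sec_coord[OF s t j] hol_sec_coord[OF s' t j]]
      hol_in_diff[OF hol_sec_coord[OF s t j] hol_sec_coord[OF s' t j]]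
      coord_add[OF triv_coord[OF t(1)]] coord_minus[OF m triv_coord[OF t(1)]] j V by auto
  show "hol_sec X E c (\<lambda>y. s y \<oplus>\<^bsub>fibre E y\<^esub> s' y) x"
    by (rule hol_secI[OF c t U complex_module_closed(1)[OF m] sub(1)]) (use V in auto)
  show "hol_sec X E c (\<lambda>y. s y \<ominus>\<^bsub>fibre E y\<^esub> s' y) x"
    by (rule hol_secI[OF c t U complex_module_closed(3)[OF m] sub(2)]) (use V in auto)
qed

lemma hol_sec_smult:
  assumes c: "c \<in> charts_at X x" and s: "hol_sec X E c s x" and g: "hol_in c g x"
  shows "hol_sec X E c (\<lambda>y. g y \<odot>\<^bsub>fibre E y\<^esub> s y) x"
proof -
  obtain W r \<phi> where t: "(W, r, \<phi>) \<in> trivs E" "x \<in> W" using triv_at[OF charts_at_points[OF c]] .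
  obtain V where V: "openin (mtop X) V" "x \<in> V" "\<forall>y\<in>V. s y \<in> carrier (fibre E y)"
    using s by (auto simp: hol_sec_def)
  let ?U = "V \<inter> W"
  have U: "openin (mtop X) ?U" "x \<in> ?U" using V t triv_open by auto
  note m = fibre_module[OF triv_points[OF t(1)]]
  have "hol_in c (\<lambda>y. \<phi> y (g y \<odot>\<^bsub>fibre E y\<^esub> s y) j) x" if j: "j < r" for j
    using hol_in_cong[OF c U, of "\<lambda>y. \<phi> y (g y \<odot>\<^bsub>fibre E y\<^esub> s y) j" "\<lambda>y. g y * \<phi> y (s y) j"]
      hol_in_mult[OF g hol_sec_coord[OF s t j]] coord_smult[OF triv_coord[OF t(1)]] j V by auto
  then show ?thesis
    using V by (intro hol_secI[OF c t U complex_module_closed(2)[OF m]]) auto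
qed

lemma holomorphic_sections_iff:
  assumes W: "openin (mtop X) W"
  shows "s \<in> holomorphic_sections X E W \<longleftrightarrow>
    s \<in> (\<Pi>\<^sub>E x\<in>W. carrier (fibre E x)) \<and> (\<forall>x\<in>W. \<forall>c\<in>charts_at X x. hol_sec X E c s x)"
proof -
  have "hol_sec X E c s x \<longleftrightarrow> (\<forall>W' r \<phi>. (W', r, \<phi>) \<in> trivs E \<longrightarrow> x \<in> W' \<longrightarrow> (\<forall>j<r. hol_in c (\<lambda>y. \<phi> y (s y) j) x))"
    if "s \<in> (\<Pi>\<^sub>E x\<in>W. carrier (fibre E x))" "x \<in> W" for c x
    using that W unfolding hol_sec_def by (meson PiE_mem)
  then show ?thesis unfolding holomorphic_sections_def holomorphic_fun_iff by fast
qed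

lemma
  assumes W: "openin (mtop X) W" and s: "s \<in> holomorphic_sections X E W"
  shows section_ext: "s \<in> extensional W"
    and section_in: "x \<in> W \<Longrightarrow> s x \<in> carrier (fibre E x)"
    and section_hol: "x \<in> W \<Longrightarrow> c \<in> charts_at X x \<Longrightarrow> hol_sec X E c s x"
  using s unfolding holomorphic_sections_iff[OF W] by (auto simp: PiE_iff)

lemma sectionI:
  assumes W: "openin (mtop X) W"
    and "\<And>x c. x \<in> W \<Longrightarrow> c \<in> charts_at X x \<Longrightarrow> hol_sec X E c s x"
  shows "restrict s W \<in> holomorphic_sections X E W"
  unfolding holomorphic_sections_iff[OF W]
proof (intro conjI ballI)
  show "restrict s W \<in> (\<Pi>\<^sub>E x\<in>W. carrier (fibre E x))"
  proof
    fix x assume x: "x \<in> W"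
    then obtain c where "c \<in> charts_at X x" using charts_at_nonempty openin_subset[OF W] by blast
    then show "restrict s W x \<in> carrier (fibre E x)" using hol_sec_carrier[OF assms(2)] x by simp
  qed simp
  fix x c assume *: "x \<in> W" "c \<in> charts_at X x"
  show "hol_sec X E c (restrict s W) x" by (rule hol_sec_cong[OF *(2) W *(1) _ assms(2)[OF *]]) simp
qed

lemma section_restrict:
  assumes "openin (mtop X) W" "s \<in> holomorphic_sections X E W" "openin (mtop X) W'" "W' \<subseteq> W"
  shows "restrict s W' \<in> holomorphic_sections X E W'"
  using assms section_hol[OF assms(1,2)] by (intro sectionI) auto

text \<open>The definition speaks of scalar forms in all trivializations. Here it is turned into
  conditions on the fibres: linearity in the tangent vector, and holomorphy along the coordinate
  fields of each chart. The tuples of length one below translate between a scalar 1-form and a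
  function of a single tangent vector.\<close>

lemma bundle_one_forms_iff:
  assumes W: "openin (mtop X) W"
  shows "\<eta> \<in> bundle_one_forms X E W \<longleftrightarrow>
    \<eta> \<in> (\<Pi>\<^sub>E x\<in>W. tangent_space X x \<rightarrow>\<^sub>E carrier (fibre E x)) \<and>
    (\<forall>x\<in>W. \<forall>\<xi>\<in>tangent_space X x.
       (\<forall>\<zeta>\<in>tangent_space X x. \<eta> x (tangent_add X x \<xi> \<zeta>) = \<eta> x \<xi> \<oplus>\<^bsub>fibre E x\<^esub> \<eta> x \<zeta>) \<and>
       (\<forall>a. \<eta> x (tangent_scale X x a \<xi>) = a \<odot>\<^bsub>fibre E x\<^esub> \<eta> x \<xi>)) \<and>
    (\<forall>x\<in>W. \<forall>c\<in>charts_at X x. \<forall>v. hol_sec X E c (\<lambda>y. \<eta> y (coord_tangent X y c v)) x)"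
    (is "_ \<longleftrightarrow> ?A \<and> ?B \<and> ?C")
proof -
  let ?\<omega> = "\<lambda>W' r \<phi> j. \<lambda>x\<in>W \<inter> W'. \<lambda>\<Xi>\<in>tangent_tuples X 1 x. \<phi> x (\<eta> x (\<Xi> 0)) j"
  have tup: "(\<lambda>i\<in>{..<1}. \<xi>) \<in> tangent_tuples X 1 x" if "\<xi> \<in> tangent_space X x" for x \<xi>
    using that by (simp add: tangent_tuples_def)
  have coord_tup: "\<eta> y (coord_tangent X y c v) \<in> carrier (fibre E y)" if ?A "y \<in> W" "c \<in> charts_at X y" for y c v
    using that coord_tangent_in[OF that(3)] by (auto simp: PiE_iff)
  have eval: "hol_in c (\<lambda>y. ?\<omega> W' r \<phi> j y (\<lambda>i\<in>{..<1}. coord_tangent X y c (v i))) x \<longleftrightarrow>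
      hol_in c (\<lambda>y. \<phi> y (\<eta> y (coord_tangent X y c (v 0))) j) x"
    if t: "(W', r, \<phi>) \<in> trivs E" "x \<in> W \<inter> W'" and c: "c \<in> charts_at X x" for W' r \<phi> j c v x
  proof (rule hol_in_cong[OF c, of "W \<inter> W' \<inter> fst c"])
    have "c \<in> charts X" "x \<in> fst c" using c by (auto simp: charts_at_iff)
    then show "openin (mtop X) (W \<inter> W' \<inter> fst c)" "x \<in> W \<inter> W' \<inter> fst c"
      using W triv_open[OF t(1)] chart_openin[of c] t by auto
    fix y assume y: "y \<in> W \<inter> W' \<inter> fst c"
    then have "c \<in> charts_at X y" using c by (simp add: charts_at_iff)
    from coord_tuple_in[OF this, of v 1]
    show "?\<omega> W' r \<phi> j y (\<lambda>i\<in>{..<1}. coord_tangent X y c (v i)) = \<phi> y (\<eta> y (coord_tangent X y c (v 0))) j"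
      using y by simp
  qed
  show ?thesis
  proof
    assume \<eta>: "\<eta> \<in> bundle_one_forms X E W"
    have A: ?A using \<eta> by (simp add: bundle_one_forms_def)
    have form: "?\<omega> W' r \<phi> j \<in> holomorphic_forms X (W \<inter> W') 1" if "(W', r, \<phi>) \<in> trivs E" "j < r" for W' r \<phi> j
      using \<eta> that unfolding bundle_one_forms_def by fast
    have B: ?B
    proof (intro ballI conjI allI)
      fix x \<xi> assume x: "x \<in> W" and \<xi>: "\<xi> \<in> tangent_space X x"
      have xp: "x \<in> points X" using x openin_subset[OF W] by blast
      obtain W' r \<phi> where t: "(W', r, \<phi>) \<in> trivs E" "x \<in> W'" using triv_at[OF xp] .
      note m = fibre_module[OF xp] and \<phi> = triv_coord[OF t]
      have in\<eta>: "\<eta> x \<zeta> \<in> carrier (fibre E x)" if "\<zeta> \<in> tangent_space X x" for \<zeta> using A x that by (auto simp: PiE_iff)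
      let ?\<Xi> = "\<lambda>i\<in>{..<1::nat}. \<xi>"
      have upd: "?\<Xi>(0 := \<zeta>) = (\<lambda>i\<in>{..<1}. \<zeta>)" for \<zeta> by auto
      fix \<zeta> assume \<zeta>: "\<zeta> \<in> tangent_space X x"
      show "\<eta> x (tangent_add X x \<xi> \<zeta>) = \<eta> x \<xi> \<oplus>\<^bsub>fibre E x\<^esub> \<eta> x \<zeta>"
      proof (rule coord_eqI[OF \<phi>])
        fix j assume j: "j < r"
        show "\<phi> x (\<eta> x (tangent_add X x \<xi> \<zeta>)) j = \<phi> x (\<eta> x \<xi> \<oplus>\<^bsub>fibre E x\<^esub> \<eta> x \<zeta>) j"
          using form_additive[OF form[OF t(1) j] _ tup[OF \<xi>] _ \<zeta>, of 0] x t \<xi> \<zeta> j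
          by (simp add: upd tup tangent_add_in coord_add[OF \<phi>] in\<eta> del: One_nat_def)
      qed (use \<xi> \<zeta> in \<open>auto intro!: complex_module_closed[OF m] in\<eta> tangent_add_in\<close>)
    next
      fix x \<xi> a assume x: "x \<in> W" and \<xi>: "\<xi> \<in> tangent_space X x"
      have xp: "x \<in> points X" using x openin_subset[OF W] by blast
      obtain W' r \<phi> where t: "(W', r, \<phi>) \<in> trivs E" "x \<in> W'" using triv_at[OF xp] .
      note m = fibre_module[OF xp] and \<phi> = triv_coord[OF t]
      have in\<eta>: "\<eta> x \<zeta> \<in> carrier (fibre E x)" if "\<zeta> \<in> tangent_space X x" for \<zeta> using A x that by (auto simp: PiE_iff)
      let ?\<Xi> = "\<lambda>i\<in>{..<1::nat}. \<xi>"
      have upd: "?\<Xi>(0 := \<zeta>) = (\<lambda>i\<in>{..<1}. \<zeta>)" for \<zeta> by auto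
      show "\<eta> x (tangent_scale X x a \<xi>) = a \<odot>\<^bsub>fibre E x\<^esub> \<eta> x \<xi>"
      proof (rule coord_eqI[OF \<phi>])
        fix j assume j: "j < r"
        show "\<phi> x (\<eta> x (tangent_scale X x a \<xi>)) j = \<phi> x (a \<odot>\<^bsub>fibre E x\<^esub> \<eta> x \<xi>) j"
          using form_homogeneous[OF form[OF t(1) j] _ tup[OF \<xi>], of 0 a] x t \<xi> j
          by (simp add: upd tup tangent_scale_in coord_smult[OF \<phi>] in\<eta> del: One_nat_def)
      qed (use \<xi> in \<open>auto intro!: complex_module_closed[OF m] in\<eta> tangent_scale_in\<close>)
    qed
    have C: ?C
    proof (intro ballI allI)
      fix x c v assume x: "x \<in> W" and c: "c \<in> charts_at X x"
      obtain W' r \<phi> where t: "(W', r, \<phi>) \<in> trivs E" "x \<in> W'" using triv_at[OF charts_at_points[OF c]] .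
      have cc: "c \<in> charts X" "x \<in> fst c" using c by (auto simp: charts_at_iff)
      show "hol_sec X E c (\<lambda>y. \<eta> y (coord_tangent X y c v)) x"
      proof (rule hol_secI[OF c t, of "W \<inter> fst c"])
        show "openin (mtop X) (W \<inter> fst c)" using W chart_openin[OF cc(1)] by blast
        fix y assume "y \<in> W \<inter> fst c"
        then show "\<eta> y (coord_tangent X y c v) \<in> carrier (fibre E y)"
          using cc by (intro coord_tup[OF A]) (auto simp: charts_at_iff)
      next
        fix j assume j: "j < r"
        show "hol_in c (\<lambda>y. \<phi> y (\<eta> y (coord_tangent X y c v)) j) x"
          using form_hol_in[OF form[OF t(1) j] _ c, of "\<lambda>_. v"] eval[OF t(1) _ c, of j "\<lambda>_. v"] x t by simp
      qed (use x cc in auto)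
    qed
    show "?A \<and> ?B \<and> ?C" using A B C by blast
  next
    assume ABC: "?A \<and> ?B \<and> ?C"
    then have A: ?A by blast
    have "?\<omega> W' r \<phi> j \<in> holomorphic_forms X (W \<inter> W') 1" if t: "(W', r, \<phi>) \<in> trivs E" and j: "j < r" for W' r \<phi> j
    proof (rule holomorphic_formsI)
      fix x \<Xi> i \<xi> assume *: "x \<in> W \<inter> W'" "\<Xi> \<in> tangent_tuples X 1 x" "i < (1::nat)" "\<xi> \<in> tangent_space X x"
      have \<Xi>: "\<Xi> 0 \<in> tangent_space X x" using tangent_tuplesD[OF *(2)] by simp
      have "\<Xi>(0 := tangent_add X x (\<Xi> 0) \<xi>) \<in> tangent_tuples X 1 x" "\<Xi>(0 := \<xi>) \<in> tangent_tuples X 1 x"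
        using tangent_tuples_upd[OF *(2)] tangent_add_in[OF \<Xi> *(4)] *(4) by auto
      moreover have "\<eta> x (\<Xi> 0) \<in> carrier (fibre E x)" "\<eta> x \<xi> \<in> carrier (fibre E x)"
        using A *(1,4) \<Xi> by (auto simp: PiE_iff)
      ultimately show "?\<omega> W' r \<phi> j x (\<Xi>(i := tangent_add X x (\<Xi> i) \<xi>)) = ?\<omega> W' r \<phi> j x \<Xi> + ?\<omega> W' r \<phi> j x (\<Xi>(i := \<xi>))"
        using * ABC \<Xi> j coord_add[OF triv_coord[OF t]] by simp
    next
      fix x \<Xi> i a assume *: "x \<in> W \<inter> W'" "\<Xi> \<in> tangent_tuples X 1 x" "i < (1::nat)"
      have \<Xi>: "\<Xi> 0 \<in> tangent_space X x" using tangent_tuplesD[OF *(2)] by simp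
      have "\<Xi>(0 := tangent_scale X x a (\<Xi> 0)) \<in> tangent_tuples X 1 x"
        using tangent_tuples_upd[OF *(2)] tangent_scale_in[OF \<Xi>] by auto
      moreover have "\<eta> x (\<Xi> 0) \<in> carrier (fibre E x)" using A *(1) \<Xi> by (auto simp: PiE_iff)
      ultimately show "?\<omega> W' r \<phi> j x (\<Xi>(i := tangent_scale X x a (\<Xi> i))) = a * ?\<omega> W' r \<phi> j x \<Xi>"
        using * ABC \<Xi> j coord_smult[OF triv_coord[OF t]] by simp
    next
      fix x c v assume *: "x \<in> W \<inter> W'" "c \<in> charts_at X x"
      then show "hol_in c (\<lambda>y. ?\<omega> W' r \<phi> j y (\<lambda>i\<in>{..<1}. coord_tangent X y c (v i))) x"
        using eval[OF t *] ABC hol_sec_coord[OF _ t _ j] by blast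
    qed auto
    then show "\<eta> \<in> bundle_one_forms X E W" using A unfolding bundle_one_forms_def by fast
  qed
qed

lemma
  assumes W: "openin (mtop X) W" and \<eta>: "\<eta> \<in> bundle_one_forms X E W"
  shows one_form_ext: "\<eta> \<in> (\<Pi>\<^sub>E x\<in>W. tangent_space X x \<rightarrow>\<^sub>E carrier (fibre E x))"
    and one_form_in: "x \<in> W \<Longrightarrow> \<xi> \<in> tangent_space X x \<Longrightarrow> \<eta> x \<xi> \<in> carrier (fibre E x)"
    and one_form_add: "x \<in> W \<Longrightarrow> \<xi> \<in> tangent_space X x \<Longrightarrow> \<zeta> \<in> tangent_space X x \<Longrightarrow>
      \<eta> x (tangent_add X x \<xi> \<zeta>) = \<eta> x \<xi> \<oplus>\<^bsub>fibre E x\<^esub> \<eta> x \<zeta>"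
    and one_form_scale: "x \<in> W \<Longrightarrow> \<xi> \<in> tangent_space X x \<Longrightarrow>
      \<eta> x (tangent_scale X x a \<xi>) = a \<odot>\<^bsub>fibre E x\<^esub> \<eta> x \<xi>"
    and one_form_hol: "x \<in> W \<Longrightarrow> c \<in> charts_at X x \<Longrightarrow> hol_sec X E c (\<lambda>y. \<eta> y (coord_tangent X y c v)) x"
  using \<eta> unfolding bundle_one_forms_iff[OF W] by (auto simp: PiE_iff)

end

section \<open>Bundle isomorphisms\<close>

context atlas
begin

text \<open>The coordinates of the image are sums of coordinates of \<open>s\<close> times
  coordinates of the images of a frame. It therefore suffices to test a fibrewise linear family on a
  frame; this serves isomorphisms, their inverses and \<open>hom_connection\<close> alike.\<close>

lemma hol_sec_map:
  assumes E: "holomorphic_bundle X E" and F: "holomorphic_bundle X F"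
    and c: "c \<in> charts_at X x" and t: "(W, r, \<phi>) \<in> trivs E" "x \<in> W"
    and V: "openin (mtop X) V" "x \<in> V" and T: "\<And>y. y \<in> V \<Longrightarrow> clinear (fibre E y) (fibre F y) (T y)"
    and basis: "\<And>k. k < r \<Longrightarrow> hol_sec X F c (\<lambda>y. T y (basis_vector (fibre E y) r (\<phi> y) k)) x"
    and s: "hol_sec X E c s x"
  shows "hol_sec X F c (\<lambda>y. T y (s y)) x"
proof -
  interpret E: holo_bundle X E by unfold_locales fact
  interpret F: holo_bundle X F by unfold_locales fact
  obtain W' r' \<psi> where t': "(W', r', \<psi>) \<in> trivs F" "x \<in> W'" using F.triv_at[OF charts_at_points[OF c]] .
  obtain V' where V': "openin (mtop X) V'" "x \<in> V'" "\<And>y. y \<in> V' \<Longrightarrow> s y \<in> carrier (fibre E y)"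
    using s by (auto simp: hol_sec_def)
  let ?U = "V \<inter> V' \<inter> W \<inter> W'"
  have U: "openin (mtop X) ?U" "x \<in> ?U"
    using V V' t t' E.triv_open[OF t(1)] F.triv_open[OF t'(1)] by (auto intro!: openin_Int)
  show ?thesis
  proof (rule F.hol_secI[OF c t' U])
    fix y assume "y \<in> ?U"
    then show "T y (s y) \<in> carrier (fibre F y)" using clinear_in[OF T] V' by auto
  next
    fix j assume j: "j < r'"
    have "\<psi> y (T y (s y)) j = (\<Sum>k<r. \<phi> y (s y) k * \<psi> y (T y (basis_vector (fibre E y) r (\<phi> y) k)) j)" if "y \<in> ?U" for y
      using that V'
      by (intro coord_clinear[OF E.fibre_module[OF E.triv_points[OF t(1)]] E.triv_coord[OF t(1)] F.triv_coord[OF t'(1)] T] j) auto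
    moreover have "hol_in c (\<lambda>y. \<Sum>k<r. \<phi> y (s y) k * \<psi> y (T y (basis_vector (fibre E y) r (\<phi> y) k)) j) x"
      by (intro hol_in_sum hol_in_mult hol_sec_coord[OF s t] hol_sec_coord[OF basis t' j]) auto
    ultimately show "hol_in c (\<lambda>y. \<psi> y (T y (s y)) j) x"
      using hol_in_cong[OF c U, of "\<lambda>y. \<psi> y (T y (s y)) j"] by simp
  qed
qed

lemma
  assumes "m \<in> bundle_isos X E F"
  shows iso_ext: "m \<in> (\<Pi>\<^sub>E x\<in>points X. carrier (fibre E x) \<rightarrow>\<^sub>E carrier (fibre F x))"
    and iso_bij: "x \<in> points X \<Longrightarrow> bij_betw (m x) (carrier (fibre E x)) (carrier (fibre F x))"
    and iso_clinear: "x \<in> points X \<Longrightarrow> clinear (fibre E x) (fibre F x) (m x)"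
  using assms by (auto simp: bundle_isos_def clinear_def bij_betw_def)

lemma iso_hol_sec:
  assumes E: "holomorphic_bundle X E" and F: "holomorphic_bundle X F" and m: "m \<in> bundle_isos X E F"
    and c: "c \<in> charts_at X x" and s: "hol_sec X E c s x"
  shows "hol_sec X F c (\<lambda>y. m y (s y)) x"
proof -
  interpret E: holo_bundle X E by unfold_locales fact
  interpret F: holo_bundle X F by unfold_locales fact
  note x = charts_at_points[OF c]
  obtain W r \<phi> where t: "(W, r, \<phi>) \<in> trivs E" "x \<in> W" using E.triv_at[OF x] .
  obtain W' r' \<psi> where t': "(W', r', \<psi>) \<in> trivs F" "x \<in> W'" using F.triv_at[OF x] .
  have lin: "clinear (fibre E y) (fibre F y) (m y)" if "y \<in> W" for y
    by (rule iso_clinear[OF m E.triv_points[OF t(1) that]])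
  have mat: "holomorphic_matrix X (fibre E) (W, r, \<phi>) (W', r', \<psi>) m"
    using m t t' unfolding bundle_isos_def by blast
  have basis: "hol_sec X F c (\<lambda>y. m y (basis_vector (fibre E y) r (\<phi> y) k)) x" if "k < r" for k
    by (rule F.hol_secI[OF c t' E.triv_open[OF t(1)] t(2)])
      (use mat c t t' that in \<open>auto simp: holomorphic_matrix_def holomorphic_fun_iff
        intro!: clinear_in[OF lin] basis_vector_in[OF E.triv_coord[OF t(1)]]\<close>)
  show ?thesis by (rule hol_sec_map[OF E F c t E.triv_open[OF t(1)] t(2) lin basis s])
qed

text \<open>Converse to \<open>iso_hol_sec\<close>: the matrix entries are coordinates of images of
  frame vectors, and frames are holomorphic.\<close>

lemma bundle_isosI:
  assumes E: "holomorphic_bundle X E" and F: "holomorphic_bundle X F"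
    and "m \<in> (\<Pi>\<^sub>E x\<in>points X. carrier (fibre E x) \<rightarrow>\<^sub>E carrier (fibre F x))"
    and "\<And>x. x \<in> points X \<Longrightarrow> bij_betw (m x) (carrier (fibre E x)) (carrier (fibre F x))"
    and "\<And>x. x \<in> points X \<Longrightarrow> clinear (fibre E x) (fibre F x) (m x)"
    and hol: "\<And>x c s. x \<in> points X \<Longrightarrow> c \<in> charts_at X x \<Longrightarrow> hol_sec X E c s x \<Longrightarrow> hol_sec X F c (\<lambda>y. m y (s y)) x"
  shows "m \<in> bundle_isos X E F"
proof -
  interpret E: holo_bundle X E by unfold_locales fact
  interpret F: holo_bundle X F by unfold_locales fact
  have "holomorphic_matrix X (fibre E) (W, r, \<phi>) (W', r', \<psi>) m"
    if t: "(W, r, \<phi>) \<in> trivs E" and t': "(W', r', \<psi>) \<in> trivs F" for W r \<phi> W' r' \<psi>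
    unfolding holomorphic_matrix_def prod.case holomorphic_fun_iff
  proof (intro allI impI ballI)
    fix k j x c assume *: "k < r" "j < r'" "x \<in> W \<inter> W'" "c \<in> charts_at X x"
    then show "hol_in c (\<lambda>x. \<psi> x (m x (basis_vector (fibre E x) r (\<phi> x) k)) j) x"
      using hol_sec_coord[OF hol[OF _ *(4) E.hol_sec_basis_vector[OF *(4) t]] t'] E.triv_points[OF t] by auto
  qed
  then have "\<forall>t\<in>trivs E. \<forall>t'\<in>trivs F. holomorphic_matrix X (fibre E) t t' m"
    by (metis prod_cases3)
  then show ?thesis using assms(3-5) by (auto simp: bundle_isos_def clinear_def)
qed

text \<open>Coordinates transported along \<open>m\<close> show that both local ranks agree. The
  matrix of the inverse map is then inverse to a square holomorphic matrix, and Cramer's rule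
  applies.\<close>

lemma iso_inverse_hol_sec:
  assumes E: "holomorphic_bundle X E" and F: "holomorphic_bundle X F" and m: "m \<in> bundle_isos X E F"
    and c: "c \<in> charts_at X x" and s: "hol_sec X F c s x"
  shows "hol_sec X E c (\<lambda>y. inv_into (carrier (fibre E y)) (m y) (s y)) x"
proof -
  interpret E: holo_bundle X E by unfold_locales fact
  interpret F: holo_bundle X F by unfold_locales fact
  note x = charts_at_points[OF c]
  obtain W r \<phi> where t: "(W, r, \<phi>) \<in> trivs E" "x \<in> W" using E.triv_at[OF x] .
  obtain W' r' \<psi> where t': "(W', r', \<psi>) \<in> trivs F" "x \<in> W'" using F.triv_at[OF x] .
  let ?b = "\<lambda>y. basis_vector (fibre E y) r (\<phi> y)" and ?b' = "\<lambda>y. basis_vector (fibre F y) r' (\<psi> y)"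
  let ?m' = "\<lambda>y. inv_into (carrier (fibre E y)) (m y)"
  have r: "r' = r"
    using coord_iso_dim_unique[OF E.fibre_module[OF x] coord_iso_pullback[OF F.triv_coord[OF t'] iso_clinear[OF m x] iso_bij[OF m x]]
      E.triv_coord[OF t]] .
  have pts: "y \<in> points X" if "y \<in> W" for y using E.triv_points[OF t(1) that] .
  have inv: "clinear (fibre F y) (fibre E y) (?m' y)" if "y \<in> W" for y
    by (intro clinear_inv E.fibre_module iso_clinear[OF m] iso_bij[OF m] pts that)
  have m_inv: "m y (?m' y v) = v" if "y \<in> W" "v \<in> carrier (fibre F y)" for y v
    using iso_bij[OF m pts[OF that(1)]] that(2) by (simp add: bij_betw_def f_inv_into_f)
  have U: "openin (mtop X) (W \<inter> W')" "x \<in> W \<inter> W'"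
    using E.triv_open[OF t(1)] F.triv_open[OF t'(1)] t t' by auto
  have basis: "hol_sec X E c (\<lambda>y. ?m' y (?b' y k)) x" if k: "k < r'" for k
  proof (rule E.hol_secI[OF c t U])
    fix y assume "y \<in> W \<inter> W'"
    then show "?m' y (?b' y k) \<in> carrier (fibre E y)"
      by (intro clinear_in[OF inv] basis_vector_in F.triv_coord[OF t'(1)]) auto
  next
    fix j assume j: "j < r"
    show "hol_in c (\<lambda>y. \<phi> y (?m' y (?b' y k)) j) x"
    proof (rule hol_in_inverse_matrix[OF c U, where r = r and A = "\<lambda>y i j. \<psi> y (m y (?b y j)) i"
          and B = "\<lambda>y j k. \<phi> y (?m' y (?b' y k)) j"])
      fix y i k assume y: "y \<in> W \<inter> W'" and ik: "i < r" "k < r"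
      have yW: "y \<in> W" "y \<in> W'" using y by auto
      have b': "?b' y k \<in> carrier (fibre F y)" by (rule basis_vector_in[OF F.triv_coord[OF t'(1) yW(2)]])
      have "(\<Sum>j<r. \<phi> y (?m' y (?b' y k)) j * \<psi> y (m y (?b y j)) i) = \<psi> y (m y (?m' y (?b' y k))) i"
        using coord_clinear[OF E.fibre_module[OF pts[OF yW(1)]] E.triv_coord[OF t(1) yW(1)] F.triv_coord[OF t'(1) yW(2)]
          iso_clinear[OF m pts[OF yW(1)]] clinear_in[OF inv[OF yW(1)] b'], of i] ik r by simp
      then show "(\<Sum>j<r. \<psi> y (m y (?b y j)) i * \<phi> y (?m' y (?b' y k)) j) = (if i = k then 1 else 0)"
        using m_inv[OF yW(1) b'] coord_basis_vector[OF F.triv_coord[OF t'(1) yW(2)], of i k] ik r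
        by (simp add: mult.commute)
    next
      fix i j assume ij: "i < r" "j < r"
      show "hol_in c (\<lambda>y. \<psi> y (m y (?b y j)) i) x"
        using hol_sec_coord[OF iso_hol_sec[OF E F m c E.hol_sec_basis_vector[OF c t]] t'] ij r by simp
    qed (use j k r in auto)
  qed
  show ?thesis by (rule hol_sec_map[OF F E c t' E.triv_open[OF t(1)] t(2) inv basis s])
qed

section \<open>The category of bundles with connection\<close>

lemma Ob_HVB_cat: "E \<in> Ob (HVB_cat X) \<longleftrightarrow> holomorphic_bundle X E \<and> holomorphic_connection X E (conn E)"
  and Hom_HVB_cat: "Hom (HVB_cat X) E F = bundle_isos X E F"
  and Id_HVB_cat: "Id (HVB_cat X) E = (\<lambda>x\<in>points X. \<lambda>e\<in>carrier (fibre E x). e)"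
  and Comp_HVB_cat: "Comp (HVB_cat X) E F G n m = (\<lambda>x\<in>points X. \<lambda>e\<in>carrier (fibre E x). n x (m x e))"
  by (simp_all add: HVB_cat_def)

lemma Id_bundle_iso:
  assumes E: "holomorphic_bundle X E"
  shows "(\<lambda>x\<in>points X. \<lambda>e\<in>carrier (fibre E x). e) \<in> bundle_isos X E E"
proof (rule bundle_isosI[OF E E])
  interpret E: holo_bundle X E by unfold_locales fact
  fix x c s assume x: "x \<in> points X" "c \<in> charts_at X x" and s: "hol_sec X E c s x"
  obtain V where V: "openin (mtop X) V" "x \<in> V" "\<forall>y\<in>V. s y \<in> carrier (fibre E y)"
    using s by (auto simp: hol_sec_def)
  show "hol_sec X E c (\<lambda>y. (\<lambda>x\<in>points X. \<lambda>e\<in>carrier (fibre E x). e) y (s y)) x"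
    by (rule E.hol_sec_cong[OF x(2) V(1,2) _ s]) (use V(3) openin_subset[OF V(1)] in auto)
next
  interpret E: holo_bundle X E by unfold_locales fact
  fix x assume "x \<in> points X"
  then show "bij_betw ((\<lambda>x\<in>points X. \<lambda>e\<in>carrier (fibre E x). e) x) (carrier (fibre E x)) (carrier (fibre E x))"
    by (auto simp: bij_betw_def inj_on_def)
  show "clinear (fibre E x) (fibre E x) ((\<lambda>x\<in>points X. \<lambda>e\<in>carrier (fibre E x). e) x)"
    using \<open>x \<in> points X\<close> complex_module_closed[OF E.fibre_module] by (auto simp: clinear_def)
qed auto

lemma Comp_bundle_iso:
  assumes E: "holomorphic_bundle X E" and F: "holomorphic_bundle X F" and G: "holomorphic_bundle X G"
    and m: "m \<in> bundle_isos X E F" and n: "n \<in> bundle_isos X F G"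
  shows "(\<lambda>x\<in>points X. \<lambda>e\<in>carrier (fibre E x). n x (m x e)) \<in> bundle_isos X E G"
proof (rule bundle_isosI[OF E G])
  interpret E: holo_bundle X E by unfold_locales fact
  interpret G: holo_bundle X G by unfold_locales fact
  fix x c s assume x: "x \<in> points X" "c \<in> charts_at X x" and s: "hol_sec X E c s x"
  obtain V where V: "openin (mtop X) V" "x \<in> V" "\<forall>y\<in>V. s y \<in> carrier (fibre E y)"
    using s by (auto simp: hol_sec_def)
  show "hol_sec X G c (\<lambda>y. (\<lambda>x\<in>points X. \<lambda>e\<in>carrier (fibre E x). n x (m x e)) y (s y)) x"
    by (rule G.hol_sec_cong[OF x(2) V(1,2) _ iso_hol_sec[OF F G n x(2) iso_hol_sec[OF E F m x(2) s]]])
      (use V(3) openin_subset[OF V(1)] in auto)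
next
  interpret E: holo_bundle X E by unfold_locales fact
  fix x assume x: "x \<in> points X"
  have "bij_betw (\<lambda>e. n x (m x e)) (carrier (fibre E x)) (carrier (fibre G x))"
    using bij_betw_trans[OF iso_bij[OF m x] iso_bij[OF n x]] by (simp add: comp_def)
  then show "bij_betw ((\<lambda>x\<in>points X. \<lambda>e\<in>carrier (fibre E x). n x (m x e)) x) (carrier (fibre E x)) (carrier (fibre G x))"
    using x by (simp cong: bij_betw_cong)
  show "clinear (fibre E x) (fibre G x) ((\<lambda>x\<in>points X. \<lambda>e\<in>carrier (fibre E x). n x (m x e)) x)"
    using clinear_compose[OF iso_clinear[OF m x] iso_clinear[OF n x]] x complex_module_closed[OF E.fibre_module[OF x]]
    by (simp add: clinear_def)
qed (use clinear_in[OF iso_clinear[OF m]] clinear_in[OF iso_clinear[OF n]] in auto)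

text \<open>Identities and composites are restricted to the points and to the fibres. The unit laws
  are equalities of functions because \<open>bundle_isos\<close> contains only functions restricted
  in the same way.\<close>

lemma category_HVB: "category (HVB_cat X)"
  unfolding category_def
proof (intro conjI ballI)
  fix E F m assume *: "E \<in> Ob (HVB_cat X)" "F \<in> Ob (HVB_cat X)" "m \<in> Hom (HVB_cat X) E F"
  then have m: "m \<in> bundle_isos X E F" by (simp add: Hom_HVB_cat)
  have mem: "m x e \<in> carrier (fibre F x)" if "x \<in> points X" "e \<in> carrier (fibre E x)" for x e
    using clinear_in[OF iso_clinear[OF m]] that by simp
  have ext: "m x = undefined" if "x \<notin> points X" for x using iso_ext[OF m] that by (auto simp: PiE_iff extensional_def)
  have ext': "m x e = undefined" if "x \<in> points X" "e \<notin> carrier (fibre E x)" for x e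
    using PiE_mem[OF iso_ext[OF m] that(1)] that(2) by (auto simp: PiE_iff extensional_def)
  show "Comp (HVB_cat X) E E F m (Id (HVB_cat X) E) = m" "Comp (HVB_cat X) E F F (Id (HVB_cat X) F) m = m"
    using ext ext' mem by (auto simp: Comp_HVB_cat Id_HVB_cat fun_eq_iff restrict_def)
next
  fix E F G K m n k
  assume "m \<in> Hom (HVB_cat X) E F"
  then have m: "m \<in> bundle_isos X E F" by (simp add: Hom_HVB_cat)
  have mem: "m x e \<in> carrier (fibre F x)" if "x \<in> points X" "e \<in> carrier (fibre E x)" for x e
    using clinear_in[OF iso_clinear[OF m]] that by simp
  show "Comp (HVB_cat X) E F K (Comp (HVB_cat X) F G K k n) m = Comp (HVB_cat X) E G K k (Comp (HVB_cat X) E F G n m)"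
    using mem by (auto simp: Comp_HVB_cat fun_eq_iff restrict_def)
next
  fix E F G m n assume "E \<in> Ob (HVB_cat X)" "F \<in> Ob (HVB_cat X)" "G \<in> Ob (HVB_cat X)"
    "m \<in> Hom (HVB_cat X) E F" "n \<in> Hom (HVB_cat X) F G"
  then show "Comp (HVB_cat X) E F G n m \<in> Hom (HVB_cat X) E G"
    using Comp_bundle_iso[of E F G m n] by (simp add: Hom_HVB_cat Ob_HVB_cat Comp_HVB_cat)
qed (simp_all add: Hom_HVB_cat Ob_HVB_cat Id_HVB_cat Id_bundle_iso)

end


section \<open>Connections\<close>

lemma
  assumes "holomorphic_connection X E N"
  shows connection_ext: "N \<in> (\<Pi>\<^sub>E W\<in>{W. openin (mtop X) W}. holomorphic_sections X E W \<rightarrow>\<^sub>E bundle_one_forms X E W)"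
    and connection_form: "openin (mtop X) W \<Longrightarrow> s \<in> holomorphic_sections X E W \<Longrightarrow> N W s \<in> bundle_one_forms X E W"
    and connection_add: "openin (mtop X) W \<Longrightarrow> s \<in> holomorphic_sections X E W \<Longrightarrow> t \<in> holomorphic_sections X E W \<Longrightarrow>
      x \<in> W \<Longrightarrow> \<xi> \<in> tangent_space X x \<Longrightarrow>
      N W (\<lambda>y\<in>W. s y \<oplus>\<^bsub>fibre E y\<^esub> t y) x \<xi> = N W s x \<xi> \<oplus>\<^bsub>fibre E x\<^esub> N W t x \<xi>"
    and connection_leibniz: "openin (mtop X) W \<Longrightarrow> s \<in> holomorphic_sections X E W \<Longrightarrow> holomorphic_fun X W g \<Longrightarrow>
      x \<in> W \<Longrightarrow> \<xi> \<in> tangent_space X x \<Longrightarrow> N W (\<lambda>y\<in>W. g y \<odot>\<^bsub>fibre E y\<^esub> s y) x \<xi> =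
         (differential X g x \<xi> \<odot>\<^bsub>fibre E x\<^esub> s x) \<oplus>\<^bsub>fibre E x\<^esub> (g x \<odot>\<^bsub>fibre E x\<^esub> N W s x \<xi>)"
    and connection_restrict: "openin (mtop X) W \<Longrightarrow> openin (mtop X) W' \<Longrightarrow> W' \<subseteq> W \<Longrightarrow>
      s \<in> holomorphic_sections X E W \<Longrightarrow> N W' (restrict s W') = restrict (N W s) W'"
  using assms unfolding holomorphic_connection_def by (simp_all add: PiE_iff)

context holo_bundle
begin

lemma section_add:
  assumes "openin (mtop X) W" "s \<in> holomorphic_sections X E W" "t \<in> holomorphic_sections X E W"
  shows "(\<lambda>y\<in>W. s y \<oplus>\<^bsub>fibre E y\<^esub> t y) \<in> holomorphic_sections X E W"
  using assms by (intro sectionI hol_sec_add section_hol) auto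

lemma section_smult:
  assumes "openin (mtop X) W" "s \<in> holomorphic_sections X E W" "holomorphic_fun X W g"
  shows "(\<lambda>y\<in>W. g y \<odot>\<^bsub>fibre E y\<^esub> s y) \<in> holomorphic_sections X E W"
  using assms by (intro sectionI hol_sec_smult section_hol) (auto simp: holomorphic_fun_iff)

lemma coord_section:
  assumes "(W', r, \<phi>) \<in> trivs E" "openin (mtop X) W" "W \<subseteq> W'" "\<And>j. j < r \<Longrightarrow> holomorphic_fun X W (\<lambda>y. a y j)"
  shows "(\<lambda>y\<in>W. coord_vector (fibre E y) r (\<phi> y) (a y)) \<in> holomorphic_sections X E W"
  using assms by (intro sectionI hol_sec_coord_vector[OF _ assms(1)]) (auto simp: holomorphic_fun_iff)

text \<open>The section has constant coordinates in the trivialization, equal to those of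
  \<open>e\<close>.\<close>

lemma section_through:
  assumes "(W, r, \<phi>) \<in> trivs E" "x \<in> W" "e \<in> carrier (fibre E x)"
  obtains s where "s \<in> holomorphic_sections X E W" "s x = e"
proof
  show "(\<lambda>y\<in>W. coord_vector (fibre E y) r (\<phi> y) (\<phi> x e)) \<in> holomorphic_sections X E W"
    using assms triv_open by (intro coord_section) (auto simp: holomorphic_fun_iff hol_in_const)
  show "(\<lambda>y\<in>W. coord_vector (fibre E y) r (\<phi> y) (\<phi> x e)) x = e"
    using assms(2) coord_coord_vector[OF triv_coord[OF assms(1,2)]]
    by (auto intro!: coord_eqI[OF triv_coord[OF assms(1,2)] coord_vector_in[OF triv_coord[OF assms(1,2)]] assms(3)])
qed

lemma frame_section:
  assumes "(W', r, \<phi>) \<in> trivs E" "openin (mtop X) W" "W \<subseteq> W'"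
  shows "(\<lambda>y\<in>W. basis_vector (fibre E y) r (\<phi> y) k) \<in> holomorphic_sections X E W"
  unfolding basis_vector_eq using assms by (intro coord_section) (auto simp: holomorphic_fun_iff hol_in_const)

end

section \<open>The induced connection on Hom\<close>

locale bundle_iso = atlas X for X :: "('p, 'v::complex_model_space) cmanifold" +
  fixes E F :: "('p, 'v, 'f) vbundle" and m :: "('p, 'f) bundle_map"
  assumes E_Ob: "E \<in> Ob (HVB_cat X)" and F_Ob: "F \<in> Ob (HVB_cat X)" and iso: "m \<in> bundle_isos X E F"

sublocale bundle_iso \<subseteq> E: holo_bundle X E
  using E_Ob by unfold_locales (simp add: Ob_HVB_cat)

sublocale bundle_iso \<subseteq> F: holo_bundle X F
  using F_Ob by unfold_locales (simp add: Ob_HVB_cat)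

context bundle_iso
begin

lemma E_conn: "holomorphic_connection X E (conn E)" and F_conn: "holomorphic_connection X F (conn F)"
  using E_Ob F_Ob by (simp_all add: Ob_HVB_cat)

lemma iso_section:
  assumes W: "openin (mtop X) W" and s: "s \<in> holomorphic_sections X E W"
  shows "(\<lambda>y\<in>W. m y (s y)) \<in> holomorphic_sections X F W"
  by (rule F.sectionI[OF W iso_hol_sec[OF E.is_bundle F.is_bundle iso _ E.section_hol[OF W s]]])

text \<open>The formula behind \<open>hom_connection\<close>, as a function of a whole section. That
  only the value of the section at \<open>x\<close> matters is shown in
  \<open>defect_pointwise\<close>.\<close>

definition defect :: "'p set \<Rightarrow> ('p \<Rightarrow> 'f) \<Rightarrow> 'p \<Rightarrow> ('p, 'v) tangent \<Rightarrow> 'f" where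
  "defect W s x \<xi> = conn F W (\<lambda>y\<in>W. m y (s y)) x \<xi> \<ominus>\<^bsub>fibre F x\<^esub> m x (conn E W s x \<xi>)"

lemma x_points: "openin (mtop X) W \<Longrightarrow> x \<in> W \<Longrightarrow> x \<in> points X"
  using openin_subset by blast

context
  fixes W :: "'p set" and s :: "'p \<Rightarrow> 'f" and x :: 'p and \<xi> :: "('p, 'v) tangent"
  assumes W: "openin (mtop X) W" and s: "s \<in> holomorphic_sections X E W"
    and x: "x \<in> W" and \<xi>: "\<xi> \<in> tangent_space X x"
begin

lemma conn_E_in: "conn E W s x \<xi> \<in> carrier (fibre E x)"
  by (rule E.one_form_in[OF W connection_form[OF E_conn W s] x \<xi>])

lemma conn_F_in: "conn F W (\<lambda>y\<in>W. m y (s y)) x \<xi> \<in> carrier (fibre F x)"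
  by (rule F.one_form_in[OF W connection_form[OF F_conn W iso_section[OF W s]] x \<xi>])

lemma m_conn_in: "m x (conn E W s x \<xi>) \<in> carrier (fibre F x)"
  by (rule clinear_in[OF iso_clinear[OF iso x_points[OF W x]] conn_E_in])

lemma defect_in: "defect W s x \<xi> \<in> carrier (fibre F x)"
  unfolding defect_def by (rule complex_module_closed(3)[OF F.fibre_module[OF x_points[OF W x]] conn_F_in m_conn_in])

lemma coord_defect:
  "coord_iso (fibre F x) q \<psi> \<Longrightarrow> j < q \<Longrightarrow>
    \<psi> (defect W s x \<xi>) j = \<psi> (conn F W (\<lambda>y\<in>W. m y (s y)) x \<xi>) j - \<psi> (m x (conn E W s x \<xi>)) j"
  unfolding defect_def by (rule coord_minus[OF F.fibre_module[OF x_points[OF W x]] _ conn_F_in m_conn_in])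

end

lemma defect_add:
  assumes W: "openin (mtop X) W" and s: "s \<in> holomorphic_sections X E W" and t: "t \<in> holomorphic_sections X E W"
    and x: "x \<in> W" and \<xi>: "\<xi> \<in> tangent_space X x" and \<psi>: "coord_iso (fibre F x) q \<psi>" and j: "j < q"
  shows "\<psi> (defect W (\<lambda>y\<in>W. s y \<oplus>\<^bsub>fibre E y\<^esub> t y) x \<xi>) j = \<psi> (defect W s x \<xi>) j + \<psi> (defect W t x \<xi>) j"
proof -
  note xp = x_points[OF W x]
  have "(\<lambda>y\<in>W. m y ((\<lambda>y\<in>W. s y \<oplus>\<^bsub>fibre E y\<^esub> t y) y)) =
      (\<lambda>y\<in>W. (\<lambda>y\<in>W. m y (s y)) y \<oplus>\<^bsub>fibre F y\<^esub> (\<lambda>y\<in>W. m y (t y)) y)"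
    using clinear_add[OF iso_clinear[OF iso x_points[OF W]] E.section_in[OF W s] E.section_in[OF W t]]
    by (intro restrict_ext) simp
  then have "conn F W (\<lambda>y\<in>W. m y ((\<lambda>y\<in>W. s y \<oplus>\<^bsub>fibre E y\<^esub> t y) y)) x \<xi> =
      conn F W (\<lambda>y\<in>W. m y (s y)) x \<xi> \<oplus>\<^bsub>fibre F x\<^esub> conn F W (\<lambda>y\<in>W. m y (t y)) x \<xi>"
    using connection_add[OF F_conn W iso_section[OF W s] iso_section[OF W t] x \<xi>] by simp
  moreover have "m x (conn E W (\<lambda>y\<in>W. s y \<oplus>\<^bsub>fibre E y\<^esub> t y) x \<xi>) =
      m x (conn E W s x \<xi>) \<oplus>\<^bsub>fibre F x\<^esub> m x (conn E W t x \<xi>)"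
    using connection_add[OF E_conn W s t x \<xi>]
      clinear_add[OF iso_clinear[OF iso xp] conn_E_in[OF W s x \<xi>] conn_E_in[OF W t x \<xi>]] by simp
  ultimately show ?thesis
    using coord_defect[OF W E.section_add[OF W s t] x \<xi> \<psi> j] coord_defect[OF W s x \<xi> \<psi> j] coord_defect[OF W t x \<xi> \<psi> j]
      coord_add[OF \<psi> conn_F_in[OF W s x \<xi>] conn_F_in[OF W t x \<xi>] j]
      coord_add[OF \<psi> m_conn_in[OF W s x \<xi>] m_conn_in[OF W t x \<xi>] j] by simp
qed

text \<open>The differential of \<open>g\<close> enters both terms of the defect and cancels.\<close>

lemma defect_smult:
  assumes W: "openin (mtop X) W" and s: "s \<in> holomorphic_sections X E W" and g: "holomorphic_fun X W g"
    and x: "x \<in> W" and \<xi>: "\<xi> \<in> tangent_space X x" and \<psi>: "coord_iso (fibre F x) q \<psi>" and j: "j < q"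
  shows "\<psi> (defect W (\<lambda>y\<in>W. g y \<odot>\<^bsub>fibre E y\<^esub> s y) x \<xi>) j = g x * \<psi> (defect W s x \<xi>) j"
proof -
  note xp = x_points[OF W x]
  note lin = iso_clinear[OF iso xp]
  note mE = complex_module_closed[OF E.fibre_module[OF xp]] and mF = complex_module_closed[OF F.fibre_module[OF xp]]
  have sx: "s x \<in> carrier (fibre E x)" by (rule E.section_in[OF W s x])
  have msx: "m x (s x) \<in> carrier (fibre F x)" by (rule clinear_in[OF lin sx])
  note cE = conn_E_in[OF W s x \<xi>] and cF = conn_F_in[OF W s x \<xi>] and mc = m_conn_in[OF W s x \<xi>]
  have "(\<lambda>y\<in>W. m y ((\<lambda>y\<in>W. g y \<odot>\<^bsub>fibre E y\<^esub> s y) y)) = (\<lambda>y\<in>W. g y \<odot>\<^bsub>fibre F y\<^esub> (\<lambda>y\<in>W. m y (s y)) y)"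
    using clinear_smult[OF iso_clinear[OF iso x_points[OF W]] E.section_in[OF W s]]
    by (intro restrict_ext) simp
  then have "conn F W (\<lambda>y\<in>W. m y ((\<lambda>y\<in>W. g y \<odot>\<^bsub>fibre E y\<^esub> s y) y)) x \<xi> =
      (differential X g x \<xi> \<odot>\<^bsub>fibre F x\<^esub> m x (s x)) \<oplus>\<^bsub>fibre F x\<^esub> (g x \<odot>\<^bsub>fibre F x\<^esub> conn F W (\<lambda>y\<in>W. m y (s y)) x \<xi>)"
    using connection_leibniz[OF F_conn W iso_section[OF W s] g x \<xi>] x by simp
  moreover have "m x (conn E W (\<lambda>y\<in>W. g y \<odot>\<^bsub>fibre E y\<^esub> s y) x \<xi>) =
      (differential X g x \<xi> \<odot>\<^bsub>fibre F x\<^esub> m x (s x)) \<oplus>\<^bsub>fibre F x\<^esub> (g x \<odot>\<^bsub>fibre F x\<^esub> m x (conn E W s x \<xi>))"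
    using connection_leibniz[OF E_conn W s g x \<xi>] clinear_add[OF lin mE(2)[OF sx sx] mE(2)[OF cE cE]]
      clinear_smult[OF lin sx] clinear_smult[OF lin cE] by simp
  ultimately show ?thesis
    using coord_defect[OF W E.section_smult[OF W s g] x \<xi> \<psi> j] coord_defect[OF W s x \<xi> \<psi> j]
      coord_add[OF \<psi> mF(2)[OF msx msx] mF(2)[OF cF cF] j] coord_add[OF \<psi> mF(2)[OF msx msx] mF(2)[OF mc mc] j]
      coord_smult[OF \<psi> cF j] coord_smult[OF \<psi> mc j] by (simp add: right_diff_distrib)
qed

lemma defect_restrict:
  assumes W: "openin (mtop X) W" and s: "s \<in> holomorphic_sections X E W"
    and W': "openin (mtop X) W'" "W' \<subseteq> W" and x: "x \<in> W'"
  shows "defect W' (restrict s W') x \<xi> = defect W s x \<xi>"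
proof -
  have "(\<lambda>y\<in>W'. m y (restrict s W' y)) = restrict (\<lambda>y\<in>W. m y (s y)) W'"
    using W'(2) by (auto simp: fun_eq_iff)
  then show ?thesis
    using connection_restrict[OF F_conn W W' iso_section[OF W s]] connection_restrict[OF E_conn W W' s] x
    by (simp add: defect_def)
qed

text \<open>Additivity and linearity over holomorphic functions allow an expansion in a frame, since
  on \<open>W\<close> the coordinate functions of \<open>s\<close> are themselves holomorphic. The
  induction is that of \<open>coord_expansion\<close> with sections in place of vectors.\<close>

lemma defect_expansion:
  assumes t: "(W', r, \<phi>) \<in> trivs E" and W: "openin (mtop X) W" "W \<subseteq> W'" and s: "s \<in> holomorphic_sections X E W"
    and x: "x \<in> W" and \<xi>: "\<xi> \<in> tangent_space X x" and \<psi>: "coord_iso (fibre F x) q \<psi>" and j: "j < q"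
  shows "\<psi> (defect W s x \<xi>) j =
    (\<Sum>k<r. \<phi> x (s x) k * \<psi> (defect W (\<lambda>y\<in>W. basis_vector (fibre E y) r (\<phi> y) k) x \<xi>) j)"
proof -
  let ?b = "\<lambda>k. \<lambda>y\<in>W. basis_vector (fibre E y) r (\<phi> y) k"
  have b: "?b k \<in> holomorphic_sections X E W" for k by (rule E.frame_section[OF t W])
  have \<phi>: "coord_iso (fibre E y) r (\<phi> y)" if "y \<in> W" for y using E.triv_coord[OF t] W(2) that by blast
  have mE: "module complex_ring (fibre E y)" if "y \<in> W" for y using E.fibre_module x_points[OF W(1)] that by blast
  \<comment> \<open>Coordinates are required to vanish on all of \<open>W\<close>: vanishing at
    \<open>x\<close> alone would not control the derivative of the section.\<close>
  have "\<psi> (defect W s x \<xi>) j = (\<Sum>k<n. \<phi> x (s x) k * \<psi> (defect W (?b k) x \<xi>) j)"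
    if "s \<in> holomorphic_sections X E W" "n \<le> r" "\<And>k y. y \<in> W \<Longrightarrow> n \<le> k \<Longrightarrow> k < r \<Longrightarrow> \<phi> y (s y) k = 0" for s n
    using that
  proof (induction n arbitrary: s)
    case 0
    \<comment> \<open>A section with vanishing coordinates equals its own double, so by
      \<open>defect_add\<close> its defect has coordinates equal to their doubles.\<close>
    have "(\<lambda>y\<in>W. s y \<oplus>\<^bsub>fibre E y\<^esub> s y) = s"
    proof
      fix y
      show "(\<lambda>y\<in>W. s y \<oplus>\<^bsub>fibre E y\<^esub> s y) y = s y"
      proof (cases "y \<in> W")
        case True
        note sy = E.section_in[OF W(1) 0(1) True]
        have "s y \<oplus>\<^bsub>fibre E y\<^esub> s y = s y"
          using 0(3)[OF True] by (intro coord_eqI[OF \<phi>[OF True] complex_module_closed(1)[OF mE[OF True] sy sy] sy])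
            (simp add: coord_add[OF \<phi>[OF True] sy sy])
        then show ?thesis using True by simp
      qed (use E.section_ext[OF W(1) 0(1)] in \<open>auto simp: extensional_def\<close>)
    qed
    then show ?case using defect_add[OF W(1) 0(1) 0(1) x \<xi> \<psi> j] by simp
  next
    case (Suc n)
    define g where "g y = \<phi> y (s y) n" for y
    define s' where "s' = (\<lambda>y\<in>W. coord_vector (fibre E y) r (\<phi> y) (\<lambda>k. if k = n then 0 else \<phi> y (s y) k))"
    have n: "n < r" using Suc.prems(2) by simp
    have hol: "holomorphic_fun X W (\<lambda>y. \<phi> y (s y) k)" if "k < r" for k
      using hol_sec_coord[OF E.section_hol[OF W(1) Suc.prems(1)] t _ that] W(2) by (auto simp: holomorphic_fun_iff)
    have s': "s' \<in> holomorphic_sections X E W"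
      unfolding s'_def
    proof (rule E.coord_section[OF t W])
      fix k assume "k < r"
      then show "holomorphic_fun X W (\<lambda>y. if k = n then 0 else \<phi> y (s y) k)"
        using hol[of k] by (cases "k = n") (auto simp: holomorphic_fun_iff hol_in_const)
    qed
    have gb: "(\<lambda>y\<in>W. g y \<odot>\<^bsub>fibre E y\<^esub> ?b n y) \<in> holomorphic_sections X E W"
      by (rule E.section_smult[OF W(1) b]) (use hol[OF n] in \<open>simp add: g_def\<close>)
    have s'_coord: "\<phi> y (s' y) k = (if k = n then 0 else \<phi> y (s y) k)" if "y \<in> W" "k < r" for y k
      using that by (simp add: s'_def coord_coord_vector[OF \<phi>[OF that(1)]])
    have "s = (\<lambda>y\<in>W. s' y \<oplus>\<^bsub>fibre E y\<^esub> (\<lambda>y\<in>W. g y \<odot>\<^bsub>fibre E y\<^esub> ?b n y) y)"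
    proof
      fix y
      show "s y = (\<lambda>y\<in>W. s' y \<oplus>\<^bsub>fibre E y\<^esub> (\<lambda>y\<in>W. g y \<odot>\<^bsub>fibre E y\<^esub> ?b n y) y) y"
      proof (cases "y \<in> W")
        case True
        note sy = E.section_in[OF W(1) Suc.prems(1) True] E.section_in[OF W(1) s' True] E.section_in[OF W(1) gb True]
          E.section_in[OF W(1) b True]
        have "s y = s' y \<oplus>\<^bsub>fibre E y\<^esub> (\<lambda>y\<in>W. g y \<odot>\<^bsub>fibre E y\<^esub> ?b n y) y"
        proof (rule coord_eqI[OF \<phi>[OF True] sy(1) complex_module_closed(1)[OF mE[OF True] sy(2,3)]])
          fix k assume k: "k < r"
          show "\<phi> y (s y) k = \<phi> y (s' y \<oplus>\<^bsub>fibre E y\<^esub> (\<lambda>y\<in>W. g y \<odot>\<^bsub>fibre E y\<^esub> ?b n y) y) k"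
            unfolding coord_add[OF \<phi>[OF True] sy(2,3) k] s'_coord[OF True k]
            using True coord_smult[OF \<phi>[OF True] sy(4) k] coord_basis_vector[OF \<phi>[OF True] k]
            by (auto simp: g_def)
        qed
        then show ?thesis using True by simp
      qed (use E.section_ext[OF W(1) Suc.prems(1)] in \<open>auto simp: extensional_def\<close>)
    qed
    then have "\<psi> (defect W s x \<xi>) j = \<psi> (defect W s' x \<xi>) j + \<psi> (defect W (\<lambda>y\<in>W. g y \<odot>\<^bsub>fibre E y\<^esub> ?b n y) x \<xi>) j"
      using defect_add[OF W(1) s' gb x \<xi> \<psi> j] by simp
    also have "\<psi> (defect W (\<lambda>y\<in>W. g y \<odot>\<^bsub>fibre E y\<^esub> ?b n y) x \<xi>) j = g x * \<psi> (defect W (?b n) x \<xi>) j"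
      by (rule defect_smult[OF W(1) b _ x \<xi> \<psi> j]) (use hol[OF n] in \<open>simp add: g_def\<close>)
    also have "\<psi> (defect W s' x \<xi>) j = (\<Sum>k<n. \<phi> x (s' x) k * \<psi> (defect W (?b k) x \<xi>) j)"
      using Suc.prems s'_coord by (intro Suc.IH[OF s']) (auto simp: le_Suc_eq)
    also have "\<dots> = (\<Sum>k<n. \<phi> x (s x) k * \<psi> (defect W (?b k) x \<xi>) j)"
      using s'_coord[OF x] n by (intro sum.cong) auto
    finally show ?case unfolding sum.lessThan_Suc g_def .
  qed
  from this[OF s order.refl] show ?thesis by simp
qed

text \<open>Both sections are restricted to a common trivialized neighbourhood, where their frame
  expansions have the same coefficients at \<open>x\<close>. This is the uniqueness required by the
  description in \<open>hom_connection\<close>.\<close>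

lemma defect_pointwise:
  assumes W: "openin (mtop X) W" "s \<in> holomorphic_sections X E W" "x \<in> W"
    and W': "openin (mtop X) W'" "s' \<in> holomorphic_sections X E W'" "x \<in> W'"
    and eq: "s x = s' x" and \<xi>: "\<xi> \<in> tangent_space X x"
  shows "defect W s x \<xi> = defect W' s' x \<xi>"
proof -
  note xp = x_points[OF W(1,3)]
  obtain Wt r \<phi> where t: "(Wt, r, \<phi>) \<in> trivs E" "x \<in> Wt" using E.triv_at[OF xp] .
  obtain q \<psi> where \<psi>: "coord_iso (fibre F x) q \<psi>" using F.fibre_coord[OF xp] .
  let ?U = "W \<inter> W' \<inter> Wt"
  have U: "openin (mtop X) ?U" "?U \<subseteq> Wt" "?U \<subseteq> W" "?U \<subseteq> W'" "x \<in> ?U"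
    using W W' t E.triv_open[OF t(1)] by (auto intro!: openin_Int)
  have sU: "restrict s ?U \<in> holomorphic_sections X E ?U" "restrict s' ?U \<in> holomorphic_sections X E ?U"
    using E.section_restrict[OF W(1,2) U(1,3)] E.section_restrict[OF W'(1,2) U(1,4)] by auto
  have "defect ?U (restrict s ?U) x \<xi> = defect ?U (restrict s' ?U) x \<xi>"
    using defect_expansion[OF t(1) U(1,2) sU(1) U(5) \<xi> \<psi>] defect_expansion[OF t(1) U(1,2) sU(2) U(5) \<xi> \<psi>] U(5) eq
    by (intro coord_eqI[OF \<psi> defect_in[OF U(1) sU(1) U(5) \<xi>] defect_in[OF U(1) sU(2) U(5) \<xi>]]) simp
  then show ?thesis
    using defect_restrict[OF W(1,2) U(1,3,5)] defect_restrict[OF W'(1,2) U(1,4,5)] by simp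
qed

lemma hom_connection_apply:
  assumes "openin (mtop X) W" "s \<in> holomorphic_sections X E W" "x \<in> W" "\<xi> \<in> tangent_space X x"
  shows "hom_connection X E F m x \<xi> (s x) = defect W s x \<xi>"
  unfolding hom_connection_def
proof (rule the_equality)
  fix w assume "\<exists>W' s'. openin (mtop X) W' \<and> x \<in> W' \<and> s' \<in> holomorphic_sections X E W' \<and> s' x = s x \<and>
      w = conn F W' (\<lambda>y\<in>W'. m y (s' y)) x \<xi> \<ominus>\<^bsub>fibre F x\<^esub> m x (conn E W' s' x \<xi>)"
  then show "w = defect W s x \<xi>"
    using defect_pointwise[OF _ _ _ assms(1-3) _ assms(4)] unfolding defect_def by blast
qed (use assms in \<open>unfold defect_def, blast\<close>)

lemma hom_connection_clinear:
  assumes x: "x \<in> points X" and \<xi>: "\<xi> \<in> tangent_space X x"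
  shows "clinear (fibre E x) (fibre F x) (hom_connection X E F m x \<xi>)"
proof -
  obtain W r \<phi> where t: "(W, r, \<phi>) \<in> trivs E" "x \<in> W" using E.triv_at[OF x] .
  obtain q \<psi> where \<psi>: "coord_iso (fibre F x) q \<psi>" using F.fibre_coord[OF x] .
  note W = E.triv_open[OF t(1)]
  note mF = complex_module_closed[OF F.fibre_module[OF x]]
  show ?thesis unfolding clinear_def
  proof (intro conjI ballI allI)
    fix e assume e: "e \<in> carrier (fibre E x)"
    obtain s where s: "s \<in> holomorphic_sections X E W" "s x = e" using E.section_through[OF t e] .
    note he = hom_connection_apply[OF W s(1) t(2) \<xi>]
    show in1: "hom_connection X E F m x \<xi> e \<in> carrier (fibre F x)"
      using he defect_in[OF W s(1) t(2) \<xi>] s(2) by simp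
    show "hom_connection X E F m x \<xi> (a \<odot>\<^bsub>fibre E x\<^esub> e) = a \<odot>\<^bsub>fibre F x\<^esub> hom_connection X E F m x \<xi> e" for a
    proof -
      have g: "holomorphic_fun X W (\<lambda>_. a)" by (simp add: holomorphic_fun_iff hol_in_const)
      note as = E.section_smult[OF W s(1) g]
      have "defect W (\<lambda>y\<in>W. a \<odot>\<^bsub>fibre E y\<^esub> s y) x \<xi> = a \<odot>\<^bsub>fibre F x\<^esub> defect W s x \<xi>"
        using defect_smult[OF W s(1) g t(2) \<xi> \<psi>] coord_smult[OF \<psi> defect_in[OF W s(1) t(2) \<xi>]]
        by (intro coord_eqI[OF \<psi> defect_in[OF W as t(2) \<xi>] mF(2)[OF defect_in[OF W s(1) t(2) \<xi>] defect_in[OF W s(1) t(2) \<xi>]]]) simp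
      then show ?thesis using hom_connection_apply[OF W as t(2) \<xi>] he s(2) t(2) by simp
    qed
    fix e' assume e': "e' \<in> carrier (fibre E x)"
    obtain s' where s': "s' \<in> holomorphic_sections X E W" "s' x = e'" using E.section_through[OF t e'] .
    note ss = E.section_add[OF W s(1) s'(1)]
    note d = defect_in[OF W s(1) t(2) \<xi>] defect_in[OF W s'(1) t(2) \<xi>]
    have "defect W (\<lambda>y\<in>W. s y \<oplus>\<^bsub>fibre E y\<^esub> s' y) x \<xi> = defect W s x \<xi> \<oplus>\<^bsub>fibre F x\<^esub> defect W s' x \<xi>"
      using defect_add[OF W s(1) s'(1) t(2) \<xi> \<psi>] coord_add[OF \<psi> d]
      by (intro coord_eqI[OF \<psi> defect_in[OF W ss t(2) \<xi>] mF(1)[OF d]]) simp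
    then show "hom_connection X E F m x \<xi> (e \<oplus>\<^bsub>fibre E x\<^esub> e') =
        hom_connection X E F m x \<xi> e \<oplus>\<^bsub>fibre F x\<^esub> hom_connection X E F m x \<xi> e'"
      using hom_connection_apply[OF W ss t(2) \<xi>] he hom_connection_apply[OF W s'(1) t(2) \<xi>] s(2) s'(2) t(2) by simp
  qed
qed

lemma
  assumes x: "x \<in> points X" and \<xi>: "\<xi> \<in> tangent_space X x" and e: "e \<in> carrier (fibre E x)"
  shows hom_connection_tangent_add: "\<zeta> \<in> tangent_space X x \<Longrightarrow>
      hom_connection X E F m x (tangent_add X x \<xi> \<zeta>) e =
      hom_connection X E F m x \<xi> e \<oplus>\<^bsub>fibre F x\<^esub> hom_connection X E F m x \<zeta> e"
    and hom_connection_tangent_scale: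
      "hom_connection X E F m x (tangent_scale X x a \<xi>) e = a \<odot>\<^bsub>fibre F x\<^esub> hom_connection X E F m x \<xi> e"
proof -
  obtain W r \<phi> where t: "(W, r, \<phi>) \<in> trivs E" "x \<in> W" using E.triv_at[OF x] .
  obtain q \<psi> where \<psi>: "coord_iso (fibre F x) q \<psi>" using F.fibre_coord[OF x] .
  note W = E.triv_open[OF t(1)]
  obtain s where s: "s \<in> holomorphic_sections X E W" "s x = e" using E.section_through[OF t e] .
  note mF = complex_module_closed[OF F.fibre_module[OF x]]
  note lin = iso_clinear[OF iso x]
  note fE = E.one_form_add[OF W connection_form[OF E_conn W s(1)] t(2)] E.one_form_scale[OF W connection_form[OF E_conn W s(1)] t(2)]
  note fF = F.one_form_add[OF W connection_form[OF F_conn W iso_section[OF W s(1)]] t(2)]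
     F.one_form_scale[OF W connection_form[OF F_conn W iso_section[OF W s(1)]] t(2)]
  note sec = W s(1) t(2)
  note he = hom_connection_apply[OF sec, unfolded s(2)]
  { assume \<zeta>: "\<zeta> \<in> tangent_space X x"
    have d: "defect W s x \<xi> \<in> carrier (fibre F x)" "defect W s x \<zeta> \<in> carrier (fibre F x)"
      "defect W s x (tangent_add X x \<xi> \<zeta>) \<in> carrier (fibre F x)"
      using \<xi> \<zeta> by (auto intro!: defect_in[OF sec] tangent_add_in)
    have "defect W s x (tangent_add X x \<xi> \<zeta>) = defect W s x \<xi> \<oplus>\<^bsub>fibre F x\<^esub> defect W s x \<zeta>"
    proof (rule coord_eqI[OF \<psi> d(3) mF(1)[OF d(1,2)]])
      fix j assume j: "j < q"
      show "\<psi> (defect W s x (tangent_add X x \<xi> \<zeta>)) j = \<psi> (defect W s x \<xi> \<oplus>\<^bsub>fibre F x\<^esub> defect W s x \<zeta>) j"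
        using coord_add[OF \<psi> d(1,2) j] coord_defect[OF sec _ \<psi> j] fE(1)[OF \<xi> \<zeta>] fF(1)[OF \<xi> \<zeta>]
          clinear_add[OF lin conn_E_in[OF sec \<xi>] conn_E_in[OF sec \<zeta>]]
          coord_add[OF \<psi> m_conn_in[OF sec \<xi>] m_conn_in[OF sec \<zeta>] j]
          coord_add[OF \<psi> conn_F_in[OF sec \<xi>] conn_F_in[OF sec \<zeta>] j] tangent_add_in[OF \<xi> \<zeta>] \<xi> \<zeta> by simp
    qed
    then show "hom_connection X E F m x (tangent_add X x \<xi> \<zeta>) e =
        hom_connection X E F m x \<xi> e \<oplus>\<^bsub>fibre F x\<^esub> hom_connection X E F m x \<zeta> e"
      using he[OF \<xi>] he[OF \<zeta>] he[OF tangent_add_in[OF \<xi> \<zeta>]] by simp }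
  have d: "defect W s x \<xi> \<in> carrier (fibre F x)" "defect W s x (tangent_scale X x a \<xi>) \<in> carrier (fibre F x)"
    using \<xi> by (auto intro!: defect_in[OF sec] tangent_scale_in)
  have "defect W s x (tangent_scale X x a \<xi>) = a \<odot>\<^bsub>fibre F x\<^esub> defect W s x \<xi>"
  proof (rule coord_eqI[OF \<psi> d(2) mF(2)[OF d(1) d(1)]])
    fix j assume j: "j < q"
    show "\<psi> (defect W s x (tangent_scale X x a \<xi>)) j = \<psi> (a \<odot>\<^bsub>fibre F x\<^esub> defect W s x \<xi>) j"
      using coord_smult[OF \<psi> d(1) j] coord_defect[OF sec _ \<psi> j] fE(2)[OF \<xi>] fF(2)[OF \<xi>]
        clinear_smult[OF lin conn_E_in[OF sec \<xi>]] coord_smult[OF \<psi> m_conn_in[OF sec \<xi>] j]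
        coord_smult[OF \<psi> conn_F_in[OF sec \<xi>] j] tangent_scale_in[OF \<xi>] \<xi> by (simp add: right_diff_distrib)
  qed
  then show "hom_connection X E F m x (tangent_scale X x a \<xi>) e = a \<odot>\<^bsub>fibre F x\<^esub> hom_connection X E F m x \<xi> e"
    using he[OF \<xi>] he[OF tangent_scale_in[OF \<xi>]] by simp
qed

text \<open>By linearity it is enough to treat frame sections. There the explicit formula is
  available, and it is built from holomorphic sections by operations that preserve
  holomorphy.\<close>

lemma hom_connection_hol_sec:
  assumes c: "c \<in> charts_at X x" and s: "hol_sec X E c s x"
  shows "hol_sec X F c (\<lambda>y. hom_connection X E F m y (coord_tangent X y c v) (s y)) x"
proof -
  obtain W r \<phi> where t: "(W, r, \<phi>) \<in> trivs E" "x \<in> W" using E.triv_at[OF charts_at_points[OF c]] .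
  note W = E.triv_open[OF t(1)]
  have cc: "c \<in> charts X" "x \<in> fst c" using c by (auto simp: charts_at_iff)
  let ?V = "W \<inter> fst c"
  have V: "openin (mtop X) ?V" "x \<in> ?V" using W chart_openin[OF cc(1)] t cc by auto
  have cy: "c \<in> charts_at X y" if "y \<in> ?V" for y using that cc by (simp add: charts_at_iff)
  show ?thesis
  proof (rule hol_sec_map[OF E.is_bundle F.is_bundle c t V _ _ s])
    fix y assume "y \<in> ?V"
    then show "clinear (fibre E y) (fibre F y) (hom_connection X E F m y (coord_tangent X y c v))"
      using cy by (intro hom_connection_clinear coord_tangent_in charts_at_points) auto
  next
    fix k assume "k < r"
    let ?b = "\<lambda>y\<in>W. basis_vector (fibre E y) r (\<phi> y) k"
    have b: "?b \<in> holomorphic_sections X E W" by (rule E.frame_section[OF t(1) W]) simp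
    have "hol_sec X F c (\<lambda>y. conn F W (\<lambda>y\<in>W. m y (?b y)) y (coord_tangent X y c v) \<ominus>\<^bsub>fibre F y\<^esub>
        m y (conn E W ?b y (coord_tangent X y c v))) x"
      by (intro F.hol_sec_minus[OF c] F.one_form_hol[OF W connection_form[OF F_conn W iso_section[OF W b]] t(2) c]
          iso_hol_sec[OF E.is_bundle F.is_bundle iso c] E.one_form_hol[OF W connection_form[OF E_conn W b] t(2) c])
    then show "hol_sec X F c (\<lambda>y. hom_connection X E F m y (coord_tangent X y c v) (basis_vector (fibre E y) r (\<phi> y) k)) x"
    proof (rule F.hol_sec_cong[OF c V, rotated])
      fix y assume y: "y \<in> ?V"
      then show "conn F W (\<lambda>y\<in>W. m y (?b y)) y (coord_tangent X y c v) \<ominus>\<^bsub>fibre F y\<^esub>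
          m y (conn E W ?b y (coord_tangent X y c v)) =
        hom_connection X E F m y (coord_tangent X y c v) (basis_vector (fibre E y) r (\<phi> y) k)"
        using hom_connection_apply[OF W b, of y "coord_tangent X y c v"] coord_tangent_in[OF cy[OF y]]
        by (simp add: defect_def)
    qed
  qed
qed

end

text \<open>The source and the target carry the same connection, so the two terms of the defect
  cancel.\<close>

lemma (in atlas) hom_connection_Id:
  assumes E: "E \<in> Ob (HVB_cat X)" and x: "x \<in> points X" and \<xi>: "\<xi> \<in> tangent_space X x"
    and e: "e \<in> carrier (fibre E x)" and \<phi>: "coord_iso (fibre E x) r \<phi>" and j: "j < r"
  shows "\<phi> (hom_connection X E E (Id (HVB_cat X) E) x \<xi> e) j = 0"
proof -
  interpret bundle_iso X E E "Id (HVB_cat X) E"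
    using E by unfold_locales (simp_all add: Id_bundle_iso Ob_HVB_cat Id_HVB_cat)
  obtain W r' \<phi>' where t: "(W, r', \<phi>') \<in> trivs E" "x \<in> W" using E.triv_at[OF x] .
  note W = E.triv_open[OF t(1)]
  obtain s where s: "s \<in> holomorphic_sections X E W" "s x = e" using E.section_through[OF t e] .
  have "(\<lambda>y\<in>W. Id (HVB_cat X) E y (s y)) = s"
    using E.section_in[OF W s(1)] E.section_ext[OF W s(1)] openin_subset[OF W]
    by (auto simp: Id_HVB_cat fun_eq_iff extensional_def)
  moreover have "Id (HVB_cat X) E x (conn E W s x \<xi>) = conn E W s x \<xi>"
    using conn_E_in[OF W s(1) t(2) \<xi>] x by (simp add: Id_HVB_cat)
  ultimately show ?thesis
    using hom_connection_apply[OF W s(1) t(2) \<xi>] coord_defect[OF W s(1) t(2) \<xi> \<phi> j] s(2) by simp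
qed

text \<open>The Leibniz rule: in the defect of the composite on a section \<open>s\<close>, the
  image under \<open>n\<close> of the derivative of \<open>m s\<close> is added and
  subtracted.\<close>

lemma (in atlas) hom_connection_Comp:
  assumes m: "bundle_iso X E F m" and n: "bundle_iso X F G n"
    and x: "x \<in> points X" and \<xi>: "\<xi> \<in> tangent_space X x" and e: "e \<in> carrier (fibre E x)"
  shows "hom_connection X E G (Comp (HVB_cat X) E F G n m) x \<xi> e =
    hom_connection X F G n x \<xi> (m x e) \<oplus>\<^bsub>fibre G x\<^esub> n x (hom_connection X E F m x \<xi> e)"
proof -
  interpret m: bundle_iso X E F m by fact
  interpret n: bundle_iso X F G n by fact
  let ?nm = "Comp (HVB_cat X) E F G n m"
  interpret nm: bundle_iso X E G ?nm
    using m.E_Ob n.F_Ob m.iso n.iso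
    by unfold_locales (simp_all add: Comp_HVB_cat Comp_bundle_iso[OF m.E.is_bundle m.F.is_bundle n.F.is_bundle])
  obtain W r \<phi> where t: "(W, r, \<phi>) \<in> trivs E" "x \<in> W" using m.E.triv_at[OF x] .
  note W = m.E.triv_open[OF t(1)]
  obtain s where s: "s \<in> holomorphic_sections X E W" "s x = e" using m.E.section_through[OF t e] .
  let ?ms = "\<lambda>y\<in>W. m y (s y)"
  note ms = m.iso_section[OF W s(1)]
  obtain q \<psi> where \<psi>: "coord_iso (fibre G x) q \<psi>" using n.F.fibre_coord[OF x] .
  note mG = complex_module_closed[OF n.F.fibre_module[OF x]]
  note linn = iso_clinear[OF n.iso x]
  obtain q' \<psi>' where \<psi>': "coord_iso (fibre F x) q' \<psi>'" using m.F.fibre_coord[OF x] .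
  have nms: "(\<lambda>y\<in>W. ?nm y (s y)) = (\<lambda>y\<in>W. n y (?ms y))"
    using m.E.section_in[OF W s(1)] openin_subset[OF W] by (intro restrict_ext) (auto simp: Comp_HVB_cat)
  have nmc: "?nm x (conn E W s x \<xi>) = n x (m x (conn E W s x \<xi>))"
    using m.conn_E_in[OF W s(1) t(2) \<xi>] x by (simp add: Comp_HVB_cat)
  note mc = m.m_conn_in[OF W s(1) t(2) \<xi>] and mF = m.conn_F_in[OF W s(1) t(2) \<xi>]
  note dm = m.defect_in[OF W s(1) t(2) \<xi>]
  have "m.defect W s x \<xi> \<oplus>\<^bsub>fibre F x\<^esub> m x (conn E W s x \<xi>) = conn F W ?ms x \<xi>"
    using m.coord_defect[OF W s(1) t(2) \<xi> \<psi>'] coord_add[OF \<psi>' dm mc]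
    by (intro coord_eqI[OF \<psi>' complex_module_closed(1)[OF m.F.fibre_module[OF x] dm mc] mF]) simp
  then have n_conn: "n x (conn F W ?ms x \<xi>) = n x (m.defect W s x \<xi>) \<oplus>\<^bsub>fibre G x\<^esub> n x (m x (conn E W s x \<xi>))"
    using clinear_add[OF linn dm mc] by simp
  have ndm: "n x (m.defect W s x \<xi>) \<in> carrier (fibre G x)" by (rule clinear_in[OF linn dm])
  have nmcG: "n x (m x (conn E W s x \<xi>)) \<in> carrier (fibre G x)" by (rule clinear_in[OF linn mc])
  note dn = n.defect_in[OF W ms t(2) \<xi>]
  have "nm.defect W s x \<xi> = n.defect W ?ms x \<xi> \<oplus>\<^bsub>fibre G x\<^esub> n x (m.defect W s x \<xi>)"
  proof (rule coord_eqI[OF \<psi> nm.defect_in[OF W s(1) t(2) \<xi>] mG(1)[OF dn ndm]])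
    fix j assume j: "j < q"
    show "\<psi> (nm.defect W s x \<xi>) j = \<psi> (n.defect W ?ms x \<xi> \<oplus>\<^bsub>fibre G x\<^esub> n x (m.defect W s x \<xi>)) j"
      using nm.coord_defect[OF W s(1) t(2) \<xi> \<psi> j] n.coord_defect[OF W ms t(2) \<xi> \<psi> j]
        coord_add[OF \<psi> dn ndm j] coord_add[OF \<psi> ndm nmcG j]
      unfolding nms nmc n_conn by simp
  qed
  then show ?thesis
    using nm.hom_connection_apply[OF W s(1) t(2) \<xi>] n.hom_connection_apply[OF W ms t(2) \<xi>]
      m.hom_connection_apply[OF W s(1) t(2) \<xi>] s(2) t(2) by simp
qed

section \<open>Pullback of bundles\<close>

context atlas
begin

lemma compatible_trivs_sym: "compatible_trivs X F t t' \<Longrightarrow> compatible_trivs X F t' t"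
  by (simp add: compatible_trivs_def)

text \<open>Compatibility through a single trivialization says nothing away from its domain, so
  transitivity needs a covering family: around each point the transition matrix factors through a
  member of \<open>B\<close>.\<close>

lemma compatible_trivs_trans:
  assumes F: "\<And>x. x \<in> points X \<Longrightarrow> module complex_ring (F x)"
    and B: "\<And>t. t \<in> B \<Longrightarrow> is_triv X F t" "points X \<subseteq> (\<Union>(W, r, \<phi>)\<in>B. W)"
    and t: "is_triv X F t" "is_triv X F t'"
    and "\<And>u. u \<in> B \<Longrightarrow> compatible_trivs X F u t" "\<And>u. u \<in> B \<Longrightarrow> compatible_trivs X F u t'"
  shows "compatible_trivs X F t t'"
proof -
  have "holomorphic_matrix X F (W1, r1, \<phi>1) (W2, r2, \<phi>2) (\<lambda>x v. v)"
    if t: "is_triv X F (W1, r1, \<phi>1)" "is_triv X F (W2, r2, \<phi>2)"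
      and comp: "\<And>u. u \<in> B \<Longrightarrow> compatible_trivs X F u (W1, r1, \<phi>1)" "\<And>u. u \<in> B \<Longrightarrow> compatible_trivs X F u (W2, r2, \<phi>2)"
    for W1 r1 \<phi>1 W2 r2 \<phi>2
    unfolding holomorphic_matrix_def prod.case holomorphic_fun_iff
  proof (intro allI impI ballI)
    fix k j x c assume k: "k < r1" and j: "j < r2" and x: "x \<in> W1 \<inter> W2" and c: "c \<in> charts_at X x"
    obtain W r \<phi> where u: "(W, r, \<phi>) \<in> B" "x \<in> W" using B(2) charts_at_points[OF c] by blast
    have open': "openin (mtop X) W" "openin (mtop X) W1" "openin (mtop X) W2"
      and coord: "\<And>y. y \<in> W \<Longrightarrow> coord_iso (F y) r (\<phi> y)" "\<And>y. y \<in> W1 \<Longrightarrow> coord_iso (F y) r1 (\<phi>1 y)"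
        "\<And>y. y \<in> W2 \<Longrightarrow> coord_iso (F y) r2 (\<phi>2 y)"
      using B(1)[OF u(1)] t by (auto simp: is_triv_def)
    let ?U = "W \<inter> W1 \<inter> W2"
    have U: "openin (mtop X) ?U" "x \<in> ?U" using open' x u by (auto intro!: openin_Int)
    let ?b = "\<lambda>y. basis_vector (F y) r1 (\<phi>1 y) k"
    have "\<phi>2 y (?b y) j = (\<Sum>i<r. \<phi> y (?b y) i * \<phi>2 y (basis_vector (F y) r (\<phi> y) i) j)" if "y \<in> ?U" for y
      using that openin_subset[OF U(1)] j
      by (intro coord_clinear[OF F coord(1) coord(3) clinear_id] basis_vector_in[OF coord(2)]) auto
    moreover have "hol_in c (\<lambda>y. \<Sum>i<r. \<phi> y (?b y) i * \<phi>2 y (basis_vector (F y) r (\<phi> y) i) j) x"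
    proof (intro hol_in_sum hol_in_mult)
      fix i assume "i \<in> {..<r}"
      then show "hol_in c (\<lambda>y. \<phi> y (?b y) i) x" "hol_in c (\<lambda>y. \<phi>2 y (basis_vector (F y) r (\<phi> y) i) j) x"
        using comp[OF u(1)] u(2) x c k j by (auto simp: compatible_trivs_def holomorphic_matrix_def holomorphic_fun_iff)
    qed
    ultimately show "hol_in c (\<lambda>x. \<phi>2 x (basis_vector (F x) r1 (\<phi>1 x) k) j) x"
      using hol_in_cong[OF c U, of "\<lambda>y. \<phi>2 y (?b y) j"] by simp
  qed
  then show ?thesis using assms(4-7) unfolding compatible_trivs_def by (metis prod_cases3)
qed

text \<open>As for atlases of manifolds: any two members of the closure are compatible through the
  covering family \<open>B\<close>, so closing a second time adds and removes nothing.\<close>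

lemma triv_closure_maximal:
  assumes F: "\<And>x. x \<in> points X \<Longrightarrow> module complex_ring (F x)"
    and B: "\<And>t. t \<in> B \<Longrightarrow> is_triv X F t" "points X \<subseteq> (\<Union>(W, r, \<phi>)\<in>B. W)"
    and comp: "\<And>t t'. t \<in> B \<Longrightarrow> t' \<in> B \<Longrightarrow> compatible_trivs X F t t'"
  shows "B \<subseteq> triv_closure X F B" "triv_closure X F (triv_closure X F B) = triv_closure X F B"
proof -
  show B': "B \<subseteq> triv_closure X F B" using B(1) comp by (auto simp: triv_closure_def)
  have "compatible_trivs X F t t'" if "t \<in> triv_closure X F B" "t' \<in> triv_closure X F B" for t t'
  proof (rule compatible_trivs_trans[OF F B])
    show "is_triv X F t" "is_triv X F t'" using that by (simp_all add: triv_closure_def)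
    fix u assume "u \<in> B"
    then have "compatible_trivs X F t u" "compatible_trivs X F t' u" using that by (simp_all add: triv_closure_def)
    then show "compatible_trivs X F u t" "compatible_trivs X F u t'" by (blast intro: compatible_trivs_sym)+
  qed
  then show "triv_closure X F (triv_closure X F B) = triv_closure X F B"
    using B' by (auto simp: triv_closure_def)
qed

text \<open>A covering subfamily determines the whole holomorphic structure. Equality of two
  pullback structures is thereby reduced to an inclusion for the pulled back
  trivializations.\<close>

lemma triv_closure_cover:
  assumes E: "holomorphic_bundle X E" and B: "B \<subseteq> trivs E" "points X \<subseteq> (\<Union>(W, r, \<phi>)\<in>B. W)"
  shows "triv_closure X (fibre E) B = trivs E"
proof
  interpret E: holo_bundle X E by unfold_locales fact
  have tr: "trivs E = triv_closure X (fibre E) (trivs E)" using E by (simp add: holomorphic_bundle_def)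
  have triv: "is_triv X (fibre E) t" if "t \<in> trivs E" for t using that tr by (auto simp: triv_closure_def)
  have comp: "compatible_trivs X (fibre E) t t'" if "t \<in> trivs E" "t' \<in> trivs E" for t t'
    using that tr by (auto simp: triv_closure_def)
  show "trivs E \<subseteq> triv_closure X (fibre E) B" using triv comp B(1) by (auto simp: triv_closure_def)
  show "triv_closure X (fibre E) B \<subseteq> trivs E"
  proof
    fix t assume t: "t \<in> triv_closure X (fibre E) B"
    have "compatible_trivs X (fibre E) t t'" if "t' \<in> trivs E" for t'
    proof (rule compatible_trivs_trans[OF E.fibre_module triv[OF subsetD[OF B(1)]] B(2) _ triv[OF that]])
      show "is_triv X (fibre E) t" using t by (simp add: triv_closure_def)
      fix u assume u: "u \<in> B"
      then have "compatible_trivs X (fibre E) t u" using t by (simp add: triv_closure_def)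
      then show "compatible_trivs X (fibre E) u t" by (rule compatible_trivs_sym)
      show "compatible_trivs X (fibre E) u t'" using comp[OF _ that] B(1) u by blast
    qed
    then have "t \<in> triv_closure X (fibre E) (trivs E)" using t by (auto simp: triv_closure_def)
    then show "t \<in> trivs E" using tr by simp
  qed
qed

text \<open>The last component of a trivialization is arbitrary outside \<open>W\<close>. This
  matters when pulling back along a map that is the identity on points only.\<close>

lemma trivs_cong:
  assumes E: "holomorphic_bundle X E" and t: "(W, r, \<phi>) \<in> trivs E" and eq: "\<And>x. x \<in> W \<Longrightarrow> \<phi>' x = \<phi> x"
  shows "(W, r, \<phi>') \<in> trivs E"
proof -
  interpret E: holo_bundle X E by unfold_locales fact
  have "compatible_trivs X (fibre E) (W, r, \<phi>') (W1, r1, \<phi>1)" if t1: "(W1, r1, \<phi>1) \<in> trivs E" for W1 r1 \<phi>1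
  proof -
    have comp: "compatible_trivs X (fibre E) (W, r, \<phi>) (W1, r1, \<phi>1)" by (rule E.triv_compatible[OF t t1])
    have U: "openin (mtop X) (W \<inter> W1)" by (intro openin_Int E.triv_open[OF t] E.triv_open[OF t1])
    have "hol_in c (\<lambda>y. \<phi>1 y (basis_vector (fibre E y) r (\<phi>' y) k) j) x \<longleftrightarrow>
        hol_in c (\<lambda>y. \<phi>1 y (basis_vector (fibre E y) r (\<phi> y) k) j) x"
      "hol_in c (\<lambda>y. \<phi>' y (basis_vector (fibre E y) r1 (\<phi>1 y) k) j) x \<longleftrightarrow>
        hol_in c (\<lambda>y. \<phi> y (basis_vector (fibre E y) r1 (\<phi>1 y) k) j) x"
      if "c \<in> charts_at X x" "x \<in> W \<inter> W1" for c x k j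
      using eq by (auto intro!: hol_in_cong[OF that(1) U that(2)])
    then show ?thesis
      using comp by (auto simp: compatible_trivs_def holomorphic_matrix_def holomorphic_fun_iff)
  qed
  moreover have "is_triv X (fibre E) (W, r, \<phi>')"
    using E.triv_open[OF t] E.triv_coord[OF t] eq by (auto simp: is_triv_def)
  ultimately have "(W, r, \<phi>') \<in> triv_closure X (fibre E) (trivs E)" by (auto simp: triv_closure_def)
  then show ?thesis using E by (simp add: holomorphic_bundle_def)
qed

end

section \<open>The pulled back bundle and its sheets\<close>

definition pulled_trivs ::
  "('p, 'v) cmanifold \<Rightarrow> ('p \<Rightarrow> 'q) \<Rightarrow> ('q, 'w, 'f) vbundle \<Rightarrow> ('p, 'f) triv set" where
  "pulled_trivs X f E = (\<lambda>(W, r, \<phi>). (f -` W \<inter> points X, r, \<lambda>x. \<phi> (f x))) ` trivs E"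

text \<open>\<open>Q\<close> is the pullback bundle of \<open>E\<close> with an arbitrary connection component.\<close>

locale etale_bundle = etale_map X Y f + E: holo_bundle Y E
  for X :: "('p, 'v::complex_model_space) cmanifold" and Y :: "('q, 'v) cmanifold" and f
    and E :: "('q, 'v, 'f) vbundle" +
  fixes Q :: "('p, 'v, 'f) vbundle"
  assumes fibre_Q: "fibre Q = (\<lambda>x\<in>points X. fibre E (f x))"
    and trivs_Q: "trivs Q = triv_closure X (fibre Q) (pulled_trivs X f E)"
begin

lemma fibre_Q_apply [simp]: "x \<in> points X \<Longrightarrow> fibre Q x = fibre E (f x)"
  by (simp add: fibre_Q)

lemma pulled_triv: "(W, r, \<phi>) \<in> trivs E \<Longrightarrow> (f -` W \<inter> points X, r, \<lambda>x. \<phi> (f x)) \<in> pulled_trivs X f E"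
  by (force simp: pulled_trivs_def)

lemma module_Q: "x \<in> points X \<Longrightarrow> module complex_ring (fibre Q x)"
  using E.fibre_module image_points by simp

lemma pulled_trivs_is_triv: "t \<in> pulled_trivs X f E \<Longrightarrow> is_triv X (fibre Q) t"
  using openin_preimage E.triv_open E.triv_coord by (auto simp: pulled_trivs_def is_triv_def)

lemma pulled_trivs_cover: "points X \<subseteq> (\<Union>(W, r, \<phi>)\<in>pulled_trivs X f E. W)"
proof
  fix x assume x: "x \<in> points X"
  obtain W r \<phi> where t: "(W, r, \<phi>) \<in> trivs E" "f x \<in> W" using E.triv_at[OF image_points[OF x]] .
  show "x \<in> (\<Union>(W, r, \<phi>)\<in>pulled_trivs X f E. W)"
    by (rule UN_I[OF pulled_triv[OF t(1)]]) (use t(2) x in simp)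
qed

lemma pulled_trivs_compatible:
  assumes "t \<in> pulled_trivs X f E" "t' \<in> pulled_trivs X f E"
  shows "compatible_trivs X (fibre Q) t t'"
proof -
  have "holomorphic_matrix X (fibre Q) (f -` W \<inter> points X, r, \<lambda>x. \<phi> (f x)) (f -` W' \<inter> points X, r', \<lambda>x. \<phi>' (f x)) (\<lambda>x v. v)"
    if t: "(W, r, \<phi>) \<in> trivs E" "(W', r', \<phi>') \<in> trivs E" for W r \<phi> W' r' \<phi>'
    unfolding holomorphic_matrix_def prod.case holomorphic_fun_iff
  proof (intro allI impI ballI)
    fix k j x c assume k: "k < r" and j: "j < r'"
      and x: "x \<in> f -` W \<inter> points X \<inter> (f -` W' \<inter> points X)" and c: "c \<in> charts_at X x"
    obtain c' where c': "c' \<in> charts_at Y (f x)" "chart_over f c c'" using chart_below[OF c] .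
    then have c'Y: "c' \<in> charts Y" by (simp add: charts_at_iff)
    have "hol_in c' (\<lambda>y. \<phi>' y (basis_vector (fibre E y) r (\<phi> y) k) j) (f x)"
      using E.triv_compatible[OF t] c'(1) x k j
      by (auto simp: compatible_trivs_def holomorphic_matrix_def holomorphic_fun_iff)
    then show "hol_in c (\<lambda>x. \<phi>' (f x) (basis_vector (fibre Q x) r (\<phi> (f x)) k) j) x"
      using hol_in_over[OF c c'Y c'(2) openin_topspace, where h = "\<lambda>y. \<phi>' y (basis_vector (fibre E y) r (\<phi> y) k) j"
          and g = "\<lambda>x. \<phi>' (f x) (basis_vector (fibre Q x) r (\<phi> (f x)) k) j"] x by simp
  qed
  then show ?thesis using assms by (auto simp: pulled_trivs_def compatible_trivs_def)
qed

lemma Q_bundle: "holomorphic_bundle X Q"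
proof -
  note max = X.triv_closure_maximal[OF module_Q pulled_trivs_is_triv pulled_trivs_cover pulled_trivs_compatible,
      folded trivs_Q]
  have "W \<subseteq> points X" if "(W, r, \<phi>) \<in> trivs Q" for W r \<phi>
    using that trivs_Q by (auto simp: triv_closure_def is_triv_def dest!: openin_subset)
  then have "(case t of (W, r, \<phi>) \<Rightarrow> W) \<subseteq> points X" if "t \<in> trivs Q" for t
    using that by (cases t) simp
  then have "(\<Union>(W, r, \<phi>)\<in>trivs Q. W) = points X"
    by (intro equalityI UN_least order_trans[OF pulled_trivs_cover UN_mono[OF max(1) order_refl]])
  then show ?thesis using module_Q max(2) by (simp add: holomorphic_bundle_def) (simp add: fibre_Q)
qed

sublocale Q: holo_bundle X Q
  by unfold_locales (rule Q_bundle)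

lemma pulled_triv_Q: "(W, r, \<phi>) \<in> trivs E \<Longrightarrow> (f -` W \<inter> points X, r, \<lambda>x. \<phi> (f x)) \<in> trivs Q"
  using X.triv_closure_maximal(1)[OF module_Q pulled_trivs_is_triv pulled_trivs_cover pulled_trivs_compatible,
      folded trivs_Q] pulled_triv by blast

text \<open>In a pulled back trivialization the coordinates of \<open>s\<close> at \<open>y\<close>
  are those of \<open>s'\<close> at \<open>f y\<close>. Both directions are used, to pull sections
  back and to push them down.\<close>

lemma hol_sec_over:
  assumes c: "c \<in> charts_at X x" "c' \<in> charts Y" "chart_over f c c'"
    and V: "openin (mtop X) V" "x \<in> V" and eq: "\<And>y. y \<in> V \<Longrightarrow> s y = s' (f y)"
  shows "hol_sec X Q c s x \<longleftrightarrow> hol_sec Y E c' s' (f x)"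
proof
  have c'x: "c' \<in> charts_at Y (f x)" by (rule chart_over_at[OF c(3,2)]) (use c(1) in \<open>simp add: charts_at_iff\<close>)
  have x: "x \<in> points X" by (rule X.charts_at_points[OF c(1)])
  have hol_eq: "hol_in c (\<lambda>y. \<phi> (f y) (s y) j) x \<longleftrightarrow> hol_in c' (\<lambda>q. \<phi> q (s' q) j) (f x)" for \<phi> :: "'q \<Rightarrow> 'f \<Rightarrow> nat \<Rightarrow> complex" and j
    by (rule hol_in_over[OF c V]) (simp add: eq)
  obtain W r \<phi> where t: "(W, r, \<phi>) \<in> trivs E" "f x \<in> W" using E.triv_at[OF image_points[OF x]] .
  { assume s: "hol_sec X Q c s x"
    obtain V' where V': "openin (mtop X) V'" "x \<in> V'" "\<forall>y\<in>V'. s y \<in> carrier (fibre Q y)"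
      using s by (auto simp: hol_sec_def)
    have VV: "openin (mtop X) (V \<inter> V')" using V V' by blast
    show "hol_sec Y E c' s' (f x)"
    proof (rule E.hol_secI[OF c'x t openin_image[OF VV]])
      fix q assume "q \<in> f ` (V \<inter> V')"
      then show "s' q \<in> carrier (fibre E q)" using V'(3) eq openin_subset[OF VV] by fastforce
    next
      fix j assume "j < r"
      then show "hol_in c' (\<lambda>y. \<phi> y (s' y) j) (f x)"
        using hol_sec_coord[OF s pulled_triv_Q[OF t(1)]] t(2) x hol_eq by simp
    qed (use V V' in blast) }
  { assume s': "hol_sec Y E c' s' (f x)"
    obtain V' where V': "openin (mtop Y) V'" "f x \<in> V'" "\<forall>y\<in>V'. s' y \<in> carrier (fibre E y)"
      using s' by (auto simp: hol_sec_def)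
    have VV: "openin (mtop X) (V \<inter> (f -` V' \<inter> points X))" using V openin_preimage[OF V'(1)] by blast
    show "hol_sec X Q c s x"
    proof (rule Q.hol_secI[OF c(1) pulled_triv_Q[OF t(1)] _ VV])
      fix j assume "j < r"
      then show "hol_in c (\<lambda>y. \<phi> (f y) (s y) j) x" using hol_sec_coord[OF s' t] hol_eq by simp
    qed (use V V' x t eq in auto) }
qed

lemma pullback_section:
  assumes W: "openin (mtop Y) W" and s: "s \<in> holomorphic_sections Y E W"
  shows "(\<lambda>y\<in>f -` W \<inter> points X. s (f y)) \<in> holomorphic_sections X Q (f -` W \<inter> points X)"
proof (rule Q.sectionI[OF openin_preimage[OF W]])
  fix x c assume x: "x \<in> f -` W \<inter> points X" and c: "c \<in> charts_at X x"
  obtain c' where c': "c' \<in> charts_at Y (f x)" "chart_over f c c'" using chart_below[OF c] .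
  then have "c' \<in> charts Y" by (simp add: charts_at_iff)
  then show "hol_sec X Q c (\<lambda>y. s (f y)) x"
    using hol_sec_over[OF c _ c'(2) openin_topspace, where s' = s and s = "\<lambda>y. s (f y)"] E.section_hol[OF W s _ c'(1)] x by simp
qed

text \<open>Over a sheet, sections of the pulled back bundle descend to its image, which is open,
  and there the connection of \<open>E\<close> can be applied to them.\<close>

definition sheet :: "'p set \<Rightarrow> bool" where
  "sheet V \<longleftrightarrow> openin (mtop X) V \<and> inj_on f V"

definition push :: "'p set \<Rightarrow> ('p \<Rightarrow> 'f) \<Rightarrow> 'q \<Rightarrow> 'f" where
  "push V s = (\<lambda>q\<in>f ` V. s (inv_into V f q))"

lemma sheet_chart:
  assumes "openin (mtop X) W" "c \<in> charts_at X x" "x \<in> W"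
  shows "sheet (fst c \<inter> W)" "x \<in> fst c \<inter> W"
proof -
  have c: "c \<in> charts X" "x \<in> fst c" using assms by (auto simp: charts_at_iff)
  obtain c' where "c' \<in> charts_at Y (f x)" "chart_over f c c'" using chart_below[OF assms(2)] .
  then show "sheet (fst c \<inter> W)"
    using chart_over_inj[of c c'] c X.chart_openin[OF c(1)] assms(1) by (auto simp: sheet_def intro: inj_on_subset)
  show "x \<in> fst c \<inter> W" using c assms(3) by simp
qed

lemma sheet_inv: "sheet V \<Longrightarrow> y \<in> V \<Longrightarrow> inv_into V f (f y) = y"
  by (simp add: sheet_def)

lemma push_apply: "sheet V \<Longrightarrow> y \<in> V \<Longrightarrow> push V s (f y) = s y"
  by (simp add: push_def sheet_inv)

lemma push_eqI: "sheet V \<Longrightarrow> t \<in> extensional (f ` V) \<Longrightarrow> (\<And>y. y \<in> V \<Longrightarrow> s y = t (f y)) \<Longrightarrow> push V s = t"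
  by (rule extensionalityI[of _ "f ` V"]) (auto simp: push_apply, simp add: push_def)

lemma push_section:
  assumes V: "sheet V" "V \<subseteq> W" and W: "openin (mtop X) W" and s: "s \<in> holomorphic_sections X Q W"
  shows "push V s \<in> holomorphic_sections Y E (f ` V)"
  unfolding push_def
proof (rule E.sectionI)
  have oV: "openin (mtop X) V" using V(1) by (simp add: sheet_def)
  then show "openin (mtop Y) (f ` V)" by (rule openin_image)
  fix q c' assume q: "q \<in> f ` V" and c': "c' \<in> charts_at Y q"
  then obtain x where x: "x \<in> V" "q = f x" by blast
  have xp: "x \<in> points X" using openin_subset[OF oV] x(1) by blast
  obtain c where c: "c \<in> charts_at X x" "chart_over f c c'" using chart_above[of c' x] c' x xp by blast
  have "c' \<in> charts Y" using c' by (simp add: charts_at_iff)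
  then have "hol_sec X Q c s x \<longleftrightarrow> hol_sec Y E c' (\<lambda>q. s (inv_into V f q)) (f x)"
    using sheet_inv[OF V(1)] by (intro hol_sec_over[OF c(1) _ c(2) oV x(1)]) auto
  then show "hol_sec Y E c' (\<lambda>q. s (inv_into V f q)) q"
    using Q.section_hol[OF W s _ c(1)] x V(2) by auto
qed

end

section \<open>Existence and uniqueness of the pulled back connection\<close>

lemma (in atlas) bundle_one_forms_closed_ext:
  assumes "holomorphic_bundle X E" "openin (mtop X) W" "\<eta> \<in> bundle_one_forms X E W"
  shows "\<eta> \<in> extensional W" "x \<in> W \<Longrightarrow> \<eta> x \<in> extensional (tangent_space X x)"
proof -
  interpret holo_bundle X E by unfold_locales fact
  note e = one_form_ext[OF assms(2,3)]
  show "\<eta> \<in> extensional W" using e by (simp add: PiE_iff)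
  show "x \<in> W \<Longrightarrow> \<eta> x \<in> extensional (tangent_space X x)" using PiE_mem[OF e, of x] by (simp add: PiE_iff)
qed

lemma (in atlas) connection_eqI:
  assumes E: "holomorphic_bundle X E"
    and N: "N \<in> (\<Pi>\<^sub>E W\<in>{W. openin (mtop X) W}. holomorphic_sections X E W \<rightarrow>\<^sub>E bundle_one_forms X E W)"
    and N': "N' \<in> (\<Pi>\<^sub>E W\<in>{W. openin (mtop X) W}. holomorphic_sections X E W \<rightarrow>\<^sub>E bundle_one_forms X E W)"
    and eq: "\<And>W s x \<xi>. openin (mtop X) W \<Longrightarrow> s \<in> holomorphic_sections X E W \<Longrightarrow> x \<in> W \<Longrightarrow> \<xi> \<in> tangent_space X x \<Longrightarrow>
      N W s x \<xi> = N' W s x \<xi>"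
  shows "N = N'"
proof (rule PiE_ext[OF N N'])
  fix W assume W: "W \<in> {W. openin (mtop X) W}"
  show "N W = N' W"
  proof (rule PiE_ext[OF PiE_mem[OF N W] PiE_mem[OF N' W]])
    fix s assume s: "s \<in> holomorphic_sections X E W"
    have W': "openin (mtop X) W" using W by simp
    have f: "N W s \<in> bundle_one_forms X E W" "N' W s \<in> bundle_one_forms X E W"
      using PiE_mem[OF PiE_mem[OF N W] s] PiE_mem[OF PiE_mem[OF N' W] s] .
    show "N W s = N' W s"
    proof (rule extensionalityI[OF bundle_one_forms_closed_ext(1)[OF E W' f(1)] bundle_one_forms_closed_ext(1)[OF E W' f(2)]])
      fix x assume x: "x \<in> W"
      show "N W s x = N' W s x"
        by (rule extensionalityI[OF bundle_one_forms_closed_ext(2)[OF E W' f(1) x] bundle_one_forms_closed_ext(2)[OF E W' f(2) x]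
          eq[OF W' s x]])
    qed
  qed
qed

locale etale_bundle_conn = etale_bundle +
  assumes E_conn: "holomorphic_connection Y E (conn E)"
begin

text \<open>The only possible formula: near \<open>x\<close> the section \<open>s\<close> is the
  pullback of \<open>push V s\<close>, whose derivative is prescribed. The chosen chart merely
  provides a sheet around \<open>x\<close>.\<close>

definition pulled_conn :: "('a, 'b, 'd) connection" where
  "pulled_conn = (\<lambda>W\<in>{W. openin (mtop X) W}. \<lambda>s\<in>holomorphic_sections X Q W. \<lambda>x\<in>W. \<lambda>\<xi>\<in>tangent_space X x.
     let V = fst (SOME c. c \<in> charts_at X x) \<inter> W
     in conn E (f ` V) (push V s) (f x) (tangent_map X Y f x \<xi>))"

text \<open>The property under the definite description in \<open>bundle_pullback\<close>.\<close>

definition pullback_spec :: "('a, 'b, 'd) connection \<Rightarrow> bool" where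
  "pullback_spec N \<longleftrightarrow> holomorphic_connection X Q N \<and>
     (\<forall>W. openin (mtop Y) W \<longrightarrow> (\<forall>s\<in>holomorphic_sections Y E W.
        \<forall>x\<in>f -` W \<inter> points X. \<forall>\<xi>\<in>tangent_space X x.
          N (f -` W \<inter> points X) (\<lambda>y\<in>f -` W \<inter> points X. s (f y)) x \<xi> =
            conn E W s (f x) (tangent_map X Y f x \<xi>)))"

lemma conn_push_restrict:
  assumes V: "sheet V" "V \<subseteq> W" "sheet V'" "V' \<subseteq> V" "x \<in> V'" and W: "openin (mtop X) W" and s: "s \<in> holomorphic_sections X Q W"
  shows "conn E (f ` V') (push V' s) (f x) = conn E (f ` V) (push V s) (f x)"
proof -
  have o: "openin (mtop Y) (f ` V)" "openin (mtop Y) (f ` V')"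
    using V by (auto simp: sheet_def intro: openin_image)
  have "push V' s = restrict (push V s) (f ` V')"
    using V(4) by (intro push_eqI[OF V(3)]) (auto simp: push_apply[OF V(1)] subset_iff)
  then show ?thesis
    using connection_restrict[OF E_conn o image_mono[OF V(4)] push_section[OF V(1,2) W s]] V(5) by simp
qed

text \<open>Any sheet may be used. Two sheets around \<open>x\<close> are compared through their
  intersection, since the connection of \<open>E\<close> commutes with restriction.\<close>

lemma pulled_conn_apply:
  assumes W: "openin (mtop X) W" and s: "s \<in> holomorphic_sections X Q W"
    and V: "sheet V" "V \<subseteq> W" "x \<in> V" and \<xi>: "\<xi> \<in> tangent_space X x"
  shows "pulled_conn W s x \<xi> = conn E (f ` V) (push V s) (f x) (tangent_map X Y f x \<xi>)"
proof -
  define V0 where "V0 = fst (SOME c. c \<in> charts_at X x) \<inter> W"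
  have xW: "x \<in> W" using V by blast
  have "x \<in> points X" using openin_subset[OF W] xW by blast
  then have "(SOME c. c \<in> charts_at X x) \<in> charts_at X x"
    using someI_ex[of "\<lambda>c. c \<in> charts_at X x"] X.charts_at_nonempty by simp
  note V0 = sheet_chart[OF W this xW, folded V0_def]
  have V0W: "V0 \<subseteq> W" by (simp add: V0_def)
  have V': "sheet (V \<inter> V0)" using V(1) V0(1) by (auto simp: sheet_def intro: inj_on_subset)
  have "pulled_conn W s x \<xi> = conn E (f ` V0) (push V0 s) (f x) (tangent_map X Y f x \<xi>)"
    using W s xW \<xi> by (simp add: pulled_conn_def V0_def Let_def)
  also have "\<dots> = conn E (f ` (V \<inter> V0)) (push (V \<inter> V0) s) (f x) (tangent_map X Y f x \<xi>)"
    using conn_push_restrict[OF V0(1) V0W V' Int_lower2 _ W s, of x] V0(2) V(3) by simp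
  also have "\<dots> = conn E (f ` V) (push V s) (f x) (tangent_map X Y f x \<xi>)"
    using conn_push_restrict[OF V(1,2) V' Int_lower1 _ W s, of x] V0(2) V(3) by simp
  finally show ?thesis .
qed

lemma sheet_within:
  assumes "openin (mtop X) W" "x \<in> W"
  obtains V where "sheet V" "V \<subseteq> W" "x \<in> V"
proof -
  obtain c where "c \<in> charts_at X x" using X.charts_at_nonempty openin_subset[OF assms(1)] assms(2) by blast
  from sheet_chart[OF assms(1) this assms(2)] show ?thesis using that by blast
qed

lemma push_form:
  assumes "sheet V" "V \<subseteq> W" "openin (mtop X) W" "s \<in> holomorphic_sections X Q W"
  shows "openin (mtop Y) (f ` V)" "conn E (f ` V) (push V s) \<in> bundle_one_forms Y E (f ` V)"
proof -
  show o: "openin (mtop Y) (f ` V)" using assms(1) openin_image by (simp add: sheet_def)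
  show "conn E (f ` V) (push V s) \<in> bundle_one_forms Y E (f ` V)"
    by (rule connection_form[OF E_conn o push_section[OF assms]])
qed

lemma pulled_conn_form:
  assumes W: "openin (mtop X) W" and s: "s \<in> holomorphic_sections X Q W"
  shows "pulled_conn W s \<in> bundle_one_forms X Q W"
  unfolding Q.bundle_one_forms_iff[OF W]
proof (intro conjI ballI allI)
  have in1: "pulled_conn W s x \<xi> \<in> carrier (fibre Q x)" if x: "x \<in> W" and \<xi>: "\<xi> \<in> tangent_space X x" for x \<xi>
  proof -
    obtain V where V: "sheet V" "V \<subseteq> W" "x \<in> V" using sheet_within[OF W x] .
    have xp: "x \<in> points X" using openin_subset[OF W] x by blast
    note pf = push_form[OF V(1,2) W s]
    show ?thesis
      using E.one_form_in[OF pf _ tangent_map_in[OF xp \<xi>]] V(3) pulled_conn_apply[OF W s V \<xi>] xp by simp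
  qed
  then show "pulled_conn W s \<in> (\<Pi>\<^sub>E x\<in>W. tangent_space X x \<rightarrow>\<^sub>E carrier (fibre Q x))"
    using W s by (auto simp: pulled_conn_def PiE_iff)
next
  fix x \<xi> assume x: "x \<in> W" and \<xi>: "\<xi> \<in> tangent_space X x"
  obtain V where V: "sheet V" "V \<subseteq> W" "x \<in> V" using sheet_within[OF W x] .
  have xp: "x \<in> points X" using openin_subset[OF W] x by blast
  note pf = push_form[OF V(1,2) W s]
  { fix \<zeta> assume \<zeta>: "\<zeta> \<in> tangent_space X x"
    show "pulled_conn W s x (tangent_add X x \<xi> \<zeta>) = pulled_conn W s x \<xi> \<oplus>\<^bsub>fibre Q x\<^esub> pulled_conn W s x \<zeta>"
      using E.one_form_add[OF pf _ tangent_map_in[OF xp \<xi>] tangent_map_in[OF xp \<zeta>]] V(3) xp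
        pulled_conn_apply[OF W s V \<xi>] pulled_conn_apply[OF W s V \<zeta>] pulled_conn_apply[OF W s V X.tangent_add_in[OF \<xi> \<zeta>]]
      by (simp add: tangent_map_add[OF xp \<xi> \<zeta>]) }
  show "pulled_conn W s x (tangent_scale X x a \<xi>) = a \<odot>\<^bsub>fibre Q x\<^esub> pulled_conn W s x \<xi>" for a
    using E.one_form_scale[OF pf _ tangent_map_in[OF xp \<xi>]] V(3) xp
      pulled_conn_apply[OF W s V \<xi>] pulled_conn_apply[OF W s V X.tangent_scale_in[OF \<xi>]]
    by (simp add: tangent_map_scale[OF xp \<xi>])
next
  fix x c v assume x: "x \<in> W" and c: "c \<in> charts_at X x"
  note V = sheet_chart[OF W c x]
  let ?V = "fst c \<inter> W"
  note pf = push_form[OF V(1) _ W s]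
  obtain c' where c': "c' \<in> charts_at Y (f x)" "chart_over f c c'" using chart_below[OF c] .
  have c'Y: "c' \<in> charts Y" using c' by (simp add: charts_at_iff)
  have oV: "openin (mtop X) ?V" using V(1) by (simp add: sheet_def)
  have "pulled_conn W s y (coord_tangent X y c v) = conn E (f ` ?V) (push ?V s) (f y) (coord_tangent Y (f y) c' v)"
    if y: "y \<in> ?V" for y
  proof -
    have cy: "c \<in> charts_at X y" using y c by (simp add: charts_at_iff)
    show ?thesis
      using pulled_conn_apply[OF W s V(1) _ y X.coord_tangent_in[OF cy]] tangent_map_coord[OF cy c'Y c'(2)] by simp
  qed
  then have "hol_sec X Q c (\<lambda>y. pulled_conn W s y (coord_tangent X y c v)) x \<longleftrightarrow>
     hol_sec Y E c' (\<lambda>q. conn E (f ` ?V) (push ?V s) q (coord_tangent Y q c' v)) (f x)"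
    by (intro hol_sec_over[OF c c'Y c'(2) oV V(2)])
  then show "hol_sec X Q c (\<lambda>y. pulled_conn W s y (coord_tangent X y c v)) x"
    using E.one_form_hol[OF pf _ c'(1)] V(2) by blast
qed

lemma pulled_conn_connection: "holomorphic_connection X Q pulled_conn"
  unfolding holomorphic_connection_def
proof (intro conjI allI impI ballI)
  show "pulled_conn \<in> (\<Pi>\<^sub>E W\<in>{W. openin (mtop X) W}. holomorphic_sections X Q W \<rightarrow>\<^sub>E bundle_one_forms X Q W)"
    using pulled_conn_form by (auto simp: PiE_iff) (auto simp: pulled_conn_def)
next
  fix W s t x \<xi>
  assume *: "openin (mtop X) W \<and> s \<in> holomorphic_sections X Q W \<and> t \<in> holomorphic_sections X Q W"
    and x: "x \<in> W" and \<xi>: "\<xi> \<in> tangent_space X x"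
  then have W: "openin (mtop X) W" and s: "s \<in> holomorphic_sections X Q W" and t: "t \<in> holomorphic_sections X Q W" by auto
  obtain V where V: "sheet V" "V \<subseteq> W" "x \<in> V" using sheet_within[OF W x] .
  have xp: "y \<in> points X" if "y \<in> W" for y using openin_subset[OF W] that by blast
  have "push V (\<lambda>y\<in>W. s y \<oplus>\<^bsub>fibre Q y\<^esub> t y) = (\<lambda>q\<in>f ` V. push V s q \<oplus>\<^bsub>fibre E q\<^esub> push V t q)"
    using V(2) xp by (intro push_eqI[OF V(1)]) (auto simp: push_apply[OF V(1)] subset_iff)
  then show "pulled_conn W (\<lambda>y\<in>W. s y \<oplus>\<^bsub>fibre Q y\<^esub> t y) x \<xi> = pulled_conn W s x \<xi> \<oplus>\<^bsub>fibre Q x\<^esub> pulled_conn W t x \<xi>"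
    using connection_add[OF E_conn push_form(1)[OF V(1,2) W s] push_section[OF V(1,2) W s] push_section[OF V(1,2) W t]
        _ tangent_map_in[OF xp[OF x] \<xi>]] V(3) xp[OF x]
      pulled_conn_apply[OF W s V \<xi>] pulled_conn_apply[OF W t V \<xi>] pulled_conn_apply[OF W Q.section_add[OF W s t] V \<xi>]
    by simp
next
  fix W s g x \<xi>
  assume *: "openin (mtop X) W \<and> s \<in> holomorphic_sections X Q W \<and> holomorphic_fun X W g"
    and x: "x \<in> W" and \<xi>: "\<xi> \<in> tangent_space X x"
  then have W: "openin (mtop X) W" and s: "s \<in> holomorphic_sections X Q W" and g: "holomorphic_fun X W g" by auto
  obtain V where V: "sheet V" "V \<subseteq> W" "x \<in> V" using sheet_within[OF W x] .
  have oV: "openin (mtop X) V" using V(1) by (simp add: sheet_def)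
  have xp: "y \<in> points X" if "y \<in> W" for y using openin_subset[OF W] that by blast
  \<comment> \<open>On the sheet a function upstairs becomes a function on the image, with the same
    differential, so the Leibniz rule of \<open>E\<close> can be applied to it.\<close>
  let ?h = "\<lambda>q. g (inv_into V f q)"
  have hf: "g y = ?h (f y)" if "y \<in> V" for y using sheet_inv[OF V(1) that] by simp
  have h: "hol_in c' ?h (f y)" if y: "y \<in> V" and c': "c' \<in> charts_at Y (f y)" for y c'
  proof -
    have yp: "y \<in> points X" using xp V(2) y by blast
    obtain c where c: "c \<in> charts_at X y" "chart_over f c c'" using chart_above[OF c' yp] .
    have "c' \<in> charts Y" using c' by (simp add: charts_at_iff)
    then have "hol_in c g y \<longleftrightarrow> hol_in c' ?h (f y)" using hf by (intro hol_in_over[OF c(1) _ c(2) oV y]) auto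
    then show ?thesis using g c(1) y V(2) by (auto simp: holomorphic_fun_iff)
  qed
  then have hh: "holomorphic_fun Y (f ` V) ?h" by (auto simp: holomorphic_fun_iff)
  have push: "push V (\<lambda>y\<in>W. g y \<odot>\<^bsub>fibre Q y\<^esub> s y) = (\<lambda>q\<in>f ` V. ?h q \<odot>\<^bsub>fibre E q\<^esub> push V s q)"
    using V(2) xp by (intro push_eqI[OF V(1)]) (auto simp: push_apply[OF V(1)] sheet_inv[OF V(1)] subset_iff)
  have diff: "differential Y ?h (f x) (tangent_map X Y f x \<xi>) = differential X g x \<xi>"
    using hf h[OF V(3)] by (intro differential_over[OF xp[OF x] \<xi> oV V(3)]) auto
  show "pulled_conn W (\<lambda>y\<in>W. g y \<odot>\<^bsub>fibre Q y\<^esub> s y) x \<xi> =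
      (differential X g x \<xi> \<odot>\<^bsub>fibre Q x\<^esub> s x) \<oplus>\<^bsub>fibre Q x\<^esub> (g x \<odot>\<^bsub>fibre Q x\<^esub> pulled_conn W s x \<xi>)"
    using connection_leibniz[OF E_conn push_form(1)[OF V(1,2) W s] push_section[OF V(1,2) W s] hh
        _ tangent_map_in[OF xp[OF x] \<xi>]] V(3) xp[OF x]
      pulled_conn_apply[OF W s V \<xi>] pulled_conn_apply[OF W Q.section_smult[OF W s g] V \<xi>]
    by (simp add: push diff push_apply[OF V(1,3)] sheet_inv[OF V(1,3)])
next
  fix W W' s
  assume *: "openin (mtop X) W \<and> openin (mtop X) W' \<and> W' \<subseteq> W \<and> s \<in> holomorphic_sections X Q W"
  then have W: "openin (mtop X) W" "openin (mtop X) W'" "W' \<subseteq> W" and s: "s \<in> holomorphic_sections X Q W" by auto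
  note s' = Q.section_restrict[OF W(1) s W(2,3)]
  note f' = pulled_conn_form[OF W(2) s'] and f = pulled_conn_form[OF W(1) s]
  show "pulled_conn W' (restrict s W') = restrict (pulled_conn W s) W'"
  proof (rule extensionalityI[OF X.bundle_one_forms_closed_ext(1)[OF Q_bundle W(2) f'] restrict_extensional])
    fix x assume x: "x \<in> W'"
    then have xW: "x \<in> W" using W by blast
    have "pulled_conn W' (restrict s W') x = pulled_conn W s x"
    proof (rule extensionalityI[OF X.bundle_one_forms_closed_ext(2)[OF Q_bundle W(2) f' x]
          X.bundle_one_forms_closed_ext(2)[OF Q_bundle W(1) f xW]])
      fix \<xi> assume \<xi>: "\<xi> \<in> tangent_space X x"
      obtain V where V: "sheet V" "V \<subseteq> W'" "x \<in> V" using sheet_within[OF W(2) x] .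
      have VW: "V \<subseteq> W" using V W by blast
      have "push V (restrict s W') = push V s"
        using V(2) by (intro push_eqI[OF V(1)]) (auto simp: push_apply[OF V(1)] push_def subset_iff sheet_inv[OF V(1)])
      then show "pulled_conn W' (restrict s W') x \<xi> = pulled_conn W s x \<xi>"
        using pulled_conn_apply[OF W(2) s' V \<xi>] pulled_conn_apply[OF W(1) s V(1) VW V(3) \<xi>] by simp
    qed
    then show "pulled_conn W' (restrict s W') x = restrict (pulled_conn W s) W' x" using x by simp
  qed
qed

lemma pullback_spec_pulled_conn: "pullback_spec pulled_conn"
  unfolding pullback_spec_def
proof (intro conjI allI impI ballI pulled_conn_connection)
  fix W s x \<xi>
  assume W: "openin (mtop Y) W" and s: "s \<in> holomorphic_sections Y E W"
    and x: "x \<in> f -` W \<inter> points X" and \<xi>: "\<xi> \<in> tangent_space X x"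
  let ?W = "f -` W \<inter> points X" and ?s = "\<lambda>y\<in>f -` W \<inter> points X. s (f y)"
  note oW = openin_preimage[OF W]
  obtain V where V: "sheet V" "V \<subseteq> ?W" "x \<in> V" using sheet_within[OF oW x] .
  have oV: "openin (mtop Y) (f ` V)" using V(1) openin_image by (simp add: sheet_def)
  have fV: "f ` V \<subseteq> W" using V(2) by blast
  have "push V ?s = restrict s (f ` V)"
    using V(2) by (intro push_eqI[OF V(1)]) (auto simp: subset_iff)
  then show "pulled_conn ?W ?s x \<xi> = conn E W s (f x) (tangent_map X Y f x \<xi>)"
    using pulled_conn_apply[OF oW pullback_section[OF W s] V \<xi>] connection_restrict[OF E_conn W oV fV s] V(3) by simp
qed

text \<open>The specification concerns pulled back sections over full preimages only. On a sheet
  \<open>V\<close> every section agrees with the pullback of \<open>push V s\<close>, but the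
  preimage of the image of \<open>V\<close> may be larger than \<open>V\<close>; locality of
  \<open>N\<close> bridges the gap by restricting both to \<open>V\<close>.\<close>

lemma pullback_spec_unique:
  assumes N: "pullback_spec N"
  shows "N = pulled_conn"
proof (rule X.connection_eqI[OF Q_bundle])
  have conn: "holomorphic_connection X Q N" using N by (simp add: pullback_spec_def)
  show "N \<in> (\<Pi>\<^sub>E W\<in>{W. openin (mtop X) W}. holomorphic_sections X Q W \<rightarrow>\<^sub>E bundle_one_forms X Q W)"
    by (rule connection_ext[OF conn])
  show "pulled_conn \<in> (\<Pi>\<^sub>E W\<in>{W. openin (mtop X) W}. holomorphic_sections X Q W \<rightarrow>\<^sub>E bundle_one_forms X Q W)"
    by (rule connection_ext[OF pulled_conn_connection])
  fix W s x \<xi>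
  assume W: "openin (mtop X) W" and s: "s \<in> holomorphic_sections X Q W" and x: "x \<in> W" and \<xi>: "\<xi> \<in> tangent_space X x"
  obtain V where V: "sheet V" "V \<subseteq> W" "x \<in> V" using sheet_within[OF W x] .
  have oV: "openin (mtop X) V" using V(1) by (simp add: sheet_def)
  note sV = push_section[OF V(1,2) W s] and oY = push_form(1)[OF V(1,2) W s]
  let ?V' = "f -` f ` V \<inter> points X" and ?s' = "\<lambda>y\<in>f -` f ` V \<inter> points X. push V s (f y)"
  have VV': "V \<subseteq> ?V'" using openin_subset[OF oV] by blast
  have "restrict s V = restrict ?s' V"
    using VV' by (auto simp: fun_eq_iff push_apply[OF V(1)] subset_iff)
  then have "restrict (N W s) V = restrict (N ?V' ?s') V"
    using connection_restrict[OF conn W oV V(2) s]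
      connection_restrict[OF conn openin_preimage[OF oY] oV VV' pullback_section[OF oY sV]] by simp
  from fun_cong[OF this, of x] have "N W s x = N ?V' ?s' x" by (simp only: restrict_apply'[OF V(3)])
  moreover have "N ?V' ?s' x \<xi> = conn E (f ` V) (push V s) (f x) (tangent_map X Y f x \<xi>)"
    using N oY sV V(3) VV' \<xi> unfolding pullback_spec_def by blast
  ultimately show "N W s x \<xi> = pulled_conn W s x \<xi>" using pulled_conn_apply[OF W s V \<xi>] by simp
qed

end

section \<open>The presheaf of holomorphic vector bundles\<close>

lemma holomorphic_connection_cong:
  assumes "fibre E = fibre E'" "trivs E = trivs E'"
  shows "holomorphic_connection X E N \<longleftrightarrow> holomorphic_connection X E' N"
  by (simp add: holomorphic_connection_def holomorphic_sections_def bundle_one_forms_def assms)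

lemma fibre_bundle_pullback: "fibre (bundle_pullback X Y f E) = (\<lambda>x\<in>points X. fibre E (f x))"
  by (simp add: bundle_pullback_def Let_def)

lemma trivs_bundle_pullback:
  "trivs (bundle_pullback X Y f E) = triv_closure X (fibre (bundle_pullback X Y f E)) (pulled_trivs X f E)"
  by (simp add: bundle_pullback_def Let_def pulled_trivs_def)

lemma etale_bundle_conn_pullback:
  assumes "etale_map X Y f" "E \<in> Ob (HVB_cat Y)"
  shows "etale_bundle_conn X Y f E (bundle_pullback X Y f E)"
proof -
  interpret etale_map X Y f by fact
  show ?thesis
    using assms(2) by unfold_locales
      (simp_all add: Y.Ob_HVB_cat fibre_bundle_pullback trivs_bundle_pullback[unfolded fibre_bundle_pullback])
qed

lemma conn_bundle_pullback:
  fixes X :: "('p, 'v::complex_model_space) cmanifold" and Y :: "('q, 'v) cmanifold" and E :: "('q, 'v, 'f) vbundle"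
  assumes "etale_map X Y f" "E \<in> Ob (HVB_cat Y)"
  shows "conn (bundle_pullback X Y f E) = etale_bundle_conn.pulled_conn X Y f E (bundle_pullback X Y f E)"
proof -
  let ?P = "bundle_pullback X Y f E"
  interpret etale_bundle_conn X Y f E ?P by (rule etale_bundle_conn_pullback[OF assms])
  define E0 :: "('p, 'v, 'f) vbundle" where "E0 = \<lparr>fibre = fibre ?P, trivs = trivs ?P, conn = undefined\<rparr>"
  have eq: "holomorphic_connection X E0 N \<longleftrightarrow> holomorphic_connection X ?P N" for N
    by (rule holomorphic_connection_cong) (simp_all add: E0_def)
  have "conn ?P = (THE N. holomorphic_connection X E0 N \<and>
           (\<forall>W. openin (mtop Y) W \<longrightarrow> (\<forall>s\<in>holomorphic_sections Y E W.
              \<forall>x\<in>f -` W \<inter> points X. \<forall>\<xi>\<in>tangent_space X x.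
                N (f -` W \<inter> points X) (\<lambda>y\<in>f -` W \<inter> points X. s (f y)) x \<xi> =
                  conn E W s (f x) (tangent_map X Y f x \<xi>))))"
    by (simp add: bundle_pullback_def Let_def E0_def)
  also have "\<dots> = (THE N. pullback_spec N)" unfolding eq pullback_spec_def ..
  also have "\<dots> = pulled_conn"
    using pullback_spec_pulled_conn pullback_spec_unique by (rule the_equality)
  finally show ?thesis .
qed

text \<open>Replaces the definite description by a universal property: a candidate for the pulled
  back connection only has to satisfy the specification. Both functoriality laws use it.\<close>

lemma bundle_pullback_spec:
  assumes "etale_map X Y f" "E \<in> Ob (HVB_cat Y)"
  shows "etale_bundle_conn.pullback_spec X Y f E (bundle_pullback X Y f E) N \<longleftrightarrow> N = conn (bundle_pullback X Y f E)"
proof -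
  interpret etale_bundle_conn X Y f E "bundle_pullback X Y f E" by (rule etale_bundle_conn_pullback[OF assms])
  show ?thesis
    unfolding conn_bundle_pullback[OF assms] using pullback_spec_pulled_conn pullback_spec_unique by blast
qed

lemma bundle_pullback_Ob:
  assumes "etale_map X Y f" "E \<in> Ob (HVB_cat Y)"
  shows "bundle_pullback X Y f E \<in> Ob (HVB_cat X)"
proof -
  interpret etale_bundle_conn X Y f E "bundle_pullback X Y f E" by (rule etale_bundle_conn_pullback[OF assms])
  show ?thesis using Q_bundle pulled_conn_connection conn_bundle_pullback[OF assms] by (simp add: X.Ob_HVB_cat)
qed

lemma conn_bundle_pullback_apply:
  assumes "etale_map X Y f" "E \<in> Ob (HVB_cat Y)" "openin (mtop Y) W" "s \<in> holomorphic_sections Y E W"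
    and "x \<in> points X" "f x \<in> W" "\<xi> \<in> tangent_space X x"
  shows "conn (bundle_pullback X Y f E) (f -` W \<inter> points X) (\<lambda>y\<in>f -` W \<inter> points X. s (f y)) x \<xi> =
    conn E W s (f x) (tangent_map X Y f x \<xi>)"
proof -
  interpret etale_bundle_conn X Y f E "bundle_pullback X Y f E" by (rule etale_bundle_conn_pullback[OF assms(1,2)])
  have "pullback_spec (conn (bundle_pullback X Y f E))" using bundle_pullback_spec[OF assms(1,2)] by simp
  then show ?thesis using assms(3-) unfolding pullback_spec_def by blast
qed

lemma bundle_map_pullback_iso:
  assumes f: "etale_map X Y f" and E: "E \<in> Ob (HVB_cat Y)" and F: "F \<in> Ob (HVB_cat Y)"
    and m: "m \<in> bundle_isos Y E F"
  shows "bundle_map_pullback X f m \<in> bundle_isos X (bundle_pullback X Y f E) (bundle_pullback X Y f F)"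
proof -
  interpret E: etale_bundle_conn X Y f E "bundle_pullback X Y f E" by (rule etale_bundle_conn_pullback[OF f E])
  interpret F: etale_bundle_conn X Y f F "bundle_pullback X Y f F" by (rule etale_bundle_conn_pullback[OF f F])
  show ?thesis
  proof (rule E.X.bundle_isosI[OF E.Q_bundle F.Q_bundle])
    show "bundle_map_pullback X f m \<in> (\<Pi>\<^sub>E x\<in>points X. carrier (fibre (bundle_pullback X Y f E) x) \<rightarrow>\<^sub>E
        carrier (fibre (bundle_pullback X Y f F) x))"
      using PiE_mem[OF E.Y.iso_ext[OF m] E.image_points] by (auto simp: bundle_map_pullback_def)
  next
    fix x assume x: "x \<in> points X"
    then show "bij_betw (bundle_map_pullback X f m x) (carrier (fibre (bundle_pullback X Y f E) x))
        (carrier (fibre (bundle_pullback X Y f F) x))"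
      "clinear (fibre (bundle_pullback X Y f E) x) (fibre (bundle_pullback X Y f F) x) (bundle_map_pullback X f m x)"
      using E.Y.iso_bij[OF m E.image_points[OF x]] E.Y.iso_clinear[OF m E.image_points[OF x]]
      by (simp_all add: bundle_map_pullback_def)
  next
    fix x c s assume x: "x \<in> points X" and c: "c \<in> charts_at X x"
      and s: "hol_sec X (bundle_pullback X Y f E) c s x"
    let ?V = "fst c \<inter> points X"
    note V = E.sheet_chart[OF openin_topspace c x]
    have oV: "openin (mtop X) ?V" using V(1) by (simp add: E.sheet_def)
    obtain c' where c': "c' \<in> charts_at Y (f x)" "chart_over f c c'" using E.chart_below[OF c] .
    have c'Y: "c' \<in> charts Y" using c' by (simp add: charts_at_iff)
    \<comment> \<open>The section \<open>s\<close> lives upstairs and need not descend globally. On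
      the sheet \<open>?V\<close> it is the pullback of \<open>?s\<close>, to which \<open>m\<close>
      can be applied below.\<close>
    let ?s = "\<lambda>q. s (inv_into ?V f q)"
    have "hol_sec Y E c' ?s (f x)"
      using s E.hol_sec_over[OF c c'Y c'(2) oV V(2), of s ?s] E.sheet_inv[OF V(1)] by simp
    then have "hol_sec Y F c' (\<lambda>q. m q (?s q)) (f x)"
      by (rule E.Y.iso_hol_sec[OF E.E.is_bundle F.E.is_bundle m c'(1)])
    then show "hol_sec X (bundle_pullback X Y f F) c (\<lambda>y. bundle_map_pullback X f m y (s y)) x"
      using F.hol_sec_over[OF c c'Y c'(2) oV V(2), of "\<lambda>y. bundle_map_pullback X f m y (s y)" "\<lambda>q. m q (?s q)"]
        E.sheet_inv[OF V(1)] by (simp add: bundle_map_pullback_def)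
  qed
qed

text \<open>Because only the value \<open>e\<close> matters, the left side may be computed with the
  pullback of a section from below. On such sections the pulled back connections are given by their
  specification, and the two defects coincide term by term.\<close>

lemma hom_connection_pullback:
  assumes f: "etale_map X Y f" and m: "bundle_iso Y E F m"
    and x: "x \<in> points X" and \<xi>: "\<xi> \<in> tangent_space X x" and e: "e \<in> carrier (fibre E (f x))"
  shows "hom_connection X (bundle_pullback X Y f E) (bundle_pullback X Y f F) (bundle_map_pullback X f m) x \<xi> e =
    hom_connection Y E F m (f x) (tangent_map X Y f x \<xi>) e"
proof -
  interpret f: etale_map X Y f by fact
  interpret m: bundle_iso Y E F m by fact
  interpret E: etale_bundle_conn X Y f E "bundle_pullback X Y f E" by (rule etale_bundle_conn_pullback[OF f m.E_Ob])
  interpret fm: bundle_iso X "bundle_pullback X Y f E" "bundle_pullback X Y f F" "bundle_map_pullback X f m"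
    by unfold_locales (intro bundle_pullback_Ob[OF f] m.E_Ob m.F_Ob bundle_map_pullback_iso[OF f _ _ m.iso])+
  obtain W r \<phi> where t: "(W, r, \<phi>) \<in> trivs E" "f x \<in> W" using m.E.triv_at[OF f.image_points[OF x]] .
  note W = m.E.triv_open[OF t(1)]
  obtain s where s: "s \<in> holomorphic_sections Y E W" "s (f x) = e" using m.E.section_through[OF t e] .
  let ?W = "f -` W \<inter> points X" and ?s = "\<lambda>y\<in>f -` W \<inter> points X. s (f y)"
  have xW: "x \<in> ?W" using x t(2) by simp
  have ms: "(\<lambda>y\<in>?W. bundle_map_pullback X f m y (?s y)) = (\<lambda>y\<in>?W. (\<lambda>q\<in>W. m q (s q)) (f y))"
    by (auto simp: bundle_map_pullback_def fun_eq_iff)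
  have at: "bundle_map_pullback X f m x = m (f x)" "fibre (bundle_pullback X Y f F) x = fibre F (f x)"
    using x by (simp_all add: bundle_map_pullback_def fibre_bundle_pullback)
  have "fm.defect ?W ?s x \<xi> = m.defect W s (f x) (tangent_map X Y f x \<xi>)"
    unfolding fm.defect_def m.defect_def ms at
      conn_bundle_pullback_apply[OF f m.E_Ob W s(1) x t(2) \<xi>]
      conn_bundle_pullback_apply[OF f m.F_Ob W m.iso_section[OF W s(1)] x t(2) \<xi>] ..
  then show ?thesis
    using fm.hom_connection_apply[OF f.openin_preimage[OF W] E.pullback_section[OF W s(1)] xW \<xi>]
      m.hom_connection_apply[OF W s(1) t(2) f.tangent_map_in[OF x \<xi>]] s(2) x t(2) by simp
qed

lemma bundle_map_pullback_Id:
  assumes "etale_map X Y f"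
  shows "bundle_map_pullback X f (Id (HVB_cat Y) E) = Id (HVB_cat X) (bundle_pullback X Y f E)"
proof -
  interpret etale_map X Y f by fact
  show ?thesis
    using image_points by (auto simp: bundle_map_pullback_def X.Id_HVB_cat Y.Id_HVB_cat fibre_bundle_pullback fun_eq_iff)
qed

lemma bundle_map_pullback_Comp:
  assumes "etale_map X Y f"
  shows "bundle_map_pullback X f (Comp (HVB_cat Y) E F G n m) =
    Comp (HVB_cat X) (bundle_pullback X Y f E) (bundle_pullback X Y f F) (bundle_pullback X Y f G)
      (bundle_map_pullback X f n) (bundle_map_pullback X f m)"
proof -
  interpret etale_map X Y f by fact
  show ?thesis
    using image_points by (auto simp: bundle_map_pullback_def X.Comp_HVB_cat Y.Comp_HVB_cat fibre_bundle_pullback fun_eq_iff)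
qed

lemma simplicial_map_HVB:
  assumes f: "etale_map X Y f"
  shows "simplicial_map (psh_obj HVB Y) (psh_obj HVB X) (psh_map HVB X Y f)"
proof -
  interpret etale_map X Y f by fact
  have "simplicial_map (nerve (HVB_cat Y)) (nerve (HVB_cat X)) (\<lambda>k. \<lambda>(E, g)\<in>simp (nerve (HVB_cat Y)) k.
      (\<lambda>j\<in>{..k}. bundle_pullback X Y f (E j), \<lambda>j\<in>{1..k}. bundle_map_pullback X f (g j)))"
    by (rule simplicial_map_nerve[OF Y.category_HVB X.category_HVB])
      (simp_all add: X.Hom_HVB_cat Y.Hom_HVB_cat bundle_pullback_Ob[OF f] bundle_map_pullback_iso[OF f]
        bundle_map_pullback_Id[OF f] bundle_map_pullback_Comp[OF f])
  then show ?thesis by (simp add: HVB_def)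
qed

text \<open>An equality of records, checked in three parts: fibres agree literally, trivializations
  by \<open>triv_closure_cover\<close>, connections by uniqueness of the pulled back
  connection.\<close>

lemma bundle_pullback_ident:
  assumes X: "complex_atlas X" and f: "\<And>x. x \<in> points X \<Longrightarrow> f x = x" and E: "E \<in> Ob (HVB_cat X)"
  shows "bundle_pullback X X f E = E"
proof -
  let ?P = "bundle_pullback X X f E"
  note et = etale_ident[OF X f]
  interpret etale_bundle_conn X X f E ?P by (rule etale_bundle_conn_pullback[OF et(1) E])
  have pre: "f -` W \<inter> points X = W" if "W \<subseteq> points X" for W using that f by auto
  have fib: "fibre ?P = fibre E"
    using E.is_bundle f by (auto simp: fibre_bundle_pullback holomorphic_bundle_def fun_eq_iff extensional_def)
  have "pulled_trivs X f E \<subseteq> trivs E"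
  proof
    fix t assume "t \<in> pulled_trivs X f E"
    then obtain W r \<phi> where t: "(W, r, \<phi>) \<in> trivs E" "t = (f -` W \<inter> points X, r, \<lambda>x. \<phi> (f x))"
      by (auto simp: pulled_trivs_def)
    have W: "W \<subseteq> points X" using openin_subset[OF E.triv_open[OF t(1)]] .
    have "(W, r, \<lambda>x. \<phi> (f x)) \<in> trivs E" using W f by (intro X.trivs_cong[OF E.is_bundle t(1)]) auto
    then show "t \<in> trivs E" using t(2) pre[OF W] by simp
  qed
  then have tr: "trivs ?P = trivs E"
    using X.triv_closure_cover[OF E.is_bundle _ pulled_trivs_cover] trivs_Q fib by simp
  have "pullback_spec (conn E)"
    unfolding pullback_spec_def
  proof (intro conjI allI impI ballI)
    show "holomorphic_connection X ?P (conn E)"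
      using E_conn holomorphic_connection_cong[OF fib tr] by simp
    fix W s x \<xi> assume W: "openin (mtop X) W" and s: "s \<in> holomorphic_sections X E W"
      and x: "x \<in> f -` W \<inter> points X" and \<xi>: "\<xi> \<in> tangent_space X x"
    have Wp: "W \<subseteq> points X" using openin_subset[OF W] .
    have "(\<lambda>y\<in>W. s (f y)) = s"
      using Wp f E.section_ext[OF W s] by (auto simp: fun_eq_iff extensional_def)
    moreover have "f x = x" using x f by blast
    moreover have "tangent_map X X f x \<xi> = \<xi>" by (rule etale_ident(2)[OF X f _ \<xi>]) (use x in auto)
    ultimately show "conn E (f -` W \<inter> points X) (\<lambda>y\<in>f -` W \<inter> points X. s (f y)) x \<xi> = conn E W s (f x) (tangent_map X X f x \<xi>)"
      by (simp only: pre[OF Wp])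
  qed
  then have "conn ?P = conn E" using bundle_pullback_spec[OF et(1) E] by simp
  then show ?thesis using fib tr by simp
qed

text \<open>The same three comparisons as for the identity. The connection of the iterated pullback
  satisfies the specification for the composite by the chain rule for tangent maps.\<close>

lemma bundle_pullback_compose:
  assumes f: "etale_map X Y f" and g: "etale_map Y Z g" and E: "E \<in> Ob (HVB_cat Z)"
  shows "bundle_pullback X Z (g \<circ> f) E = bundle_pullback X Y f (bundle_pullback Y Z g E)"
proof -
  let ?G = "bundle_pullback Y Z g E"
  let ?F = "bundle_pullback X Y f ?G" and ?H = "bundle_pullback X Z (g \<circ> f) E"
  have h: "etale_map X Z (g \<circ> f)" by (rule etale_compose[OF f g]) simp
  note GOb = bundle_pullback_Ob[OF g E]
  interpret h: etale_bundle_conn X Z "g \<circ> f" E ?H by (rule etale_bundle_conn_pullback[OF h E])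
  interpret g: etale_bundle_conn Y Z g E ?G by (rule etale_bundle_conn_pullback[OF g E])
  interpret f: etale_bundle_conn X Y f ?G ?F by (rule etale_bundle_conn_pullback[OF f GOb])
  have fib: "fibre ?H = fibre ?F"
    using f.image_points by (auto simp: fibre_bundle_pullback fun_eq_iff)
  have "pulled_trivs X (g \<circ> f) E \<subseteq> trivs ?F"
  proof
    fix t assume "t \<in> pulled_trivs X (g \<circ> f) E"
    then obtain W r \<phi> where t: "(W, r, \<phi>) \<in> trivs E" "t = ((g \<circ> f) -` W \<inter> points X, r, \<lambda>x. \<phi> (g (f x)))"
      by (auto simp: pulled_trivs_def)
    have "f -` (g -` W \<inter> points Y) \<inter> points X = (g \<circ> f) -` W \<inter> points X" using f.image_points by auto
    then show "t \<in> trivs ?F" using f.pulled_triv_Q[OF g.pulled_triv_Q[OF t(1)]] t(2) by simp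
  qed
  then have tr: "trivs ?H = trivs ?F"
    using h.X.triv_closure_cover[OF f.Q_bundle _ h.pulled_trivs_cover] h.trivs_Q fib by simp
  have "h.pullback_spec (conn ?F)"
    unfolding h.pullback_spec_def
  proof (intro conjI allI impI ballI)
    show "holomorphic_connection X ?H (conn ?F)"
      using bundle_pullback_Ob[OF f GOb] holomorphic_connection_cong[OF fib tr] by (simp add: h.X.Ob_HVB_cat)
    fix W s x \<xi> assume W: "openin (mtop Z) W" and s: "s \<in> holomorphic_sections Z E W"
      and x: "x \<in> (g \<circ> f) -` W \<inter> points X" and \<xi>: "\<xi> \<in> tangent_space X x"
    let ?W = "g -` W \<inter> points Y" and ?s = "\<lambda>y\<in>g -` W \<inter> points Y. s (g y)"
    have xp: "x \<in> points X" and gx: "g (f x) \<in> W" and fx: "f x \<in> points Y" using x f.image_points by auto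
    have pre: "f -` ?W \<inter> points X = (g \<circ> f) -` W \<inter> points X" using f.image_points by auto
    have res: "(\<lambda>y\<in>(g \<circ> f) -` W \<inter> points X. ?s (f y)) = (\<lambda>y\<in>(g \<circ> f) -` W \<inter> points X. s ((g \<circ> f) y))"
      using f.image_points by (auto simp: fun_eq_iff)
    have "conn ?F (f -` ?W \<inter> points X) (\<lambda>y\<in>f -` ?W \<inter> points X. ?s (f y)) x \<xi> =
        conn ?G ?W ?s (f x) (tangent_map X Y f x \<xi>)"
      by (rule conn_bundle_pullback_apply[OF f GOb g.openin_preimage[OF W] g.pullback_section[OF W s] xp _ \<xi>])
        (use gx fx in simp)
    also have "\<dots> = conn E W s ((g \<circ> f) x) (tangent_map X Z (g \<circ> f) x \<xi>)"
      using conn_bundle_pullback_apply[OF g E W s fx gx f.tangent_map_in[OF xp \<xi>]]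
        tangent_map_compose[OF f g _ xp \<xi>, of "g \<circ> f"] by simp
    finally show "conn ?F ((g \<circ> f) -` W \<inter> points X) (\<lambda>y\<in>(g \<circ> f) -` W \<inter> points X. s ((g \<circ> f) y)) x \<xi> =
        conn E W s ((g \<circ> f) x) (tangent_map X Z (g \<circ> f) x \<xi>)" unfolding pre res .
  qed
  then have "conn ?H = conn ?F" using bundle_pullback_spec[OF h E] by simp
  then show ?thesis using fib tr by simp
qed

lemma psh_map_HVB_apply:
  assumes "(E, g) \<in> simp (psh_obj HVB Y) k"
  shows "psh_map HVB X Y f k (E, g) = (\<lambda>j\<in>{..k}. bundle_pullback X Y f (E j), \<lambda>j\<in>{1..k}. bundle_map_pullback X f (g j))"
  using assms by (simp add: HVB_def)

lemma (in atlas) simp_HVB_iff: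
  "(E, g) \<in> simp (psh_obj HVB X) k \<longleftrightarrow>
     (\<forall>i\<le>k. E i \<in> Ob (HVB_cat X)) \<and> E \<in> extensional {..k} \<and>
     (\<forall>i<k. g (Suc i) \<in> bundle_isos X (E i) (E (Suc i))) \<and> g \<in> extensional {1..k}"
  by (simp add: HVB_def simp_nerve_iff Hom_HVB_cat)

lemma psh_map_HVB_id:
  assumes X: "complex_atlas X" and f: "\<And>x. x \<in> points X \<Longrightarrow> f x = x" and h: "h \<in> simp (psh_obj HVB X) k"
  shows "psh_map HVB X X f k h = h"
proof -
  interpret atlas X by unfold_locales fact
  obtain E g where [simp]: "h = (E, g)" by (cases h)
  have *: "\<And>i. i \<le> k \<Longrightarrow> E i \<in> Ob (HVB_cat X)" "E \<in> extensional {..k}"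
    "\<And>i. i < k \<Longrightarrow> g (Suc i) \<in> bundle_isos X (E i) (E (Suc i))" "g \<in> extensional {1..k}"
    using h by (auto simp: simp_HVB_iff)
  have "bundle_map_pullback X f (g j) = g j" if j: "j \<in> {1..k}" for j
  proof -
    obtain i where i: "j = Suc i" "i < k" using j by (cases j) auto
    have "g j \<in> extensional (points X)" using iso_ext[OF *(3)[OF i(2)]] i(1) by (simp add: PiE_iff)
    then show ?thesis using f by (auto simp: bundle_map_pullback_def fun_eq_iff extensional_def)
  qed
  then show ?thesis
    using * bundle_pullback_ident[OF X f *(1)] psh_map_HVB_apply[OF h[simplified], of X f]
    by (auto simp: fun_eq_iff extensional_def)
qed

lemma psh_map_HVB_compose:
  assumes f: "etale_map X Y f" and g: "etale_map Y Z g" and h: "h \<in> simp (psh_obj HVB Z) k"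
  shows "psh_map HVB X Z (g \<circ> f) k h = psh_map HVB X Y f k (psh_map HVB Y Z g k h)"
proof -
  interpret f: etale_map X Y f by fact
  interpret g: etale_map Y Z g by fact
  obtain E m where [simp]: "h = (E, m)" by (cases h)
  have E: "\<And>i. i \<le> k \<Longrightarrow> E i \<in> Ob (HVB_cat Z)" using h by (simp add: g.Y.simp_HVB_iff)
  have gh: "psh_map HVB Y Z g k h \<in> simp (psh_obj HVB Y) k"
    by (rule simplicial_mapD(4)[OF simplicial_map_HVB[OF g] h])
  have maps: "bundle_map_pullback X (g \<circ> f) (m j) = bundle_map_pullback X f (bundle_map_pullback Y g (m j))" for j
    using f.image_points by (auto simp: bundle_map_pullback_def fun_eq_iff)
  show ?thesis
    using h gh bundle_pullback_compose[OF f g E]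
    by (auto simp: psh_map_HVB_apply maps intro!: restrict_ext)
qed

section \<open>The Chern character\<close>

text \<open>The ingredients of \<open>Ch_form\<close>, with the composites of the simplex replaced by a family
  \<open>g p q : B p \<rightarrow> B q\<close> that is functorial in \<open>p \<le> q\<close>.\<close>

definition chain_letter ::
  "('p, 'v::complex_model_space) cmanifold \<Rightarrow> (nat \<Rightarrow> ('p, 'v, 'f) vbundle) \<Rightarrow> (nat \<Rightarrow> nat \<Rightarrow> ('p, 'f) bundle_map) \<Rightarrow>
     'p \<Rightarrow> nat \<Rightarrow> ('p, 'v) tangent \<Rightarrow> 'f \<Rightarrow> 'f" where
  "chain_letter X B g x = (\<lambda>j. hom_connection X (B j) (B (Suc j)) (g j (Suc j)) x)"

definition chain_trace ::
  "('p, 'v::complex_model_space) cmanifold \<Rightarrow> (nat \<Rightarrow> ('p, 'v, 'f) vbundle) \<Rightarrow> (nat \<Rightarrow> nat \<Rightarrow> ('p, 'f) bundle_map) \<Rightarrow>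
     nat \<Rightarrow> 'p \<Rightarrow> (nat \<Rightarrow> ('p, 'v) tangent) \<Rightarrow> complex" where
  "chain_trace X B g l x \<Psi> = vtrace (fibre (B 0) x)
     (\<lambda>e. inv_into (carrier (fibre (B 0) x)) (g 0 l x) (word_comp (chain_letter X B g x) \<Psi> l l e))"

definition chain_form ::
  "('p, 'v::complex_model_space) cmanifold \<Rightarrow> (nat \<Rightarrow> ('p, 'v, 'f) vbundle) \<Rightarrow> (nat \<Rightarrow> nat \<Rightarrow> ('p, 'f) bundle_map) \<Rightarrow>
     nat \<Rightarrow> ('p, 'v) form" where
  "chain_form X B g l x \<Xi> = (\<Sum>\<sigma> | \<sigma> permutes {..<l}. of_int (sign \<sigma>) * chain_trace X B g l x (\<Xi> \<circ> \<sigma>))"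

lemma word_comp_cong:
  assumes "\<And>i. i < j \<Longrightarrow> A i = A' i" "\<And>i. i < j \<Longrightarrow> \<Psi> (l - Suc i) = \<Psi>' (l - Suc i)"
  shows "word_comp A \<Psi> l j = word_comp A' \<Psi>' l j"
  using assms by (induction j) auto

lemma chain_form_cong:
  assumes "\<And>j. j \<le> l \<Longrightarrow> B j = B' j" "\<And>p q. p \<le> q \<Longrightarrow> q \<le> l \<Longrightarrow> g p q = g' p q"
  shows "chain_form X B g l x \<Xi> = chain_form X B' g' l x \<Xi>"
proof -
  have "word_comp (chain_letter X B g x) \<Psi> l l = word_comp (chain_letter X B' g' x) \<Psi> l l" for \<Psi>
    by (rule word_comp_cong) (simp_all add: chain_letter_def assms)
  then show ?thesis by (simp add: chain_form_def chain_trace_def assms)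
qed

lemma vtrace_add:
  assumes V: "module complex_ring V" and \<phi>: "coord_iso V r \<phi>" and S: "clinear V V S" and T: "clinear V V T"
  shows "vtrace V (\<lambda>e. S e \<oplus>\<^bsub>V\<^esub> T e) = vtrace V S + vtrace V T"
proof -
  have add: "\<phi> (S e \<oplus>\<^bsub>V\<^esub> T e) j = \<phi> (S e) j + \<phi> (T e) j" if "e \<in> carrier V" "j < r" for e j
    using that by (intro coord_add[OF \<phi>] clinear_in[OF S] clinear_in[OF T])
  have ST: "clinear V V (\<lambda>e. S e \<oplus>\<^bsub>V\<^esub> T e)"
    unfolding clinear_def
  proof (intro conjI ballI allI)
    fix v assume v: "v \<in> carrier V"
    note Sv = clinear_in[OF S v] clinear_in[OF T v]
    show "S v \<oplus>\<^bsub>V\<^esub> T v \<in> carrier V" by (rule complex_module_closed(1)[OF V Sv])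
    { fix w assume w: "w \<in> carrier V"
      note Sw = clinear_in[OF S w] clinear_in[OF T w] and c = complex_module_closed(1)[OF V]
      show "S (v \<oplus>\<^bsub>V\<^esub> w) \<oplus>\<^bsub>V\<^esub> T (v \<oplus>\<^bsub>V\<^esub> w) = (S v \<oplus>\<^bsub>V\<^esub> T v) \<oplus>\<^bsub>V\<^esub> (S w \<oplus>\<^bsub>V\<^esub> T w)"
        unfolding clinear_add[OF S v w] clinear_add[OF T v w] using Sv Sw
        by (intro coord_eqI[OF \<phi>] c) (simp_all add: coord_add[OF \<phi>] c) }
    fix a
    note c = complex_module_closed[OF V]
    show "S (a \<odot>\<^bsub>V\<^esub> v) \<oplus>\<^bsub>V\<^esub> T (a \<odot>\<^bsub>V\<^esub> v) = a \<odot>\<^bsub>V\<^esub> (S v \<oplus>\<^bsub>V\<^esub> T v)"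
      unfolding clinear_smult[OF S v] clinear_smult[OF T v]
      using Sv c(2)[OF Sv(1) Sv(1)] c(2)[OF Sv(2) Sv(2)] c(1)[OF Sv]
      by (intro coord_eqI[OF \<phi>] c(1) c(2)) (simp_all add: coord_add[OF \<phi>] coord_smult[OF \<phi>] algebra_simps)
  qed
  show ?thesis
    unfolding vtrace_eq[OF V \<phi> ST] vtrace_eq[OF V \<phi> S] vtrace_eq[OF V \<phi> T]
    by (simp add: add basis_vector_in[OF \<phi>] sum.distrib)
qed

section \<open>Chains of bundle isomorphisms and their trace forms\<close>

locale iso_chain = atlas X for X :: "('p, 'v::complex_model_space) cmanifold" +
  fixes B :: "nat \<Rightarrow> ('p, 'v, 'f) vbundle" and g :: "nat \<Rightarrow> nat \<Rightarrow> ('p, 'f) bundle_map" and n :: nat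
  assumes chain_iso: "p \<le> q \<Longrightarrow> q \<le> n \<Longrightarrow> bundle_iso X (B p) (B q) (g p q)"
    and chain_comp: "p \<le> q \<Longrightarrow> q \<le> r \<Longrightarrow> r \<le> n \<Longrightarrow>
      g p r = Comp (HVB_cat X) (B p) (B q) (B r) (g q r) (g p q)"
begin

lemma chain_bundle: "p \<le> n \<Longrightarrow> holo_bundle X (B p)"
  using chain_iso[of p p] by (simp add: bundle_iso_def bundle_iso_axioms_def holo_bundle_def holo_bundle_axioms_def Ob_HVB_cat)

context
  fixes x :: 'p
  assumes x: "x \<in> points X"
begin

lemma chain_module: "p \<le> n \<Longrightarrow> module complex_ring (fibre (B p) x)"
  by (rule holo_bundle.fibre_module[OF chain_bundle x])

lemma chain_coord: assumes "p \<le> n" obtains r \<phi> where "coord_iso (fibre (B p) x) r \<phi>"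
  using holo_bundle.fibre_coord[OF chain_bundle[OF assms] x] .

lemma chain_clinear: "p \<le> q \<Longrightarrow> q \<le> n \<Longrightarrow> clinear (fibre (B p) x) (fibre (B q) x) (g p q x)"
  by (rule iso_clinear[OF bundle_iso.iso[OF chain_iso] x])

lemma chain_bij: "p \<le> q \<Longrightarrow> q \<le> n \<Longrightarrow> bij_betw (g p q x) (carrier (fibre (B p) x)) (carrier (fibre (B q) x))"
  by (rule iso_bij[OF bundle_iso.iso[OF chain_iso] x])

abbreviation "g_inv p q \<equiv> inv_into (carrier (fibre (B p) x)) (g p q x)"

lemma chain_inv_clinear: "p \<le> q \<Longrightarrow> q \<le> n \<Longrightarrow> clinear (fibre (B q) x) (fibre (B p) x) (g_inv p q)"
  by (rule clinear_inv[OF chain_module chain_clinear chain_bij]) auto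

lemma chain_comp_apply:
  "p \<le> q \<Longrightarrow> q \<le> r \<Longrightarrow> r \<le> n \<Longrightarrow> e \<in> carrier (fibre (B p) x) \<Longrightarrow> g p r x e = g q r x (g p q x e)"
  using x by (simp add: chain_comp[of p q r] Comp_HVB_cat)

lemma chain_inv_left: "p \<le> q \<Longrightarrow> q \<le> n \<Longrightarrow> e \<in> carrier (fibre (B p) x) \<Longrightarrow> g_inv p q (g p q x e) = e"
  using chain_bij by (simp add: bij_betw_def)

lemma chain_inv_right: "p \<le> q \<Longrightarrow> q \<le> n \<Longrightarrow> w \<in> carrier (fibre (B q) x) \<Longrightarrow> g p q x (g_inv p q w) = w"
  using chain_bij by (simp add: bij_betw_def f_inv_into_f)

lemma chain_inv_comp:
  assumes "p \<le> q" "q \<le> r" "r \<le> n" "w \<in> carrier (fibre (B r) x)"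
  shows "g_inv p r w = g_inv p q (g_inv q r w)"
proof -
  let ?e = "g_inv p q (g_inv q r w)"
  have 1: "g_inv q r w \<in> carrier (fibre (B q) x)" using assms by (intro clinear_in[OF chain_inv_clinear]) auto
  then have e: "?e \<in> carrier (fibre (B p) x)" using assms by (intro clinear_in[OF chain_inv_clinear]) auto
  have "g p r x ?e = w"
    using assms 1 e by (simp add: chain_comp_apply[of p q r] chain_inv_right)
  then show ?thesis using chain_inv_left[of p r ?e] assms e by simp
qed

lemma letter_clinear:
  "j < n \<Longrightarrow> \<xi> \<in> tangent_space X x \<Longrightarrow> clinear (fibre (B j) x) (fibre (B (Suc j)) x) (chain_letter X B g x j \<xi>)"
  unfolding chain_letter_def by (rule bundle_iso.hom_connection_clinear[OF chain_iso x]) auto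

lemma word_clinear:
  assumes "\<forall>i<l. \<Psi> i \<in> tangent_space X x" "j \<le> l" "l \<le> n"
  shows "clinear (fibre (B 0) x) (fibre (B j) x) (word_comp (chain_letter X B g x) \<Psi> l j)"
  using assms(2)
proof (induction j)
  case 0
  then show ?case by (simp add: clinear_id)
next
  case (Suc j)
  then have "clinear (fibre (B 0) x) (fibre (B j) x) (word_comp (chain_letter X B g x) \<Psi> l j)" by simp
  from clinear_compose[OF this letter_clinear] show ?case using Suc.prems assms by simp
qed

text \<open>The vector in place \<open>a\<close> is read exactly once, by the letter with index
  \<open>l - Suc a\<close>, as \<open>word_comp\<close> goes through the tuple backwards. The
  induction starts just after that letter and carries the sum through the remaining letters, which
  are linear.\<close>

lemma word_tangent_add:
  assumes \<Psi>: "\<forall>i<l. \<Psi> i \<in> tangent_space X x" and \<xi>: "\<xi> \<in> tangent_space X x" and a: "a < l" and l: "l \<le> n"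
    and e: "e \<in> carrier (fibre (B 0) x)" and j: "l - a \<le> j" "j \<le> l"
  shows "word_comp (chain_letter X B g x) (\<Psi>(a := tangent_add X x (\<Psi> a) \<xi>)) l j e =
    word_comp (chain_letter X B g x) \<Psi> l j e \<oplus>\<^bsub>fibre (B j) x\<^esub> word_comp (chain_letter X B g x) (\<Psi>(a := \<xi>)) l j e"
  using j
proof (induction j rule: dec_induct)
  case base
  define i where "i = l - Suc a"
  have i: "l - a = Suc i" "l - Suc i = a" "i < n" "i \<le> l" "Suc i \<le> n" using a l by (auto simp: i_def)
  have eq: "word_comp (chain_letter X B g x) (\<Psi>(a := \<zeta>)) l i = word_comp (chain_letter X B g x) \<Psi> l i" for \<zeta>
    by (rule word_comp_cong) (use i a in auto)
  have "word_comp (chain_letter X B g x) \<Psi> l i e \<in> carrier (fibre (B i) x)"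
    by (rule clinear_in[OF word_clinear[OF \<Psi> i(4) l] e])
  then have "chain_letter X B g x i (tangent_add X x (\<Psi> a) \<xi>) (word_comp (chain_letter X B g x) \<Psi> l i e) =
      chain_letter X B g x i (\<Psi> a) (word_comp (chain_letter X B g x) \<Psi> l i e) \<oplus>\<^bsub>fibre (B (Suc i)) x\<^esub>
      chain_letter X B g x i \<xi> (word_comp (chain_letter X B g x) \<Psi> l i e)"
    using bundle_iso.hom_connection_tangent_add[OF chain_iso[OF _ i(5), of i] x \<Psi>[rule_format, OF a] _ \<xi>]
    unfolding chain_letter_def by simp
  then show ?case unfolding i(1) word_comp.simps i(2) eq by simp
next
  case (step j)
  have \<Psi>': "\<forall>i<l. (\<Psi>(a := \<xi>)) i \<in> tangent_space X x" using \<Psi> \<xi> by simp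
  have j: "j \<le> l" "j < n" "l - Suc j < l" "l - Suc j \<noteq> a" using step l a by auto
  note w = clinear_in[OF word_clinear[OF \<Psi> j(1) l] e] clinear_in[OF word_clinear[OF \<Psi>' j(1) l] e]
  show ?case
    using step.IH j clinear_add[OF letter_clinear[OF j(2) \<Psi>[rule_format, OF j(3)]] w] by simp
qed

lemma word_tangent_scale:
  assumes \<Psi>: "\<forall>i<l. \<Psi> i \<in> tangent_space X x" and a: "a < l" and l: "l \<le> n"
    and e: "e \<in> carrier (fibre (B 0) x)" and j: "l - a \<le> j" "j \<le> l"
  shows "word_comp (chain_letter X B g x) (\<Psi>(a := tangent_scale X x z (\<Psi> a))) l j e =
    z \<odot>\<^bsub>fibre (B j) x\<^esub> word_comp (chain_letter X B g x) \<Psi> l j e"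
  using j
proof (induction j rule: dec_induct)
  case base
  define i where "i = l - Suc a"
  have i: "l - a = Suc i" "l - Suc i = a" "i < n" "i \<le> l" "Suc i \<le> n" using a l by (auto simp: i_def)
  have eq: "word_comp (chain_letter X B g x) (\<Psi>(a := \<zeta>)) l i = word_comp (chain_letter X B g x) \<Psi> l i" for \<zeta>
    by (rule word_comp_cong) (use i a in auto)
  have "word_comp (chain_letter X B g x) \<Psi> l i e \<in> carrier (fibre (B i) x)"
    by (rule clinear_in[OF word_clinear[OF \<Psi> i(4) l] e])
  then have "chain_letter X B g x i (tangent_scale X x z (\<Psi> a)) (word_comp (chain_letter X B g x) \<Psi> l i e) =
      z \<odot>\<^bsub>fibre (B (Suc i)) x\<^esub> chain_letter X B g x i (\<Psi> a) (word_comp (chain_letter X B g x) \<Psi> l i e)"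
    using bundle_iso.hom_connection_tangent_scale[OF chain_iso[OF _ i(5), of i] x \<Psi>[rule_format, OF a]]
    unfolding chain_letter_def by simp
  then show ?case unfolding i(1) word_comp.simps i(2) eq by simp
next
  case (step j)
  have j: "j \<le> l" "j < n" "l - Suc j < l" "l - Suc j \<noteq> a" using step l a by auto
  show ?case
    using step.IH j clinear_smult[OF letter_clinear[OF j(2) \<Psi>[rule_format, OF j(3)]] clinear_in[OF word_clinear[OF \<Psi> j(1) l] e]] by simp
qed

lemma trace_clinear:
  assumes "\<forall>i<l. \<Psi> i \<in> tangent_space X x" "l \<le> n"
  shows "clinear (fibre (B 0) x) (fibre (B 0) x) (\<lambda>e. g_inv 0 l (word_comp (chain_letter X B g x) \<Psi> l l e))"
  by (rule clinear_compose[OF word_clinear[OF assms(1) order.refl assms(2)] chain_inv_clinear[OF le0 assms(2)]])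

lemma chain_trace_eq:
  assumes "\<forall>i<l. \<Psi> i \<in> tangent_space X x" "l \<le> n" "coord_iso (fibre (B 0) x) r \<phi>"
  shows "chain_trace X B g l x \<Psi> = (\<Sum>k<r. \<phi> (g_inv 0 l (word_comp (chain_letter X B g x) \<Psi> l l
     (basis_vector (fibre (B 0) x) r \<phi> k))) k)"
  unfolding chain_trace_def by (rule vtrace_eq[OF chain_module[OF le0] assms(3) trace_clinear[OF assms(1,2)]])

lemma chain_trace_add:
  assumes \<Psi>: "\<forall>i<l. \<Psi> i \<in> tangent_space X x" and \<xi>: "\<xi> \<in> tangent_space X x" and a: "a < l" and l: "l \<le> n"
  shows "chain_trace X B g l x (\<Psi>(a := tangent_add X x (\<Psi> a) \<xi>)) =
    chain_trace X B g l x \<Psi> + chain_trace X B g l x (\<Psi>(a := \<xi>))"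
proof -
  obtain r \<phi> where \<phi>: "coord_iso (fibre (B 0) x) r \<phi>" using chain_coord[OF le0] .
  have \<Psi>1: "\<forall>i<l. (\<Psi>(a := \<xi>)) i \<in> tangent_space X x" using \<Psi> \<xi> by simp
  have \<Psi>2: "\<forall>i<l. (\<Psi>(a := tangent_add X x (\<Psi> a) \<xi>)) i \<in> tangent_space X x"
    using \<Psi> tangent_add_in[OF \<Psi>[rule_format, OF a] \<xi>] by simp
  have "\<phi> (g_inv 0 l (word_comp (chain_letter X B g x) (\<Psi>(a := tangent_add X x (\<Psi> a) \<xi>)) l l e)) k =
      \<phi> (g_inv 0 l (word_comp (chain_letter X B g x) \<Psi> l l e)) k +
      \<phi> (g_inv 0 l (word_comp (chain_letter X B g x) (\<Psi>(a := \<xi>)) l l e)) k"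
    if e: "e \<in> carrier (fibre (B 0) x)" and k: "k < r" for e k
    using word_tangent_add[OF \<Psi> \<xi> a l e] clinear_add[OF chain_inv_clinear[OF le0 l]
        clinear_in[OF word_clinear[OF \<Psi> order.refl l] e] clinear_in[OF word_clinear[OF \<Psi>1 order.refl l] e]]
      coord_add[OF \<phi> clinear_in[OF trace_clinear[OF \<Psi> l] e] clinear_in[OF trace_clinear[OF \<Psi>1 l] e] k] l a by (simp del: fun_upd_apply)
  then show ?thesis
    unfolding chain_trace_eq[OF \<Psi> l \<phi>] chain_trace_eq[OF \<Psi>1 l \<phi>] chain_trace_eq[OF \<Psi>2 l \<phi>]
    by (simp add: basis_vector_in[OF \<phi>] sum.distrib)
qed

lemma chain_trace_scale:
  assumes \<Psi>: "\<forall>i<l. \<Psi> i \<in> tangent_space X x" and a: "a < l" and l: "l \<le> n"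
  shows "chain_trace X B g l x (\<Psi>(a := tangent_scale X x z (\<Psi> a))) = z * chain_trace X B g l x \<Psi>"
proof -
  obtain r \<phi> where \<phi>: "coord_iso (fibre (B 0) x) r \<phi>" using chain_coord[OF le0] .
  have \<Psi>2: "\<forall>i<l. (\<Psi>(a := tangent_scale X x z (\<Psi> a))) i \<in> tangent_space X x"
    using \<Psi> tangent_scale_in[OF \<Psi>[rule_format, OF a]] by simp
  have "\<phi> (g_inv 0 l (word_comp (chain_letter X B g x) (\<Psi>(a := tangent_scale X x z (\<Psi> a))) l l e)) k =
      z * \<phi> (g_inv 0 l (word_comp (chain_letter X B g x) \<Psi> l l e)) k"
    if e: "e \<in> carrier (fibre (B 0) x)" and k: "k < r" for e k
    using word_tangent_scale[OF \<Psi> a l e] clinear_smult[OF chain_inv_clinear[OF le0 l]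
        clinear_in[OF word_clinear[OF \<Psi> order.refl l] e]]
      coord_smult[OF \<phi> clinear_in[OF trace_clinear[OF \<Psi> l] e] k] by simp
  then show ?thesis
    unfolding chain_trace_eq[OF \<Psi> l \<phi>] chain_trace_eq[OF \<Psi>2 l \<phi>]
    by (simp add: basis_vector_in[OF \<phi>] sum_distrib_left)
qed

end

lemma word_hol_sec:
  assumes c: "c \<in> charts_at X x" and s: "hol_sec X (B 0) c s x" and "j \<le> l" "l \<le> n"
  shows "hol_sec X (B j) c (\<lambda>y. word_comp (chain_letter X B g y) (\<lambda>i. coord_tangent X y c (v i)) l j (s y)) x"
  using assms(3)
proof (induction j)
  case (Suc j)
  then have "hol_sec X (B j) c (\<lambda>y. word_comp (chain_letter X B g y) (\<lambda>i. coord_tangent X y c (v i)) l j (s y)) x"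
    by simp
  from bundle_iso.hom_connection_hol_sec[OF chain_iso c this] show ?case
    using Suc.prems assms(4) by (simp add: chain_letter_def)
qed (use s in simp)

text \<open>\<open>vtrace\<close> chooses a basis in each fibre separately. Near \<open>x\<close>
  the trace is recomputed in a holomorphic frame of \<open>B 0\<close>, where every ingredient,
  including the inverse of the total composite, preserves holomorphy.\<close>

lemma chain_trace_hol:
  assumes c: "c \<in> charts_at X x" and l: "l \<le> n"
  shows "hol_in c (\<lambda>y. chain_trace X B g l y (\<lambda>i. coord_tangent X y c (v i))) x"
proof -
  interpret B0: holo_bundle X "B 0" by (rule chain_bundle) simp
  interpret Bl: holo_bundle X "B l" by (rule chain_bundle[OF l])
  obtain W r \<phi> where t: "(W, r, \<phi>) \<in> trivs (B 0)" "x \<in> W" using B0.triv_at[OF charts_at_points[OF c]] .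
  have cc: "c \<in> charts X" "x \<in> fst c" using c by (auto simp: charts_at_iff)
  have U: "openin (mtop X) (W \<inter> fst c)" "x \<in> W \<inter> fst c"
    using B0.triv_open[OF t(1)] chart_openin[OF cc(1)] t cc by auto
  let ?w = "\<lambda>y k. inv_into (carrier (fibre (B 0) y)) (g 0 l y)
    (word_comp (chain_letter X B g y) (\<lambda>i. coord_tangent X y c (v i)) l l (basis_vector (fibre (B 0) y) r (\<phi> y) k))"
  have "chain_trace X B g l y (\<lambda>i. coord_tangent X y c (v i)) = (\<Sum>k<r. \<phi> y (?w y k) k)" if "y \<in> W \<inter> fst c" for y
  proof -
    have "c \<in> charts_at X y" using that cc by (simp add: charts_at_iff)
    then show ?thesis
      using that by (intro chain_trace_eq[OF charts_at_points] allI impI coord_tangent_in l B0.triv_coord[OF t(1)]) auto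
  qed
  moreover have "hol_in c (\<lambda>y. \<Sum>k<r. \<phi> y (?w y k) k) x"
  proof (rule hol_in_sum)
    fix k assume "k \<in> {..<r}"
    moreover have "hol_sec X (B 0) c (\<lambda>y. ?w y k) x"
      by (intro iso_inverse_hol_sec[OF B0.is_bundle Bl.is_bundle bundle_iso.iso[OF chain_iso] c] word_hol_sec[OF c]
          B0.hol_sec_basis_vector[OF c t] l) auto
    ultimately show "hol_in c (\<lambda>y. \<phi> y (?w y k) k) x" using hol_sec_coord[OF _ t] by simp
  qed
  ultimately show ?thesis
    using hol_in_cong[OF c U, of "\<lambda>y. chain_trace X B g l y (\<lambda>i. coord_tangent X y c (v i))"] by simp
qed

lemma chain_form_in:
  assumes l: "l \<le> n"
  shows "restricted_form l (chain_form X B g l) \<in> holomorphic_forms X (points X) l"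
proof (rule restricted_form_in)
  have perm: "\<sigma> i < l" if "\<sigma> permutes {..<l}" "i < l" for \<sigma> i
    using permutes_in_image[OF that(1), of i] that(2) by simp
  have tup: "\<forall>i<l. (\<Xi> \<circ> \<sigma>) i \<in> tangent_space X x" if "\<Xi> \<in> tangent_tuples X l x" "\<sigma> permutes {..<l}" for \<Xi> \<sigma> x
    using tangent_tuplesD[OF that(1) perm[OF that(2)]] by simp
  \<comment> \<open>Changing the vector in place \<open>i\<close> changes the permuted tuple in the
    single place that \<sigma> sends to \<open>i\<close>.\<close>
  have upd: "\<exists>a<l. \<forall>\<zeta>. \<Xi>(i := \<zeta>) \<circ> \<sigma> = (\<Xi> \<circ> \<sigma>)(a := \<zeta>) \<and> \<sigma> a = i"
    if "\<sigma> permutes {..<l}" "i < l" for \<sigma> i and \<Xi> :: "nat \<Rightarrow> ('p, 'v) tangent"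
  proof (intro exI[of _ "inv_into UNIV \<sigma> i"] conjI allI)
    show "inv_into UNIV \<sigma> i < l" using perm[OF permutes_inv[OF that(1)] that(2)] .
    show "\<sigma> (inv_into UNIV \<sigma> i) = i" using permutes_inverses(1)[OF that(1)] .
    show "\<Xi>(i := \<zeta>) \<circ> \<sigma> = (\<Xi> \<circ> \<sigma>)(inv_into UNIV \<sigma> i := \<zeta>)" for \<zeta>
      using permutes_inverses[OF that(1)] by (auto simp: fun_eq_iff)
  qed
  { fix x \<Xi> i \<xi> assume *: "x \<in> points X" "\<Xi> \<in> tangent_tuples X l x" "i < l" "\<xi> \<in> tangent_space X x"
    have "chain_trace X B g l x (\<Xi>(i := tangent_add X x (\<Xi> i) \<xi>) \<circ> \<sigma>) =
        chain_trace X B g l x (\<Xi> \<circ> \<sigma>) + chain_trace X B g l x (\<Xi>(i := \<xi>) \<circ> \<sigma>)" if \<sigma>: "\<sigma> permutes {..<l}" for \<sigma>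
    proof -
      obtain a where a: "a < l" "\<And>\<zeta>. \<Xi>(i := \<zeta>) \<circ> \<sigma> = (\<Xi> \<circ> \<sigma>)(a := \<zeta>)" "\<sigma> a = i" using upd[OF \<sigma> *(3), of \<Xi>] by blast
      show ?thesis unfolding a(2) using chain_trace_add[OF *(1) tup[OF *(2) \<sigma>] *(4) a(1) l] a(3) by (simp add: comp_def)
    qed
    then show "chain_form X B g l x (\<Xi>(i := tangent_add X x (\<Xi> i) \<xi>)) = chain_form X B g l x \<Xi> + chain_form X B g l x (\<Xi>(i := \<xi>))"
      unfolding chain_form_def sum.distrib[symmetric] by (intro sum.cong) (auto simp: distrib_left) }
  { fix x \<Xi> i z assume *: "x \<in> points X" "\<Xi> \<in> tangent_tuples X l x" "i < l"
    have "chain_trace X B g l x (\<Xi>(i := tangent_scale X x z (\<Xi> i)) \<circ> \<sigma>) = z * chain_trace X B g l x (\<Xi> \<circ> \<sigma>)"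
      if \<sigma>: "\<sigma> permutes {..<l}" for \<sigma>
    proof -
      obtain a where a: "a < l" "\<And>\<zeta>. \<Xi>(i := \<zeta>) \<circ> \<sigma> = (\<Xi> \<circ> \<sigma>)(a := \<zeta>)" "\<sigma> a = i" using upd[OF \<sigma> *(3), of \<Xi>] by blast
      show ?thesis unfolding a(2) using chain_trace_scale[OF *(1) tup[OF *(2) \<sigma>] a(1) l] a(3) by (simp add: comp_def)
    qed
    then show "chain_form X B g l x (\<Xi>(i := tangent_scale X x z (\<Xi> i))) = z * chain_form X B g l x \<Xi>"
      unfolding chain_form_def sum_distrib_left by (intro sum.cong) auto }
  { fix x \<Xi> i j assume *: "\<Xi> \<in> tangent_tuples X l x" "i < l" "j < l" "i \<noteq> j" "\<Xi> i = \<Xi> j"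
    \<comment> \<open>Composing every permutation with this transposition permutes the summands,
      keeps the permuted tuples and reverses all signs, so the form equals its own negative.\<close>
    let ?t = "Transposition.transpose i j"
    have t: "?t permutes {..<l}" using * by (intro permutes_swap_id) auto
    have "\<Xi> \<circ> ?t = \<Xi>" using *(5) by (auto simp: fun_eq_iff Transposition.transpose_def)
    then have \<Xi>t: "\<Xi> \<circ> (?t \<circ> \<sigma>) = \<Xi> \<circ> \<sigma>" for \<sigma> :: "nat \<Rightarrow> nat" by (metis comp_assoc)
    have sgn: "sign (?t \<circ> \<sigma>) = - sign \<sigma>" if "\<sigma> permutes {..<l}" for \<sigma>
      using sign_compose[of ?t \<sigma>] permutation_permutes[of \<sigma>] that * by (auto simp: sign_swap_id permutation_swap_id)
    have "chain_form X B g l x \<Xi> =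
        (\<Sum>\<sigma> | \<sigma> permutes {..<l}. of_int (sign (?t \<circ> \<sigma>)) * chain_trace X B g l x (\<Xi> \<circ> (?t \<circ> \<sigma>)))"
      unfolding chain_form_def by (rule setum_permutations_compose_left[OF t])
    also have "\<dots> = - chain_form X B g l x \<Xi>"
      unfolding \<Xi>t chain_form_def sum_negf[symmetric] using sgn by (intro sum.cong) auto
    finally show "chain_form X B g l x \<Xi> = 0" by simp }
  fix x c v assume c: "c \<in> charts_at X x"
  have "chain_form X B g l y (\<lambda>i\<in>{..<l}. coord_tangent X y c (v i)) =
      (\<Sum>\<sigma> | \<sigma> permutes {..<l}. of_int (sign \<sigma>) * chain_trace X B g l y (\<lambda>i. coord_tangent X y c (v (\<sigma> i))))" for y
  proof -
    have "word_comp (chain_letter X B g y) ((\<lambda>i\<in>{..<l}. coord_tangent X y c (v i)) \<circ> \<sigma>) l l =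
        word_comp (chain_letter X B g y) (\<lambda>i. coord_tangent X y c (v (\<sigma> i))) l l" if "\<sigma> permutes {..<l}" for \<sigma>
      by (rule word_comp_cong) (use perm[OF that] in auto)
    then show ?thesis unfolding chain_form_def chain_trace_def by (intro sum.cong) auto
  qed
  then show "hol_in c (\<lambda>y. chain_form X B g l y (\<lambda>i\<in>{..<l}. coord_tangent X y c (v i))) x"
    by (simp only:) (intro hol_in_sum hol_in_mult hol_in_const chain_trace_hol[OF c l])
qed

end

text \<open>A word with \<open>l + 1\<close> letters, of which letter \<open>a\<close> is an
  isomorphism and consumes no tangent vector. The letters after it are therefore shifted by one
  against the tuple and read \<open>\<Psi> (l - j)\<close> instead of
  \<open>\<Psi> (l - Suc j)\<close>.\<close>

primrec insert_word ::
  "(nat \<Rightarrow> 't \<Rightarrow> 'f \<Rightarrow> 'f) \<Rightarrow> (nat \<Rightarrow> 'f \<Rightarrow> 'f) \<Rightarrow> (nat \<Rightarrow> 't) \<Rightarrow> nat \<Rightarrow> nat \<Rightarrow> nat \<Rightarrow> 'f \<Rightarrow> 'f" where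
  "insert_word A h \<Psi> l a 0 = (\<lambda>e. e)"
| "insert_word A h \<Psi> l a (Suc j) = (\<lambda>e. (if j < a then A j (\<Psi> (l - Suc j)) else if j = a then h a else A j (\<Psi> (l - j)))
     (insert_word A h \<Psi> l a j e))"

lemma insert_word_eq: "j \<le> a \<Longrightarrow> insert_word A h \<Psi> l a j = word_comp A \<Psi> l j"
  by (induction j) auto

text \<open>The coface map of the simplex category that omits the vertex \<open>j\<close>.\<close>

definition face_index :: "nat \<Rightarrow> nat \<Rightarrow> nat" where
  "face_index j p = (if p < j then p else Suc p)"

lemma nth_face: "Suc p < length xs \<Longrightarrow> (take j xs @ drop (Suc j) xs) ! p = xs ! face_index j p"
  by (auto simp: face_index_def nth_append min_def)

lemma alternating_telescope:
  fixes t :: "nat \<Rightarrow> 'a::comm_ring_1"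
  shows "(\<Sum>j\<in>{1..m}. (-1) ^ j * (t (j - 1) + t j)) = (-1) ^ m * t m - t 0"
  by (induction m) (auto simp: algebra_simps)

section \<open>Faces of a chain and the telescoping sum\<close>

context iso_chain
begin

lemma face_chain:
  assumes "n = Suc l" "j \<le> Suc l"
  shows "iso_chain X (\<lambda>p. B (face_index j p)) (\<lambda>p q. g (face_index j p) (face_index j q)) l"
  by (rule iso_chain.intro[OF atlas_axioms], rule iso_chain_axioms.intro)
    (use assms in \<open>auto intro!: chain_iso chain_comp simp: face_index_def\<close>)

context
  fixes x :: 'p and \<Psi> :: "nat \<Rightarrow> ('p, 'v) tangent" and l :: nat
  assumes x: "x \<in> points X" and \<Psi>: "\<forall>i<l. \<Psi> i \<in> tangent_space X x" and n: "n = Suc l" and l: "0 < l"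
begin

abbreviation "A \<equiv> chain_letter X B g x"
abbreviation "ins \<equiv> insert_word (chain_letter X B g x) (\<lambda>a. g a (Suc a) x) \<Psi> l"
abbreviation "face_letter j \<equiv>
  chain_letter X (\<lambda>p. B (face_index j p)) (\<lambda>p q. g (face_index j p) (face_index j q)) x"
abbreviation "face_trace j \<equiv>
  chain_trace X (\<lambda>p. B (face_index j p)) (\<lambda>p q. g (face_index j p) (face_index j q)) l x \<Psi>"

text \<open>With letters counted from 0, this is the quantity T with index \<open>a + 1\<close> of
  the overview.\<close>

definition insert_trace :: "nat \<Rightarrow> complex" where
  "insert_trace a = vtrace (fibre (B 0) x) (\<lambda>e. g_inv x 0 n (ins a n e))"

lemma insert_word_clinear:
  assumes "a \<le> l" "j \<le> n"
  shows "clinear (fibre (B 0) x) (fibre (B j) x) (ins a j)"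
  using assms(2)
proof (induction j)
  case 0
  then show ?case by (simp add: clinear_id)
next
  case (Suc j)
  then have IH: "clinear (fibre (B 0) x) (fibre (B j) x) (ins a j)" by simp
  have "clinear (fibre (B j) x) (fibre (B (Suc j)) x)
      (if j < a then A j (\<Psi> (l - Suc j)) else if j = a then g a (Suc a) x else A j (\<Psi> (l - j)))"
    using Suc.prems assms(1) n l \<Psi> letter_clinear[OF x, of j] chain_clinear[OF x, of a "Suc a"] by auto
  from clinear_compose[OF IH this] show ?case by simp
qed

lemma insert_trace_clinear:
  assumes "a \<le> l"
  shows "clinear (fibre (B 0) x) (fibre (B 0) x) (\<lambda>e. g_inv x 0 n (ins a n e))"
  by (rule clinear_compose[OF insert_word_clinear[OF assms order.refl] chain_inv_clinear[OF x le0 order.refl]])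

text \<open>The Leibniz rule for the letter that spans the omitted vertex.\<close>

lemma face_word:
  assumes j: "j < l" and i: "Suc j \<le> i" "i \<le> l" and e: "e \<in> carrier (fibre (B 0) x)"
  shows "word_comp (face_letter (Suc j)) \<Psi> l i e =
    ins j (Suc i) e \<oplus>\<^bsub>fibre (B (Suc i)) x\<^esub> ins (Suc j) (Suc i) e"
  using i
proof (induction i rule: dec_induct)
  case base
  define w where "w = word_comp A \<Psi> l j e"
  have w: "w \<in> carrier (fibre (B j) x)"
    unfolding w_def using \<Psi> j n by (intro clinear_in[OF word_clinear[OF x _ _ _] e]) auto
  have \<xi>: "\<Psi> (l - Suc j) \<in> tangent_space X x" using \<Psi> j by simp
  have "word_comp (face_letter (Suc j)) \<Psi> l j = word_comp A \<Psi> l j"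
    by (rule word_comp_cong) (auto simp: chain_letter_def face_index_def)
  then have "word_comp (face_letter (Suc j)) \<Psi> l (Suc j) e =
      hom_connection X (B j) (B (Suc (Suc j))) (g j (Suc (Suc j))) x (\<Psi> (l - Suc j)) w"
    by (simp add: w_def chain_letter_def face_index_def)
  also have "\<dots> = A (Suc j) (\<Psi> (l - Suc j)) (g j (Suc j) x w) \<oplus>\<^bsub>fibre (B (Suc (Suc j))) x\<^esub>
      g (Suc j) (Suc (Suc j)) x (A j (\<Psi> (l - Suc j)) w)"
    using hom_connection_Comp[OF chain_iso[of j "Suc j"] chain_iso[of "Suc j" "Suc (Suc j)"] x \<xi> w]
      chain_comp[of j "Suc j" "Suc (Suc j)"] j n by (simp add: chain_letter_def)
  also have "g j (Suc j) x w = ins j (Suc j) e" by (simp add: w_def insert_word_eq)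
  also have "A j (\<Psi> (l - Suc j)) w = ins (Suc j) (Suc j) e" by (simp add: w_def insert_word_eq)
  finally show ?case by simp
next
  case (step i)
  have i: "Suc i < n" "j \<le> l" "Suc j \<le> l" "Suc i \<le> n" "l - Suc i < l" using step j n by auto
  have "word_comp (face_letter (Suc j)) \<Psi> l (Suc i) e =
      A (Suc i) (\<Psi> (l - Suc i)) (ins j (Suc i) e \<oplus>\<^bsub>fibre (B (Suc i)) x\<^esub> ins (Suc j) (Suc i) e)"
    using step by (simp add: chain_letter_def face_index_def)
  also have "\<dots> = A (Suc i) (\<Psi> (l - Suc i)) (ins j (Suc i) e) \<oplus>\<^bsub>fibre (B (Suc (Suc i))) x\<^esub>
      A (Suc i) (\<Psi> (l - Suc i)) (ins (Suc j) (Suc i) e)"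
    using \<Psi> i by (intro clinear_add[OF letter_clinear[OF x i(1)]] clinear_in[OF insert_word_clinear _]) (auto intro: e)
  finally show ?case using step j by simp
qed

lemma face_trace_middle:
  assumes j: "j < l"
  shows "face_trace (Suc j) = insert_trace j + insert_trace (Suc j)"
proof -
  obtain r \<phi> where \<phi>: "coord_iso (fibre (B 0) x) r \<phi>" using chain_coord[OF x le0] .
  have "face_trace (Suc j) = vtrace (fibre (B 0) x) (\<lambda>e. g_inv x 0 n (word_comp (face_letter (Suc j)) \<Psi> l l e))"
    using j n by (simp add: chain_trace_def face_index_def)
  also have "\<dots> = vtrace (fibre (B 0) x) (\<lambda>e. g_inv x 0 n (ins j n e) \<oplus>\<^bsub>fibre (B 0) x\<^esub> g_inv x 0 n (ins (Suc j) n e))"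
  proof (rule vtrace_cong[OF chain_module[OF x le0] \<phi>])
    fix e assume e: "e \<in> carrier (fibre (B 0) x)"
    have "word_comp (face_letter (Suc j)) \<Psi> l l e = ins j n e \<oplus>\<^bsub>fibre (B n) x\<^esub> ins (Suc j) n e"
      using face_word[OF j _ order.refl e] j n by simp
    moreover have "ins j n e \<in> carrier (fibre (B n) x)" "ins (Suc j) n e \<in> carrier (fibre (B n) x)"
      using j e by (auto intro!: clinear_in[OF insert_word_clinear])
    ultimately show "g_inv x 0 n (word_comp (face_letter (Suc j)) \<Psi> l l e) =
        g_inv x 0 n (ins j n e) \<oplus>\<^bsub>fibre (B 0) x\<^esub> g_inv x 0 n (ins (Suc j) n e)"
      using clinear_add[OF chain_inv_clinear[OF x le0 order.refl]] by simp
  qed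
  also have "\<dots> = insert_trace j + insert_trace (Suc j)"
    unfolding insert_trace_def using j by (intro vtrace_add[OF chain_module[OF x le0] \<phi>] insert_trace_clinear) auto
  finally show ?thesis .
qed

text \<open>The inserted isomorphism \<open>g l n\<close> is cancelled by the corresponding factor
  of the inverse of \<open>g 0 n\<close>.\<close>

lemma face_trace_last: "face_trace (Suc l) = insert_trace l"
proof -
  obtain r \<phi> where \<phi>: "coord_iso (fibre (B 0) x) r \<phi>" using chain_coord[OF x le0] .
  have "word_comp (face_letter (Suc l)) \<Psi> l l = word_comp A \<Psi> l l"
    by (rule word_comp_cong) (auto simp: chain_letter_def face_index_def)
  then have "face_trace (Suc l) = vtrace (fibre (B 0) x) (\<lambda>e. g_inv x 0 l (word_comp A \<Psi> l l e))"
    by (simp add: chain_trace_def face_index_def)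
  also have "\<dots> = insert_trace l"
    unfolding insert_trace_def
  proof (rule vtrace_cong[OF chain_module[OF x le0] \<phi>])
    fix e assume e: "e \<in> carrier (fibre (B 0) x)"
    have w: "word_comp A \<Psi> l l e \<in> carrier (fibre (B l) x)"
      by (rule clinear_in[OF word_clinear[OF x \<Psi> order.refl] e]) (simp add: n)
    have "ins l n e = g l n x (word_comp A \<Psi> l l e)" by (simp add: n insert_word_eq)
    then show "g_inv x 0 l (word_comp A \<Psi> l l e) = g_inv x 0 n (ins l n e)"
      using chain_inv_comp[OF x, of 0 l n "g l n x (word_comp A \<Psi> l l e)"] w n
        clinear_in[OF chain_clinear[OF x, of l n] w] chain_inv_left[OF x, of l n "word_comp A \<Psi> l l e"] by simp
  qed
  finally show ?thesis .
qed

text \<open>Cyclicity of the trace, in the form of invariance under conjugation with \<open>g 0 1\<close>.\<close>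

lemma face_trace_first: "face_trace 0 = insert_trace 0"
proof -
  interpret F: iso_chain X "\<lambda>p. B (face_index 0 p)" "\<lambda>p q. g (face_index 0 p) (face_index 0 q)" l
    by (rule face_chain[OF n le0])
  obtain r \<phi> where \<phi>: "coord_iso (fibre (B 0) x) r \<phi>" using chain_coord[OF x le0] .
  have one: "1 \<le> n" using n by simp
  obtain s \<psi> where \<psi>: "coord_iso (fibre (B 1) x) s \<psi>" using chain_coord[OF x one] .
  \<comment> \<open>Inserting \<open>g 0 1\<close> as the first letter amounts to applying it before
    the word of the face that omits the vertex 0.\<close>
  have ins: "ins 0 (Suc i) e = word_comp (face_letter 0) \<Psi> l i (g 0 1 x e)" for i e
    by (induction i) (simp_all add: chain_letter_def face_index_def)
  let ?S = "\<lambda>u. g_inv x 1 n (word_comp (face_letter 0) \<Psi> l l u)"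
  have S: "clinear (fibre (B 1) x) (fibre (B 1) x) ?S"
    using F.trace_clinear[OF x \<Psi> order.refl] n by (simp add: face_index_def)
  have W: "clinear (fibre (B 1) x) (fibre (B n) x) (word_comp (face_letter 0) \<Psi> l l)"
    using F.word_clinear[OF x \<Psi> order.refl order.refl] n by (simp add: face_index_def)
  have "insert_trace 0 = vtrace (fibre (B 0) x) (\<lambda>e. g_inv x 0 1 (?S (g 0 1 x e)))"
    unfolding insert_trace_def
  proof (rule vtrace_cong[OF chain_module[OF x le0] \<phi>])
    fix e assume e: "e \<in> carrier (fibre (B 0) x)"
    have "g 0 1 x e \<in> carrier (fibre (B 1) x)" by (rule clinear_in[OF chain_clinear[OF x le0 one] e])
    from clinear_in[OF W this] show "g_inv x 0 n (ins 0 n e) = g_inv x 0 1 (?S (g 0 1 x e))"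
      using chain_inv_comp[OF x le0 one order.refl] ins[of l e] by (simp add: n)
  qed
  also have "\<dots> = vtrace (fibre (B 1) x) ?S"
    by (rule vtrace_conjugate[OF chain_module[OF x le0] chain_module[OF x one] \<psi> chain_clinear[OF x le0 one]
      chain_bij[OF x le0 one] S])
  also have "\<dots> = face_trace 0" using n by (simp add: chain_trace_def face_index_def)
  finally show ?thesis by simp
qed

lemma face_trace_sum: "(\<Sum>j\<le>Suc l. (-1) ^ j * face_trace j) = 0"
proof -
  have "(\<Sum>j\<in>{1..l}. (-1) ^ j * face_trace j) = (\<Sum>j\<in>{1..l}. (-1) ^ j * (insert_trace (j - 1) + insert_trace j))"
  proof (rule sum.cong)
    fix j assume "j \<in> {1..l}"
    then obtain i where "j = Suc i" "i < l" by (cases j) auto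
    then show "(-1) ^ j * face_trace j = (-1) ^ j * (insert_trace (j - 1) + insert_trace j)"
      using face_trace_middle[of i] by simp
  qed simp
  also have "\<dots> = (-1) ^ l * insert_trace l - insert_trace 0" by (rule alternating_telescope)
  finally have mid: "(\<Sum>j\<in>{1..l}. (-1) ^ j * face_trace j) = (-1) ^ l * insert_trace l - insert_trace 0" .
  have "{..Suc l} = insert 0 (insert (Suc l) {1..l})" by auto
  then have "(\<Sum>j\<le>Suc l. (-1) ^ j * face_trace j) =
      face_trace 0 + ((-1) ^ Suc l * face_trace (Suc l) + (\<Sum>j\<in>{1..l}. (-1) ^ j * face_trace j))" by simp
  then show ?thesis unfolding mid face_trace_first face_trace_last by simp
qed

end

text \<open>The traces telescope for each permutation of the tangent vectors separately, so the sum
  over faces is moved inside the sum over permutations.\<close>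

lemma chain_form_boundary:
  assumes "x \<in> points X" "\<Xi> \<in> tangent_tuples X l x" "n = Suc l" "0 < l"
  shows "(\<Sum>j\<le>Suc l. (-1) ^ j *
    chain_form X (\<lambda>p. B (face_index j p)) (\<lambda>p q. g (face_index j p) (face_index j q)) l x \<Xi>) = 0"
proof -
  have zero: "(\<Sum>j\<le>Suc l. (-1) ^ j * chain_trace X (\<lambda>p. B (face_index j p))
      (\<lambda>p q. g (face_index j p) (face_index j q)) l x (\<Xi> \<circ> \<sigma>)) = 0" if "\<sigma> permutes {..<l}" for \<sigma>
  proof (rule face_trace_sum[OF assms(1) _ assms(3,4)])
    show "\<forall>i<l. (\<Xi> \<circ> \<sigma>) i \<in> tangent_space X x"
      using tangent_tuplesD[OF assms(2)] permutes_in_image[OF that] by (metis comp_apply lessThan_iff)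
  qed
  have "(\<Sum>j\<le>Suc l. (-1) ^ j *
      chain_form X (\<lambda>p. B (face_index j p)) (\<lambda>p q. g (face_index j p) (face_index j q)) l x \<Xi>) =
    (\<Sum>\<sigma> | \<sigma> permutes {..<l}. of_int (sign \<sigma>) * (\<Sum>j\<le>Suc l. (-1) ^ j * chain_trace X (\<lambda>p. B (face_index j p))
      (\<lambda>p q. g (face_index j p) (face_index j q)) l x (\<Xi> \<circ> \<sigma>)))"
    unfolding chain_form_def sum_distrib_left by (subst sum.swap) (intro sum.cong refl mult.left_commute)
  also have "\<dots> = 0" using zero by (intro sum.neutral) auto
  finally show ?thesis .
qed

end

section \<open>The Chern character as a chain map\<close>

context atlas
begin

lemma simplex_chain:
  assumes "(E, f) \<in> simp (psh_obj HVB X) k" "is \<in> simplex_generators k l"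
  shows "iso_chain X (\<lambda>j. E (is ! j)) (\<lambda>p q. nerve_comp (HVB_cat X) E f (is ! p) (is ! q)) l"
proof -
  have x: "(E, f) \<in> simp (nerve (HVB_cat X)) k" using assms(1) by (simp add: HVB_def)
  have idx: "is ! p \<le> is ! q" "is ! q \<le> k" if "p \<le> q" "q \<le> l" for p q
    using assms(2) that by (auto simp: in_simplex_generators_iff le_less)
  show ?thesis
  proof unfold_locales
    fix p q assume pq: "p \<le> q" "q \<le> l"
    show "E (is ! p) \<in> Ob (HVB_cat X)" "E (is ! q) \<in> Ob (HVB_cat X)"
      using x idx[OF pq] by (auto simp: simp_nerve_iff)
    show "nerve_comp (HVB_cat X) E f (is ! p) (is ! q) \<in> bundle_isos X (E (is ! p)) (E (is ! q))"
      using nerve_comp_in_Hom[OF category_HVB x idx[OF pq]] by (simp add: Hom_HVB_cat)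
  next
    fix p q r assume pqr: "p \<le> q" "q \<le> r" "r \<le> l"
    have "is ! p \<le> is ! q" using idx[of p q] pqr by simp
    then show "nerve_comp (HVB_cat X) E f (is ! p) (is ! r) =
        Comp (HVB_cat X) (E (is ! p)) (E (is ! q)) (E (is ! r))
          (nerve_comp (HVB_cat X) E f (is ! q) (is ! r)) (nerve_comp (HVB_cat X) E f (is ! p) (is ! q))"
      using nerve_comp_trans[OF category_HVB x _ idx[OF pqr(2,3)]] by simp
  qed
qed

lemma Ch_form_eq:
  "0 < l \<Longrightarrow> Ch_form X (E, f) l is =
     restricted_form l (chain_form X (\<lambda>j. E (is ! j)) (\<lambda>p q. nerve_comp (HVB_cat X) E f (is ! p) (is ! q)) l)"
  by (simp add: Ch_form_def restricted_form_def chain_form_def chain_trace_def chain_letter_def Let_def)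

lemma Ch_form_0:
  "Ch_form X (E, f) 0 is = restricted_form 0 (\<lambda>x \<Xi>. of_nat (vdim (fibre (E (is ! 0)) x)))"
  by (simp add: Ch_form_def restricted_form_def)

lemma Ch_form_in:
  assumes "(E, f) \<in> simp (psh_obj HVB X) k" "is \<in> simplex_generators k l"
  shows "Ch_form X (E, f) l is \<in> holomorphic_forms X (points X) l"
proof (cases "l = 0")
  case True
  interpret iso_chain X "\<lambda>j. E (is ! j)" "\<lambda>p q. nerve_comp (HVB_cat X) E f (is ! p) (is ! q)" l
    by (rule simplex_chain[OF assms])
  interpret B: holo_bundle X "E (is ! 0)" using chain_bundle[of 0] by simp
  show ?thesis unfolding True Ch_form_0
  proof (rule restricted_form_in)
    fix x c assume x: "x \<in> points X" and c: "c \<in> charts_at X x"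
    obtain W r \<phi> where t: "(W, r, \<phi>) \<in> trivs (E (is ! 0))" "x \<in> W" using B.triv_at[OF x] .
    \<comment> \<open>The dimension is locally constant, being the rank of a trivialization, and
      hence holomorphic.\<close>
    have "vdim (fibre (E (is ! 0)) y) = r" if "y \<in> W" for y
      using vdim_eq[OF B.fibre_module[OF B.triv_points[OF t(1) that]] B.triv_coord[OF t(1) that]] .
    then show "hol_in c (\<lambda>y. of_nat (vdim (fibre (E (is ! 0)) y))) x"
      using hol_in_cong[OF c B.triv_open[OF t(1)] t(2), of "\<lambda>y. of_nat (vdim (fibre (E (is ! 0)) y))" "\<lambda>y. of_nat r"]
        hol_in_const by simp
  qed auto
next
  case False
  then show ?thesis using iso_chain.chain_form_in[OF simplex_chain[OF assms] order.refl] by (simp add: Ch_form_eq)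
qed

lemma Ch_form_boundary:
  assumes "(E, f) \<in> simp (psh_obj HVB X) k" "is \<in> simplex_generators k (Suc l)"
    and x: "x \<in> points X" and \<Xi>: "\<Xi> \<in> tangent_tuples X l x"
  shows "(\<Sum>j\<le>Suc l. (-1) ^ j * Ch_form X (E, f) l (take j is @ drop (Suc j) is) x \<Xi>) = 0"
proof -
  let ?B = "\<lambda>j. E (is ! j)" and ?g = "\<lambda>p q. nerve_comp (HVB_cat X) E f (is ! p) (is ! q)"
  interpret iso_chain X ?B ?g "Suc l" by (rule simplex_chain[OF assms(1,2)])
  have len: "length is = Suc (Suc l)" using assms(2) by (simp add: simplex_generators_def)
  show ?thesis
  proof (cases "l = 0")
    case True
    \<comment> \<open>In degree 0 there are no letters to telescope: the boundary is the difference
      of the dimensions at the two vertices, which are isomorphic.\<close>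
    have "vdim (fibre (?B 0) x) = vdim (fibre (?B 1) x)"
    proof -
      have one: "1 \<le> Suc l" by simp
      obtain r \<phi> where \<phi>: "coord_iso (fibre (?B 1) x) r \<phi>" using chain_coord[OF x one] .
      show ?thesis
        by (rule vdim_iso[OF chain_module[OF x le0] chain_module[OF x one] \<phi> chain_clinear[OF x le0 one] chain_bij[OF x le0 one]])
    qed
    then show ?thesis
      using x \<Xi> True len by (simp add: Ch_form_0 restricted_form_def hd_conv_nth hd_drop_conv_nth nth_append)
  next
    case False
    then have l0: "0 < l" by simp
    have "Ch_form X (E, f) l (take j is @ drop (Suc j) is) x \<Xi> =
        chain_form X (\<lambda>p. ?B (face_index j p)) (\<lambda>p q. ?g (face_index j p) (face_index j q)) l x \<Xi>"
      if "j \<le> Suc l" for j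
    proof -
      have "Ch_form X (E, f) l (take j is @ drop (Suc j) is) x \<Xi> =
          chain_form X (\<lambda>p. E ((take j is @ drop (Suc j) is) ! p)) (\<lambda>p q. nerve_comp (HVB_cat X) E f
            ((take j is @ drop (Suc j) is) ! p) ((take j is @ drop (Suc j) is) ! q)) l x \<Xi>"
        using False x \<Xi> unfolding Ch_form_eq[OF l0] restricted_form_def by simp
      also have "\<dots> = chain_form X (\<lambda>p. ?B (face_index j p)) (\<lambda>p q. ?g (face_index j p) (face_index j q)) l x \<Xi>"
        using len by (intro chain_form_cong) (simp_all add: nth_face)
      finally show ?thesis .
    qed
    then show ?thesis
      using chain_form_boundary[OF x \<Xi> refl] False by simp
  qed
qed

text \<open>A generator of degree \<open>-l\<close> goes to an element of that degree. The
  coefficient of \<open>u^p\<close> is then a form of degree \<open>2 * p - l\<close>, and among the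
  admissible exponents only \<open>p = l\<close> gives an \<open>l\<close>-form.\<close>

definition Ch_gen :: "('p, 'v, 'f) HVB_simplex \<Rightarrow> nat \<Rightarrow> nat list \<Rightarrow> ('p, 'v) form_poly" where
  "Ch_gen Ef l is = (\<lambda>p\<in>{p. l \<le> 2 * p}. if p = l then Ch_form X Ef l is else form_zero X (2 * p - l))"

lemma Ch_gen_in:
  assumes "Ef \<in> simp (psh_obj HVB X) k" "is \<in> simplex_generators k l"
  shows "Ch_gen Ef l is \<in> carrier (Omega_group X l)"
proof (rule carrier_Omega_groupI[where S = "{l}"])
  obtain E f where Ef: "Ef = (E, f)" by (cases Ef)
  fix p assume "l \<le> 2 * p"
  then show "Ch_gen Ef l is p \<in> holomorphic_forms X (points X) (2 * p - l)"
    using Ch_form_in[of E f k "is" l] assms form_zero_in by (auto simp: Ch_gen_def Ef)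
qed (auto simp: Ch_gen_def)

lemma Ch_apply:
  "Ef \<in> simp (psh_obj HVB X) k \<Longrightarrow> Ch X k Ef l = free_extension (simplex_generators k l) (Omega_group X l) (Ch_gen Ef l)"
  by (simp add: Ch_def Ch_gen_def[abs_def])

lemma Ch_hom:
  assumes "Ef \<in> simp (psh_obj HVB X) k"
  shows "Ch X k Ef l \<in> hom (free_Abelian_group (simplex_generators k l)) (Omega_group X l)"
  unfolding Ch_apply[OF assms] by (rule free_extension_hom[OF comm_group_Omega_group Ch_gen_in[OF assms]])

lemma Ch_frag_of:
  assumes "Ef \<in> simp (psh_obj HVB X) k" "is \<in> simplex_generators k l"
  shows "Ch X k Ef l (frag_of is) = Ch_gen Ef l is"
  unfolding Ch_apply[OF assms(1)] by (rule free_extension_frag_of[where g = "Ch_gen Ef l", OF comm_group_Omega_group assms(2) Ch_gen_in[OF assms]])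

lemma group_Omega_group: "group (Omega_group X l)"
  using comm_group_Omega_group by (rule comm_group.axioms(2))

text \<open>The right side is the zero of the target group in multiplicative notation, the value of
  its differential. Both sides are homomorphisms in \<open>c\<close>, so generators suffice;
  evaluation at an exponent, a point and a tuple then leaves an alternating sum of complex
  numbers.\<close>

lemma Ch_Diff:
  assumes Ef: "Ef \<in> simp (psh_obj HVB X) k" and c: "Poly_Mapping.keys c \<subseteq> simplex_generators k (Suc l)"
  shows "Ch X k Ef l (Diff (normalized_chains k) l c) = \<one>\<^bsub>Omega_group X l\<^esub>"
proof (rule hom_free_Abelian_group_eqI[where h = "\<lambda>c. Ch X k Ef l (Diff (normalized_chains k) l c)",
    OF group_Omega_group _ _ _ c])
  let ?d = "Diff (normalized_chains k) l"
  have add: "?d (a + b) = ?d a + ?d b" for a b by (simp add: Diff_normalized_chains frag_extend_add)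
  show "(\<lambda>c. Ch X k Ef l (?d c)) \<in> hom (free_Abelian_group (simplex_generators k (Suc l))) (Omega_group X l)"
    using keys_Diff_normalized_chains[of _ k l] hom_mult[OF Ch_hom[OF Ef, of l]] hom_in_carrier[OF Ch_hom[OF Ef, of l]]
    by (intro homI) (simp_all add: add)
  show "(\<lambda>_. \<one>\<^bsub>Omega_group X l\<^esub>) \<in> hom (free_Abelian_group (simplex_generators k (Suc l))) (Omega_group X l)"
    by (rule trivial_hom[OF group_Omega_group])
  fix "is" assume mem: "is \<in> simplex_generators k (Suc l)"
  let ?face = "\<lambda>j. take j is @ drop (Suc j) is"
  have keys: "Poly_Mapping.keys (?d (frag_of is)) \<subseteq> simplex_generators k l"
    by (rule keys_Diff_normalized_chains) (simp add: mem)
  obtain E f where Ef_eq: "Ef = (E, f)" by (cases Ef)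
  show "Ch X k Ef l (?d (frag_of is)) = \<one>\<^bsub>Omega_group X l\<^esub>"
  proof (rule Omega_group_eqI[OF _ one_Omega_group_in])
    show "Ch X k Ef l (?d (frag_of is)) \<in> carrier (Omega_group X l)"
      using hom_in_carrier[OF Ch_hom[OF Ef]] keys by simp
    fix p x \<Xi> assume p: "l \<le> 2 * p" and x: "x \<in> points X" and \<Xi>: "\<Xi> \<in> tangent_tuples X (2 * p - l) x"
    let ?ev = "\<lambda>c. Ch X k Ef l c p x \<Xi>"
    have "?ev (a + b) = ?ev a + ?ev b"
      if "Poly_Mapping.keys a \<subseteq> simplex_generators k l" "Poly_Mapping.keys b \<subseteq> simplex_generators k l" for a b
      using hom_mult[OF Ch_hom[OF Ef, of l], of a b] that mult_Omega_group_apply[OF p x \<Xi>] by simp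
    from additive_frag_sum[of "simplex_generators k l" ?ev "{..Suc l}" ?face "\<lambda>j. (-1) ^ j", OF this]
    have "?ev (?d (frag_of is)) = (\<Sum>j\<le>Suc l. (-1) ^ j * ?ev (frag_of (?face j)))"
      using simplex_generators_face[OF mem] by (simp add: Diff_normalized_chains)
    also have "\<dots> = (\<Sum>j\<le>Suc l. (-1) ^ j * (if p = l then Ch_form X Ef l (?face j) x \<Xi> else 0))"
      using simplex_generators_face[OF mem] p x \<Xi>
      by (intro sum.cong) (auto simp: Ch_frag_of[OF Ef] Ch_gen_def form_zero_apply)
    also have "\<dots> = 0"
      using Ch_form_boundary[of E f k "is" l x \<Xi>] Ef mem x \<Xi> by (cases "p = l") (simp_all add: Ef_eq)
    finally show "?ev (?d (frag_of is)) = \<one>\<^bsub>Omega_group X l\<^esub> p x \<Xi>" using one_Omega_group_apply[OF p x \<Xi>] by simp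
  qed
qed

lemma Ch_in:
  assumes "Ef \<in> simp (psh_obj HVB X) k"
  shows "Ch X k Ef \<in> simp (psh_obj Omega X) k"
proof -
  have "Ch X k Ef l \<in> extensional (carrier (free_Abelian_group (simplex_generators k l)))" for l
    unfolding Ch_apply[OF assms] free_extension_def by simp
  then show ?thesis
    using Ch_hom[OF assms] Ch_Diff[OF assms] by (simp add: Omega_def simp_DK chain_maps_iff Omega_complex_def)
qed

end

section \<open>Degenerate simplices\<close>

context iso_chain
begin

text \<open>The letter with index \<open>a\<close> is the derivative of an identity and vanishes,
  and the later letters and the final inverse are linear, so the whole word vanishes.\<close>

lemma chain_trace_degenerate:
  assumes x: "x \<in> points X" and \<Psi>: "\<forall>i<l. \<Psi> i \<in> tangent_space X x" and a: "a < l" and l: "l \<le> n"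
    and B: "B (Suc a) = B a" and g: "g a (Suc a) = Id (HVB_cat X) (B a)"
  shows "chain_trace X B g l x \<Psi> = 0"
proof -
  obtain r \<phi> where \<phi>: "coord_iso (fibre (B 0) x) r \<phi>" using chain_coord[OF x le0] .
  have an: "a \<le> n" "a < n" using a l by auto
  obtain s \<psi> where \<psi>: "coord_iso (fibre (B a) x) s \<psi>" using chain_coord[OF x an(1)] .
  let ?w = "word_comp (chain_letter X B g x) \<Psi> l"
  \<comment> \<open>Vanishing of the word from letter \<open>a\<close> on, in the form of a vector
    equal to its own double, which passes through the subsequent linear letters.\<close>
  have null: "?w j e \<oplus>\<^bsub>fibre (B j) x\<^esub> ?w j e = ?w j e"
    if e: "e \<in> carrier (fibre (B 0) x)" and j: "Suc a \<le> j" "j \<le> l" for e j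
    using j
  proof (induction j rule: dec_induct)
    case base
    have w: "?w a e \<in> carrier (fibre (B a) x)" using a by (intro clinear_in[OF word_clinear[OF x \<Psi> _ l] e]) simp
    have v: "?w (Suc a) e \<in> carrier (fibre (B a) x)" using clinear_in[OF word_clinear[OF x \<Psi> _ l] e, of "Suc a"] a B by simp
    have zero: "\<psi> (?w (Suc a) e) i = 0" if "i < s" for i
      using hom_connection_Id[OF bundle_iso.E_Ob[OF chain_iso[of a a]] x _ w \<psi> that, of "\<Psi> (l - Suc a)"] \<Psi> a an
      by (simp add: chain_letter_def B g)
    then show ?case unfolding B
      by (intro coord_eqI[OF \<psi> complex_module_closed(1)[OF chain_module[OF x an(1)] v v] v]) (simp add: coord_add[OF \<psi> v v] zero del: word_comp.simps)
  next
    case (step j)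
    have j: "j < n" "l - Suc j < l" "j \<le> l" using step a l by auto
    have w: "?w j e \<in> carrier (fibre (B j) x)" by (rule clinear_in[OF word_clinear[OF x \<Psi> j(3) l] e])
    show ?case
      using clinear_add[OF letter_clinear[OF x j(1), of "\<Psi> (l - Suc j)"] w w] \<Psi> j(2) step by simp
  qed
  have "\<phi> (g_inv x 0 l (?w l e)) k = 0" if e: "e \<in> carrier (fibre (B 0) x)" and k: "k < r" for e k
  proof -
    have w: "?w l e \<in> carrier (fibre (B l) x)" by (rule clinear_in[OF word_clinear[OF x \<Psi> order.refl l] e])
    have u: "g_inv x 0 l (?w l e) \<in> carrier (fibre (B 0) x)" by (rule clinear_in[OF chain_inv_clinear[OF x le0 l] w])
    have "g_inv x 0 l (?w l e) = g_inv x 0 l (?w l e) \<oplus>\<^bsub>fibre (B 0) x\<^esub> g_inv x 0 l (?w l e)"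
      using clinear_add[OF chain_inv_clinear[OF x le0 l] w w] null[OF e _ order.refl] a by simp
    then have "\<phi> (g_inv x 0 l (?w l e)) k = \<phi> (g_inv x 0 l (?w l e)) k + \<phi> (g_inv x 0 l (?w l e)) k"
      using coord_add[OF \<phi> u u k] by simp
    then show ?thesis by simp
  qed
  then show ?thesis unfolding chain_trace_eq[OF x \<Psi> l \<phi>] by (simp add: basis_vector_in[OF \<phi>])
qed

lemma chain_form_degenerate:
  assumes "x \<in> points X" "\<Xi> \<in> tangent_tuples X l x" "a < l" "l \<le> n" "B (Suc a) = B a" "g a (Suc a) = Id (HVB_cat X) (B a)"
  shows "chain_form X B g l x \<Xi> = 0"
proof -
  have "chain_trace X B g l x (\<Xi> \<circ> \<sigma>) = 0" if "\<sigma> permutes {..<l}" for \<sigma>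
  proof (rule chain_trace_degenerate[OF assms(1) _ assms(3-6)])
    show "\<forall>i<l. (\<Xi> \<circ> \<sigma>) i \<in> tangent_space X x"
      using tangent_tuplesD[OF assms(2)] permutes_in_image[OF that] by (metis comp_apply lessThan_iff)
  qed
  then show ?thesis unfolding chain_form_def by (intro sum.neutral) simp
qed

end

context atlas
begin

lemma restricted_form_cong:
  "(\<And>x \<Xi>. x \<in> points X \<Longrightarrow> \<Xi> \<in> tangent_tuples X k x \<Longrightarrow> \<omega> x \<Xi> = \<eta> x \<Xi>) \<Longrightarrow>
    restricted_form k \<omega> = restricted_form k \<eta>"
  unfolding restricted_form_def by (intro restrict_ext)

text \<open>If \<rho> is strictly increasing on the indices, then all bundles and composites
  involved are those of the original simplex at the image indices. Otherwise two neighbouring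
  indices have the same image, and the morphism between them is an identity.\<close>

lemma Ch_form_act:
  assumes \<rho>: "\<rho> \<in> Delta_hom m n" and Ef: "Ef \<in> simp (psh_obj HVB X) n" and mem: "is \<in> simplex_generators m l"
  shows "Ch_form X (act (psh_obj HVB X) m n \<rho> Ef) l is =
    (if sorted_wrt (<) (map \<rho> is) then Ch_form X Ef l (map \<rho> is) else form_zero X l)"
proof -
  obtain E f where Ef_eq: "Ef = (E, f)" by (cases Ef)
  have x: "(E, f) \<in> simp (nerve (HVB_cat X)) n" using Ef by (simp add: HVB_def Ef_eq)
  define E' where "E' = (\<lambda>j\<in>{..m}. E (\<rho> j))"
  define f' where "f' = (\<lambda>j\<in>{1..m}. nerve_comp (HVB_cat X) E f (\<rho> (j - 1)) (\<rho> j))"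
  have act: "act (psh_obj HVB X) m n \<rho> Ef = (E', f')" by (simp add: HVB_def Ef_eq act_nerve E'_def f'_def)
  have x': "(E', f') \<in> simp (psh_obj HVB X) m"
    using act_nerve_in[OF category_HVB \<rho> x] by (simp add: HVB_def act_nerve E'_def f'_def)
  have len: "length is = Suc l" and idx: "is ! p \<le> is ! q" "is ! q \<le> m" if "p \<le> q" "q \<le> l" for p q
    using mem that by (auto simp: in_simplex_generators_iff le_less)
  have len: "length is = Suc l" using mem by (simp add: simplex_generators_def)
  have E': "E' (is ! j) = E (\<rho> (is ! j))" if "j \<le> l" for j using idx(2)[OF order.refl that] by (simp add: E'_def)
  have f': "nerve_comp (HVB_cat X) E' f' (is ! p) (is ! q) = nerve_comp (HVB_cat X) E f (\<rho> (is ! p)) (\<rho> (is ! q))"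
    if "p \<le> q" "q \<le> l" for p q
    unfolding E'_def f'_def by (rule nerve_comp_act[OF category_HVB \<rho> x idx[OF that]])
  show ?thesis
  proof (cases "sorted_wrt (<) (map \<rho> is)")
    case True
    have "Ch_form X (E', f') l is = Ch_form X (E, f) l (map \<rho> is)"
    proof (cases "l = 0")
      case True
      then show ?thesis using E'[of 0] len by (simp add: Ch_form_0)
    next
      case False
      then have l: "0 < l" by simp
      show ?thesis unfolding Ch_form_eq[OF l]
        by (intro restricted_form_cong chain_form_cong) (use len E' f' in simp_all)
    qed
    then show ?thesis using True act Ef_eq by simp
  next
    case False
    then obtain a where a: "a < l" "\<rho> (is ! a) = \<rho> (is ! Suc a)" using not_sorted_wrt_less_map[OF \<rho> mem] by blast
    then have l: "0 < l" by simp
    interpret iso_chain X "\<lambda>j. E' (is ! j)" "\<lambda>p q. nerve_comp (HVB_cat X) E' f' (is ! p) (is ! q)" l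
      by (rule simplex_chain[OF x' mem])
    have "Ch_form X (E', f') l is = restricted_form l (\<lambda>_ _. 0)"
      unfolding Ch_form_eq[OF l]
    proof (rule restricted_form_cong, rule chain_form_degenerate[OF _ _ a(1) order.refl])
      show "E' (is ! Suc a) = E' (is ! a)" using E'[of a] E'[of "Suc a"] a by simp
      show "nerve_comp (HVB_cat X) E' f' (is ! a) (is ! Suc a) = Id (HVB_cat X) (E' (is ! a))"
        using f'[of a "Suc a"] E'[of a] a by (simp add: nerve_comp_same)
    qed
    then show ?thesis using False act by (simp add: restricted_form_def form_zero_def)
  qed
qed

lemma group_Omega_complex: "group (Grp (Omega_complex X) l)"
  using group_Omega_group by (simp add: Omega_complex_def)

lemma simplicial_map_Ch: "simplicial_map (psh_obj HVB X) (psh_obj Omega X) (Ch X)"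
proof (rule simplicial_mapI)
  show HVB: "simplicial_set (psh_obj HVB X)" by (simp add: HVB_def simplicial_set_nerve category_HVB)
  show Omega: "simplicial_set (psh_obj Omega X)" by (simp add: Omega_def simplicial_set_DK)
  show "Ch X n \<in> simp (psh_obj HVB X) n \<rightarrow>\<^sub>E simp (psh_obj Omega X) n" for n
    using Ch_in by (auto simp: PiE_iff) (simp add: Ch_def)
  fix m n \<rho> and Ef :: "('p, 'v, 'a) HVB_simplex"
  assume \<rho>: "\<rho> \<in> Delta_hom m n" and Ef: "Ef \<in> simp (psh_obj HVB X) n"
  have Ef': "act (psh_obj HVB X) m n \<rho> Ef \<in> simp (psh_obj HVB X) m"
    by (rule simplicial_setD(1)[OF HVB \<rho> Ef])
  show "Ch X m (act (psh_obj HVB X) m n \<rho> Ef) = act (psh_obj Omega X) m n \<rho> (Ch X n Ef)"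
  proof (rule DK_simplex_eqI[OF group_Omega_complex])
    show "Ch X m (act (psh_obj HVB X) m n \<rho> Ef) \<in> simp (DK (Omega_complex X)) m"
      "act (psh_obj Omega X) m n \<rho> (Ch X n Ef) \<in> simp (DK (Omega_complex X)) m"
      using Ch_in[OF Ef'] simplicial_setD(1)[OF Omega \<rho> Ch_in[OF Ef]] by (simp_all add: Omega_def)
    fix l "is" assume mem: "is \<in> simplex_generators m l"
    \<comment> \<open>This covers the generators that \<open>normalized_chains_map\<close> sends to
      0, where \<open>Ch_form_act\<close> yields the zero form.\<close>
    have "Ch X n Ef l 0 = \<one>\<^bsub>Omega_group X l\<^esub>"
      using hom_one[OF Ch_hom[OF Ef, of l] group_free_Abelian_group group_Omega_group] by simp
    then have "Ch X n Ef l (normalized_chains_map \<rho> (frag_of is)) = Ch_gen (act (psh_obj HVB X) m n \<rho> Ef) l is"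
      using Ch_frag_of[OF Ef simplex_generators_map[OF \<rho> mem]]
      by (auto simp: normalized_chains_map_frag_of Ch_gen_def Ch_form_act[OF \<rho> Ef mem] one_Omega_group fun_eq_iff)
    then show "Ch X m (act (psh_obj HVB X) m n \<rho> Ef) l (frag_of is) = act (psh_obj Omega X) m n \<rho> (Ch X n Ef) l (frag_of is)"
      using mem by (simp add: Ch_frag_of[OF Ef' mem] Omega_def act_DK)
  qed
qed

end

section \<open>Naturality of the Chern character under etale maps\<close>

lemma chain_trace_pullback:
  assumes f: "etale_map X Y f" and c: "iso_chain Y B g l" and x: "x \<in> points X"
    and \<Psi>: "\<forall>i<l. \<Psi> i \<in> tangent_space X x"
  shows "chain_trace X (\<lambda>j. bundle_pullback X Y f (B j)) (\<lambda>p q. bundle_map_pullback X f (g p q)) l x \<Psi> =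
    chain_trace Y B g l (f x) (\<lambda>i. tangent_map X Y f x (\<Psi> i))"
proof -
  interpret f: etale_map X Y f by fact
  interpret c: iso_chain Y B g l by fact
  let ?\<Psi> = "\<lambda>i. tangent_map X Y f x (\<Psi> i)"
  have fx: "f x \<in> points Y" by (rule f.image_points[OF x])
  have \<Psi>': "\<forall>i<l. ?\<Psi> i \<in> tangent_space Y (f x)" using \<Psi> f.tangent_map_in[OF x] by blast
  let ?A = "chain_letter X (\<lambda>j. bundle_pullback X Y f (B j)) (\<lambda>p q. bundle_map_pullback X f (g p q)) x"
  \<comment> \<open>The fibres of the pulled back bundles at \<open>x\<close> are the fibres below
    at \<open>f x\<close>. Both words thus act on the same vector spaces, and only their letters
    have to be compared.\<close>
  have word: "word_comp ?A \<Psi> l j e = word_comp (chain_letter Y B g (f x)) ?\<Psi> l j e"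
    if e: "e \<in> carrier (fibre (B 0) (f x))" and j: "j \<le> l" for e j
    using j
  proof (induction j)
    case (Suc j)
    have "word_comp (chain_letter Y B g (f x)) ?\<Psi> l j e \<in> carrier (fibre (B j) (f x))"
      using Suc.prems by (intro clinear_in[OF c.word_clinear[OF fx \<Psi>' _ order.refl] e]) simp
    then show ?case
      using Suc hom_connection_pullback[OF f c.chain_iso[of j "Suc j"] x, of "\<Psi> (l - Suc j)"] \<Psi>
      by (simp add: chain_letter_def)
  qed simp
  obtain r \<phi> where \<phi>: "coord_iso (fibre (B 0) (f x)) r \<phi>" using c.chain_coord[OF fx le0] .
  have "vtrace (fibre (B 0) (f x)) (\<lambda>e. inv_into (carrier (fibre (B 0) (f x))) (g 0 l (f x)) (word_comp ?A \<Psi> l l e)) =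
      vtrace (fibre (B 0) (f x)) (\<lambda>e. inv_into (carrier (fibre (B 0) (f x))) (g 0 l (f x))
        (word_comp (chain_letter Y B g (f x)) ?\<Psi> l l e))"
    by (rule vtrace_cong[OF c.chain_module[OF fx le0] \<phi>]) (simp add: word)
  then show ?thesis using x by (simp add: chain_trace_def fibre_bundle_pullback bundle_map_pullback_def)
qed

lemma chain_form_pullback:
  assumes f: "etale_map X Y f" and c: "iso_chain Y B g l" and x: "x \<in> points X" and \<Xi>: "\<Xi> \<in> tangent_tuples X l x"
  shows "chain_form X (\<lambda>j. bundle_pullback X Y f (B j)) (\<lambda>p q. bundle_map_pullback X f (g p q)) l x \<Xi> =
    chain_form Y B g l (f x) (\<lambda>i\<in>{..<l}. tangent_map X Y f x (\<Xi> i))"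
proof -
  interpret f: etale_map X Y f by fact
  have "chain_trace X (\<lambda>j. bundle_pullback X Y f (B j)) (\<lambda>p q. bundle_map_pullback X f (g p q)) l x (\<Xi> \<circ> \<sigma>) =
      chain_trace Y B g l (f x) ((\<lambda>i\<in>{..<l}. tangent_map X Y f x (\<Xi> i)) \<circ> \<sigma>)" if \<sigma>: "\<sigma> permutes {..<l}" for \<sigma>
  proof -
    have lt: "\<sigma> i < l" if "i < l" for i using permutes_in_image[OF \<sigma>, of i] that by simp
    have "chain_trace X (\<lambda>j. bundle_pullback X Y f (B j)) (\<lambda>p q. bundle_map_pullback X f (g p q)) l x (\<Xi> \<circ> \<sigma>) =
        chain_trace Y B g l (f x) (\<lambda>i. tangent_map X Y f x ((\<Xi> \<circ> \<sigma>) i))"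
      using f.X.tangent_tuplesD[OF \<Xi>] lt by (intro chain_trace_pullback[OF f c x]) simp
    also have "\<dots> = chain_trace Y B g l (f x) ((\<lambda>i\<in>{..<l}. tangent_map X Y f x (\<Xi> i)) \<circ> \<sigma>)"
    proof -
      have "word_comp (chain_letter Y B g (f x)) (\<lambda>i. tangent_map X Y f x ((\<Xi> \<circ> \<sigma>) i)) l l =
          word_comp (chain_letter Y B g (f x)) ((\<lambda>i\<in>{..<l}. tangent_map X Y f x (\<Xi> i)) \<circ> \<sigma>) l l"
        by (rule word_comp_cong) (use lt in auto)
      then show ?thesis by (simp only: chain_trace_def)
    qed
    finally show ?thesis .
  qed
  then show ?thesis unfolding chain_form_def by (intro sum.cong) auto
qed

lemma Ch_form_pullback:
  assumes f: "etale_map X Y f" and Ef: "Ef \<in> simp (psh_obj HVB Y) k" and mem: "is \<in> simplex_generators k l"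
  shows "Ch_form X (psh_map HVB X Y f k Ef) l is = form_pullback X Y f l (Ch_form Y Ef l is)"
proof -
  interpret f: etale_map X Y f by fact
  obtain E g where Ef_eq: "Ef = (E, g)" by (cases Ef)
  have x: "(E, g) \<in> simp (psh_obj HVB Y) k" "(E, g) \<in> simp (nerve (HVB_cat Y)) k" using Ef by (simp_all add: HVB_def Ef_eq)
  define E' where "E' = (\<lambda>j\<in>{..k}. bundle_pullback X Y f (E j))"
  define g' where "g' = (\<lambda>j\<in>{1..k}. bundle_map_pullback X f (g j))"
  have pull: "psh_map HVB X Y f k Ef = (E', g')" using psh_map_HVB_apply[OF x(1)] by (simp add: Ef_eq E'_def g'_def)
  have idx: "is ! p \<le> is ! q" "is ! q \<le> k" if "p \<le> q" "q \<le> l" for p q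
    using mem that by (auto simp: in_simplex_generators_iff le_less)
  have E': "E' (is ! j) = bundle_pullback X Y f (E (is ! j))" if "j \<le> l" for j
    using idx(2)[OF order.refl that] by (simp add: E'_def)
  have g': "nerve_comp (HVB_cat X) E' g' (is ! p) (is ! q) = bundle_map_pullback X f (nerve_comp (HVB_cat Y) E g (is ! p) (is ! q))"
    if "p \<le> q" "q \<le> l" for p q
    unfolding E'_def g'_def
    by (rule nerve_comp_functor[where Fo = "bundle_pullback X Y f" and Fm = "bundle_map_pullback X f", OF f.Y.category_HVB x(2) idx[OF that]])
      (simp_all add: bundle_map_pullback_Id[OF f] bundle_map_pullback_Comp[OF f])
  note chain = f.Y.simplex_chain[OF x(1) mem]
  show ?thesis
  proof (cases "l = 0")
    case True
    then show ?thesis unfolding pull unfolding Ef_eq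
      using E'[of 0] f.tangent_map_tuple[where k = 0] f.image_points
      by (auto simp: f.X.Ch_form_0 f.Y.Ch_form_0 f.X.restricted_form_def f.Y.restricted_form_def form_pullback_def
        fibre_bundle_pullback intro!: restrict_ext)
  next
    case False
    then have l: "0 < l" by simp
    have "Ch_form X (E', g') l is = f.X.restricted_form l (chain_form X (\<lambda>j. bundle_pullback X Y f (E (is ! j)))
        (\<lambda>p q. bundle_map_pullback X f (nerve_comp (HVB_cat Y) E g (is ! p) (is ! q))) l)"
      unfolding f.X.Ch_form_eq[OF l] by (intro f.X.restricted_form_cong chain_form_cong) (use E' g' in simp_all)
    also have "\<dots> = form_pullback X Y f l (Ch_form Y (E, g) l is)"
      unfolding f.Y.Ch_form_eq[OF l]
      using chain_form_pullback[OF f chain] f.tangent_map_tuple f.image_points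
      by (auto simp: f.X.restricted_form_def f.Y.restricted_form_def form_pullback_def intro!: restrict_ext)
    finally show ?thesis unfolding pull unfolding Ef_eq .
  qed
qed

lemma Ch_pullback:
  assumes f: "etale_map X Y f" and Ef: "Ef \<in> simp (psh_obj HVB Y) k"
  shows "Ch X k (psh_map HVB X Y f k Ef) = psh_map Omega X Y f k (Ch Y k Ef)"
proof -
  interpret f: etale_map X Y f by fact
  have Ef': "psh_map HVB X Y f k Ef \<in> simp (psh_obj HVB X) k" by (rule simplicial_mapD(4)[OF simplicial_map_HVB[OF f] Ef])
  note ChY = f.Y.Ch_in[OF Ef]
  show ?thesis
  proof (rule DK_simplex_eqI[OF f.X.group_Omega_complex])
    show "Ch X k (psh_map HVB X Y f k Ef) \<in> simp (DK (Omega_complex X)) k"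
      "psh_map Omega X Y f k (Ch Y k Ef) \<in> simp (DK (Omega_complex X)) k"
      using f.X.Ch_in[OF Ef'] simplicial_mapD(4)[OF simplicial_map_Omega[OF f] ChY] by (simp_all add: Omega_def)
    fix l "is" assume mem: "is \<in> simplex_generators k l"
    have "f.X.Ch_gen (psh_map HVB X Y f k Ef) l is = Omega_pullback X Y f l (f.Y.Ch_gen Ef l is)"
      using Ch_form_pullback[OF f Ef mem] f.form_pullback_zero
      by (auto simp: f.X.Ch_gen_def f.Y.Ch_gen_def Omega_pullback_def intro!: restrict_ext)
    then show "Ch X k (psh_map HVB X Y f k Ef) l (frag_of is) = psh_map Omega X Y f k (Ch Y k Ef) l (frag_of is)"
      using mem by (simp add: f.X.Ch_frag_of[OF Ef' mem] f.Y.Ch_frag_of[OF Ef mem] psh_map_Omega_apply[OF ChY])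
  qed
qed

section \<open>The Cech nerve\<close>

lemma complex_atlas_open_submanifold:
  assumes X: "complex_atlas X" and W: "openin (mtop X) W"
  shows "complex_atlas (open_submanifold X W)"
proof -
  interpret atlas X by unfold_locales fact
  have chart: "\<exists>d\<in>charts X. c = (fst d \<inter> W, snd d)" if "c \<in> charts (open_submanifold X W)" for c
    using that by (auto simp: open_submanifold_def intro: bexI[rotated])
  \<comment> \<open>\<open>inv_into\<close> depends on the domain, which has shrunk; on the smaller
    image injectivity makes the two inverses agree.\<close>
  have inv: "chart_inv (fst d \<inter> W, snd d) z = chart_inv d z" if d: "d \<in> charts X" and z: "z \<in> snd d ` (fst d \<inter> W)" for d z
  proof -
    obtain x where x: "x \<in> fst d" "x \<in> W" "z = snd d x" using z by blast
    have "inj_on (snd d) (fst d \<inter> W)" using chart_inj[OF d] by (rule inj_on_subset) simp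
    then show ?thesis using x d by (simp add: chart_inv_def[of "(_, _)"])
  qed
  show ?thesis
    unfolding complex_atlas_def
  proof (intro conjI ballI allI impI)
    fix c assume "c \<in> charts (open_submanifold X W)"
    then obtain d where d: "d \<in> charts X" and c: "c = (fst d \<inter> W, snd d)" using chart by blast
    show "openin (mtop (open_submanifold X W)) (fst c)"
      using chart_openin[OF d] W by (auto simp: open_submanifold_def c openin_open_subtopology)
    show "inj_on (snd c) (fst c)" using chart_inj[OF d] by (auto simp: c intro: inj_on_subset)
    show "open (snd c ` (fst c \<inter> V))" if "openin (mtop (open_submanifold X W)) V" for V
    proof -
      have V: "openin (mtop X) V" "V \<subseteq> W" using that W by (auto simp: open_submanifold_def openin_open_subtopology)
      then have "fst c \<inter> V = fst d \<inter> V" by (auto simp: c)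
      then show ?thesis using open_chart_image[OF d V(1)] by (simp add: c)
    qed
    show "openin (mtop (open_submanifold X W)) {x \<in> fst c. snd c x \<in> S}" if "open S" for S
    proof -
      have "{x \<in> fst c. snd c x \<in> S} = {x \<in> fst d. snd d x \<in> S} \<inter> W" by (auto simp: c)
      then show ?thesis using openin_Int[OF openin_chart_preimage[OF d that] W] W
        by (simp add: open_submanifold_def openin_open_subtopology)
    qed
  next
    show "points (open_submanifold X W) \<subseteq> (\<Union>c\<in>charts (open_submanifold X W). fst c)"
      using charts_at_nonempty by (force simp: open_submanifold_def charts_at_iff)
  next
    fix c c' assume "c \<in> charts (open_submanifold X W)" "c' \<in> charts (open_submanifold X W)"
    then obtain d d' where d: "d \<in> charts X" "d' \<in> charts X" and c: "c = (fst d \<inter> W, snd d)" "c' = (fst d' \<inter> W, snd d')"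
      using chart by blast
    show "cholomorphic_on (snd c ` (fst c \<inter> fst c')) (snd c' \<circ> chart_inv c)"
      unfolding cholomorphic_on_iff
    proof
      fix y assume "y \<in> snd c ` (fst c \<inter> fst c')"
      then obtain x where x: "x \<in> fst d" "x \<in> fst d'" "x \<in> W" "y = snd d x" by (auto simp: c)
      then have "chol_at (snd d' \<circ> chart_inv d) y" using chol_at_transition[of d x d'] d by (simp add: charts_at_iff)
      moreover have "chol_at (snd c' \<circ> chart_inv c) y \<longleftrightarrow> chol_at (snd d' \<circ> chart_inv d) y"
        by (rule chol_at_cong_open[OF open_chart_image[OF d(1) W]]) (use x inv[OF d(1)] in \<open>auto simp: c\<close>)
      ultimately show "chol_at (snd c' \<circ> chart_inv c) y" by simp
    qed
  qed
qed

lemma complex_atlas_coproduct_manifold: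
  assumes N: "\<And>j. j \<in> J \<Longrightarrow> complex_atlas (N j)"
  shows "complex_atlas (coproduct_manifold J N)"
proof -
  let ?X = "coproduct_manifold J N"
  have at: "atlas (N j)" if "j \<in> J" for j using N[OF that] by unfold_locales
  have open_iff: "openin (mtop ?X) V \<longleftrightarrow> V \<subseteq> (SIGMA j:J. points (N j)) \<and> (\<forall>j\<in>J. openin (mtop (N j)) {x. (j, x) \<in> V})" for V
    by (simp add: coproduct_manifold_def openin_sum_topology comp_def)
  have chart: "\<exists>j\<in>J. \<exists>d\<in>charts (N j). c = ({j} \<times> fst d, snd d \<circ> snd)" if "c \<in> charts ?X" for c
    using that by (auto simp: coproduct_manifold_def case_prod_beta)
  have chart_in: "({j} \<times> fst d, snd d \<circ> snd) \<in> charts ?X" if "j \<in> J" "d \<in> charts (N j)" for j d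
    using that by (force simp: coproduct_manifold_def case_prod_beta)
  have inv: "chart_inv ({j} \<times> fst d, snd d \<circ> snd) (snd d x) = (j, x)" if "j \<in> J" "d \<in> charts (N j)" "x \<in> fst d" for j d x
  proof -
    have "inj_on (snd d \<circ> snd) ({j} \<times> fst d)"
      using atlas.chart_inj[OF at[OF that(1)] that(2)] by (auto simp: inj_on_def)
    from inv_into_f_f[OF this, of "(j, x)"] show ?thesis using that(3) by (simp add: chart_inv_def)
  qed
  have open_slice: "openin (mtop ?X) ({j} \<times> D)" if "j \<in> J" "openin (mtop (N j)) D" for j D
  proof -
    have "openin (mtop (N i)) {x. (i, x) \<in> {j} \<times> D}" for i using that(2) by (cases "i = j") simp_all
    then show ?thesis unfolding open_iff using that openin_subset[OF that(2)] by auto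
  qed
  show ?thesis
    unfolding complex_atlas_def
  proof (intro conjI ballI allI impI)
    fix c assume "c \<in> charts ?X"
    then obtain j d where j: "j \<in> J" and d: "d \<in> charts (N j)" and c: "c = ({j} \<times> fst d, snd d \<circ> snd)" using chart by blast
    interpret atlas "N j" using at[OF j] .
    show "openin (mtop ?X) (fst c)" unfolding c fst_conv by (rule open_slice[OF j chart_openin[OF d]])
    show "inj_on (snd c) (fst c)" using chart_inj[OF d] by (auto simp: c inj_on_def)
    show "open (snd c ` (fst c \<inter> V))" if "openin (mtop ?X) V" for V
    proof -
      have "snd c ` (fst c \<inter> V) = snd d ` (fst d \<inter> {x. (j, x) \<in> V})" by (force simp: c)
      then show ?thesis using open_chart_image[OF d, of "{x. (j, x) \<in> V}"] that j by (simp add: open_iff)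
    qed
    show "openin (mtop ?X) {x \<in> fst c. snd c x \<in> S}" if "open S" for S
    proof -
      have "{x \<in> fst c. snd c x \<in> S} = {j} \<times> {x \<in> fst d. snd d x \<in> S}" by (auto simp: c)
      then show ?thesis using open_slice[OF j openin_chart_preimage[OF d that]] by simp
    qed
  next
    show "points ?X \<subseteq> (\<Union>c\<in>charts ?X. fst c)"
    proof
      fix p assume "p \<in> points ?X"
      then obtain j x where j: "j \<in> J" and x: "x \<in> points (N j)" and p: "p = (j, x)"
        by (auto simp: coproduct_manifold_def)
      obtain d where "d \<in> charts (N j)" "x \<in> fst d"
        using atlas.charts_at_nonempty[OF at[OF j] x] by (auto simp: charts_at_iff)
      then show "p \<in> (\<Union>c\<in>charts ?X. fst c)" by (intro UN_I[OF chart_in[OF j]]) (simp_all add: p)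
    qed
  next
    fix c c' assume cc': "c \<in> charts ?X" "c' \<in> charts ?X"
    obtain j d where j: "j \<in> J" and d: "d \<in> charts (N j)" and c: "c = ({j} \<times> fst d, snd d \<circ> snd)" using chart[OF cc'(1)] by blast
    obtain i d' where i: "i \<in> J" and d': "d' \<in> charts (N i)" and c': "c' = ({i} \<times> fst d', snd d' \<circ> snd)" using chart[OF cc'(2)] by blast
    interpret atlas "N j" using at[OF j] .
    show "cholomorphic_on (snd c ` (fst c \<inter> fst c')) (snd c' \<circ> chart_inv c)"
      unfolding cholomorphic_on_iff
    proof
      fix y assume "y \<in> snd c ` (fst c \<inter> fst c')"
      \<comment> \<open>Charts of different summands are disjoint, so an overlap forces
        \<open>i = j\<close>.\<close>
      then obtain x where ij: "i = j" and x: "x \<in> fst d" "x \<in> fst d'" "y = snd d x" by (auto simp: c c')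
      then have "chol_at (snd d' \<circ> chart_inv d) y" using chol_at_transition[of d x d'] d d' by (simp add: charts_at_iff)
      moreover have "chol_at (snd c' \<circ> chart_inv c) y \<longleftrightarrow> chol_at (snd d' \<circ> chart_inv d) y"
        by (rule chol_at_cong_open[OF open_chart_image[OF d chart_openin[OF d]]])
          (use x d inv[OF j d] in \<open>auto simp: c c'\<close>)
      ultimately show "chol_at (snd c' \<circ> chart_inv c) y" by simp
    qed
  qed
qed

section \<open>The cosimplicial object of an open cover\<close>

locale covered_atlas = atlas M
  for M :: "('p, 'v::complex_model_space) cmanifold" +
  fixes I :: "'i set" and U :: "'i \<Rightarrow> 'p set"
  assumes cover: "open_cover M I U"
begin

abbreviation (input) W :: "nat \<Rightarrow> (nat \<Rightarrow> 'i) \<Rightarrow> 'p set" where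
  "W k i \<equiv> \<Inter>j\<in>{..k}. U (i j)"

lemma openin_W: "i \<in> {..k} \<rightarrow>\<^sub>E I \<Longrightarrow> openin (mtop M) (W k i)"
  using cover by (intro openin_Inter) (auto simp: open_cover_def)

lemma complex_atlas_cech_nerve: "complex_atlas (cech_nerve M I U k)"
  unfolding cech_nerve_def
  by (intro complex_atlas_coproduct_manifold complex_atlas_open_submanifold atlas openin_W)

lemma points_cech_nerve: "points (cech_nerve M I U k) = (SIGMA i:{..k} \<rightarrow>\<^sub>E I. W k i)"
proof -
  have "points M \<inter> W k i = W k i" if "i \<in> {..k} \<rightarrow>\<^sub>E I" for i
    using openin_subset[OF openin_W[OF that]] by (rule Int_absorb1)
  then show ?thesis
    unfolding cech_nerve_def coproduct_manifold_def open_submanifold_def by (simp add: comp_def cong: Sigma_cong)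
qed

lemma charts_cech_nerve:
  "charts (cech_nerve M I U k) = {({i} \<times> (fst d \<inter> W k i), snd d \<circ> snd) | i d. i \<in> {..k} \<rightarrow>\<^sub>E I \<and> d \<in> charts M}"
  unfolding cech_nerve_def coproduct_manifold_def open_submanifold_def case_prod_beta image_image cmanifold.simps fst_conv snd_conv
  by blast

text \<open>The component \<open>i\<close> of level \<open>m\<close> is contained in the component
  of level \<open>k\<close> for the reindexed tuple, because fewer sets are intersected there. Both
  carry restrictions of the same charts of \<open>M\<close>, and these lie over each other.\<close>

lemma etale_cech_map:
  assumes \<rho>: "\<rho> \<in> Delta_hom k m"
  shows "etale_map (cech_nerve M I U m) (cech_nerve M I U k) (cech_map k \<rho>)"
proof -
  have i': "compose {..k} i \<rho> \<in> {..k} \<rightarrow>\<^sub>E I" if "i \<in> {..m} \<rightarrow>\<^sub>E I" for i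
    using that Delta_hom_le[OF \<rho>] by (auto simp: compose_def)
  have W: "x \<in> W k (compose {..k} i \<rho>)" if "x \<in> W m i" for i x
    using that Delta_hom_le[OF \<rho>] by (auto simp: compose_def)
  let ?c = "\<lambda>k d i. ({i} \<times> (fst d \<inter> W k i), snd d \<circ> snd)"
  have over: "chart_over (cech_map k \<rho>) (?c m d i) (?c k d (compose {..k} i \<rho>))" for d :: "('p, 'v) chart" and i
    using W[of _ i] by (auto simp: chart_over_def cech_map_def)
  have mem: "?c k d i \<in> charts (cech_nerve M I U k)" if "i \<in> {..k} \<rightarrow>\<^sub>E I" "d \<in> charts M" for k d i
    using that unfolding charts_cech_nerve by blast
  have "etale (cech_nerve M I U m) (cech_nerve M I U k) (cech_map k \<rho>)"
    unfolding etale_def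
  proof (intro conjI ballI impI)
    fix c assume "c \<in> charts (cech_nerve M I U m)"
    then obtain i d where i: "i \<in> {..m} \<rightarrow>\<^sub>E I" "d \<in> charts M" and c: "c = ?c m d i" unfolding charts_cech_nerve by blast
    show "\<exists>c'\<in>charts (cech_nerve M I U k). chart_over (cech_map k \<rho>) c c'"
      unfolding c using over mem[OF i'[OF i(1)] i(2)] by (rule bexI)
  next
    fix c' p assume c': "c' \<in> charts (cech_nerve M I U k)" and p: "p \<in> points (cech_nerve M I U m)"
      and mem': "cech_map k \<rho> p \<in> fst c'"
    obtain i x where i: "i \<in> {..m} \<rightarrow>\<^sub>E I" and x: "x \<in> W m i" and p: "p = (i, x)"
      using p unfolding points_cech_nerve by blast
    obtain i1 d where d: "d \<in> charts M" and c': "c' = ?c k d i1" using c' unfolding charts_cech_nerve by blast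
    have i1: "i1 = compose {..k} i \<rho>" and xd: "x \<in> fst d" using mem' by (auto simp: c' p cech_map_def)
    have at: "?c m d i \<in> charts_at (cech_nerve M I U m) p"
      using mem[OF i d] x xd by (simp add: charts_at_iff p)
    show "\<exists>c\<in>charts_at (cech_nerve M I U m) p. chart_over (cech_map k \<rho>) c c'"
      unfolding c' i1 using over at by (rule bexI)
  qed
  then show ?thesis using complex_atlas_cech_nerve by unfold_locales
qed

lemma cech_map_id: "p \<in> points (cech_nerve M I U k) \<Longrightarrow> cech_map k (\<lambda>i\<in>{..k}. i) p = p"
  by (auto simp: points_cech_nerve cech_map_def compose_def PiE_iff extensional_def fun_eq_iff)

text \<open>The Cech nerve and the presheaf are both contravariant, so the levels are covariant in
  [k]. The hypotheses are the presheaf laws along etale maps, the form in which they have been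
  established for bundles and for forms.\<close>

lemma cosimplicial_cech_eval:
  fixes F :: "((nat \<Rightarrow> 'i) \<times> 'p, 'v, 'a) presheaf"
  assumes map: "\<And>X Y f. etale_map X Y f \<Longrightarrow> simplicial_map (psh_obj F Y) (psh_obj F X) (psh_map F X Y f)"
    and id: "\<And>X f k h. complex_atlas X \<Longrightarrow> (\<And>x. x \<in> points X \<Longrightarrow> f x = x) \<Longrightarrow> h \<in> simp (psh_obj F X) k \<Longrightarrow>
      psh_map F X X f k h = h"
    and compose: "\<And>X Y Z f g k h. etale_map X Y f \<Longrightarrow> etale_map Y Z g \<Longrightarrow> h \<in> simp (psh_obj F Z) k \<Longrightarrow>
      psh_map F X Z (g \<circ> f) k h = psh_map F X Y f k (psh_map F Y Z g k h)"
  shows "cosimplicial_sset (cech_eval F M I U)"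
proof -
  have "simplicial_set (psh_obj F (cech_nerve M I U l))" for l
    by (rule simplicial_mapD(1)[OF map[OF etale_cech_map[OF Delta_hom_id]]])
  moreover have "psh_map F (cech_nerve M I U m) (cech_nerve M I U j) (cech_map j (compose {..j} \<rho> \<sigma>)) n x =
      psh_map F (cech_nerve M I U m) (cech_nerve M I U k) (cech_map k \<rho>) n
        (psh_map F (cech_nerve M I U k) (cech_nerve M I U j) (cech_map j \<sigma>) n x)"
    if "\<sigma> \<in> Delta_hom j k" "\<rho> \<in> Delta_hom k m" "x \<in> simp (psh_obj F (cech_nerve M I U j)) n" for j k m n \<rho> \<sigma> x
  proof -
    have "cech_map j (compose {..j} \<rho> \<sigma>) = (cech_map j \<sigma> \<circ> cech_map k \<rho> :: (nat \<Rightarrow> 'i) \<times> 'p \<Rightarrow> _)"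
      by (rule ext) (simp add: cech_map_def case_prod_beta compose_Delta_assoc[OF that(1)])
    then show ?thesis using compose[OF etale_cech_map[OF that(2)] etale_cech_map[OF that(1)] that(3)] by (simp only:)
  qed
  ultimately show ?thesis
    by (simp add: cosimplicial_sset_def cech_eval_def map etale_cech_map id complex_atlas_cech_nerve cech_map_id)
qed

end

theorem corollary3p3:
  fixes M :: "('p, 'v::complex_model_space) cmanifold"
    and I :: "'i set"
    and U :: "'i \<Rightarrow> 'p set"
    and HVB_N :: "((nat \<Rightarrow> 'i) \<times> 'p, 'v, 'f) HVB_simplex cosset"
    and Omega_N :: "((nat \<Rightarrow> 'i) \<times> 'p, 'v) Omega_simplex cosset"
    and Ch_N :: "nat \<Rightarrow> nat \<Rightarrow> ((nat \<Rightarrow> 'i) \<times> 'p, 'v, 'f) HVB_simplex \<Rightarrow>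
                   ((nat \<Rightarrow> 'i) \<times> 'p, 'v) Omega_simplex"
  assumes "complex_manifold M"
    and "open_cover M I U"
  defines "HVB_N \<equiv> cech_eval HVB M I U"
    and "Omega_N \<equiv> cech_eval Omega M I U"
    and "Ch_N \<equiv> (\<lambda>l. Ch (cech_nerve M I U l))"
  shows "cosimplicial_map HVB_N Omega_N Ch_N \<and>
         simplicial_map (Tot HVB_N) (Tot Omega_N) (Tot_map Ch_N HVB_N)"
proof -
  interpret covered_atlas M I U
    using assms(1,2) by unfold_locales (simp_all add: complex_manifold_atlas)
  have "cosimplicial_sset HVB_N" unfolding HVB_N_def
    by (rule cosimplicial_cech_eval[OF simplicial_map_HVB psh_map_HVB_id psh_map_HVB_compose])
  moreover have "cosimplicial_sset Omega_N" unfolding Omega_N_def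
    by (rule cosimplicial_cech_eval[OF simplicial_map_Omega psh_map_Omega_id psh_map_Omega_compose]) simp_all
  ultimately have "cosimplicial_map HVB_N Omega_N Ch_N"
    by (simp add: cosimplicial_map_def HVB_N_def Omega_N_def Ch_N_def cech_eval_def Ch_pullback[OF etale_cech_map]
      atlas.simplicial_map_Ch[OF atlas.intro[OF complex_atlas_cech_nerve]])
  then show ?thesis using simplicial_map_Tot by blast
qed

end
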